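(* Let $n\geq 2$, $0<p\leq\infty$, $0<q\leq\infty$, let $f\in\dot B^s_{p,q}(\mathbb R^n)$ have a function representative, and assume that $L\in\mathbb N$, $s\in\mathbb R$ satisfy $\frac{n}{p}<s<L$. Then for every $r$ (the parameter in the definition of the maximal functions $S^L_t f$, $V^L_t f$, $D^L_h f$) satisfying $\frac{n}{s}<r<p$, the following five quasinorms are equivalent quasinorms in $\dot B^s_{p,q}(\mathbb R^n)$ (i.e. each of them is comparable to $\|f\|_{\dot B^s_{p,q}(\mathbb R^n)}$ with constants independent of $f$): $$\|\{2^{ks}S^L_{2^{-k}}f\}_{k\in\mathbb Z}\|_{l^q(L^p)},\qquad \|\{2^{ks}\operatorname*{ess\,sup}_{0<\tau<2}S^L_{\tau 2^{-k}}f\}_{k\in\mathbb Z}\|_{l^q(L^p)},$$ $$\|\{2^{ks}V^L_{2^{-k}}f\}_{k\in\mathbb Z}\|_{l^q(L^p)},\qquad \|\{2^{ks}\operatorname*{ess\,sup}_{0<\tau<2}V^L_{\tau 2^{-k}}f\}_{k\in\mathbb Z}\|_{l^q(L^p)},$$ $$\|\{2^{ks}\operatorname*{ess\,sup}_{0<|h|<2}D^L_{2^{-k}h}f\}_{k\in\mathbb Z}\|_{l^q(L^p)}.$$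
   Context: $\mathbb N$ is the set of positive integers. $\mathcal S(\mathbb R^n)$ is the Schwartz space, $\mathcal S'(\mathbb R^n)$ the tempered distributions, $\mathcal P(\mathbb R^n)$ the polynomials. The Fourier transform is $\mathcal F_n f(\xi)=\int f(x)e^{-2\pi i x\cdot\xi}dx$. Fix $\psi\in\mathcal S(\mathbb R^n)$ with $0\le\mathcal F_n\psi\le1$, $\operatorname{supp}\mathcal F_n\psi\subseteq\{\frac12\le|\xi|<2\}$ and $\sum_{j\in\mathbb Z}\mathcal F_n\psi(2^{-j}\xi)=1$ for $\xi\ne0$. For $f\in\mathcal S'(\mathbb R^n)$, $j\in\mathbb Z$, put $f_j=\psi_{2^{-j}}*f$ with $\psi_{2^{-j}}(y)=2^{jn}\psi(2^jy)$. For a sequence $\{g_k\}_{k\in\mathbb Z}$ of functions, $\|\{g_k\}\|_{l^q(L^p)}$ is the $l^q$-quasinorm of the sequence $\{\|g_k\|_{L^p(\mathbb R^n)}\}_k$. For $0<p,q\le\infty$, $s\in\mathbb R$, the homogeneous Besov-Lipschitz space is $\dot B^s_{p,q}(\mathbb R^n)=\{f\in\mathcal S'(\mathbb R^n)/\mathcal P(\mathbb R^n):\|f\|_{\dot B^s_{p,q}(\mathbb R^n)}:=\|\{2^{ks}f_k\}_{k\in\mathbb Z}\|_{l^q(L^p)}<\infty\}$. Iterated differences: $\Delta^1_hf(x)=f(x+h)-f(x)$, $\Delta^L_hf=\Delta^1_h(\Delta^{L-1}_hf)$. Let $\mathbb S^{n-1}$ be the unit sphere, $\mathcal H^{n-1}$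 the $(n-1)$-dimensional Hausdorff measure on it, $|\mathbb S^{n-1}|=\mathcal H^{n-1}(\mathbb S^{n-1})$, $A=\{z\in\mathbb R^n:1\le|z|<2\}$ with volume $|A|$. For $t>0$, $r>0$, $x\in\mathbb R^n$, $0\ne h\in\mathbb R^n$, $L\in\mathbb N$: $$(S^L_tf)(x)=\operatorname*{ess\,sup}_{y\in\mathbb R^n}\Big|\frac1{|\mathbb S^{n-1}|}\int_{\mathbb S^{n-1}}(\Delta^L_{tz}f)(x-y)\,d\mathcal H^{n-1}(z)\Big|(1+t^{-1}|y|)^{-n/r},$$ $$(V^L_tf)(x)=\operatorname*{ess\,sup}_{y\in\mathbb R^n}\Big|\frac1{|A|}\int_A(\Delta^L_{tz}f)(x-y)\,dz\Big|(1+t^{-1}|y|)^{-n/r},$$ $$(D^L_hf)(x)=\operatorname*{ess\,sup}_{y\in\mathbb R^n}|(\Delta^L_hf)(x-y)|\Big(1+\frac{|y|}{|h|}\Big)^{-n/r}.$$ Convention for elements of $\mathcal S'/\mathcal P$: an integral (or supremum) of an equivalence class is understood when the class has a function representative, and integrals (suprema) of distinct representatives of the same class are identified. In upper bounds by $\|f\|_{\dot B^s_{p,q}}$, the class $\Delta^L_hf$ is represented by the function given by the pointwise sum $\sum_{j\in\mathbb Z}\Delta^L_hf_j(x)$ for almost every $h$ and $x$ (so it is $0$ when $f$ is a polynomial). *)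

theory Defs
  imports "HOL-Analysis.Analysis" "HOL-Probability.Essential_Supremum"
begin

section \<open>Schwartz functions and tempered distributions\<close>

definition partial_deriv :: "'n::finite \<Rightarrow> (real^'n \<Rightarrow> complex) \<Rightarrow> real^'n \<Rightarrow> complex" where
  "partial_deriv i \<phi> x = frechet_derivative \<phi> (at x) (axis i 1)"

text \<open>A list of coordinate directions plays the role of a multi-index; its length is the order.\<close>

definition iter_partial :: "'n::finite list \<Rightarrow> (real^'n \<Rightarrow> complex) \<Rightarrow> real^'n \<Rightarrow> complex" where
  "iter_partial a \<phi> = fold partial_deriv a \<phi>"

definition schwartz :: "(real^'n::finite \<Rightarrow> complex) \<Rightarrow> bool" where
  "schwartz \<phi> \<longleftrightarrow>
     (\<forall>a. (\<forall>x. iter_partial a \<phi> differentiable (at x)) \<and>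
          (\<forall>N. bounded (range (\<lambda>x. (1 + norm x) ^ N *\<^sub>R iter_partial a \<phi> x))))"

definition schwartz_norm :: "nat \<Rightarrow> (real^'n::finite \<Rightarrow> complex) \<Rightarrow> real" where
  "schwartz_norm N \<phi> =
     (\<Sum>a | length a \<le> N. SUP x. (1 + norm x) ^ N * cmod (iter_partial a \<phi> x))"

text \<open>A tempered distribution is a functional whose values matter on Schwartz functions only.\<close>

definition tempered_distribution :: "((real^'n::finite \<Rightarrow> complex) \<Rightarrow> complex) \<Rightarrow> bool" where
  "tempered_distribution u \<longleftrightarrow>
     (\<forall>\<phi> \<eta>. schwartz \<phi> \<longrightarrow> schwartz \<eta> \<longrightarrow> u (\<lambda>x. \<phi> x + \<eta> x) = u \<phi> + u \<eta>) \<and>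
     (\<forall>c \<phi>. schwartz \<phi> \<longrightarrow> u (\<lambda>x. c * \<phi> x) = c * u \<phi>) \<and>
     (\<exists>N C. \<forall>\<phi>. schwartz \<phi> \<longrightarrow> cmod (u \<phi>) \<le> C * schwartz_norm N \<phi>)"

text \<open>\<open>F\<close> is a function representative of the class of \<open>u\<close> modulo polynomials: the
  distribution \<open>u\<close> minus some polynomial is given by integration against \<open>F\<close>. Choosing \<open>F\<close>
  Borel measurable is no loss, as it only matters almost everywhere.\<close>

definition function_rep ::
  "((real^'n::finite \<Rightarrow> complex) \<Rightarrow> complex) \<Rightarrow> (real^'n \<Rightarrow> complex) \<Rightarrow> bool" where
  "function_rep u F \<longleftrightarrow>
     F \<in> borel_measurable borel \<and>
     (\<exists>P. polynomial_function P \<and>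
       (\<forall>\<phi>. schwartz \<phi> \<longrightarrow> integrable lborel (\<lambda>x. F x * \<phi> x) \<and>
            u \<phi> = (LINT x|lborel. F x * \<phi> x) + (LINT x|lborel. P x * \<phi> x)))"

definition fourier :: "(real^'n::finite \<Rightarrow> complex) \<Rightarrow> real^'n \<Rightarrow> complex" where
  "fourier \<phi> \<xi> = (LINT x|lborel. \<phi> x * exp (- (2 * of_real pi * \<i> * of_real (x \<bullet> \<xi>))))"


section \<open>Quasinorms with exponents in $(0,\infty]$\<close>

definition ennpowr :: "ennreal \<Rightarrow> real \<Rightarrow> ennreal" where
  "ennpowr x a = (if x = top then top else ennreal (enn2real x powr a))"

definition Lp_qnorm :: "'a measure \<Rightarrow> ereal \<Rightarrow> ('a \<Rightarrow> ennreal) \<Rightarrow> ennreal" where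
  "Lp_qnorm M p g =
     (if p = \<infinity> then esssup M g
      else ennpowr (\<integral>\<^sup>+x. ennpowr (g x) (real_of_ereal p) \<partial>M) (1 / real_of_ereal p))"

text \<open>The sequence space is the Lebesgue space of counting measure on the integers.\<close>

definition lqLp_qnorm :: "ereal \<Rightarrow> ereal \<Rightarrow> (int \<Rightarrow> real^'n::finite \<Rightarrow> ennreal) \<Rightarrow> ennreal" where
  "lqLp_qnorm p q g = Lp_qnorm (count_space UNIV) q (\<lambda>k. Lp_qnorm lborel p (g k))"


section \<open>Homogeneous Besov-Lipschitz spaces\<close>

definition littlewood_paley :: "(real^'n::finite \<Rightarrow> complex) \<Rightarrow> bool" where
  "littlewood_paley \<psi> \<longleftrightarrow>
     schwartz \<psi> \<and>
     (\<forall>\<xi>. fourier \<psi> \<xi> \<in> \<real> \<and> 0 \<le> Re (fourier \<psi> \<xi>) \<and> Re (fourier \<psi> \<xi>) \<le> 1) \<and>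
     closure {\<xi>. fourier \<psi> \<xi> \<noteq> 0} \<subseteq> {\<xi>. 1 / 2 \<le> norm \<xi> \<and> norm \<xi> < 2} \<and>
     (\<forall>\<xi>. \<xi> \<noteq> 0 \<longrightarrow> ((\<lambda>j::int. fourier \<psi> (2 powi (- j) *\<^sub>R \<xi>)) has_sum 1) UNIV)"

text \<open>\<open>dyadic \<psi> j\<close> is $\psi_{2^{-j}}$ and \<open>lp_piece \<psi> u j\<close> is the smooth function
  $u_j = \psi_{2^{-j}} * u$.\<close>

definition dyadic :: "(real^'n::finite \<Rightarrow> complex) \<Rightarrow> int \<Rightarrow> real^'n \<Rightarrow> complex" where
  "dyadic \<psi> j y = 2 powi (j * int CARD('n)) * \<psi> (2 powi j *\<^sub>R y)"

definition lp_piece ::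
  "(real^'n::finite \<Rightarrow> complex) \<Rightarrow> ((real^'n \<Rightarrow> complex) \<Rightarrow> complex) \<Rightarrow> int \<Rightarrow> real^'n \<Rightarrow> complex" where
  "lp_piece \<psi> u j x = u (\<lambda>y. dyadic \<psi> j (x - y))"

definition besov_qnorm ::
  "(real^'n::finite \<Rightarrow> complex) \<Rightarrow> real \<Rightarrow> ereal \<Rightarrow> ereal \<Rightarrow> ((real^'n \<Rightarrow> complex) \<Rightarrow> complex) \<Rightarrow> ennreal"
where
  "besov_qnorm \<psi> s p q u =
     lqLp_qnorm p q (\<lambda>k x. ennreal (2 powr (of_int k * s)) * ennreal (cmod (lp_piece \<psi> u k x)))"

text \<open>The elements of the space are classes of tempered distributions modulo polynomials. The pieces
  $u_j$ annihilate polynomials, so we work with the distributions in these classes.\<close>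

definition besov ::
  "(real^'n::finite \<Rightarrow> complex) \<Rightarrow> real \<Rightarrow> ereal \<Rightarrow> ereal \<Rightarrow> ((real^'n \<Rightarrow> complex) \<Rightarrow> complex) set"
where
  "besov \<psi> s p q = {u. tempered_distribution u \<and> besov_qnorm \<psi> s p q u < top}"


section \<open>Iterated differences\<close>

definition diff1 :: "real^'n::finite \<Rightarrow> (real^'n \<Rightarrow> complex) \<Rightarrow> real^'n \<Rightarrow> complex" where
  "diff1 h F x = F (x + h) - F x"

definition iter_diff :: "nat \<Rightarrow> (real^'n::finite \<Rightarrow> complex) \<Rightarrow> real^'n \<Rightarrow> real^'n \<Rightarrow> complex" where
  "iter_diff L F h = (diff1 h ^^ L) F"

text \<open>The function representing the class $\Delta^L_h u$, namely
  $x \mapsto \sum_{j\in\mathbb{Z}} \Delta^L_h u_j(x)$.\<close>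

definition class_diff ::
  "(real^'n::finite \<Rightarrow> complex) \<Rightarrow> nat \<Rightarrow> ((real^'n \<Rightarrow> complex) \<Rightarrow> complex) \<Rightarrow> real^'n \<Rightarrow> real^'n \<Rightarrow> complex"
where
  "class_diff \<psi> L u h x = (\<Sum>\<^sub>\<infinity>j::int. iter_diff L (lp_piece \<psi> u j) h x)"


section \<open>Hausdorff measure\<close>

definition hausdorff_content :: "nat \<Rightarrow> real \<Rightarrow> 'a::metric_space set \<Rightarrow> ennreal" where
  "hausdorff_content d \<delta> E =
     (INF C \<in> {C :: nat \<Rightarrow> 'a set. E \<subseteq> (\<Union>i. C i) \<and> (\<forall>i. bounded (C i) \<and> diameter (C i) \<le> \<delta>)}.
        \<Sum>i. if C i = {} then 0 else ennreal (unit_ball_vol (real d) * (diameter (C i) / 2) ^ d))"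

definition hausdorff_outer :: "nat \<Rightarrow> 'a::metric_space set \<Rightarrow> ennreal" where
  "hausdorff_outer d E = (SUP \<delta>\<in>{0<..}. hausdorff_content d \<delta> E)"

text \<open>The outer measure is countably additive on Borel sets by Caratheodory's criterion, so
  \<open>emeasure\<close> of this measure agrees with it there.\<close>

definition hausdorff_measure :: "nat \<Rightarrow> 'a::metric_space measure" where
  "hausdorff_measure d = measure_of UNIV (sets borel) (hausdorff_outer d)"


section \<open>Maximal functions\<close>

text \<open>The argument \<open>D\<close> is a family of differences, \<open>D h x\<close> standing for $(\Delta^L_h f)(x)$: either
  \<open>iter_diff L F\<close> for a function \<open>F\<close>, or \<open>class_diff \<psi> L u\<close> for a class.\<close>

definition sphere_mean :: "(real^'n::finite \<Rightarrow> real^'n \<Rightarrow> complex) \<Rightarrow> real \<Rightarrow> real^'n \<Rightarrow> complex" where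
  "sphere_mean D t x =
     (LINT z:sphere 0 1|hausdorff_measure (CARD('n) - 1). D (t *\<^sub>R z) x) /
     of_real (measure (hausdorff_measure (CARD('n) - 1)) (sphere (0 :: real^'n) 1))"

definition annulus :: "(real^'n::finite) set" where
  "annulus = {z. 1 \<le> norm z \<and> norm z < 2}"

definition annulus_mean :: "(real^'n::finite \<Rightarrow> real^'n \<Rightarrow> complex) \<Rightarrow> real \<Rightarrow> real^'n \<Rightarrow> complex" where
  "annulus_mean D t x =
     (LINT z:annulus|lborel. D (t *\<^sub>R z) x) / of_real (measure lborel (annulus :: (real^'n) set))"

definition peetre_max :: "real \<Rightarrow> real \<Rightarrow> (real^'n::finite \<Rightarrow> complex) \<Rightarrow> real^'n \<Rightarrow> ennreal" where
  "peetre_max r t G x =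
     esssup lborel (\<lambda>y. ennreal (cmod (G (x - y)) * (1 + norm y / t) powr (- (real CARD('n) / r))))"

definition S_max ::
  "real \<Rightarrow> real \<Rightarrow> (real^'n::finite \<Rightarrow> real^'n \<Rightarrow> complex) \<Rightarrow> real^'n \<Rightarrow> ennreal" where
  "S_max r t D = peetre_max r t (sphere_mean D t)"

definition V_max ::
  "real \<Rightarrow> real \<Rightarrow> (real^'n::finite \<Rightarrow> real^'n \<Rightarrow> complex) \<Rightarrow> real^'n \<Rightarrow> ennreal" where
  "V_max r t D = peetre_max r t (annulus_mean D t)"

definition D_max ::
  "real \<Rightarrow> real^'n::finite \<Rightarrow> (real^'n \<Rightarrow> real^'n \<Rightarrow> complex) \<Rightarrow> real^'n \<Rightarrow> ennreal" where
  "D_max r h D = peetre_max r (norm h) (D h)"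

definition esssup_on :: "'a::euclidean_space set \<Rightarrow> ('a \<Rightarrow> ennreal) \<Rightarrow> ennreal" where
  "esssup_on A g = esssup (restrict_space lborel A) g"


section \<open>The five quasinorms\<close>

definition weighted_qnorm ::
  "real \<Rightarrow> ereal \<Rightarrow> ereal \<Rightarrow> (int \<Rightarrow> real^'n::finite \<Rightarrow> ennreal) \<Rightarrow> ennreal" where
  "weighted_qnorm s p q g = lqLp_qnorm p q (\<lambda>k x. ennreal (2 powr (of_int k * s)) * g k x)"

definition S_qnorm where
  "S_qnorm s p q r D = weighted_qnorm s p q (\<lambda>k. S_max r (2 powi (- k)) D)"

definition S_sup_qnorm where
  "S_sup_qnorm s p q r D =
     weighted_qnorm s p q (\<lambda>k x. esssup_on {0<..<2} (\<lambda>\<tau>. S_max r (\<tau> * 2 powi (- k)) D x))"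

definition V_qnorm where
  "V_qnorm s p q r D = weighted_qnorm s p q (\<lambda>k. V_max r (2 powi (- k)) D)"

definition V_sup_qnorm where
  "V_sup_qnorm s p q r D =
     weighted_qnorm s p q (\<lambda>k x. esssup_on {0<..<2} (\<lambda>\<tau>. V_max r (\<tau> * 2 powi (- k)) D x))"

definition D_sup_qnorm where
  "D_sup_qnorm s p q r D =
     weighted_qnorm s p q
       (\<lambda>k x. esssup_on {h. 0 < norm h \<and> norm h < 2} (\<lambda>h. D_max r (2 powi (- k) *\<^sub>R h) D x))"

end

theory Submission
  imports Defs "HOL-Probability.Probability"
begin

text \<open>Upper bounds: \<open>f\<^sub>j\<close> is reproduced by a rapidly decreasing kernel of width $2^{-j}$, so with
  $\sigma = n/r$ one has the pointwise bound $|f_j(x-y)| \le (1+2^j|y|)^\sigma H_j(x)$, where $H_j^p$ is a multiple of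
  the convolution of $|f_j|^p$ with $2^{jn}(1+2^j|\cdot|)^{-\sigma p}$. As $\sigma p > n$ the norm of $H_j$
  is controlled by that of $f_j$ without any maximal theorem. Since $\sigma < s < L$, the quantity
  $2^{ks} |\Delta^L_h f_j(x-y)| (1+|y|/|h|)^{-\sigma}$ with $|h| \le 4 \cdot 2^{-k}$ decays geometrically in $|j-k|$
  relative to $2^{js} H_j(x)$, and sums over $j$ can be replaced by suprema.

  Lower bounds: the mean of $\Delta^L_z$ over a small symmetric measure that does not live on a hyperplane is a Fourier multiplier
  that does not vanish on the support of the transform of \<open>\<psi>\<close>. Dividing by it (by a geometric series, which
  preserves rapid decrease) gives \<open>\<phi>\<close> whose mean difference is \<open>\<psi>\<close>; moving the differences from \<open>\<phi>\<close> to \<open>f\<close>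
  bounds $f_k$ pointwise by the maximal functions at scale $2^{-k-m}$ for a fixed \<open>m\<close>.\<close>

subsection \<open>Hausdorff measure\<close>

text \<open>The two directions use different notions of difference. A representative may carry a
  polynomial of high degree, whose differences need not vanish although its pieces do; hence the
  upper bounds concern \<open>class_diff\<close>, whereas the lower bounds rest on the identity
  \<open>reproduces\<close>, which holds for representatives as well. The obstacle in the lower
  bounds is the decay of the kernel obtained by division. Derivatives of the multiplier are avoided:
  every term of the geometric series is small in sup norm by its Fourier integral, and it is local
  in space because each step shifts by at most 1; interpolation between the two facts gives decay of
  any order. This kernel is controlled in size only, while a representative is given as integrable
  against Schwartz functions; a separate argument therefore shows that representatives are
  integrable against some power of the weight (\<open>tame\<close>). Four properties of the surface
  measure enter: it is finite, lives on the sphere, is symmetric, and is not carried by a hyperplane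
  through the origin.\<close>

definition hausdorff_weight :: "nat \<Rightarrow> 'a::metric_space set \<Rightarrow> ennreal" where
  "hausdorff_weight d S = (if S = {} then 0 else ennreal (unit_ball_vol (real d) * (diameter S / 2) ^ d))"

definition fine_cover :: "real \<Rightarrow> 'a::metric_space set \<Rightarrow> (nat \<Rightarrow> 'a set) \<Rightarrow> bool" where
  "fine_cover \<delta> E C \<longleftrightarrow> E \<subseteq> (\<Union>i. C i) \<and> (\<forall>i. bounded (C i) \<and> diameter (C i) \<le> \<delta>)"

lemma hausdorff_content_alt:
  "hausdorff_content d \<delta> E = (INF C \<in> Collect (fine_cover \<delta> E). \<Sum>i. hausdorff_weight d (C i))"
  unfolding hausdorff_content_def fine_cover_def hausdorff_weight_def by simp

lemma hausdorff_content_le: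
  "fine_cover \<delta> E C \<Longrightarrow> hausdorff_content d \<delta> E \<le> (\<Sum>i. hausdorff_weight d (C i))"
  unfolding hausdorff_content_alt by (auto intro: INF_lower)

lemma hausdorff_content_mono: "E \<subseteq> E' \<Longrightarrow> hausdorff_content d \<delta> E \<le> hausdorff_content d \<delta> E'"
  unfolding hausdorff_content_alt
  by (rule INF_superset_mono) (auto simp: fine_cover_def subset_iff)

lemma hausdorff_content_antimono: "\<delta> \<le> \<delta>' \<Longrightarrow> hausdorff_content d \<delta>' E \<le> hausdorff_content d \<delta> E"
  unfolding hausdorff_content_alt
  by (rule INF_superset_mono) (auto simp: fine_cover_def, smt (verit))

lemma hausdorff_content_empty: "0 \<le> \<delta> \<Longrightarrow> hausdorff_content d \<delta> {} = 0"
proof -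
  assume "0 \<le> \<delta>"
  then have "fine_cover \<delta> {} (\<lambda>i. {} :: 'a set)" by (auto simp: fine_cover_def)
  from hausdorff_content_le[OF this, of d] show ?thesis by (simp add: hausdorff_weight_def)
qed

text \<open>Nearly optimal covers of the \<open>A i\<close>, with errors e/2^(i+1), are merged into
  one sequence by \<open>prod_decode\<close>; the errors add up to e.\<close>

lemma hausdorff_content_countably_subadditive:
  assumes "0 \<le> \<delta>"
  shows "hausdorff_content d \<delta> (\<Union>i::nat. A i) \<le> (\<Sum>i. hausdorff_content d \<delta> (A i))"
proof (cases "(\<Sum>i. hausdorff_content d \<delta> (A i)) = top")
  case False
  have fin: "hausdorff_content d \<delta> (A i) \<noteq> top" for i
  proof
    assume "hausdorff_content d \<delta> (A i) = top"
    then have "(\<Sum>i. hausdorff_content d \<delta> (A i)) = top"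
      using sum_le_suminf[of "\<lambda>i. hausdorff_content d \<delta> (A i)" "{i}"] by (simp add: top_unique)
    with False show False by simp
  qed
  show ?thesis
  proof (rule ennreal_le_epsilon)
    fix e :: real assume "0 < e"
    have "\<exists>C. fine_cover \<delta> (A i) C \<and>
        (\<Sum>j. hausdorff_weight d (C j)) \<le> hausdorff_content d \<delta> (A i) + ennreal (e * (1/2) ^ Suc i)" for i
    proof -
      have "0 < ennreal (e * (1/2) ^ Suc i)" using \<open>0 < e\<close> by simp
      then have "hausdorff_content d \<delta> (A i) < hausdorff_content d \<delta> (A i) + ennreal (e * (1/2) ^ Suc i)"
        using fin[of i] ennreal_add_left_cancel_less[of "hausdorff_content d \<delta> (A i)" 0 "ennreal (e * (1/2) ^ Suc i)"]
        by (simp add: less_top del: power_Suc)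
      then show ?thesis unfolding hausdorff_content_alt INF_less_iff by (auto intro: less_imp_le)
    qed
    then obtain C where C: "\<And>i. fine_cover \<delta> (A i) (C i)"
      "\<And>i. (\<Sum>j. hausdorff_weight d (C i j)) \<le> hausdorff_content d \<delta> (A i) + ennreal (e * (1/2) ^ Suc i)"
      by metis
    define C' where "C' n = case_prod C (prod_decode n)" for n
    have "fine_cover \<delta> (\<Union>i. A i) C'"
      unfolding fine_cover_def
    proof
      show "(\<Union>i. A i) \<subseteq> (\<Union>i. C' i)"
      proof
        fix x assume "x \<in> (\<Union>i. A i)"
        then obtain i where "x \<in> A i" by auto
        then obtain j where "x \<in> C i j" using C(1)[of i] by (auto simp: fine_cover_def)
        then have "x \<in> C' (prod_encode (i, j))" by (simp add: C'_def)
        then show "x \<in> (\<Union>i. C' i)" by blast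
      qed
      show "\<forall>i. bounded (C' i) \<and> diameter (C' i) \<le> \<delta>" using C(1) by (auto simp: fine_cover_def C'_def split: prod.split)
    qed
    from hausdorff_content_le[OF this, of d]
    have "hausdorff_content d \<delta> (\<Union>i. A i) \<le> (\<Sum>n. hausdorff_weight d (C' n))" .
    also have "\<dots> = (\<Sum>n. (\<lambda>(i,j). hausdorff_weight d (C i j)) (prod_decode n))" by (simp add: C'_def case_prod_beta)
    also have "\<dots> = (\<Sum>i. \<Sum>j. hausdorff_weight d (C i j))" by (rule suminf_ennreal_2dimen) simp
    also have "\<dots> \<le> (\<Sum>i. hausdorff_content d \<delta> (A i) + ennreal (e * (1/2) ^ Suc i))" by (intro suminf_le C) auto
    also have "\<dots> = (\<Sum>i. hausdorff_content d \<delta> (A i)) + (\<Sum>i. ennreal (e * (1/2) ^ Suc i))" by (rule suminf_add[symmetric]) auto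
    also have "(\<Sum>i. ennreal (e * (1/2) ^ Suc i)) = ennreal e"
    proof (rule suminf_ennreal_eq)
      show "(\<lambda>i. e * (1/2) ^ Suc i) sums e" using sums_mult[OF power_half_series, of e] by simp
    qed (use \<open>0 < e\<close> in simp)
    finally show "hausdorff_content d \<delta> (\<Union>i. A i) \<le> (\<Sum>i. hausdorff_content d \<delta> (A i)) + ennreal e" .
  qed
qed simp

lemma hausdorff_outer_mono: "E \<subseteq> E' \<Longrightarrow> hausdorff_outer d E \<le> hausdorff_outer d E'"
  unfolding hausdorff_outer_def by (intro SUP_mono') (rule hausdorff_content_mono)

lemma hausdorff_content_le_outer: "0 < \<delta> \<Longrightarrow> hausdorff_content d \<delta> E \<le> hausdorff_outer d E"
  unfolding hausdorff_outer_def by (rule SUP_upper) simp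

lemma hausdorff_outer_countably_subadditive:
  "hausdorff_outer d (\<Union>i::nat. A i) \<le> (\<Sum>i. hausdorff_outer d (A i))"
  unfolding hausdorff_outer_def[of d "\<Union>i. A i"]
proof (rule SUP_least)
  fix \<delta> :: real assume "\<delta> \<in> {0<..}"
  then have "hausdorff_content d \<delta> (\<Union>i. A i) \<le> (\<Sum>i. hausdorff_content d \<delta> (A i))"
    by (intro hausdorff_content_countably_subadditive) auto
  also have "\<dots> \<le> (\<Sum>i. hausdorff_outer d (A i))"
    by (intro suminf_le hausdorff_content_le_outer) (use \<open>\<delta> \<in> {0<..}\<close> in auto)
  finally show "hausdorff_content d \<delta> (\<Union>i. A i) \<le> (\<Sum>i. hausdorff_outer d (A i))" .
qed

lemma hausdorff_outer_empty: "hausdorff_outer d {} = 0"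
  unfolding hausdorff_outer_def by (simp add: hausdorff_content_empty cong: SUP_cong_simp)

lemma hausdorff_outer_measure_space: "outer_measure_space UNIV (hausdorff_outer d)"
  unfolding outer_measure_space_def positive_def increasing_def countably_subadditive_def
  by (auto simp: hausdorff_outer_empty hausdorff_outer_mono hausdorff_outer_countably_subadditive)

lemma hausdorff_outer_Un: "hausdorff_outer d (A \<union> B) \<le> hausdorff_outer d A + hausdorff_outer d B"
proof -
  have "A \<union> B = (\<Union>i. binaryset A B i)" by (simp add: UN_binaryset_eq)
  then show ?thesis
    using hausdorff_outer_countably_subadditive[of d "binaryset A B"]
      suminf_binaryset_eq[of "hausdorff_outer d" A B] by (simp add: hausdorff_outer_empty)
qed

lemma hausdorff_weight_mono:
  assumes "A \<subseteq> B" "bounded B" shows "hausdorff_weight d A \<le> hausdorff_weight d B"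
proof (cases "A = {}")
  case False
  then have "B \<noteq> {}" using assms by auto
  have "diameter A \<le> diameter B" "0 \<le> diameter A" using assms diameter_subset diameter_ge_0 bounded_subset by blast+
  then show ?thesis using False \<open>B \<noteq> {}\<close>
    unfolding hausdorff_weight_def
    by (auto intro!: ennreal_leI mult_left_mono power_mono)
qed (simp add: hausdorff_weight_def)

text \<open>No member of a cover finer than \<open>e\<close> meets both sets, so every such cover
  splits into a cover of \<open>A\<close> and a cover of \<open>B\<close> at no extra cost.\<close>

lemma hausdorff_outer_separated:
  assumes e: "0 < e" and sep: "\<And>a b. a \<in> A \<Longrightarrow> b \<in> B \<Longrightarrow> e \<le> dist a b"
  shows "hausdorff_outer d A + hausdorff_outer d B \<le> hausdorff_outer d (A \<union> B)"
proof -
  have fine: "hausdorff_content d \<delta> A + hausdorff_content d \<delta> B \<le> hausdorff_content d \<delta> (A \<union> B)"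
    if \<delta>: "0 < \<delta>" "\<delta> < e" for \<delta>
    unfolding hausdorff_content_alt[of d \<delta> "A \<union> B"]
  proof (rule INF_greatest)
    fix C assume "C \<in> Collect (fine_cover \<delta> (A \<union> B))"
    then have C: "A \<union> B \<subseteq> (\<Union>i. C i)" "\<And>i. bounded (C i)" "\<And>i. diameter (C i) \<le> \<delta>"
      by (auto simp: fine_cover_def)
    have "fine_cover \<delta> A (\<lambda>i. C i \<inter> A)" "fine_cover \<delta> B (\<lambda>i. C i \<inter> B)"
      unfolding fine_cover_def using C
      by (auto intro!: bounded_Int order_trans[OF diameter_subset C(3)])
    then have "hausdorff_content d \<delta> A + hausdorff_content d \<delta> B
      \<le> (\<Sum>i. hausdorff_weight d (C i \<inter> A)) + (\<Sum>i. hausdorff_weight d (C i \<inter> B))"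
      by (intro add_mono hausdorff_content_le)
    also have "\<dots> = (\<Sum>i. hausdorff_weight d (C i \<inter> A) + hausdorff_weight d (C i \<inter> B))" by (rule suminf_add) auto
    also have "\<dots> \<le> (\<Sum>i. hausdorff_weight d (C i))"
    proof (intro suminf_le allI)
      fix i
      have "C i \<inter> A = {} \<or> C i \<inter> B = {}"
      proof (rule ccontr)
        assume "\<not> (C i \<inter> A = {} \<or> C i \<inter> B = {})"
        then obtain a b where ab: "a \<in> C i" "a \<in> A" "b \<in> C i" "b \<in> B" by auto
        then have "dist a b \<le> diameter (C i)" using C(2) diameter_bounded_bound by blast
        with sep[OF ab(2,4)] C(3)[of i] \<delta> show False by linarith
      qed
      then show "hausdorff_weight d (C i \<inter> A) + hausdorff_weight d (C i \<inter> B) \<le> hausdorff_weight d (C i)"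
        using hausdorff_weight_mono[of "C i \<inter> A" "C i" d] hausdorff_weight_mono[of "C i \<inter> B" "C i" d] C(2)[of i]
        by (elim disjE) (simp_all add: hausdorff_weight_def[of d "{}"])
    qed auto
    finally show "hausdorff_content d \<delta> A + hausdorff_content d \<delta> B \<le> (\<Sum>i. hausdorff_weight d (C i))" .
  qed
  \<comment> \<open>The two outer measures are suprema over independent finenesses; both contents
    are compared at the smaller one, capped below \<open>e\<close>.\<close>
  have le: "hausdorff_content d \<delta>1 A + hausdorff_content d \<delta>2 B \<le> hausdorff_outer d (A \<union> B)"
    if "0 < \<delta>1" "0 < \<delta>2" for \<delta>1 \<delta>2
  proof -
    define \<delta> where "\<delta> = min (min \<delta>1 \<delta>2) (e/2)"
    have \<delta>: "0 < \<delta>" "\<delta> < e" "\<delta> \<le> \<delta>1" "\<delta> \<le> \<delta>2" using that e by (auto simp: \<delta>_def)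
    have "hausdorff_content d \<delta>1 A + hausdorff_content d \<delta>2 B \<le> hausdorff_content d \<delta> A + hausdorff_content d \<delta> B"
      by (intro add_mono hausdorff_content_antimono \<delta>)
    also have "\<dots> \<le> hausdorff_outer d (A \<union> B)"
      using fine[OF \<delta>(1,2)] hausdorff_content_le_outer[OF \<delta>(1)] by (rule order_trans)
    finally show ?thesis .
  qed
  have "hausdorff_outer d A + hausdorff_content d \<delta>2 B \<le> hausdorff_outer d (A \<union> B)" if "0 < \<delta>2" for \<delta>2
    unfolding hausdorff_outer_def[of d A]
    by (subst ennreal_SUP_add_left[symmetric]) (auto intro!: SUP_least le that)
  then show ?thesis
    unfolding hausdorff_outer_def[of d B]
    by (subst ennreal_SUP_add_right) (auto intro!: SUP_least)
qed

lemma ennreal_suminf_tail_tendsto_0: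
  fixes v :: "nat \<Rightarrow> ennreal"
  assumes "(\<Sum>i. v i) \<noteq> top"
  shows "(\<lambda>n. \<Sum>i. v (i + n)) \<longlonglongrightarrow> 0"
proof -
  have fin: "v i \<noteq> top" for i using assms sum_le_suminf[of v "{i}"] by (auto simp: top_unique)
  define w where "w i = enn2real (v i)" for i
  have v: "v i = ennreal (w i)" and w: "0 \<le> w i" for i using fin[of i] by (auto simp: w_def less_top)
  have sm: "summable w" by (rule summable_suminf_not_top) (use assms w v in auto)
  have "(\<lambda>n. ennreal (\<Sum>i. w (i + n))) \<longlonglongrightarrow> ennreal 0" by (intro tendsto_ennrealI suminf_exist_split2 sm)
  moreover have "(\<Sum>i. v (i + n)) = ennreal (\<Sum>i. w (i + n))" for n
    unfolding v using sm w by (intro suminf_ennreal2) (auto simp: summable_iff_shift)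
  ultimately show ?thesis by simp
qed

text \<open>This is Caratheodory's criterion for metric outer measures. The part of \<open>X\<close>
  off \<open>K\<close> is exhausted by the sets \<open>A n\<close> of points at distance at least
  1/(n+1) from \<open>K\<close>, each of which is separated from \<open>K\<close>; what remains is
  covered by shells whose outer measures form the tail of a convergent series.\<close>

lemma hausdorff_outer_closed_additive:
  fixes K :: "'a::metric_space set"
  assumes K: "closed K"
  shows "hausdorff_outer d (K \<inter> X) + hausdorff_outer d (- K \<inter> X) = hausdorff_outer d X"
proof (rule antisym)
  show "hausdorff_outer d X \<le> hausdorff_outer d (K \<inter> X) + hausdorff_outer d (- K \<inter> X)"
    using hausdorff_outer_Un[of d "K \<inter> X" "- K \<inter> X"] by (simp add: Int_Un_distrib2[symmetric])
  show "hausdorff_outer d (K \<inter> X) + hausdorff_outer d (- K \<inter> X) \<le> hausdorff_outer d X"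
  proof (cases "K = {} \<or> hausdorff_outer d X = top")
    case True
    then show ?thesis by (auto simp: hausdorff_outer_empty)
  next
    case False
    define A where "A n = {x \<in> X. 1 / (real n + 1) \<le> infdist x K}" for n :: nat
    define D where "D n = A (Suc n) - A n" for n
    let ?u = "\<lambda>n. hausdorff_outer d (A n)" and ?v = "\<lambda>n. hausdorff_outer d (D n)"
    have anti: "1 / (real (Suc n) + 1) < 1 / (real n + 1)" for n by (simp add: field_simps)
    have mono: "A n \<subseteq> A (Suc n)" for n using anti[of n] by (auto simp: A_def)
    then have mono': "m \<le> n \<Longrightarrow> A m \<subseteq> A n" for m n by (rule lift_Suc_mono_le)
    have AX: "A n \<subseteq> X" for n by (auto simp: A_def)
    have sepK: "hausdorff_outer d (K \<inter> X) + ?u n \<le> hausdorff_outer d X" for n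
    proof -
      have "hausdorff_outer d (K \<inter> X) + ?u n \<le> hausdorff_outer d (K \<inter> X \<union> A n)"
      proof (rule hausdorff_outer_separated)
        show "0 < 1 / (real n + 1)" by simp
        fix a b assume "a \<in> K \<inter> X" "b \<in> A n"
        then show "1 / (real n + 1) \<le> dist a b" using infdist_le[of a K b] by (auto simp: A_def dist_commute)
      qed
      also have "\<dots> \<le> hausdorff_outer d X" using AX by (intro hausdorff_outer_mono) auto
      finally show ?thesis .
    qed
    have step: "?u n + ?v (Suc n) \<le> ?u (Suc (Suc n))" for n
    proof -
      have "?u n + ?v (Suc n) \<le> hausdorff_outer d (A n \<union> D (Suc n))"
      proof (rule hausdorff_outer_separated)
        show "0 < 1 / (real n + 1) - 1 / (real (Suc n) + 1)" using anti[of n] by simp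
        fix a b assume "a \<in> A n" "b \<in> D (Suc n)"
        then have "1 / (real n + 1) \<le> infdist a K" "infdist b K < 1 / (real (Suc n) + 1)" by (auto simp: A_def D_def)
        with infdist_triangle[of a K b] show "1 / (real n + 1) - 1 / (real (Suc n) + 1) \<le> dist a b" by linarith
      qed
      also have "\<dots> \<le> ?u (Suc (Suc n))" using mono'[of n "Suc (Suc n)"] by (intro hausdorff_outer_mono) (auto simp: D_def)
      finally show ?thesis .
    qed
    \<comment> \<open>Neighbouring shells may touch, so their measures do not simply add up. But the
      shell between \<open>A (N+1)\<close> and \<open>A (N+2)\<close> is separated from
      \<open>A N\<close>; keeping two consecutive terms on the right handles even and odd shells in
      one induction.\<close>
    have sum: "(\<Sum>i<N. ?v (Suc i)) \<le> ?u N + ?u (Suc N)" for N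
    proof (induction N)
      case (Suc N)
      have "(\<Sum>i<Suc N. ?v (Suc i)) \<le> ?u N + ?u (Suc N) + ?v (Suc N)" using add_right_mono[OF Suc] by simp
      also have "\<dots> = (?u N + ?v (Suc N)) + ?u (Suc N)" by (simp add: ac_simps)
      also have "\<dots> \<le> ?u (Suc (Suc N)) + ?u (Suc N)" by (intro add_right_mono step)
      finally show ?case by (simp add: ac_simps)
    qed simp
    have "(\<Sum>i. ?v (Suc i)) \<le> hausdorff_outer d X + hausdorff_outer d X"
    proof (rule suminf_le_const)
      fix N
      show "(\<Sum>i<N. ?v (Suc i)) \<le> hausdorff_outer d X + hausdorff_outer d X"
        by (rule order_trans[OF sum]) (intro add_mono hausdorff_outer_mono AX)
    qed auto
    moreover have "hausdorff_outer d X + hausdorff_outer d X \<noteq> top" using False by simp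
    ultimately have fin: "(\<Sum>i. ?v (Suc i)) \<noteq> top" by (metis top_unique)
    have lim: "(\<lambda>n. hausdorff_outer d X + (\<Sum>i. ?v (Suc (i + n)))) \<longlonglongrightarrow> hausdorff_outer d X + 0"
      by (intro tendsto_add tendsto_const ennreal_suminf_tail_tendsto_0[OF fin])
    show ?thesis
    proof (rule LIMSEQ_le_const[OF lim[simplified]], intro exI allI impI)
      fix n :: nat
      have sub: "- K \<inter> X \<subseteq> A (Suc n) \<union> (\<Union>i. D (Suc (i + n)))"
      proof
        fix x assume x: "x \<in> - K \<inter> X"
        then have "0 < infdist x K"
          using False K infdist_nonneg[of x K] in_closed_iff_infdist_zero[of K x] by (metis ComplD IntD1 order_le_less)
        then obtain m where "1 / (real m + 1) < infdist x K" using nat_approx_posE[of "infdist x K"] by (auto simp: add.commute)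
        then have m: "x \<in> A m" using x by (auto simp: A_def)
        define k where "k = (LEAST m. x \<in> A m)"
        have "x \<in> A k" unfolding k_def using m by (rule LeastI)
        moreover have "k = 0 \<or> x \<notin> A (k - 1)"
          using not_less_Least[of "k - 1" "\<lambda>m. x \<in> A m"] unfolding k_def[symmetric] by (cases k) auto
        ultimately obtain m where m: "x \<in> A m" "m = 0 \<or> x \<notin> A (m - 1)" by blast
        show "x \<in> A (Suc n) \<union> (\<Union>i. D (Suc (i + n)))"
        proof (cases "m \<le> Suc n")
          case True
          then show ?thesis using m(1) mono' by blast
        next
          case False
          then obtain i where i: "m = Suc (Suc (i + n))" by (metis add.commute add_Suc_right less_iff_Suc_add not_le)
          then have "x \<in> D (Suc (i + n))" using m by (auto simp: D_def)
          then show ?thesis by blast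
        qed
      qed
      have "hausdorff_outer d (- K \<inter> X) \<le> ?u (Suc n) + hausdorff_outer d (\<Union>i. D (Suc (i + n)))"
        by (rule order_trans[OF hausdorff_outer_mono[OF sub] hausdorff_outer_Un])
      also have "\<dots> \<le> ?u (Suc n) + (\<Sum>i. ?v (Suc (i + n)))" by (intro add_left_mono hausdorff_outer_countably_subadditive)
      finally have "hausdorff_outer d (K \<inter> X) + hausdorff_outer d (- K \<inter> X)
         \<le> (hausdorff_outer d (K \<inter> X) + ?u (Suc n)) + (\<Sum>i. ?v (Suc (i + n)))"
        by (simp add: add_left_mono add.assoc)
      also have "\<dots> \<le> hausdorff_outer d X + (\<Sum>i. ?v (Suc (i + n)))" by (intro add_right_mono sepK)
      finally show "hausdorff_outer d (K \<inter> X) + hausdorff_outer d (- K \<inter> X)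
          \<le> hausdorff_outer d X + (\<Sum>i. ?v (Suc (i + n)))" .
    qed
  qed
qed

lemma space_hausdorff_measure [simp]: "space (hausdorff_measure d) = UNIV"
  and sets_hausdorff_measure [simp, measurable_cong]: "sets (hausdorff_measure d) = sets borel"
  unfolding hausdorff_measure_def by (auto simp: sets.sigma_sets_eq[of borel, simplified] sets_measure_of)

text \<open>\<open>measure_of\<close> yields the zero measure unless countable additivity is proved.
  It holds on the Caratheodory-measurable sets, a sigma-algebra that contains the closed sets by the
  preceding criterion and hence all Borel sets.\<close>

lemma emeasure_hausdorff_measure:
  fixes A :: "'a::metric_space set"
  assumes "A \<in> sets borel"
  shows "emeasure (hausdorff_measure d) A = hausdorff_outer d A"
proof -
  let ?L = "lambda_system UNIV UNIV (hausdorff_outer d) :: 'a set set"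
  have "sigma_algebra (UNIV::'a set) UNIV" using sigma_algebra_Pow[of UNIV] by simp
  from sigma_algebra.caratheodory_lemma[OF this hausdorff_outer_measure_space, of d]
  have L: "measure_space UNIV ?L (hausdorff_outer d)" .
  then interpret L: sigma_algebra UNIV ?L by (simp add: measure_space_def)
  have "sigma_sets UNIV (Collect closed) \<subseteq> ?L" by (rule L.sigma_sets_subset)
       (auto simp: lambda_system_def hausdorff_outer_closed_additive Compl_eq_Diff_UNIV[symmetric])
  then have sub: "sets borel \<subseteq> ?L" by (simp add: borel_eq_closed)
  have "countably_additive (sets borel) (hausdorff_outer d :: 'a set \<Rightarrow> ennreal)"
    using L sub unfolding measure_space_def countably_additive_def by blast
  then show ?thesis by (intro emeasure_measure_of[OF hausdorff_measure_def])
       (use assms in \<open>auto simp: positive_def hausdorff_outer_empty\<close>)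
qed

section \<open>Invariance of Hausdorff measure under isometries\<close>

lemma hausdorff_outer_isometry_le:
  fixes f :: "'a::metric_space \<Rightarrow> 'a"
  assumes f: "\<And>x y. dist (f x) (f y) = dist x y"
  shows "hausdorff_outer d (f ` E) \<le> hausdorff_outer d E"
  unfolding hausdorff_outer_def
proof (rule SUP_mono', unfold hausdorff_content_alt[of d _ E], rule INF_greatest)
  fix \<delta> C assume "C \<in> Collect (fine_cover \<delta> E)"
  then have C: "fine_cover \<delta> E C" by simp
  have bd: "bounded (f ` S) \<and> diameter (f ` S) = diameter S" if "bounded S" for S
  proof
    show "bounded (f ` S)" using that unfolding bounded_two_points by (simp add: f)
    have "(\<lambda>(x, y). dist x y) ` (f ` S \<times> f ` S) = (\<lambda>(x, y). dist x y) ` map_prod f f ` (S \<times> S)"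
      by (simp add: map_prod_surj_on[OF refl refl])
    also have "\<dots> = (\<lambda>(x, y). dist x y) ` (S \<times> S)" by (simp add: image_image case_prod_beta f)
    finally show "diameter (f ` S) = diameter S" unfolding diameter_def by simp
  qed
  have "fine_cover \<delta> (f ` E) (\<lambda>i. f ` C i)"
    unfolding fine_cover_def
  proof (intro conjI allI)
    show "f ` E \<subseteq> (\<Union>i. f ` C i)" using C unfolding fine_cover_def image_UN[symmetric] by (intro image_mono) simp
  qed (use C bd in \<open>auto simp: fine_cover_def\<close>)
  from hausdorff_content_le[OF this, of d]
  have "hausdorff_content d \<delta> (f ` E) \<le> (\<Sum>i. hausdorff_weight d (f ` C i))" .
  also have "(\<lambda>i. hausdorff_weight d (f ` C i)) = (\<lambda>i. hausdorff_weight d (C i))"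
    using bd C by (auto simp: hausdorff_weight_def fine_cover_def fun_eq_iff)
  finally show "hausdorff_content d \<delta> (f ` E) \<le> (\<Sum>i. hausdorff_weight d (C i))" .
qed

text \<open>The outer measure does not grow under an isometry; using this for \<open>f\<close> and
  for \<open>inv f\<close> gives equality.\<close>

lemma distr_hausdorff_measure:
  fixes f :: "'a::euclidean_space \<Rightarrow> 'a"
  assumes f: "orthogonal_transformation f"
  shows "distr (hausdorff_measure d) borel f = hausdorff_measure d"
proof (rule measure_eqI)
  have lin: "linear f" using f by (simp add: orthogonal_transformation_linear)
  then have [measurable]: "f \<in> borel_measurable borel"
    by (intro borel_measurable_continuous_onI linear_continuous_on linear_conv_bounded_linear[THEN iffD1])
  fix A :: "'a set" assume "A \<in> sets (distr (hausdorff_measure d) borel f)"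
  then have A [measurable]: "A \<in> sets borel" by simp
  have bij: "bij f" using f by (rule orthogonal_transformation_bij)
  have iso: "dist (f x) (f y) = dist x y" for x y using f by (simp add: orthogonal_transformation_isometry)
  have iso': "dist (inv f x) (inv f y) = dist x y" for x y using iso[of "inv f x" "inv f y"] bij by (simp add: bij_is_surj surj_f_inv_f)
  have m: "f -` A \<in> sets borel" using measurable_sets[of f borel borel A] by simp
  have "emeasure (distr (hausdorff_measure d) borel f) A = hausdorff_outer d (f -` A)"
    by (subst emeasure_distr) (auto simp: emeasure_hausdorff_measure m)
  also have "f -` A = inv f ` A" using bij by (rule bij_vimage_eq_inv_image)
  also have "hausdorff_outer d (inv f ` A) = hausdorff_outer d A"
  proof (rule antisym)
    show "hausdorff_outer d (inv f ` A) \<le> hausdorff_outer d A" by (rule hausdorff_outer_isometry_le[OF iso'])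
    have "A = f ` inv f ` A" using bij by (simp add: bij_is_surj image_f_inv_f)
    then show "hausdorff_outer d A \<le> hausdorff_outer d (inv f ` A)" using hausdorff_outer_isometry_le[OF iso, of d "inv f ` A"] by simp
  qed
  finally show "emeasure (distr (hausdorff_measure d) borel f) A = emeasure (hausdorff_measure d) A" by (simp add: emeasure_hausdorff_measure)
qed simp

section \<open>Finiteness and positivity of the measure of the sphere\<close>

lemma power_diff_le:
  fixes x y :: real
  assumes "0 \<le> y" "y \<le> x" "x \<le> 2"
  shows "x ^ n - y ^ n \<le> real n * 2 ^ n * (x - y)"
proof (induction n)
  case (Suc n)
  have "x ^ Suc n - y ^ Suc n = x * (x ^ n - y ^ n) + y ^ n * (x - y)" by (simp add: algebra_simps)
  also have "\<dots> \<le> 2 * (x ^ n - y ^ n) + 2 ^ n * (x - y)" using assms by (intro add_mono mult_right_mono power_mono) (auto intro: power_mono)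
  also have "\<dots> \<le> 2 * (real n * 2 ^ n * (x - y)) + 2 * 2 ^ n * (x - y)"
    using Suc assms by (intro add_mono mult_left_mono mult_right_mono) auto
  also have "\<dots> = real (Suc n) * 2 ^ Suc n * (x - y)" by (simp add: algebra_simps)
  finally show ?case .
qed simp

text \<open>The balls of radius \<delta>/2 about the points are disjoint and lie in the shell of
  radii 1 - \<delta>/2 and 1 + \<delta>/2. Its volume is of order \<delta>, theirs of order
  \<delta>^n each, which leaves n - 1 powers.\<close>

lemma sphere_packing_card:
  fixes T :: "'a::euclidean_space set"
  assumes T: "finite T" "T \<subseteq> sphere 0 1" "\<And>x y. x \<in> T \<Longrightarrow> y \<in> T \<Longrightarrow> x \<noteq> y \<Longrightarrow> \<delta> \<le> dist x y"
    and \<delta>: "0 < \<delta>" "\<delta> \<le> 1"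
  shows "real (card T) * \<delta> ^ (DIM('a) - 1) \<le> real DIM('a) * 4 ^ DIM('a)"
proof -
  let ?n = "DIM('a)" let ?c = "unit_ball_vol (real DIM('a))"
  have fm: "ball x r \<in> fmeasurable lborel" for x :: 'a and r using emeasure_lborel_ball_finite[of x r] by (intro fmeasurableI) auto
  have "real (card T) * (?c * (\<delta>/2) ^ ?n) = (\<Sum>x\<in>T. measure lborel (ball x (\<delta>/2)))" using \<delta> by (simp add: content_ball)
  also have "\<dots> = measure lborel (\<Union>x\<in>T. ball x (\<delta>/2))"
  proof (rule measure_finite_Union[symmetric])
    show "disjoint_family_on (\<lambda>x. ball x (\<delta>/2)) T"
      unfolding disjoint_family_on_def
    proof (intro ballI impI)
      fix x y assume "x \<in> T" "y \<in> T" "x \<noteq> y"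
      then have "\<delta> \<le> dist x y" using T by blast
      then show "ball x (\<delta>/2) \<inter> ball y (\<delta>/2) = {}" by (intro disjoint_ballI) simp
    qed
  qed (use T fmeasurableD2[OF fm] in auto)
  also have "\<dots> \<le> measure lborel (ball 0 (1 + \<delta>/2) - ball (0::'a) (1 - \<delta>/2))"
  proof (rule measure_mono_fmeasurable)
    show "(\<Union>x\<in>T. ball x (\<delta>/2)) \<subseteq> ball 0 (1 + \<delta>/2) - ball 0 (1 - \<delta>/2)"
    proof
      fix z assume "z \<in> (\<Union>x\<in>T. ball x (\<delta>/2))"
      then obtain x where x: "x \<in> T" "dist x z < \<delta>/2" by auto
      have "norm x = 1" using x T by (auto simp: subset_iff)
      with x norm_triangle_ineq2[of z x] norm_triangle_ineq2[of x z]
      show "z \<in> ball 0 (1 + \<delta>/2) - ball 0 (1 - \<delta>/2)" by (auto simp: dist_norm norm_minus_commute)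
    qed
  qed (use fm in \<open>auto intro!: fmeasurable.Diff borel_open\<close>)
  also have "\<dots> = measure lborel (ball (0::'a) (1 + \<delta>/2)) - measure lborel (ball (0::'a) (1 - \<delta>/2))"
  proof (rule measure_Diff)
    show "ball 0 (1 - \<delta>/2) \<subseteq> ball (0::'a) (1 + \<delta>/2)" using \<delta> by (intro subset_ball) simp
  qed (use fmeasurableD2[OF fm] in auto)
  also have "\<dots> = ?c * ((1 + \<delta>/2) ^ ?n - (1 - \<delta>/2) ^ ?n)" using \<delta> by (simp add: content_ball algebra_simps)
  also have "\<dots> \<le> ?c * (real ?n * 2 ^ ?n * ((1 + \<delta>/2) - (1 - \<delta>/2)))"
    using \<delta> by (intro mult_left_mono power_diff_le) auto
  finally have "?c * (real (card T) * (\<delta>/2) ^ ?n) \<le> ?c * (real ?n * 2 ^ ?n * \<delta>)" by (simp add: algebra_simps)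
  then have "real (card T) * (\<delta>/2) ^ ?n \<le> real ?n * 2 ^ ?n * \<delta>" by (simp add: unit_ball_vol_pos)
  then have "real (card T) * \<delta> ^ ?n \<le> real ?n * 2 ^ ?n * \<delta> * 2 ^ ?n" by (simp add: power_divide field_simps)
  also have "\<delta> ^ ?n = \<delta> ^ (?n - 1) * \<delta>" using power_Suc2[of \<delta> "?n - 1"] by simp
  finally have "(real (card T) * \<delta> ^ (?n - 1)) * \<delta> \<le> (real ?n * 4 ^ ?n) * \<delta>"
    using power_mult_distrib[of "2::real" 2 ?n] by (simp add: ac_simps)
  then show ?thesis using \<delta> by simp
qed

text \<open>A \<delta>-separated set of maximal cardinality is a \<delta>-net, so balls of radius
  \<delta> about it cover the sphere. The packing bound makes their total weight independent of
  \<delta>.\<close>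

lemma hausdorff_outer_sphere_finite:
  "hausdorff_outer (DIM('a) - 1) (sphere (0::'a::euclidean_space) 1) < top"
proof -
  let ?d = "DIM('a) - 1"
  define K where "K = unit_ball_vol (real ?d) * (real DIM('a) * 4 ^ DIM('a))"
  have "hausdorff_content ?d \<epsilon> (sphere (0::'a) 1) \<le> ennreal K" if "0 < \<epsilon>" for \<epsilon>
  proof -
    define \<delta> where "\<delta> = min 1 (\<epsilon>/2)"
    have \<delta>: "0 < \<delta>" "\<delta> \<le> 1" "2 * \<delta> \<le> \<epsilon>" using that by (auto simp: \<delta>_def)
    define P where "P T \<longleftrightarrow> finite T \<and> T \<subseteq> sphere (0::'a) 1 \<and> (\<forall>x\<in>T. \<forall>y\<in>T. x \<noteq> y \<longrightarrow> \<delta> \<le> dist x y)" for T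
    have bound: "real (card T) * \<delta> ^ ?d \<le> real DIM('a) * 4 ^ DIM('a)" if "P T" for T
      using that \<delta> unfolding P_def by (intro sphere_packing_card) auto
    \<comment> \<open>A strict upper bound for all packing cardinalities, which guarantees that a
      largest packing exists.\<close>
    define N where "N = nat \<lceil>real DIM('a) * 4 ^ DIM('a) / \<delta> ^ ?d\<rceil> + 1"
    have "card T < N" if "P T" for T
    proof -
      have "real (card T) \<le> real DIM('a) * 4 ^ DIM('a) / \<delta> ^ ?d" using bound[OF that] \<delta> by (simp add: pos_le_divide_eq)
      then show ?thesis unfolding N_def by linarith
    qed
    moreover have "P {}" by (simp add: P_def)
    ultimately obtain T where T: "P T" and max: "\<And>T'. P T' \<Longrightarrow> card T' \<le> card T"
      using ex_has_greatest_nat[of P "{}" card N] by blast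
    have fT: "finite T" using T by (simp add: P_def)
    have cov: "\<exists>y\<in>T. dist y x \<le> \<delta>" if "x \<in> sphere 0 1" for x
    proof (rule ccontr)
      assume neg: "\<not> ?thesis"
      then have "x \<notin> T" using \<delta> by force
      moreover have "P (insert x T)" using T neg that unfolding P_def by (auto simp: dist_commute not_le intro: less_imp_le)
      ultimately show False using max[of "insert x T"] fT by simp
    qed
    obtain g where g: "bij_betw g {..<card T} T"
      using fT ex_bij_betw_nat_finite[of T] by (auto simp: atLeast0LessThan)
    define C where "C i = (if i < card T then cball (g i) \<delta> else {})" for i
    have dia: "diameter (C i) \<le> 2 * \<delta>" for i using \<delta> by (auto simp: C_def)
    have "fine_cover \<epsilon> (sphere 0 1) C"
      unfolding fine_cover_def
    proof (intro conjI allI)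
      show "sphere 0 1 \<subseteq> (\<Union>i. C i)"
      proof
        fix x :: 'a assume "x \<in> sphere 0 1"
        then obtain y where y: "y \<in> T" "dist y x \<le> \<delta>" using cov by blast
        then obtain i where "i < card T" "g i = y" using g by (metis bij_betw_iff_bijections lessThan_iff)
        then have "x \<in> C i" using y by (simp add: C_def)
        then show "x \<in> (\<Union>i. C i)" by blast
      qed
    qed (use dia \<delta> in \<open>auto simp: C_def intro: order_trans\<close>)
    from hausdorff_content_le[OF this, of ?d]
    have "hausdorff_content ?d \<epsilon> (sphere (0::'a) 1) \<le> (\<Sum>i. hausdorff_weight ?d (C i))" .
    also have "\<dots> = (\<Sum>i<card T. hausdorff_weight ?d (C i))" by (rule suminf_finite) (auto simp: C_def hausdorff_weight_def)
    also have "\<dots> \<le> (\<Sum>i<card T. ennreal (unit_ball_vol (real ?d) * \<delta> ^ ?d))"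
    proof (intro sum_mono)
      fix i
      have "(diameter (C i) / 2) ^ ?d \<le> \<delta> ^ ?d" using dia[of i] by (intro power_mono) (auto simp: C_def intro!: diameter_ge_0)
      then show "hausdorff_weight ?d (C i) \<le> ennreal (unit_ball_vol (real ?d) * \<delta> ^ ?d)"
        by (auto simp: hausdorff_weight_def intro!: ennreal_leI mult_left_mono)
    qed
    also have "\<dots> = ennreal (unit_ball_vol (real ?d) * (real (card T) * \<delta> ^ ?d))"
      using \<delta> by (simp add: ennreal_of_nat_eq_real_of_nat algebra_simps flip: ennreal_mult)
    also have "\<dots> \<le> ennreal K" unfolding K_def by (intro ennreal_leI mult_left_mono bound T) auto
    finally show ?thesis .
  qed
  then have "hausdorff_outer ?d (sphere (0::'a) 1) \<le> ennreal K" unfolding hausdorff_outer_def by (intro SUP_least) auto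
  then show ?thesis by (rule le_less_trans) simp
qed

text \<open>The cone over a patch of diameter at most \<eta> is a tube around the single segment
  from 0 to \<open>a\<close>. About 1/\<eta> balls of radius 2\<eta> cover it, so its volume is of
  order \<eta>^(n-1), the Hausdorff weight of the patch.\<close>

lemma cone_cover:
  fixes S :: "'a::euclidean_space set"
  assumes S: "bounded S" "S \<inter> sphere 0 1 \<noteq> {}" and \<eta>: "diameter S \<le> \<eta>" "0 < \<eta>" "\<eta> \<le> 1"
  obtains U where "U \<in> sets lborel" "\<And>t x. 0 \<le> t \<Longrightarrow> t \<le> 1 \<Longrightarrow> x \<in> S \<inter> sphere 0 1 \<Longrightarrow> t *\<^sub>R x \<in> U"
    "emeasure lborel U \<le> ennreal (3 * unit_ball_vol (real DIM('a)) * 2 ^ DIM('a) * \<eta> ^ (DIM('a) - 1))"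
proof -
  let ?c = "unit_ball_vol (real DIM('a))"
  obtain a where a: "a \<in> S" "norm a = 1" using S by auto
  define N where "N = nat \<lceil>1 / \<eta>\<rceil>"
  define U where "U = (\<Union>j\<in>{..N}. cball ((real j * \<eta>) *\<^sub>R a) (2 * \<eta>))"
  show thesis
  proof (rule that)
    show "U \<in> sets lborel" unfolding U_def by auto
    fix t :: real and x assume t: "0 \<le> t" "t \<le> 1" and x: "x \<in> S \<inter> sphere 0 1"
    define j where "j = nat \<lfloor>t / \<eta>\<rfloor>"
    have j: "real j * \<eta> \<le> t" "t \<le> real j * \<eta> + \<eta>"
    proof -
      have "real j \<le> t / \<eta>" "t / \<eta> \<le> real j + 1" unfolding j_def using t \<eta> by auto
      then show "real j * \<eta> \<le> t" "t \<le> real j * \<eta> + \<eta>" using \<eta> by (auto simp: field_simps)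
    qed
    have "t / \<eta> \<le> 1 / \<eta>" using t \<eta> by (simp add: divide_right_mono)
    then have "j \<le> N" unfolding j_def N_def by (intro nat_mono) linarith
    have "dist a x \<le> \<eta>" using diameter_bounded_bound[OF S(1) a(1), of x] x \<eta> by auto
    have "norm ((real j * \<eta>) *\<^sub>R a - t *\<^sub>R x) = norm ((real j * \<eta> - t) *\<^sub>R a + t *\<^sub>R (a - x))"
      by (simp add: algebra_simps)
    also have "\<dots> \<le> \<bar>real j * \<eta> - t\<bar> * 1 + t * dist a x"
      using norm_triangle_ineq[of "(real j * \<eta> - t) *\<^sub>R a" "t *\<^sub>R (a - x)"] t a by (simp add: dist_norm)
    also have "\<dots> \<le> \<eta> + 1 * \<eta>" using j t \<open>dist a x \<le> \<eta>\<close> by (intro add_mono mult_mono) auto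
    finally have "t *\<^sub>R x \<in> cball ((real j * \<eta>) *\<^sub>R a) (2 * \<eta>)" by (simp add: dist_norm)
    then show "t *\<^sub>R x \<in> U" unfolding U_def using \<open>j \<le> N\<close> by auto
  next
    have "emeasure lborel U \<le> (\<Sum>j\<le>N. emeasure lborel (cball ((real j * \<eta>) *\<^sub>R a) (2 * \<eta>)))"
      unfolding U_def by (rule emeasure_subadditive_finite) auto
    also have "\<dots> = ennreal (real (Suc N) * (?c * (2 * \<eta>) ^ DIM('a)))"
      using \<eta> by (simp add: emeasure_cball ennreal_of_nat_eq_real_of_nat del: of_nat_Suc flip: ennreal_mult)
    also have "\<dots> \<le> ennreal (3 * ?c * 2 ^ DIM('a) * \<eta> ^ (DIM('a) - 1))"
    proof (rule ennreal_leI)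
      have "real N \<le> 1 / \<eta> + 1" unfolding N_def using \<eta> by simp
      then have "real (Suc N) * \<eta> \<le> (1 / \<eta> + 2) * \<eta>" using \<eta> by (intro mult_right_mono) auto
      also have "\<dots> \<le> 3" using \<eta> by (simp add: field_simps)
      finally have *: "real (Suc N) * \<eta> \<le> 3" .
      have "\<eta> ^ DIM('a) = \<eta> ^ (DIM('a) - 1) * \<eta>" using power_Suc2[of \<eta> "DIM('a) - 1"] by simp
      then have "(2 * \<eta>) ^ DIM('a) = 2 ^ DIM('a) * \<eta> ^ (DIM('a) - 1) * \<eta>" by (simp only: power_mult_distrib mult.assoc)
      then have "real (Suc N) * (?c * (2 * \<eta>) ^ DIM('a))
          = (real (Suc N) * \<eta>) * (?c * 2 ^ DIM('a) * \<eta> ^ (DIM('a) - 1))" by simp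
      also have "\<dots> \<le> 3 * (?c * 2 ^ DIM('a) * \<eta> ^ (DIM('a) - 1))" using \<eta> by (intro mult_right_mono *) auto
      finally show "real (Suc N) * (?c * (2 * \<eta>) ^ DIM('a)) \<le> 3 * ?c * 2 ^ DIM('a) * \<eta> ^ (DIM('a) - 1)" by simp
    qed
    finally show "emeasure lborel U \<le> ennreal (3 * ?c * 2 ^ DIM('a) * \<eta> ^ (DIM('a) - 1))" .
  qed
qed

text \<open>The cones over a cover of the sphere fill the unit ball. By \<open>cone_cover\<close>
  the volume of the ball is therefore at most a constant times the total weight of the cover, which
  bounds the content from below.\<close>

lemma hausdorff_outer_sphere_pos:
  assumes dim: "2 \<le> DIM('a::euclidean_space)"
  shows "0 < hausdorff_outer (DIM('a) - 1) (sphere (0::'a) 1)"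
proof -
  let ?d = "DIM('a) - 1" let ?S = "sphere (0::'a) 1" let ?c = "unit_ball_vol (real DIM('a))"
  define K where "K = 3 * ?c * 2 ^ DIM('a)"
  have K: "0 < K" by (simp add: K_def unit_ball_vol_pos)
  \<comment> \<open>With this choice the enlargement of the diameters made below costs at most half
    of the volume of the unit ball.\<close>
  define e where "e = min 1 (?c / (2 * K))"
  have e: "0 < e" "e \<le> 1" "K * e \<le> ?c / 2" using K by (auto simp: e_def min_def field_simps unit_ball_vol_pos)
  define B where "B = unit_ball_vol (real ?d) / (2 ^ ?d * K)"
  have v: "unit_ball_vol (real ?d) \<noteq> 0" using unit_ball_vol_pos[of "real ?d"] by linarith
  have B: "0 < B" using K by (simp add: B_def unit_ball_vol_pos)
  have main: "ennreal (B * ?c / 2) \<le> (\<Sum>i. hausdorff_weight ?d (C i))" if C: "fine_cover 1 ?S C" for C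
  proof -
    \<comment> \<open>\<open>cone_cover\<close> asks for a positive size, but a patch may have
      diameter 0; the added sizes are summable. Dimension at least 2 makes the exponent
      \<open>DIM('a) - 1\<close> positive, so that their powers are summable too.\<close>
    define \<eta> where "\<eta> i = max (diameter (C i)) (e * (1/2) ^ Suc i)" for i
    have bd: "bounded (C i)" "diameter (C i) \<le> 1" for i using C by (auto simp: fine_cover_def)
    have half: "(1/2::real) ^ Suc i \<le> 1" for i by (rule power_le_one) auto
    have \<eta>: "0 < \<eta> i" "\<eta> i \<le> 1" "diameter (C i) \<le> \<eta> i" for i
      using bd(2)[of i] e half[of i] mult_mono[of e 1 "(1/2) ^ Suc i" 1] by (auto simp: \<eta>_def less_max_iff_disj)
    have "\<exists>U. U \<in> sets lborel \<and> (\<forall>t x. 0 \<le> t \<longrightarrow> t \<le> 1 \<longrightarrow> x \<in> C i \<inter> ?S \<longrightarrow> t *\<^sub>R x \<in> U) \<and>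
        emeasure lborel U \<le> ennreal (K * \<eta> i ^ ?d) \<and> (C i = {} \<longrightarrow> U = {})" for i
    proof (cases "C i \<inter> ?S = {}")
      case True
      then show ?thesis by (intro exI[of _ "{}"]) auto
    next
      case False
      from cone_cover[OF bd(1) False \<eta>(3,1,2)] show ?thesis using False unfolding K_def by (metis Int_empty_left)
    qed
    then obtain U where U: "\<And>i. U i \<in> sets lborel" "\<And>i t x. 0 \<le> t \<Longrightarrow> t \<le> 1 \<Longrightarrow> x \<in> C i \<inter> ?S \<Longrightarrow> t *\<^sub>R x \<in> U i"
        "\<And>i. emeasure lborel (U i) \<le> ennreal (K * \<eta> i ^ ?d)" "\<And>i. C i = {} \<Longrightarrow> U i = {}"
      by metis
    have "cball 0 1 \<subseteq> (\<Union>i. U i)"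
    proof
      fix z :: 'a assume z: "z \<in> cball 0 1"
      obtain u where u: "u \<in> ?S" "z = norm z *\<^sub>R u"
      proof (cases "z = 0")
        case True
        obtain b :: 'a where "b \<in> Basis" using nonempty_Basis by blast
        with True show thesis by (intro that[of b]) auto
      next
        case False
        then show thesis by (intro that[of "z /\<^sub>R norm z"]) auto
      qed
      then obtain i where "u \<in> C i" using C by (auto simp: fine_cover_def)
      then show "z \<in> (\<Union>i. U i)" using U(2)[of "norm z" u i] u z by auto
    qed
    then have "emeasure lborel (cball (0::'a) 1) \<le> emeasure lborel (\<Union>i. U i)" using U(1) by (intro emeasure_mono) auto
    also have "\<dots> \<le> (\<Sum>i. emeasure lborel (U i))" using U(1) by (intro emeasure_subadditive_countably) auto
    also have "\<dots> \<le> (\<Sum>i. ennreal (1 / B) * hausdorff_weight ?d (C i) + ennreal (K * e * (1/2) ^ Suc i))"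
    proof (intro suminf_le allI)
      fix i
      show "emeasure lborel (U i) \<le> ennreal (1 / B) * hausdorff_weight ?d (C i) + ennreal (K * e * (1/2) ^ Suc i)"
      proof (cases "C i = {}")
        case True
        then show ?thesis using U(4)[of i] by simp
      next
        case False
        have dg: "0 \<le> diameter (C i)" using bd by (intro diameter_ge_0)
        have "(e * (1/2) ^ Suc i) ^ ?d \<le> (e * (1/2) ^ Suc i) ^ 1" using e half[of i] dim by (intro power_decreasing mult_le_one) auto
        then have "\<eta> i ^ ?d \<le> diameter (C i) ^ ?d + e * (1/2) ^ Suc i" using dg e unfolding \<eta>_def max_def by (auto simp: add_increasing)
        then have "K * \<eta> i ^ ?d \<le> K * diameter (C i) ^ ?d + K * e * (1/2) ^ Suc i"
          using K by (metis distrib_left mult.assoc mult_left_mono less_imp_le)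
        also have "K * diameter (C i) ^ ?d = (1 / B) * (unit_ball_vol (real ?d) * (diameter (C i) / 2) ^ ?d)"
          unfolding B_def using v K by (simp add: power_divide del: of_nat_diff)
        finally have "ennreal (K * \<eta> i ^ ?d) \<le> ennreal ((1 / B) * (unit_ball_vol (real ?d) * (diameter (C i) / 2) ^ ?d) + K * e * (1/2) ^ Suc i)"
          by (rule ennreal_leI)
        also have "\<dots> = ennreal (1 / B) * hausdorff_weight ?d (C i) + ennreal (K * e * (1/2) ^ Suc i)"
          using B dg K e False by (simp add: hausdorff_weight_def ennreal_plus[symmetric] ennreal_mult[symmetric] del: ennreal_plus)
        finally show ?thesis using U(3)[of i] by (rule order_trans[rotated])
      qed
    qed auto
    also have "\<dots> = (\<Sum>i. ennreal (1 / B) * hausdorff_weight ?d (C i)) + (\<Sum>i. ennreal (K * e * (1/2) ^ Suc i))"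
      by (rule suminf_add[symmetric]) auto
    also have "(\<Sum>i. ennreal (K * e * (1/2) ^ Suc i)) = ennreal (K * e)"
    proof (rule suminf_ennreal_eq)
      show "(\<lambda>i. K * e * (1/2) ^ Suc i) sums (K * e)" using sums_mult[OF power_half_series, of "K * e"] by simp
    qed (use e K in simp)
    also have "(\<Sum>i. ennreal (1 / B) * hausdorff_weight ?d (C i)) = ennreal (1 / B) * (\<Sum>i. hausdorff_weight ?d (C i))" by simp
    also have "emeasure lborel (cball (0::'a) 1) = ennreal ?c" by (simp add: emeasure_cball)
    also have "ennreal (K * e) \<le> ennreal (?c / 2)" using e by (intro ennreal_leI)
    finally have *: "ennreal ?c \<le> ennreal (1 / B) * (\<Sum>i. hausdorff_weight ?d (C i)) + ennreal (?c / 2)" by (simp add: add_left_mono)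
    show ?thesis
    proof (cases "(\<Sum>i. hausdorff_weight ?d (C i))")
      case (real w)
      with * B have "?c \<le> 1 / B * w + ?c / 2"
        by (simp add: ennreal_plus[symmetric] ennreal_mult[symmetric] unit_ball_vol_nonneg del: ennreal_plus)
      then have "B * ?c / 2 \<le> w" using B by (simp add: field_simps)
      then show ?thesis using real by (simp add: ennreal_leI)
    qed simp
  qed
  have "0 < ennreal (B * ?c / 2)" using B by (simp add: unit_ball_vol_pos)
  also have "\<dots> \<le> hausdorff_content ?d 1 ?S" unfolding hausdorff_content_alt by (rule INF_greatest) (use main in auto)
  also have "\<dots> \<le> hausdorff_outer ?d ?S" by (rule hausdorff_content_le_outer) simp
  finally show ?thesis .
qed

text \<open>Hausdorff measure of codimension one is not sigma-finite on the whole space. Cutting it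
  down to the sphere gives a finite measure, to which Fubini applies.\<close>

definition sphere_measure :: "(real^'n::finite) measure" where
  "sphere_measure = density (hausdorff_measure (CARD('n) - 1)) (indicator (sphere 0 1))"

lemma sets_sphere_measure [simp, measurable_cong]: "sets sphere_measure = sets borel"
  and space_sphere_measure [simp]: "space sphere_measure = UNIV"
  by (simp_all add: sphere_measure_def)

lemma sphere_in_sets_hausdorff [measurable]:
  "sphere (a :: 'a::euclidean_space) r \<in> sets (hausdorff_measure d)"
  by (simp add: borel_closed)

lemma emeasure_sphere_measure:
  fixes A :: "(real^'n::finite) set"
  shows "A \<in> sets borel \<Longrightarrow> emeasure sphere_measure A = hausdorff_outer (CARD('n) - 1) (sphere 0 1 \<inter> A)"
  unfolding sphere_measure_def
  by (subst emeasure_density) (auto simp: emeasure_hausdorff_measure indicator_inter_arith[symmetric] nn_integral_indicator)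

lemma finite_sphere_measure: "finite_measure (sphere_measure :: (real^'n::finite) measure)"
  using hausdorff_outer_sphere_finite[where 'a="real^'n"] by (intro finite_measureI) (simp add: emeasure_sphere_measure less_top)

lemma AE_sphere_measure: "AE z in sphere_measure. norm (z :: real^'n::finite) = 1"
  unfolding sphere_measure_def by (subst AE_density) (auto simp: indicator_def)

lemma sphere_measure_nontrivial:
  assumes "2 \<le> CARD('n::finite)"
  shows "0 < emeasure (sphere_measure :: (real^'n) measure) UNIV"
  using hausdorff_outer_sphere_pos[where 'a="real^'n"] assms by (simp add: emeasure_sphere_measure)

lemma distr_sphere_measure:
  fixes f :: "real^'n::finite \<Rightarrow> real^'n"
  assumes f: "orthogonal_transformation f"
  shows "distr sphere_measure borel f = sphere_measure"
proof (rule measure_eqI)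
  have "linear f" using f by (simp add: orthogonal_transformation_linear)
  then have m [measurable]: "f \<in> borel_measurable borel"
    by (intro borel_measurable_continuous_onI linear_continuous_on linear_conv_bounded_linear[THEN iffD1])
  fix A :: "(real^'n) set" assume "A \<in> sets (distr sphere_measure borel f)"
  then have A [measurable]: "A \<in> sets borel" by simp
  have B: "sphere 0 1 \<inter> A \<in> sets borel" using A by (simp add: borel_closed)
  have mf: "f -` A \<in> sets borel" "f -` (sphere 0 1 \<inter> A) \<in> sets borel" using measurable_sets[OF m A] measurable_sets[OF m B] by auto
  have "emeasure (distr sphere_measure borel f) A = hausdorff_outer (CARD('n) - 1) (sphere 0 1 \<inter> f -` A)"
    by (subst emeasure_distr) (auto simp: emeasure_sphere_measure mf)
  also have "sphere 0 1 \<inter> f -` A = f -` (sphere 0 1 \<inter> A)" using f by (auto simp: orthogonal_transformation_norm)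
  also have "hausdorff_outer (CARD('n) - 1) \<dots> = emeasure (distr (hausdorff_measure (CARD('n) - 1)) borel f) (sphere 0 1 \<inter> A)"
    using B by (subst emeasure_distr) (auto simp: emeasure_hausdorff_measure mf)
  also have "\<dots> = emeasure sphere_measure A"
    using A B by (simp add: distr_hausdorff_measure[OF f] emeasure_sphere_measure emeasure_hausdorff_measure)
  finally show "emeasure (distr sphere_measure borel f) A = emeasure sphere_measure A" .
qed simp

text \<open>If the measure were carried by one hyperplane through 0, rotations would carry it to
  every coordinate hyperplane, hence to their intersection, the origin; but it lives on unit vectors
  and has positive mass.\<close>

lemma sphere_measure_nondegenerate:
  fixes \<xi> :: "real^'n::finite"
  assumes n: "2 \<le> CARD('n)" and \<xi>: "\<xi> \<noteq> 0"
  shows "\<not> (AE z in sphere_measure. z \<bullet> \<xi> = 0)"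
proof
  assume AE: "AE z in sphere_measure. z \<bullet> \<xi> = 0"
  have "AE z in sphere_measure. z \<bullet> b = 0" if b: "b \<in> Basis" for b :: "real^'n"
  proof -
    have "norm (norm \<xi> *\<^sub>R b) = norm \<xi>" using b by simp
    with rotation_exists[OF n] obtain f where f: "orthogonal_transformation f" "f (norm \<xi> *\<^sub>R b) = \<xi>" by metis
    have "linear f" using f by (simp add: orthogonal_transformation_linear)
    then have [measurable]: "f \<in> borel_measurable borel"
      by (intro borel_measurable_continuous_onI linear_continuous_on linear_conv_bounded_linear[THEN iffD1])
    have "AE z in distr sphere_measure borel f. z \<bullet> \<xi> = 0"
      using AE unfolding distr_sphere_measure[OF f(1)] .
    then have "AE z in sphere_measure. f z \<bullet> f (norm \<xi> *\<^sub>R b) = 0" by (subst (asm) AE_distr_iff) (auto simp: f)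
    then show ?thesis using f(1) \<xi> by (auto simp: orthogonal_transformation_def)
  qed
  then have "AE z in (sphere_measure :: (real^'n) measure). \<forall>b\<in>Basis. z \<bullet> b = 0" by (intro AE_finite_allI) auto
  then have "AE z in (sphere_measure :: (real^'n) measure). z = 0" by (rule eventually_mono) (auto intro: euclidean_eqI)
  from eventually_mono[OF eventually_conj[OF this AE_sphere_measure], of "\<lambda>_. False"]
  have "AE z in (sphere_measure :: (real^'n) measure). False" by auto
  then have "emeasure (sphere_measure :: (real^'n) measure) UNIV = 0" by (subst (asm) AE_iff_measurable[OF _ refl]) auto
  with sphere_measure_nontrivial[OF n] show False by simp
qed

subsection \<open>Affine substitution\<close>

lemma nn_integral_lborel_affine:
  fixes f :: "'a::euclidean_space \<Rightarrow> ennreal"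
  assumes [measurable]: "f \<in> borel_measurable borel" and c: "c \<noteq> 0"
  shows "(\<integral>\<^sup>+x. f x \<partial>lborel) = ennreal (\<bar>c\<bar> ^ DIM('a)) * (\<integral>\<^sup>+x. f (t + c *\<^sub>R x) \<partial>lborel)"
  by (subst lborel_affine[OF c, of t])
     (simp add: nn_integral_density nn_integral_distr nn_integral_cmult)

lemma integrable_lborel_affine:
  fixes f :: "'a::euclidean_space \<Rightarrow> 'b::{banach, second_countable_topology}"
  assumes f: "integrable lborel f" and c: "c \<noteq> 0"
  shows "integrable lborel (\<lambda>x. f (t + c *\<^sub>R x))"
  using f f[THEN borel_measurable_integrable] unfolding integrable_iff_bounded
  by (subst (asm) nn_integral_lborel_affine[where c=c and t=t]) (auto simp: ennreal_mult_less_top c)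

lemma integrable_lborel_affine_iff:
  fixes f :: "'a::euclidean_space \<Rightarrow> 'b::{banach, second_countable_topology}"
  assumes c: "c \<noteq> 0"
  shows "integrable lborel (\<lambda>x. f (t + c *\<^sub>R x)) \<longleftrightarrow> integrable lborel f"
proof
  assume "integrable lborel (\<lambda>x. f (t + c *\<^sub>R x))"
  from integrable_lborel_affine[OF this, of "inverse c" "- (inverse c *\<^sub>R t)"] c
  show "integrable lborel f" by (simp add: algebra_simps)
qed (rule integrable_lborel_affine[OF _ c])

lemma integral_lborel_affine:
  fixes f :: "'a::euclidean_space \<Rightarrow> 'b::{banach, second_countable_topology}"
  assumes c: "c \<noteq> 0"
  shows "(LINT x|lborel. f x) = (\<bar>c\<bar> ^ DIM('a)) *\<^sub>R (LINT x|lborel. f (t + c *\<^sub>R x))"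
proof cases
  assume f: "integrable lborel f"
  then have [measurable]: "f \<in> borel_measurable borel" using borel_measurable_integrable by force
  show ?thesis
    using c f integrable_lborel_affine[OF f c, of t] by (subst lborel_affine[OF c, of t])
       (simp add: integral_density integral_distr)
next
  assume "\<not> integrable lborel f" with c show ?thesis
    by (simp add: integrable_lborel_affine_iff not_integrable_integral_eq)
qed

lemma lborel_integral_reflect:
  fixes f :: "'a::euclidean_space \<Rightarrow> 'b::{banach, second_countable_topology}"
  shows "(LINT y|lborel. f (x - y)) = (LINT y|lborel. f y)" using integral_lborel_affine[of "-1" f x] by simp

lemma lborel_integral_shift:
  fixes f :: "'a::euclidean_space \<Rightarrow> 'b::{banach, second_countable_topology}"
  shows "(LINT y|lborel. f (y + x)) = (LINT y|lborel. f y)" using integral_lborel_affine[of 1 f x] by (simp add: add.commute)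

lemma nn_integral_lborel_reflect:
  fixes f :: "'a::euclidean_space \<Rightarrow> ennreal"
  assumes "f \<in> borel_measurable borel"
  shows "(\<integral>\<^sup>+y. f (x - y) \<partial>lborel) = (\<integral>\<^sup>+y. f y \<partial>lborel)"
  using nn_integral_lborel_affine[OF assms, of "-1" x] by simp

subsection \<open>Polynomial weights\<close>

lemma weight_triangle: "1 + norm (x + y) \<le> (1 + norm x) * (1 + norm (y :: 'a::real_normed_vector))"
proof -
  have "norm (x + y) \<le> norm x + norm y" by (rule norm_triangle_ineq)
  moreover have "0 \<le> norm x * norm y" by (intro mult_nonneg_nonneg norm_ge_zero)
  ultimately show ?thesis unfolding distrib_left distrib_right by linarith
qed

lemma weight_triangle_diff: "1 + norm (x - y) \<le> (1 + norm x) * (1 + norm (y :: 'a::real_normed_vector))"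
  using weight_triangle[of x "- y"] by simp

lemma weight_nonzero [simp]: "1 + norm x \<noteq> 0"
  using norm_ge_zero[of x] by linarith

lemma weight_pos [simp]: "0 < 1 + norm x"
  using norm_ge_zero[of x] by linarith

lemma le_divide_weight:
  assumes "b \<le> m * a" "0 < a" "0 < b" "0 < C"
  shows "C / a \<le> C * m / (b::real)" using mult_left_mono[OF assms(1), of C] assms(2-4) by (simp add: field_simps)

lemma weight_shift:
  "a / (1 + norm (x - y)) ^ N \<le> a * (1 + norm x) ^ N / (1 + norm (y :: 'a::real_normed_vector)) ^ N"
  if "0 \<le> a"
proof -
  have "(1 + norm y) ^ N \<le> ((1 + norm x) * (1 + norm (x - y))) ^ N" using weight_triangle_diff[of x "x - y"] by (intro power_mono) auto
  then have "1 / (1 + norm (x - y)) ^ N \<le> (1 + norm x) ^ N / (1 + norm y) ^ N"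
    by (simp add: divide_simps power_mult_distrib mult.commute add_pos_nonneg)
  from mult_left_mono[OF this that] show ?thesis by simp
qed

text \<open>A point with 1 + |x| between 2^k and 2^(k+1) lies in the ball of radius 2^(k+1), so the
  integral is dominated by a geometric series whose ratio 2^(n-a) is \<open>q\<close>.\<close>

lemma nn_integral_weight_finite:
  assumes a: "real DIM('a) < a"
  shows "(\<integral>\<^sup>+x. ennreal ((1 + norm (x::'a::euclidean_space)) powr (- a)) \<partial>lborel) < top"
proof -
  let ?n = "DIM('a)" let ?c = "unit_ball_vol (real DIM('a))"
  define q where "q = 2 powr (real ?n - a)"
  have q: "0 < q" "q < 1" using a by (auto simp: q_def powr_less_one)
  define R :: "nat \<Rightarrow> real" where "R k = 2 ^ Suc k" for k
  have R: "0 \<le> R k" for k by (simp add: R_def)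
  have pt: "ennreal ((1 + norm x) powr (- a)) \<le> (\<Sum>k. ennreal (2 powr (- a * real k)) * indicator (cball 0 (R k)) x)" for x :: 'a
  proof -
    define k where "k = nat \<lfloor>log 2 (1 + norm x)\<rfloor>"
    have l: "0 \<le> log 2 (1 + norm x)" by (subst zero_le_log_cancel_iff) (auto simp: add_pos_nonneg)
    then have k: "real k \<le> log 2 (1 + norm x)" "log 2 (1 + norm x) < real k + 1" unfolding k_def by auto
    have L: "2 powr (log 2 (1 + norm x)) = 1 + norm x" by (rule powr_log_cancel) auto
    from k(1) have "2 powr real k \<le> 2 powr (log 2 (1 + norm x))" by (rule powr_mono) simp
    then have k1: "2 powr real k \<le> 1 + norm x" unfolding L .
    from k(2) have "2 powr (log 2 (1 + norm x)) < 2 powr (real (Suc k))" by (intro powr_less_mono) auto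
    then have "1 + norm x < 2 ^ Suc k" unfolding L by (subst (asm) powr_realpow) auto
    then have x: "x \<in> cball 0 (R k)" by (simp add: R_def)
    have "(1 + norm x) powr (- a) \<le> (2 powr real k) powr (- a)" using k1 a by (intro powr_mono2') auto
    then have "ennreal ((1 + norm x) powr (- a)) \<le> (\<lambda>k. ennreal (2 powr (- a * real k)) * indicator (cball 0 (R k)) x) k"
      using x by (auto simp: powr_powr mult.commute intro!: ennreal_leI)
    also have "\<dots> \<le> (\<Sum>k. ennreal (2 powr (- a * real k)) * indicator (cball 0 (R k)) x)"
      using sum_le_suminf[OF summableI, of "{k}" "\<lambda>k. ennreal (2 powr (- a * real k)) * indicator (cball 0 (R k)) x"]
      by (simp only: sum.insert sum.empty finite.emptyI empty_iff if_False not_False_eq_True add_0_right) simp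
    finally show ?thesis .
  qed
  have "(\<integral>\<^sup>+x. ennreal ((1 + norm (x::'a)) powr (- a)) \<partial>lborel)
     \<le> (\<integral>\<^sup>+x. (\<Sum>k. ennreal (2 powr (- a * real k)) * indicator (cball (0::'a) (R k)) x) \<partial>lborel)"
    by (intro nn_integral_mono pt)
  also have "\<dots> = (\<Sum>k. \<integral>\<^sup>+x. ennreal (2 powr (- a * real k)) * indicator (cball (0::'a) (R k)) x \<partial>lborel)"
    by (intro nn_integral_suminf borel_measurable_times_ennreal borel_measurable_indicator borel_measurable_const) simp
  also have "\<dots> = (\<Sum>k. ennreal (?c * 2 ^ ?n * q ^ k))"
  proof (intro suminf_cong)
    fix k
    have "R k ^ ?n = 2 ^ ?n * (2 ^ ?n) ^ k" unfolding R_def power_Suc power_mult_distrib by (simp only: power_mult[symmetric] mult.commute[of k])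
    moreover have "q ^ k = (2 ^ ?n) ^ k * 2 powr (- a * real k)"
    proof -
      have "q = 2 ^ ?n * 2 powr (- a)" unfolding q_def by (simp only: diff_conv_add_uminus powr_add powr_realpow zero_less_numeral)
      moreover have "(2 powr (- a)) ^ k = 2 powr (- a * real k)" by (subst powr_powr[symmetric]) (simp add: powr_realpow)
      ultimately show ?thesis by (simp only: power_mult_distrib)
    qed
    ultimately show "(\<integral>\<^sup>+x. ennreal (2 powr (- a * real k)) * indicator (cball (0::'a) (R k)) x \<partial>lborel) = ennreal (?c * 2 ^ ?n * q ^ k)"
      using R by (subst nn_integral_cmult_indicator)
         (auto simp: emeasure_cball ennreal_mult[symmetric] ac_simps)
  qed
  also have "\<dots> = ennreal (\<Sum>k. ?c * 2 ^ ?n * q ^ k)" using q by (intro suminf_ennreal2 summable_mult summable_geometric) auto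
  also have "\<dots> < top" by simp
  finally show ?thesis .
qed

lemma integrable_weight_powr:
  "real DIM('a) < a \<Longrightarrow> integrable lborel (\<lambda>x::'a::euclidean_space. (1 + norm x) powr (- a))"
  using nn_integral_weight_finite[where 'a='a, of a] by (intro integrableI_nonneg) auto

lemma integrable_weight:
  assumes "DIM('a) < N"
  shows "integrable lborel (\<lambda>x::'a::euclidean_space. 1 / (1 + norm x) ^ N)"
proof -
  have "(1 + norm x) powr (- real N) = 1 / (1 + norm x) ^ N" for x :: 'a by (simp add: powr_minus powr_realpow add_pos_nonneg divide_inverse)
  then show ?thesis using integrable_weight_powr[where 'a='a, of "real N"] assms by simp
qed

subsection \<open>Rapidly decreasing and tame functions\<close>

text \<open>The test functions of the proof. Only size is demanded, because the kernel produced by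
  the division is controlled in size and not in its derivatives.\<close>

definition rapid :: "(real^'n::finite \<Rightarrow> complex) \<Rightarrow> bool" where
  "rapid g \<longleftrightarrow> g \<in> borel_measurable borel \<and> (\<forall>N. \<exists>C. \<forall>x. cmod (g x) \<le> C / (1 + norm x) ^ N)"

text \<open>The counterpart of \<open>rapid\<close>: functions of polynomial growth in the mean, for
  which convolution with every rapid kernel converges absolutely. Pieces, dilates and
  representatives all belong here.\<close>

definition tame :: "(real^'n::finite \<Rightarrow> complex) \<Rightarrow> bool" where
  "tame F \<longleftrightarrow> F \<in> borel_measurable borel \<and> (\<exists>N. integrable lborel (\<lambda>x. cmod (F x) / (1 + norm x) ^ N))"

lemma rapid_measurable [measurable_dest]: "rapid g \<Longrightarrow> g \<in> borel_measurable borel"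
  and tame_measurable [measurable_dest]: "tame F \<Longrightarrow> F \<in> borel_measurable borel"
  by (auto simp: rapid_def tame_def)

lemma rapid_bound:
  assumes "rapid g"
  shows "\<exists>C>0. \<forall>x. cmod (g x) \<le> C / (1 + norm x) ^ N"
proof -
  obtain C where C: "\<And>x. cmod (g x) \<le> C / (1 + norm x) ^ N" using assms by (auto simp: rapid_def)
  have "C / (1 + norm x) ^ N \<le> max 1 C / (1 + norm x) ^ N" for x :: "real^'a" by (intro divide_right_mono) auto
  with C have "\<forall>x. cmod (g x) \<le> max 1 C / (1 + norm x) ^ N" by (meson order_trans)
  moreover have "0 < max 1 C" by simp
  ultimately show ?thesis by blast
qed

lemma rapidI:
  assumes "g \<in> borel_measurable borel" "\<And>N. \<exists>C. \<forall>x. cmod (g x) \<le> C / (1 + norm x) ^ N"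
  shows "rapid g" using assms by (auto simp: rapid_def)

lemma rapid_integrable:
  assumes "rapid (g :: real^'n::finite \<Rightarrow> complex)" shows "integrable lborel g"
proof -
  obtain C where C: "0 < C" "\<And>x. cmod (g x) \<le> C / (1 + norm x) ^ Suc CARD('n)" using rapid_bound[OF assms, of "Suc CARD('n)"] by blast
  show ?thesis
  proof (rule Bochner_Integration.integrable_bound)
    show "integrable lborel (\<lambda>x::real^'n. C * (1 / (1 + norm x) ^ Suc CARD('n)))" by (intro integrable_mult_right integrable_weight) simp
    show "AE x in lborel. norm (g x) \<le> norm (C * (1 / (1 + norm x) ^ Suc CARD('n)))" using C by (auto simp: abs_mult power_abs abs_of_nonneg)
  qed (use assms in measurable)
qed

lemma rapid_weight_integrable:
  assumes "rapid (g :: real^'n::finite \<Rightarrow> complex)"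
  shows "integrable lborel (\<lambda>x. cmod (g x) * (1 + norm x) ^ N)"
proof -
  obtain C where C: "0 < C" "\<And>x. cmod (g x) \<le> C / (1 + norm x) ^ (Suc CARD('n) + N)" using rapid_bound[OF assms, of "(Suc CARD('n) + N)"] by blast
  show ?thesis
  proof (rule Bochner_Integration.integrable_bound)
    show "integrable lborel (\<lambda>x::real^'n. C * (1 / (1 + norm x) ^ Suc CARD('n)))" by (intro integrable_mult_right integrable_weight) simp
    have "cmod (g x) * (1 + norm x) ^ N \<le> C * (1 / (1 + norm x) ^ Suc CARD('n))" for x
    proof -
      have "cmod (g x) * (1 + norm x) ^ N \<le> C / (1 + norm x) ^ (Suc CARD('n) + N) * (1 + norm x) ^ N" by (intro mult_right_mono C) auto
      also have "\<dots> = C * (1 / (1 + norm x) ^ Suc CARD('n))" by (simp add: power_add)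
      finally show ?thesis .
    qed
    then show "AE x in lborel. norm (cmod (g x) * (1 + norm x) ^ N) \<le> norm (C * (1 / (1 + norm x) ^ Suc CARD('n)))"
      using C(1) by (intro AE_I2) (simp only: real_norm_def abs_mult abs_of_nonneg norm_ge_zero zero_le_power less_imp_le weight_pos abs_divide abs_one)
  qed (use assms in measurable)
qed

lemma rapid_mult_growth:
  assumes g: "rapid g" and h: "h \<in> borel_measurable borel" "\<And>x. cmod (h x) \<le> K * (1 + norm x) ^ M"
  shows "rapid (\<lambda>x. h x * g x)"
proof (rule rapidI)
  show "(\<lambda>x. h x * g x) \<in> borel_measurable borel" using g h by measurable
  fix N
  obtain C where C: "0 < C" "\<And>x. cmod (g x) \<le> C / (1 + norm x) ^ (M + N)" using rapid_bound[OF g, of "(M + N)"] by blast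
  have "cmod (h x * g x) \<le> K * C / (1 + norm x) ^ N" for x
  proof -
    have "cmod (h x * g x) \<le> (K * (1 + norm x) ^ M) * (C / (1 + norm x) ^ (M + N))"
      unfolding norm_mult using order_trans[OF norm_ge_zero h(2)] by (intro mult_mono h C) auto
    also have "\<dots> = K * C / (1 + norm x) ^ N" by (simp add: power_add weight_nonzero)
    finally show ?thesis .
  qed
  then show "\<exists>C. \<forall>x. cmod (h x * g x) \<le> C / (1 + norm x) ^ N" by blast
qed

lemma rapid_affine:
  assumes g: "rapid (g :: real^'n::finite \<Rightarrow> complex)" and a: "a \<noteq> 0"
  shows "rapid (\<lambda>y. g (a *\<^sub>R y + b))"
proof (rule rapidI)
  have [measurable]: "g \<in> borel_measurable borel" using g by (rule rapid_measurable)
  show "(\<lambda>y. g (a *\<^sub>R y + b)) \<in> borel_measurable borel" by measurable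
  fix N
  obtain C where C: "0 < C" "\<And>x. cmod (g x) \<le> C / (1 + norm x) ^ N" using rapid_bound[OF g, of "N"] by blast
  define m where "m = (1 + 1 / \<bar>a\<bar>) * (1 + norm b)"
  have m: "0 < m" by (simp add: m_def add_pos_nonneg)
  have "1 + norm y \<le> m * (1 + norm (a *\<^sub>R y + b))" for y
  proof -
    have "1 + norm (a *\<^sub>R y) \<le> (1 + norm (a *\<^sub>R y + b)) * (1 + norm b)" using weight_triangle_diff[of "a *\<^sub>R y + b" b] by simp
    moreover have "1 + norm y \<le> (1 + 1 / \<bar>a\<bar>) * (1 + norm (a *\<^sub>R y))" using a by (simp add: field_simps)
    ultimately show ?thesis unfolding m_def
      using mult_left_mono[of "1 + norm (a *\<^sub>R y)" "(1 + norm (a *\<^sub>R y + b)) * (1 + norm b)" "1 + 1 / \<bar>a\<bar>"]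
      by (simp add: ac_simps)
  qed
  then have "(1 + norm y) ^ N \<le> m ^ N * (1 + norm (a *\<^sub>R y + b)) ^ N" for y
    unfolding power_mult_distrib[symmetric] by (intro power_mono) auto
  then have "C / (1 + norm (a *\<^sub>R y + b)) ^ N \<le> C * m ^ N / (1 + norm y) ^ N" for y by (intro le_divide_weight C(1)) auto
  with C(2) have "cmod (g (a *\<^sub>R y + b)) \<le> C * m ^ N / (1 + norm y) ^ N" for y by (meson order_trans)
  then show "\<exists>C. \<forall>y. cmod (g (a *\<^sub>R y + b)) \<le> C / (1 + norm y) ^ N" by blast
qed

lemma rapid_reflect: "rapid g \<Longrightarrow> rapid (\<lambda>y. g (x - y))"
  using rapid_affine[of g "-1" x] by simp

lemma rapid_scale: "rapid g \<Longrightarrow> a \<noteq> 0 \<Longrightarrow> rapid (\<lambda>y. g (a *\<^sub>R y))"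
  using rapid_affine[of g a 0] by simp

lemma rapid_add: "rapid f \<Longrightarrow> rapid g \<Longrightarrow> rapid (\<lambda>x. f x + g x)"
proof (rule rapidI)
  assume f: "rapid f" and g: "rapid g"
  then show "(\<lambda>x. f x + g x) \<in> borel_measurable borel" by measurable
  fix N
  obtain C where C: "0 < C" "\<And>x. cmod (f x) \<le> C / (1 + norm x) ^ N" using rapid_bound[OF f, of "N"] by blast
  obtain D where D: "0 < D" "\<And>x. cmod (g x) \<le> D / (1 + norm x) ^ N" using rapid_bound[OF g, of "N"] by blast
  have "cmod (f x + g x) \<le> (C + D) / (1 + norm x) ^ N" for x
    using norm_triangle_ineq[of "f x" "g x"] C(2)[of x] D(2)[of x] by (simp add: add_divide_distrib)
  then show "\<exists>C. \<forall>x. cmod (f x + g x) \<le> C / (1 + norm x) ^ N" by blast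
qed

lemma rapid_cmult: "rapid f \<Longrightarrow> rapid (\<lambda>x. c * f x)"
  using rapid_mult_growth[of f "\<lambda>_. c" "cmod c" 0] by simp

lemma rapid_sum: "(\<And>i. i \<in> I \<Longrightarrow> rapid (f i)) \<Longrightarrow> rapid (\<lambda>x. \<Sum>i\<in>I. f i x)"
proof (induction I rule: infinite_finite_induct)
  case (insert i I)
  then show ?case using rapid_add[of "f i" "\<lambda>x. \<Sum>i\<in>I. f i x"] by simp
qed (auto intro!: rapidI exI[of _ 0])

lemma tame_growth:
  assumes "F \<in> borel_measurable borel" "\<And>x. cmod (F x) \<le> C * (1 + norm x) ^ M"
  shows "tame (F :: real^'n::finite \<Rightarrow> complex)"
  unfolding tame_def
proof (intro conjI exI)
  show "integrable lborel (\<lambda>x. cmod (F x) / (1 + norm x) ^ (M + Suc CARD('n)))"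
  proof (rule Bochner_Integration.integrable_bound)
    show "integrable lborel (\<lambda>x::real^'n. C * (1 / (1 + norm x) ^ Suc CARD('n)))" by (intro integrable_mult_right integrable_weight) simp
    have "cmod (F x) / (1 + norm x) ^ (M + Suc CARD('n)) \<le> C * (1 / (1 + norm x) ^ Suc CARD('n))" for x
    proof -
      have "cmod (F x) / (1 + norm x) ^ (M + Suc CARD('n)) \<le> C * (1 + norm x) ^ M / (1 + norm x) ^ (M + Suc CARD('n))"
        by (intro divide_right_mono assms) auto
      also have "\<dots> = C * (1 / (1 + norm x) ^ Suc CARD('n))" by (simp add: power_add)
      finally show ?thesis .
    qed
    moreover have "0 \<le> cmod (F x) / (1 + norm x) ^ (M + Suc CARD('n))" for x by simp
    ultimately show "AE x in lborel. norm (cmod (F x) / (1 + norm x) ^ (M + Suc CARD('n))) \<le> norm (C * (1 / (1 + norm (x::real^'n)) ^ Suc CARD('n)))"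
      by (intro AE_I2) (metis abs_ge_self abs_of_nonneg order_trans real_norm_def)
  qed (use assms in measurable)
qed (use assms in auto)

lemma rapid_imp_tame: "rapid g \<Longrightarrow> tame g"
proof -
  assume g: "rapid g"
  then obtain C where "\<And>x. cmod (g x) \<le> C / (1 + norm x) ^ 0" using rapid_bound[OF g, of 0] by blast
  then have "cmod (g x) \<le> C * (1 + norm x) ^ 0" for x by simp
  with rapid_measurable[OF g] show ?thesis by (rule tame_growth)
qed

lemma tame_scale:
  assumes F: "tame (F :: real^'n::finite \<Rightarrow> complex)" and a: "0 < a"
  shows "tame (\<lambda>x. F (a *\<^sub>R x))"
proof -
  obtain N where N: "integrable lborel (\<lambda>x. cmod (F x) / (1 + norm x) ^ N)" using F by (auto simp: tame_def)
  have [measurable]: "F \<in> borel_measurable borel" using F by (rule tame_measurable)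
  define m where "m = 1 + a"
  have m: "0 < m" "1 + norm (a *\<^sub>R x) \<le> m * (1 + norm x)" for x :: "real^'n" using a by (auto simp: m_def algebra_simps)
  have "integrable lborel (\<lambda>x. cmod (F (a *\<^sub>R x)) / (1 + norm (a *\<^sub>R x)) ^ N)"
    using integrable_lborel_affine[OF N, of a 0] a by simp
  then have i: "integrable lborel (\<lambda>x. m ^ N * (cmod (F (a *\<^sub>R x)) / (1 + norm (a *\<^sub>R x)) ^ N))" by (rule integrable_mult_right)
  have "integrable lborel (\<lambda>x. cmod (F (a *\<^sub>R x)) / (1 + norm x) ^ N)"
  proof (rule Bochner_Integration.integrable_bound[OF i])
    have "cmod (F (a *\<^sub>R x)) / (1 + norm x) ^ N \<le> m ^ N * (cmod (F (a *\<^sub>R x)) / (1 + norm (a *\<^sub>R x)) ^ N)" for x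
    proof -
      have "(1 + norm (a *\<^sub>R x)) ^ N \<le> m ^ N * (1 + norm x) ^ N"
        unfolding power_mult_distrib[symmetric] using m(2) by (intro power_mono) auto
      then have "1 / (1 + norm x) ^ N \<le> m ^ N / (1 + norm (a *\<^sub>R x)) ^ N" by (simp add: divide_simps add_pos_nonneg mult.commute)
      from mult_left_mono[OF this norm_ge_zero[of "F (a *\<^sub>R x)"]] show ?thesis by (simp add: mult.commute)
    qed
    moreover have "0 \<le> cmod (F (a *\<^sub>R x)) / (1 + norm x) ^ N" for x by simp
    ultimately show "AE x in lborel. norm (cmod (F (a *\<^sub>R x)) / (1 + norm x) ^ N)
        \<le> norm (m ^ N * (cmod (F (a *\<^sub>R x)) / (1 + norm (a *\<^sub>R x)) ^ N))"
      by (intro AE_I2) (metis abs_of_nonneg order_trans real_norm_def)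
  qed measurable
  then show ?thesis unfolding tame_def by auto
qed

lemma integrable_rapid_tame:
  assumes g: "rapid g" and F: "tame F"
  shows "integrable lborel (\<lambda>y. g y * F y)"
proof -
  obtain N where N: "integrable lborel (\<lambda>x. cmod (F x) / (1 + norm x) ^ N)" using F by (auto simp: tame_def)
  obtain C where C: "0 < C" "\<And>x. cmod (g x) \<le> C / (1 + norm x) ^ N" using rapid_bound[OF g, of "N"] by blast
  have [measurable]: "F \<in> borel_measurable borel" "g \<in> borel_measurable borel" using F g by auto
  show ?thesis
  proof (rule Bochner_Integration.integrable_bound)
    show "integrable lborel (\<lambda>x. C * (cmod (F x) / (1 + norm x) ^ N))" by (intro integrable_mult_right N)
    have "cmod (g y * F y) \<le> C * (cmod (F y) / (1 + norm y) ^ N)" for y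
      using mult_right_mono[OF C(2)[of y] norm_ge_zero[of "F y"]] by (simp add: norm_mult)
    then show "AE y in lborel. norm (g y * F y) \<le> norm (C * (cmod (F y) / (1 + norm y) ^ N))" using C(1) by (auto simp: abs_mult power_abs)
  qed measurable
qed

lemma integrable_rapid_tame_reflect:
  "rapid g \<Longrightarrow> tame F \<Longrightarrow> integrable lborel (\<lambda>y. g (x - y) * F y)"
  by (rule integrable_rapid_tame) (rule rapid_reflect)

lemma integrable_pair_dominated:
  fixes k :: "'a \<times> 'b \<Rightarrow> 'c::{banach, second_countable_topology}" and f :: "'a \<Rightarrow> real" and g :: "'b \<Rightarrow> real"
  assumes M: "sigma_finite_measure M1" "sigma_finite_measure M2" and k: "k \<in> borel_measurable (M1 \<Otimes>\<^sub>M M2)"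
    and f: "integrable M1 f" and g: "integrable M2 g"
    and le: "AE p in M1 \<Otimes>\<^sub>M M2. norm (k p) \<le> f (fst p) * g (snd p)"
  shows "integrable (M1 \<Otimes>\<^sub>M M2) k"
proof -
  interpret P: pair_sigma_finite M1 M2 using M by (simp add: pair_sigma_finite_def)
  have [measurable]: "f \<in> borel_measurable M1" "g \<in> borel_measurable M2" using f g by auto
  have "integrable (M1 \<Otimes>\<^sub>M M2) (\<lambda>p. f (fst p) * g (snd p))"
  proof (rule P.Fubini_integrable)
    show "integrable M1 (\<lambda>x. LINT y|M2. norm (f (fst (x, y)) * g (snd (x, y))))"
      using integrable_mult_left[OF integrable_norm[OF f], of "LINT y|M2. norm (g y)"] by (simp add: abs_mult)
    show "AE x in M1. integrable M2 (\<lambda>y. f (fst (x, y)) * g (snd (x, y)))" using g by auto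
  qed measurable
  then show ?thesis by (rule Bochner_Integration.integrable_bound[OF _ k]) (use le in \<open>auto elim!: eventually_mono\<close>)
qed

definition cnv :: "(real^'n::finite \<Rightarrow> complex) \<Rightarrow> (real^'n \<Rightarrow> complex) \<Rightarrow> real^'n \<Rightarrow> complex" where
  "cnv g F x = (LINT y|lborel. g (x - y) * F y)"

lemma cnv_measurable [measurable]:
  assumes [measurable]: "g \<in> borel_measurable borel" "F \<in> borel_measurable borel"
  shows "cnv g F \<in> borel_measurable borel" unfolding cnv_def by measurable

lemma cnv_growth:
  assumes g: "rapid g" and F: "tame F"
  obtains C N where "\<And>x. cmod (cnv g F x) \<le> C * (1 + norm x) ^ N"
proof -
  obtain N where N: "integrable lborel (\<lambda>x. cmod (F x) / (1 + norm x) ^ N)" using F by (auto simp: tame_def)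
  obtain C where C: "0 < C" "\<And>x. cmod (g x) \<le> C / (1 + norm x) ^ N" using rapid_bound[OF g, of "N"] by blast
  define I where "I = (LINT y|lborel. cmod (F y) / (1 + norm y) ^ N)"
  have "cmod (cnv g F x) \<le> (C * I) * (1 + norm x) ^ N" for x
  proof -
    have "cmod (cnv g F x) \<le> (LINT y|lborel. cmod (g (x - y) * F y))" unfolding cnv_def by (rule integral_norm_bound)
    also have "\<dots> \<le> (LINT y|lborel. (C * (1 + norm x) ^ N) * (cmod (F y) / (1 + norm y) ^ N))"
    proof (rule integral_mono)
      show "integrable lborel (\<lambda>y. cmod (g (x - y) * F y))" by (intro integrable_norm integrable_rapid_tame_reflect g F)
      show "integrable lborel (\<lambda>y. (C * (1 + norm x) ^ N) * (cmod (F y) / (1 + norm y) ^ N))" by (intro integrable_mult_right N)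
      fix y
      have "cmod (g (x - y)) \<le> C * (1 + norm x) ^ N / (1 + norm y) ^ N" using C(2)[of "x - y"] weight_shift[of C x y N] C(1) by linarith
      from mult_right_mono[OF this norm_ge_zero[of "F y"]]
      show "cmod (g (x - y) * F y) \<le> (C * (1 + norm x) ^ N) * (cmod (F y) / (1 + norm y) ^ N)" by (simp add: norm_mult)
    qed
    also have "\<dots> = (C * I) * (1 + norm x) ^ N" unfolding integral_mult_right_zero I_def by (simp only: ac_simps)
    finally show ?thesis .
  qed
  then show thesis by (rule that)
qed

lemma tame_cnv:
  assumes "rapid g" "tame F" shows "tame (cnv g F)"
proof -
  obtain C N where "\<And>x. cmod (cnv g F x) \<le> C * (1 + norm x) ^ N" using cnv_growth[OF assms] by blast
  with cnv_measurable[OF rapid_measurable[OF assms(1)] tame_measurable[OF assms(2)]]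
  show ?thesis by (rule tame_growth)
qed

lemma cnv_commute: "cnv g F x = cnv F g x"
  unfolding cnv_def using lborel_integral_reflect[of "\<lambda>y. g (x - y) * F y" x] by (simp add: mult.commute)

lemma rapid_cnv:
  assumes a: "rapid a" and b: "rapid (b :: real^'n::finite \<Rightarrow> complex)"
  shows "rapid (cnv a b)"
proof (rule rapidI)
  show "cnv a b \<in> borel_measurable borel" using a b by (intro cnv_measurable) auto
  fix N
  obtain C where C: "0 < C" "\<And>x. cmod (a x) \<le> C / (1 + norm x) ^ N" using rapid_bound[OF a, of "N"] by blast
  define I where "I = (LINT y|lborel. cmod (b y) * (1 + norm y) ^ N)"
  have "cmod (cnv a b x) \<le> (C * I) / (1 + norm x) ^ N" for x
  proof -
    have "cmod (cnv a b x) \<le> (LINT y|lborel. cmod (a (x - y) * b y))" unfolding cnv_def by (rule integral_norm_bound)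
    also have "\<dots> \<le> (LINT y|lborel. (C / (1 + norm x) ^ N) * (cmod (b y) * (1 + norm y) ^ N))"
    proof (rule integral_mono)
      show "integrable lborel (\<lambda>y. cmod (a (x - y) * b y))" by (intro integrable_norm integrable_rapid_tame_reflect a rapid_imp_tame b)
      show "integrable lborel (\<lambda>y. (C / (1 + norm x) ^ N) * (cmod (b y) * (1 + norm y) ^ N))"
        by (intro integrable_mult_right rapid_weight_integrable b)
      fix y
      have "cmod (a (x - y)) \<le> C * (1 + norm y) ^ N / (1 + norm x) ^ N"
        using C(2)[of "x - y"] weight_shift[of C y x N] C(1) by (simp add: norm_minus_commute)
      from mult_right_mono[OF this norm_ge_zero[of "b y"]]
      show "cmod (a (x - y) * b y) \<le> (C / (1 + norm x) ^ N) * (cmod (b y) * (1 + norm y) ^ N)" by (simp add: norm_mult ac_simps)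
    qed
    also have "\<dots> = (C * I) / (1 + norm x) ^ N" unfolding integral_mult_right_zero I_def by simp
    finally show ?thesis .
  qed
  then show "\<exists>C. \<forall>x. cmod (cnv a b x) \<le> C / (1 + norm x) ^ N" by blast
qed

text \<open>Fubini on the pair (v, y). The weight of \<open>F\<close> in y is bought from the decay
  of \<open>b\<close> at v - y, at the price of a power of 1 + |v| that the decay of
  \<open>a\<close> absorbs.\<close>

lemma cnv_assoc:
  assumes a: "rapid a" and b: "rapid b" and F: "tame (F :: real^'n::finite \<Rightarrow> complex)"
  shows "cnv a (cnv b F) x = cnv (cnv a b) F x"
proof -
  obtain N where N: "integrable lborel (\<lambda>x. cmod (F x) / (1 + norm x) ^ N)" using F by (auto simp: tame_def)
  obtain C where C: "0 < C" "\<And>x. cmod (b x) \<le> C / (1 + norm x) ^ N" using rapid_bound[OF b, of "N"] by blast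
  have [measurable]: "a \<in> borel_measurable borel" "b \<in> borel_measurable borel" "F \<in> borel_measurable borel" using a b F by auto
  let ?k = "\<lambda>(v, y). a (x - v) * (b (v - y) * F y)"
  have ra: "integrable lborel (\<lambda>v. cmod (a (x - v)) * (C * (1 + norm v) ^ N))"
    using integrable_mult_right[OF rapid_weight_integrable[OF rapid_reflect[OF a, of x], of N], of C] by (simp add: ac_simps)
  have "integrable (lborel \<Otimes>\<^sub>M lborel) ?k"
  proof (rule integrable_pair_dominated[OF _ _ _ ra N])
    have "norm (?k p) \<le> cmod (a (x - fst p)) * (C * (1 + norm (fst p)) ^ N) * (cmod (F (snd p)) / (1 + norm (snd p)) ^ N)" for p
    proof -
      obtain v y where p: "p = (v, y)" by force
      have "cmod (b (v - y)) \<le> C * (1 + norm v) ^ N / (1 + norm y) ^ N" using C(2)[of "v - y"] weight_shift[of C v y N] C(1) by linarith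
      then have "cmod (a (x - v)) * cmod (F y) * cmod (b (v - y)) \<le> cmod (a (x - v)) * cmod (F y) * (C * (1 + norm v) ^ N / (1 + norm y) ^ N)"
        by (intro mult_left_mono) auto
      then show ?thesis by (simp add: p norm_mult ac_simps)
    qed
    then show "AE p in lborel \<Otimes>\<^sub>M lborel. norm (?k p) \<le> cmod (a (x - fst p)) * (C * (1 + norm (fst p)) ^ N) * (cmod (F (snd p)) / (1 + norm (snd p)) ^ N)"
      by simp
  qed (auto intro: lborel.sigma_finite_measure_axioms)
  from lborel_pair.Fubini_integral[OF this]
  have "(LINT y|lborel. LINT v|lborel. a (x - v) * (b (v - y) * F y)) = (LINT v|lborel. LINT y|lborel. a (x - v) * (b (v - y) * F y))" by simp
  moreover have "(LINT v|lborel. a (x - v) * (b (v - y) * F y)) = cnv a b (x - y) * F y" for y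
  proof -
    have "(LINT v|lborel. a (x - v) * (b (v - y) * F y)) = (LINT v|lborel. a (x - (v + y)) * (b (v + y - y) * F y))"
      using lborel_integral_shift[of "\<lambda>v. a (x - v) * (b (v - y) * F y)" y] by simp
    also have "\<dots> = (LINT v|lborel. a (x - y - v) * b v * F y)" by (simp add: algebra_simps)
    also have "\<dots> = cnv a b (x - y) * F y" unfolding cnv_def by simp
    finally show ?thesis .
  qed
  ultimately show ?thesis unfolding cnv_def[of a "cnv b F"] cnv_def[of "cnv a b" F] cnv_def[of b F] by simp
qed

subsection \<open>Schwartz functions\<close>

lemma iter_partial_Nil [simp]: "iter_partial [] \<phi> = \<phi>"
  and iter_partial_Cons [simp]: "iter_partial (i # a) \<phi> = iter_partial a (partial_deriv i \<phi>)"
  by (simp_all add: iter_partial_def)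

lemma bounded_weight_iff:
  fixes g :: "real^'n::finite \<Rightarrow> complex"
  shows "bounded (range (\<lambda>x. (1 + norm x) ^ N *\<^sub>R g x)) \<longleftrightarrow> (\<exists>C. \<forall>x. cmod (g x) \<le> C / (1 + norm x) ^ N)"
proof -
  have "(norm ((1 + norm x) ^ N *\<^sub>R g x) \<le> C) \<longleftrightarrow> cmod (g x) \<le> C / (1 + norm x) ^ N" for C x
    by (simp add: pos_le_divide_eq power_abs mult.commute)
  then show ?thesis unfolding bounded_iff by simp
qed

text \<open>Formulas for iterated partial derivatives are avoided: it is enough to exhibit a class
  of differentiable, rapidly decreasing functions that is closed under single partial
  derivatives.\<close>

lemma schwartz_coinduct:
  fixes X :: "(real^'n::finite \<Rightarrow> complex) set"
  assumes d: "\<And>g x. g \<in> X \<Longrightarrow> g differentiable (at x)"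
    and b: "\<And>g N. g \<in> X \<Longrightarrow> \<exists>C. \<forall>x. cmod (g x) \<le> C / (1 + norm x) ^ N"
    and p: "\<And>g i. g \<in> X \<Longrightarrow> partial_deriv i g \<in> X"
    and g: "g \<in> X"
  shows "schwartz g"
proof -
  have "iter_partial a g \<in> X" for a using g by (induction a arbitrary: g) (auto intro: p)
  then show ?thesis unfolding schwartz_def bounded_weight_iff using d b by blast
qed

lemma schwartz_differentiable: "schwartz \<phi> \<Longrightarrow> \<phi> differentiable (at x)"
  unfolding schwartz_def by (metis iter_partial_Nil)

lemma schwartz_continuous: "schwartz \<phi> \<Longrightarrow> continuous_on UNIV \<phi>"
  by (intro differentiable_imp_continuous_on) (auto simp: differentiable_on_def intro: differentiable_at_withinI schwartz_differentiable)

lemma schwartz_rapid: "schwartz \<phi> \<Longrightarrow> rapid \<phi>"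
proof (rule rapidI)
  assume s: "schwartz \<phi>"
  from schwartz_continuous[OF s] show "\<phi> \<in> borel_measurable borel" by (rule borel_measurable_continuous_onI)
  fix N
  have "bounded (range (\<lambda>x. (1 + norm x) ^ N *\<^sub>R iter_partial [] \<phi> x))" using s unfolding schwartz_def by blast
  then show "\<exists>C. \<forall>x. cmod (\<phi> x) \<le> C / (1 + norm x) ^ N" by (simp add: bounded_weight_iff)
qed

lemma schwartz_partial: "schwartz \<phi> \<Longrightarrow> schwartz (partial_deriv i \<phi>)"
  unfolding schwartz_def by (metis iter_partial_Cons)

lemma partial_deriv_eq: "(\<phi> has_derivative D) (at x) \<Longrightarrow> partial_deriv i \<phi> x = D (axis i 1)"
  unfolding partial_deriv_def by (metis frechet_derivative_at)

lemma has_derivative_partial: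
  fixes \<phi> :: "real^'n::finite \<Rightarrow> complex"
  assumes "\<phi> differentiable (at x)"
  shows "(\<phi> has_derivative (\<lambda>v. \<Sum>i\<in>UNIV. (v $ i) *\<^sub>R partial_deriv i \<phi> x)) (at x)"
proof -
  let ?D = "frechet_derivative \<phi> (at x)"
  have D: "(\<phi> has_derivative ?D) (at x)" using assms by (simp add: frechet_derivative_works)
  then have "linear ?D" by (rule has_derivative_linear)
  then interpret linear ?D .
  have "?D v = (\<Sum>i\<in>UNIV. (v $ i) *\<^sub>R partial_deriv i \<phi> x)" for v
  proof -
    have "?D v = ?D (\<Sum>i\<in>UNIV. (v $ i) *\<^sub>R axis i 1)" using basis_expansion[of v] by (simp add: scalar_mult_eq_scaleR)
    then show ?thesis by (simp add: sum scale partial_deriv_def)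
  qed
  then have "?D = (\<lambda>v. \<Sum>i\<in>UNIV. (v $ i) *\<^sub>R partial_deriv i \<phi> x)" by blast
  with D show ?thesis by metis
qed

lemmas schwartz_has_derivative = has_derivative_partial[OF schwartz_differentiable]

lemma schwartz_affine:
  fixes \<phi> :: "real^'n::finite \<Rightarrow> complex"
  assumes \<phi>: "schwartz \<phi>" and a: "a \<noteq> 0"
  shows "schwartz (\<lambda>y. c * \<phi> (a *\<^sub>R y + b))"
proof (rule schwartz_coinduct)
  let ?X = "{\<lambda>y. c * \<phi> (a *\<^sub>R y + b) | c \<phi>. schwartz (\<phi> :: real^'n \<Rightarrow> complex)}"
  show "(\<lambda>y. c * \<phi> (a *\<^sub>R y + b)) \<in> ?X" using \<phi> by blast
  have hd: "((\<lambda>y. c * \<phi> (a *\<^sub>R y + b)) has_derivative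
     (\<lambda>v. c * (\<Sum>i\<in>UNIV. ((a *\<^sub>R v) $ i) *\<^sub>R partial_deriv i \<phi> (a *\<^sub>R x + b)))) (at x)"
    if "schwartz \<phi>" for c \<phi> x
    by (rule has_derivative_mult_right, rule has_derivative_compose[OF _ schwartz_has_derivative[OF that]])
       (auto intro!: derivative_eq_intros)
  fix g assume "g \<in> ?X"
  then obtain c \<phi> where g: "g = (\<lambda>y. c * \<phi> (a *\<^sub>R y + b))" and \<phi>: "schwartz \<phi>" by blast
  show "g differentiable (at x)" for x unfolding g using hd[OF \<phi>] by (auto simp: differentiable_def)
  show "\<exists>C. \<forall>x. cmod (g x) \<le> C / (1 + norm x) ^ N" for N
    unfolding g using rapid_bound[OF rapid_cmult[OF rapid_affine[OF schwartz_rapid[OF \<phi>] a]]] by blast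
  fix i
  have "partial_deriv i g x = (c * of_real a) * partial_deriv i \<phi> (a *\<^sub>R x + b)" for x
    unfolding g partial_deriv_eq[OF hd[OF \<phi>]]
    by (simp add: axis_def if_distrib[of "\<lambda>t. t *\<^sub>R _"] if_distrib[of "\<lambda>t. a * t"] sum.delta' cong: if_cong) (simp add: scaleR_conv_of_real)
  then have "partial_deriv i g = (\<lambda>x. (c * of_real a) * partial_deriv i \<phi> (a *\<^sub>R x + b))" by blast
  then show "partial_deriv i g \<in> ?X" using schwartz_partial[OF \<phi>] by blast
qed

lemma schwartz_lipschitz:
  fixes \<phi> :: "real^'n::finite \<Rightarrow> complex"
  assumes "schwartz \<phi>" shows "\<exists>K\<ge>0. \<forall>x y. cmod (\<phi> x - \<phi> y) \<le> K * norm (x - y)"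
proof -
  have "\<exists>C>0. \<forall>x. cmod (partial_deriv i \<phi> x) \<le> C / (1 + norm x) ^ 0" for i
    by (rule rapid_bound[OF schwartz_rapid[OF schwartz_partial[OF assms]]])
  then obtain C where C: "\<And>i. 0 < C i" "\<And>i x. cmod (partial_deriv i \<phi> x) \<le> C i" by simp metis
  have "cmod (\<phi> x - \<phi> y) \<le> (\<Sum>i\<in>UNIV. C i) * norm (x - y)" for x y
  proof (rule differentiable_bound[OF convex_UNIV schwartz_has_derivative[OF assms]])
    fix x
    have "norm (\<Sum>i\<in>UNIV. (v $ i) *\<^sub>R partial_deriv i \<phi> x) \<le> (\<Sum>i\<in>UNIV. C i) * norm v" for v
      unfolding sum_distrib_right
    proof (rule sum_norm_le)
      fix i
      have "\<bar>v $ i\<bar> * cmod (partial_deriv i \<phi> x) \<le> norm v * C i" by (intro mult_mono C component_le_norm_cart) auto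
      then show "norm ((v $ i) *\<^sub>R partial_deriv i \<phi> x) \<le> C i * norm v" by (simp add: mult.commute)
    qed
    then show "onorm (\<lambda>v. \<Sum>i\<in>UNIV. (v $ i) *\<^sub>R partial_deriv i \<phi> x) \<le> (\<Sum>i\<in>UNIV. C i)" by (rule onorm_le)
  qed auto
  moreover have "0 \<le> (\<Sum>i\<in>UNIV. C i)" using C(1) by (intro sum_nonneg) (auto intro: less_imp_le)
  ultimately show ?thesis by blast
qed

text \<open>A remainder that is quadratic uniformly in the base point; this is what allows a
  convolution to be differentiated under the integral sign.\<close>

lemma schwartz_taylor:
  fixes \<phi> :: "real^'n::finite \<Rightarrow> complex"
  assumes s: "schwartz \<phi>"
  shows "\<exists>K\<ge>0. \<forall>x h. cmod (\<phi> (x + h) - \<phi> x - (\<Sum>i\<in>UNIV. (h $ i) *\<^sub>R partial_deriv i \<phi> x)) \<le> K * norm h ^ 2"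
proof -
  have "\<exists>K\<ge>0. \<forall>x y. cmod (partial_deriv i \<phi> x - partial_deriv i \<phi> y) \<le> K * norm (x - y)" for i
    by (rule schwartz_lipschitz[OF schwartz_partial[OF s]])
  then obtain K where K: "\<And>i. 0 \<le> K i" "\<And>i x y. cmod (partial_deriv i \<phi> x - partial_deriv i \<phi> y) \<le> K i * norm (x - y)"
    by metis
  have "cmod (\<phi> (x + h) - \<phi> x - (\<Sum>i\<in>UNIV. (h $ i) *\<^sub>R partial_deriv i \<phi> x)) \<le> (\<Sum>i\<in>UNIV. K i) * norm h ^ 2" for x h
  proof -
    have "cmod (\<phi> (x + h) - \<phi> x - (\<lambda>v. \<Sum>i\<in>UNIV. (v $ i) *\<^sub>R partial_deriv i \<phi> x) (x + h - x))
        \<le> norm (x + h - x) * ((\<Sum>i\<in>UNIV. K i) * norm h)"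
    proof (rule differentiable_bound_linearization[where S="cball x (norm h)" and f'="\<lambda>y v. \<Sum>i\<in>UNIV. (v $ i) *\<^sub>R partial_deriv i \<phi> y"])
      show "x + t *\<^sub>R (x + h - x) \<in> cball x (norm h)" if "t \<in> {0..1}" for t
        using that by (auto simp: dist_norm intro: mult_left_le_one_le)
      show "(\<phi> has_derivative (\<lambda>v. \<Sum>i\<in>UNIV. (v $ i) *\<^sub>R partial_deriv i \<phi> y)) (at y within cball x (norm h))" for y
        by (rule has_derivative_at_withinI[OF schwartz_has_derivative[OF s]])
      fix y assume y: "y \<in> cball x (norm h)"
      have "norm ((\<Sum>i\<in>UNIV. (v $ i) *\<^sub>R partial_deriv i \<phi> y) - (\<Sum>i\<in>UNIV. (v $ i) *\<^sub>R partial_deriv i \<phi> x))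
          \<le> ((\<Sum>i\<in>UNIV. K i) * norm h) * norm v" for v
      proof -
        have "norm (\<Sum>i\<in>UNIV. (v $ i) *\<^sub>R (partial_deriv i \<phi> y - partial_deriv i \<phi> x)) \<le> (\<Sum>i\<in>UNIV. norm v * (K i * norm h))"
        proof (rule sum_norm_le)
          fix i
          have "cmod (partial_deriv i \<phi> y - partial_deriv i \<phi> x) \<le> K i * norm h"
            using K(2)[of i y x] mult_left_mono[of "norm (y - x)" "norm h" "K i"] y K(1)[of i] by (simp add: dist_norm norm_minus_commute)
          then show "norm ((v $ i) *\<^sub>R (partial_deriv i \<phi> y - partial_deriv i \<phi> x)) \<le> norm v * (K i * norm h)"
            using component_le_norm_cart[of v i] by (simp add: mult_mono)
        qed
        then show ?thesis by (simp add: sum_subtractf scaleR_diff_right sum_distrib_left sum_distrib_right ac_simps)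
      qed
      then show "onorm ((\<lambda>v. \<Sum>i\<in>UNIV. (v $ i) *\<^sub>R partial_deriv i \<phi> y) - (\<lambda>v. \<Sum>i\<in>UNIV. (v $ i) *\<^sub>R partial_deriv i \<phi> x)) \<le> (\<Sum>i\<in>UNIV. K i) * norm h"
        unfolding fun_diff_def by (rule onorm_le)
    qed auto
    then show ?thesis by (simp add: power2_eq_square ac_simps)
  qed
  moreover have "0 \<le> (\<Sum>i\<in>UNIV. K i)" using K(1) by (intro sum_nonneg) auto
  ultimately show ?thesis by blast
qed

text \<open>All derivatives fall on the Schwartz factor, so the class of the convolutions of
  \<open>G\<close> with Schwartz functions is closed under partial derivatives; \<open>G\<close>
  contributes decay only.\<close>

lemma schwartz_cnv:
  fixes \<phi> :: "real^'n::finite \<Rightarrow> complex"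
  assumes \<phi>: "schwartz \<phi>" and G: "rapid G"
  shows "schwartz (cnv \<phi> G)"
proof (rule schwartz_coinduct)
  let ?X = "{cnv \<phi> G | \<phi>. schwartz (\<phi> :: real^'n \<Rightarrow> complex)}"
  show "cnv \<phi> G \<in> ?X" using \<phi> by blast
  have hd: "(cnv \<phi> G has_derivative (\<lambda>v. \<Sum>i\<in>UNIV. (v $ i) *\<^sub>R cnv (partial_deriv i \<phi>) G x)) (at x)"
    if s: "schwartz \<phi>" for \<phi> x
    unfolding has_derivative_at
  proof
    let ?S = "\<lambda>h. \<Sum>i\<in>UNIV. (h $ i) *\<^sub>R cnv (partial_deriv i \<phi>) G x"
    let ?D = "\<lambda>h. cnv \<phi> G (x + h) - cnv \<phi> G x - ?S h"
    let ?T = "\<lambda>h y. \<phi> (x + h - y) * G y - \<phi> (x - y) * G y - (\<Sum>i\<in>UNIV. (h $ i) *\<^sub>R (partial_deriv i \<phi> (x - y) * G y))"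
    show "bounded_linear ?S" by (intro bounded_linear_sum bounded_linear_scaleR_left[THEN bounded_linear_compose] bounded_linear_vec_nth)
    obtain K where K: "0 \<le> K" "\<And>x h. cmod (\<phi> (x + h) - \<phi> x - (\<Sum>i\<in>UNIV. (h $ i) *\<^sub>R partial_deriv i \<phi> x)) \<le> K * norm h ^ 2"
      using schwartz_taylor[OF s] by blast
    define I where "I = (LINT y|lborel. cmod (G y))"
    have int: "integrable lborel (\<lambda>y. \<eta> (x - y) * G y)" if "schwartz \<eta>" for \<eta> x
      by (intro integrable_rapid_tame_reflect schwartz_rapid that rapid_imp_tame G)
    have le: "cmod (?D h) \<le> K * I * norm h ^ 2" for h
    proof -
      have "?D h
        = (LINT y|lborel. ?T h y)"
        unfolding cnv_def
        by (subst Bochner_Integration.integral_diff Bochner_Integration.integral_sum integral_scaleR_right |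
            intro int Bochner_Integration.integrable_diff Bochner_Integration.integrable_sum integrable_scaleR_right s schwartz_partial refl)+
      also have "cmod \<dots> \<le> (LINT y|lborel. (K * norm h ^ 2) * cmod (G y))"
      proof (rule order_trans[OF integral_norm_bound], rule integral_mono)
        show "integrable lborel (\<lambda>y. cmod (?T h y))"
          by (intro integrable_norm int Bochner_Integration.integrable_diff Bochner_Integration.integrable_sum integrable_scaleR_right s schwartz_partial)
        show "integrable lborel (\<lambda>y. (K * norm h ^ 2) * cmod (G y))" by (intro integrable_mult_right integrable_norm rapid_integrable G)
        fix y
        have "?T h y
            = (\<phi> ((x - y) + h) - \<phi> (x - y) - (\<Sum>i\<in>UNIV. (h $ i) *\<^sub>R partial_deriv i \<phi> (x - y))) * G y"
          by (simp add: sum_distrib_right left_diff_distrib add_diff_eq diff_add_eq)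
        then show "cmod (?T h y)
            \<le> (K * norm h ^ 2) * cmod (G y)"
          using mult_right_mono[OF K(2)[of "x - y" h] norm_ge_zero[of "G y"]] by (simp add: norm_mult)
      qed
      also have "\<dots> = K * I * norm h ^ 2" unfolding I_def integral_mult_right_zero by (simp only: ac_simps)
      finally show ?thesis .
    qed
    show "(\<lambda>h. cmod (?D h) / norm h) \<midarrow>0\<rightarrow> 0"
    proof (rule Lim_null_comparison)
      show "\<forall>\<^sub>F h in at 0. norm (cmod (?D h) / norm h) \<le> K * I * norm h"
      proof (rule always_eventually, rule allI)
        fix h
        show "norm (cmod (?D h) / norm h) \<le> K * I * norm h"
        proof (cases "h = 0")
          case False
          then have "cmod (?D h) / norm h \<le> K * I * norm h ^ 2 / norm h" by (intro divide_right_mono le) auto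
          also have "\<dots> = K * I * norm h" using False by (simp add: power2_eq_square)
          finally show ?thesis by simp
        qed simp
      qed
      show "((\<lambda>h. K * I * norm h) \<longlongrightarrow> 0) (at 0)" by (rule tendsto_eq_intros refl tendsto_norm_zero tendsto_ident_at | simp)+
    qed
  qed
  fix g assume "g \<in> ?X"
  then obtain \<phi> where g: "g = cnv \<phi> G" and s: "schwartz \<phi>" by blast
  show "g differentiable (at x)" for x unfolding g using hd[OF s] by (auto simp: differentiable_def)
  show "\<exists>C. \<forall>x. cmod (g x) \<le> C / (1 + norm x) ^ N" for N
    unfolding g using rapid_bound[OF rapid_cnv[OF schwartz_rapid[OF s] G]] by blast
  fix i
  have "partial_deriv i g x = cnv (partial_deriv i \<phi>) G x" for x
    unfolding g partial_deriv_eq[OF hd[OF s]]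
    by (simp add: axis_def if_distrib[of "\<lambda>t. t *\<^sub>R _"] cong: if_cong)
  then have "partial_deriv i g = cnv (partial_deriv i \<phi>) G" by blast
  then show "partial_deriv i g \<in> ?X" using schwartz_partial[OF s] by blast
qed

section \<open>Polynomials and the Gaussian\<close>

lemma real_polynomial_function_growth:
  fixes P :: "'a::real_normed_vector \<Rightarrow> real"
  assumes "real_polynomial_function P"
  shows "\<exists>C M. 0 \<le> C \<and> (\<forall>x. \<bar>P x\<bar> \<le> C * (1 + norm x) ^ M)"
  using assms
proof induction
  case (linear f)
  obtain K where K: "\<And>x. norm (f x) \<le> norm x * K" "0 \<le> K" using bounded_linear.nonneg_bounded[OF linear] by blast
  have "norm x * K \<le> K * (1 + norm x)" for x :: 'a using K(2) by (simp add: algebra_simps)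
  with K show ?case by (intro exI[of _ K] exI[of _ 1]) (auto intro: order_trans)
next
  case (const c)
  then show ?case by (intro exI[of _ "\<bar>c\<bar>"] exI[of _ 0]) auto
next
  case (add f g)
  then obtain C M D N where *: "0 \<le> C" "\<And>x. \<bar>f x\<bar> \<le> C * (1 + norm x) ^ M" "0 \<le> D" "\<And>x. \<bar>g x\<bar> \<le> D * (1 + norm x) ^ N" by blast
  have "\<bar>f x + g x\<bar> \<le> (C + D) * (1 + norm x) ^ (M + N)" for x
  proof -
    have "C * (1 + norm x) ^ M \<le> C * (1 + norm x) ^ (M + N)" "D * (1 + norm x) ^ N \<le> D * (1 + norm x) ^ (M + N)"
      using * by (intro mult_left_mono power_increasing; simp)+
    with *(2)[of x] *(4)[of x] show ?thesis unfolding distrib_right by linarith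
  qed
  with * show ?case by (intro exI[of _ "C + D"] exI[of _ "M + N"]) auto
next
  case (mult f g)
  then obtain C M D N where *: "0 \<le> C" "\<And>x. \<bar>f x\<bar> \<le> C * (1 + norm x) ^ M" "0 \<le> D" "\<And>x. \<bar>g x\<bar> \<le> D * (1 + norm x) ^ N" by blast
  have "\<bar>f x * g x\<bar> \<le> (C * D) * (1 + norm x) ^ (M + N)" for x
  proof -
    have "\<bar>f x * g x\<bar> \<le> (C * (1 + norm x) ^ M) * (D * (1 + norm x) ^ N)" unfolding abs_mult using * by (intro mult_mono) auto
    then show ?thesis by (simp add: power_add ac_simps)
  qed
  with * show ?case by (intro exI[of _ "C * D"] exI[of _ "M + N"]) auto
qed

lemma real_polynomial_function_derivative:
  fixes P :: "'a::real_normed_vector \<Rightarrow> real"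
  assumes "real_polynomial_function P"
  shows "\<exists>P'. real_polynomial_function P' \<and> (\<forall>x. \<exists>D. (P has_derivative D) (at x) \<and> D v = P' x)"
  using assms
proof induction
  case (linear f)
  then show ?case by (intro exI[of _ "\<lambda>_. f v"]) (auto intro: bounded_linear_imp_has_derivative real_polynomial_function.intros(2))
next
  case (const c)
  then show ?case by (intro exI[of _ "\<lambda>_. 0"]) (auto intro!: real_polynomial_function.intros(2) exI[of _ "\<lambda>_. 0"] has_derivative_const)
next
  case (add f g)
  then obtain f' g' where *: "real_polynomial_function f'" "real_polynomial_function g'"
    "\<And>x. \<exists>D. (f has_derivative D) (at x) \<and> D v = f' x" "\<And>x. \<exists>D. (g has_derivative D) (at x) \<and> D v = g' x" by blast
  have "\<exists>D. ((\<lambda>x. f x + g x) has_derivative D) (at x) \<and> D v = f' x + g' x" for x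
    using *(3)[of x] *(4)[of x] by (metis (mono_tags, lifting) has_derivative_add)
  with * show ?case by (intro exI[of _ "\<lambda>x. f' x + g' x"]) (auto intro: real_polynomial_function.intros(3))
next
  case (mult f g)
  then obtain f' g' where *: "real_polynomial_function f'" "real_polynomial_function g'"
    "\<And>x. \<exists>D. (f has_derivative D) (at x) \<and> D v = f' x" "\<And>x. \<exists>D. (g has_derivative D) (at x) \<and> D v = g' x" by blast
  have "\<exists>D. ((\<lambda>x. f x * g x) has_derivative D) (at x) \<and> D v = f x * g' x + f' x * g x" for x
    using *(3)[of x] *(4)[of x] by (metis (mono_tags, lifting) has_derivative_mult)
  with * mult show ?case
    by (intro exI[of _ "\<lambda>x. f x * g' x + f' x * g x"]) (auto intro!: real_polynomial_function.intros(3) real_polynomial_function.intros(4))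
qed

text \<open>From (1 + t/k)^k \<le> exp t with t = |x|^2 and k = K + 1.\<close>

lemma gaussian_decay: "exp (- (x \<bullet> x)) * (1 + norm (x::'a::real_inner)) ^ K \<le> (2 * real (Suc K)) ^ Suc K"
proof -
  let ?k = "Suc K"
  have "2 * norm x \<le> norm x ^ 2 + 1" using zero_le_power2[of "norm x - 1"] unfolding power2_diff by simp
  moreover have "0 \<le> norm x ^ 2" by simp
  ultimately have "1 + norm x \<le> 2 * (1 + norm x ^ 2)" unfolding distrib_left by linarith
  also have "\<dots> \<le> 2 * real ?k * (1 + norm x ^ 2 / real ?k)" by (simp add: field_simps)
  finally have "(1 + norm x) ^ ?k \<le> (2 * real ?k * (1 + norm x ^ 2 / real ?k)) ^ ?k" by (intro power_mono) auto
  also have "\<dots> = (2 * real ?k) ^ ?k * (1 + norm x ^ 2 / real ?k) ^ ?k" by (simp only: power_mult_distrib)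
  also have "\<dots> \<le> (2 * real ?k) ^ ?k * exp (norm x ^ 2)"
    by (intro mult_left_mono exp_ge_one_plus_x_over_n_power_n) (auto intro: order_trans[of _ 0])
  finally have "exp (- (norm x ^ 2)) * (1 + norm x) ^ ?k \<le> (2 * real ?k) ^ ?k" by (simp add: exp_minus field_simps)
  moreover have "(1 + norm x) ^ K \<le> (1 + norm x) ^ ?k" by (intro power_increasing) auto
  ultimately show ?thesis unfolding power2_norm_eq_inner by (meson exp_ge_zero mult_left_mono order_trans)
qed

lemma schwartz_gaussian:
  "schwartz (\<lambda>x::real^'n::finite. complex_of_real (exp (- (x \<bullet> x))))"
proof (rule schwartz_coinduct)
  let ?X = "{\<lambda>x. complex_of_real (P x * exp (- (x \<bullet> x))) | P :: real^'n \<Rightarrow> real. real_polynomial_function P}"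
  have "(\<lambda>x::real^'n. complex_of_real (exp (- (x \<bullet> x)))) = (\<lambda>x. complex_of_real ((\<lambda>_. 1) x * exp (- (x \<bullet> x))))" by simp
  then show "(\<lambda>x::real^'n. complex_of_real (exp (- (x \<bullet> x)))) \<in> ?X"
    using real_polynomial_function.intros(2)[of 1] unfolding mem_Collect_eq by (intro exI[of _ "\<lambda>_. 1"] conjI)
  have hd: "((\<lambda>x. complex_of_real (P x * exp (- (x \<bullet> x)))) has_derivative
     (\<lambda>v. complex_of_real (P x * (exp (- (x \<bullet> x)) * (- (2 * (x \<bullet> v)))) + D v * exp (- (x \<bullet> x))))) (at x)"
    if "(P has_derivative D) (at x)" for P :: "real^'n \<Rightarrow> real" and D x
    using that by (auto intro!: derivative_eq_intros simp: inner_commute)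
  fix g assume "g \<in> ?X"
  then obtain P where g: "g = (\<lambda>x. complex_of_real (P x * exp (- (x \<bullet> x))))" and P: "real_polynomial_function P" by blast
  have P': "\<exists>P'. real_polynomial_function P' \<and> (\<forall>x. \<exists>D. (P has_derivative D) (at x) \<and> D v = P' x)" for v
    by (rule real_polynomial_function_derivative[OF P])
  show "g differentiable (at x)" for x unfolding g differentiable_def using hd P' by blast
  show "\<exists>C. \<forall>x. cmod (g x) \<le> C / (1 + norm x) ^ N" for N
  proof -
    obtain C M where C: "0 \<le> C" "\<And>x. \<bar>P x\<bar> \<le> C * (1 + norm x) ^ M" using real_polynomial_function_growth[OF P] by blast
    define K where "K = (2 * real (Suc (M + N))) ^ Suc (M + N)"
    have "cmod (g x) \<le> C * K / (1 + norm x) ^ N" for x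
    proof -
      have "cmod (g x) * (1 + norm x) ^ N = \<bar>P x\<bar> * (exp (- (x \<bullet> x)) * (1 + norm x) ^ N)" by (simp add: g abs_mult norm_mult)
      also have "\<dots> \<le> C * (1 + norm x) ^ M * (exp (- (x \<bullet> x)) * (1 + norm x) ^ N)" by (intro mult_right_mono C) auto
      also have "\<dots> = C * (exp (- (x \<bullet> x)) * (1 + norm x) ^ (M + N))" by (simp add: power_add ac_simps)
      also have "\<dots> \<le> C * K" unfolding K_def by (intro mult_left_mono gaussian_decay C)
      finally show ?thesis by (simp add: pos_le_divide_eq)
    qed
    then show ?thesis by blast
  qed
  fix i
  obtain P' where P': "real_polynomial_function P'" "\<And>x. \<exists>D. (P has_derivative D) (at x) \<and> D (axis i 1) = P' x"
    using P'[of "axis i 1"] by blast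
  have "partial_deriv i g x = complex_of_real ((P x * (- 2 * (x \<bullet> axis i 1)) + P' x) * exp (- (x \<bullet> x)))" for x
  proof -
    obtain D where D: "(P has_derivative D) (at x)" "D (axis i 1) = P' x" using P'(2) by blast
    show ?thesis unfolding g partial_deriv_eq[OF hd[OF D(1)]] D(2) by (simp add: algebra_simps)
  qed
  then have "partial_deriv i g = (\<lambda>x. complex_of_real ((P x * (- 2 * (x \<bullet> axis i 1)) + P' x) * exp (- (x \<bullet> x))))" by blast
  moreover have "real_polynomial_function (\<lambda>x. P x * (- 2 * (x \<bullet> axis i 1)) + P' x)"
    by (intro real_polynomial_function.intros P P' bounded_linear_inner_left)
  ultimately show "partial_deriv i g \<in> ?X"
    unfolding mem_Collect_eq by (intro exI[of _ "\<lambda>x. P x * (- 2 * (x \<bullet> axis i 1)) + P' x"] conjI)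
qed

subsection \<open>Iterated differences\<close>

lemma iter_diff_0 [simp]: "iter_diff 0 F h = F"
  and iter_diff_Suc: "iter_diff (Suc L) F h x = iter_diff L F h (x + h) - iter_diff L F h x"
  by (simp_all add: iter_diff_def diff1_def)

text \<open>The signed binomial coefficients (-1)^(L-i) binom(L,i), in the form of Pascal's
  recursion that matches one more difference.\<close>

fun diff_coef :: "nat \<Rightarrow> nat \<Rightarrow> real" where
  "diff_coef 0 i = (if i = 0 then 1 else 0)"
| "diff_coef (Suc L) i = (if i = 0 then 0 else diff_coef L (i - 1)) - diff_coef L i"

lemma diff_coef_eq_0: "L < i \<Longrightarrow> diff_coef L i = 0"
  by (induction L arbitrary: i) auto

lemma iter_diff_sum: "iter_diff L F h x = (\<Sum>i\<le>L. diff_coef L i *\<^sub>R F (x + real i *\<^sub>R h))"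
proof (induction L arbitrary: x)
  case (Suc L)
  have "(\<Sum>i\<le>Suc L. diff_coef (Suc L) i *\<^sub>R F (x + real i *\<^sub>R h))
    = (\<Sum>i\<le>Suc L. (if i = 0 then 0 else diff_coef L (i - 1)) *\<^sub>R F (x + real i *\<^sub>R h))
      - (\<Sum>i\<le>Suc L. diff_coef L i *\<^sub>R F (x + real i *\<^sub>R h))"
    by (simp only: diff_coef.simps scaleR_diff_left sum_subtractf)
  also have "(\<Sum>i\<le>Suc L. (if i = 0 then 0 else diff_coef L (i - 1)) *\<^sub>R F (x + real i *\<^sub>R h))
     = (\<Sum>i\<le>L. diff_coef L i *\<^sub>R F (x + h + real i *\<^sub>R h))"
    by (subst sum.atMost_Suc_shift) (simp add: algebra_simps)
  also have "(\<Sum>i\<le>Suc L. diff_coef L i *\<^sub>R F (x + real i *\<^sub>R h)) = (\<Sum>i\<le>L. diff_coef L i *\<^sub>R F (x + real i *\<^sub>R h))"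
    by (simp add: diff_coef_eq_0)
  finally show ?case by (simp add: iter_diff_Suc Suc)
qed simp

lemma iter_diff_measurable [measurable]:
  assumes [measurable]: "F \<in> borel_measurable borel"
  shows "(\<lambda>p. iter_diff L F (fst p) (snd p)) \<in> borel_measurable (borel \<Otimes>\<^sub>M borel)" unfolding iter_diff_sum by measurable

lemma iter_diff_bound:
  assumes "\<And>i. i \<le> L \<Longrightarrow> cmod (F (x + real i *\<^sub>R h)) \<le> S"
  shows "cmod (iter_diff L F h x) \<le> 2 ^ L * S"
  using assms
proof (induction L arbitrary: x)
  case (Suc L)
  have "cmod (F (x + real i *\<^sub>R h)) \<le> S" if "i \<le> L" for i using that Suc.prems by simp
  then have 1: "cmod (iter_diff L F h x) \<le> 2 ^ L * S" by (rule Suc.IH)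
  have "cmod (F (x + h + real i *\<^sub>R h)) \<le> S" if "i \<le> L" for i using that Suc.prems[of "Suc i"] by (simp add: algebra_simps)
  then have 2: "cmod (iter_diff L F h (x + h)) \<le> 2 ^ L * S" by (rule Suc.IH)
  show ?case unfolding iter_diff_Suc using 1 2 norm_triangle_ineq4[of "iter_diff L F h (x + h)" "iter_diff L F h x"] by simp
qed simp

lemma schwartz_iter_diff_has_derivative:
  fixes g :: "real^'n::finite \<Rightarrow> complex"
  assumes "schwartz g"
  shows "(iter_diff L g h has_derivative (\<lambda>v. \<Sum>i\<in>UNIV. (v $ i) *\<^sub>R iter_diff L (partial_deriv i g) h x)) (at x)"
proof -
  have "((\<lambda>x. \<Sum>k\<le>L. diff_coef L k *\<^sub>R g (x + real k *\<^sub>R h)) has_derivative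
     (\<lambda>v. \<Sum>k\<le>L. diff_coef L k *\<^sub>R (\<Sum>i\<in>UNIV. (v $ i) *\<^sub>R partial_deriv i g (x + real k *\<^sub>R h)))) (at x)"
    by (intro has_derivative_sum has_derivative_scaleR_right has_derivative_compose[OF _ schwartz_has_derivative[OF assms]])
       (auto intro!: derivative_eq_intros)
  moreover have "(\<Sum>k\<le>L. diff_coef L k *\<^sub>R (\<Sum>i\<in>UNIV. (v $ i) *\<^sub>R partial_deriv i g (x + real k *\<^sub>R h)))
     = (\<Sum>i\<in>UNIV. (v $ i) *\<^sub>R iter_diff L (partial_deriv i g) h x)" for v
    unfolding iter_diff_sum scaleR_sum_right
    by (subst sum.swap) (simp add: ac_simps)
  moreover have "iter_diff L g h = (\<lambda>x. \<Sum>k\<le>L. diff_coef L k *\<^sub>R g (x + real k *\<^sub>R h))" by (rule ext) (rule iter_diff_sum)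
  ultimately show ?thesis by simp
qed

text \<open>A difference of order L + 1 is the increment over \<open>h\<close> of one of order L,
  whose derivative is made of L-th differences of the partial derivatives. The mean value inequality
  thus gains one factor |h| per order.\<close>

lemma schwartz_iter_diff_decay:
  fixes g :: "real^'n::finite \<Rightarrow> complex"
  assumes "schwartz g"
  shows "\<exists>C>0. \<forall>h x. norm h \<le> 1 \<longrightarrow> cmod (iter_diff L g h x) \<le> C * norm h ^ L / (1 + norm x) ^ N"
  using assms
proof (induction L arbitrary: g)
  case 0
  obtain C where "0 < C" "\<And>x. cmod (g x) \<le> C / (1 + norm x) ^ N"
    using rapid_bound[OF schwartz_rapid[OF 0], of N] by blast
  then show ?case by (intro exI[of _ C]) simp
next
  case (Suc L)
  have "\<exists>C>0. \<forall>h x. norm h \<le> 1 \<longrightarrow> cmod (iter_diff L (partial_deriv i g) h x) \<le> C * norm h ^ L / (1 + norm x) ^ N" for i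
    by (rule Suc.IH[OF schwartz_partial[OF Suc.prems]])
  then obtain C where C: "\<And>i. 0 < C i" "\<And>i h x. norm h \<le> 1 \<Longrightarrow> cmod (iter_diff L (partial_deriv i g) h x) \<le> C i * norm h ^ L / (1 + norm x) ^ N"
    by metis
  have "cmod (iter_diff (Suc L) g h x) \<le> (2 ^ N * (\<Sum>i\<in>UNIV. C i)) * norm h ^ Suc L / (1 + norm x) ^ N" if h: "norm h \<le> 1" for h x
  proof -
    define B where "B = (\<Sum>i\<in>UNIV. C i * norm h ^ L * 2 ^ N / (1 + norm x) ^ N)"
    have "cmod (iter_diff L g h (x + h) - iter_diff L g h x) \<le> B * norm ((x + h) - x)"
    proof (rule differentiable_bound[where S="cball x (norm h)"])
      fix y assume y: "y \<in> cball x (norm h)"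
      show "(iter_diff L g h has_derivative (\<lambda>v. \<Sum>i\<in>UNIV. (v $ i) *\<^sub>R iter_diff L (partial_deriv i g) h y)) (at y within cball x (norm h))"
        by (rule has_derivative_at_withinI[OF schwartz_iter_diff_has_derivative[OF Suc.prems]])
      \<comment> \<open>As |h| is at most 1, the weight changes by at most a factor 2 along the
        segment; this is the source of 2^N.\<close>
      have w: "1 + norm x \<le> 2 * (1 + norm y)"
        using y h norm_triangle_ineq2[of x y] norm_ge_zero[of y] unfolding mem_cball dist_norm distrib_left by linarith
      have w': "1 / (1 + norm y) ^ N \<le> 2 ^ N / (1 + norm x) ^ N"
      proof -
        have "(1 + norm x) ^ N \<le> 2 ^ N * (1 + norm y) ^ N" unfolding power_mult_distrib[symmetric] by (rule power_mono[OF w]) simp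
        from le_divide_weight[OF this, of 1] show ?thesis by simp
      qed
      have "norm (\<Sum>i\<in>UNIV. (v $ i) *\<^sub>R iter_diff L (partial_deriv i g) h y) \<le> B * norm v" for v
        unfolding B_def sum_distrib_right
      proof (rule sum_norm_le)
        fix i
        have "cmod (iter_diff L (partial_deriv i g) h y) \<le> C i * norm h ^ L * (1 / (1 + norm y) ^ N)" using C(2)[OF h, of i y] by simp
        also have "\<dots> \<le> C i * norm h ^ L * (2 ^ N / (1 + norm x) ^ N)" using C(1)[of i] by (intro mult_left_mono w') auto
        finally have "cmod (iter_diff L (partial_deriv i g) h y) \<le> C i * norm h ^ L * 2 ^ N / (1 + norm x) ^ N" by simp
        then have "\<bar>v $ i\<bar> * cmod (iter_diff L (partial_deriv i g) h y) \<le> norm v * (C i * norm h ^ L * 2 ^ N / (1 + norm x) ^ N)"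
          using component_le_norm_cart[of v i] by (intro mult_mono) auto
        then show "norm ((v $ i) *\<^sub>R iter_diff L (partial_deriv i g) h y) \<le> C i * norm h ^ L * 2 ^ N / (1 + norm x) ^ N * norm v"
          by (simp add: mult.commute)
      qed
      then show "onorm (\<lambda>v. \<Sum>i\<in>UNIV. (v $ i) *\<^sub>R iter_diff L (partial_deriv i g) h y) \<le> B" by (rule onorm_le)
    qed (auto simp: dist_norm)
    also have "\<dots> = (2 ^ N * (\<Sum>i\<in>UNIV. C i)) * norm h ^ Suc L / (1 + norm x) ^ N"
      by (simp add: B_def sum_distrib_left sum_distrib_right sum_divide_distrib ac_simps)
    finally show ?thesis by (simp add: iter_diff_Suc)
  qed
  moreover have "0 < 2 ^ N * (\<Sum>i\<in>UNIV. C i)" using C(1) by (intro mult_pos_pos sum_pos) auto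
  ultimately show ?case by blast
qed


subsection \<open>Function representatives are tame\<close>

text \<open>Turns integrability of a representative against Schwartz functions into integrability
  against all rapid functions. The best weight bounds of \<open>g\<close> are combined into one
  radial envelope, enlarged so as to dominate \<open>g\<close> on unit neighbourhoods, and smoothed
  by a Gaussian.\<close>

lemma rapid_smooth_majorant:
  fixes g :: "real^'n::finite \<Rightarrow> complex"
  assumes g: "rapid g"
  shows "\<exists>\<Phi>. schwartz \<Phi> \<and> (\<forall>x. cmod (g x) \<le> cmod (\<Phi> x))"
proof -
  have "\<exists>C>0. \<forall>x. cmod (g x) \<le> C / (1 + norm x) ^ N" for N by (rule rapid_bound[OF g])
  then obtain c where c: "\<And>N. 0 < c N" "\<And>N x. cmod (g x) \<le> c N / (1 + norm x) ^ N" by metis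
  \<comment> \<open>The factor 2^N pays for moving the weight by a distance of at most 1; it gives
    the domination on unit balls in \<open>Gge\<close>.\<close>
  define G where "G x = (INF N. c N * 2 ^ N / (1 + norm x) ^ N)" for x :: "real^'n"
  have nn: "0 \<le> c N * 2 ^ N / (1 + norm x) ^ N" for N and x :: "real^'n" using c(1)[of N] by simp
  have bdd: "bdd_below (range (\<lambda>N. c N * 2 ^ N / (1 + norm x) ^ N))" for x :: "real^'n" by (rule bdd_belowI2[of _ 0]) (rule nn)
  have Gm [measurable]: "G \<in> borel_measurable borel" unfolding G_def by (rule borel_measurable_cINF) (auto intro: bdd)
  have G0: "0 \<le> G x" for x unfolding G_def by (rule cINF_greatest) (auto intro: nn)
  have Gle: "G x \<le> c N * 2 ^ N / (1 + norm x) ^ N" for N x unfolding G_def by (rule cINF_lower[OF bdd]) simp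
  have Gge: "cmod (g x) \<le> G y" if "dist x y \<le> 1" for x y
    unfolding G_def
  proof (rule cINF_greatest)
    fix N
    have "1 + norm y \<le> 2 * (1 + norm x)"
      using that norm_triangle_ineq2[of y x] norm_ge_zero[of x] unfolding distrib_left dist_norm norm_minus_commute[of x y] by linarith
    then have "(1 + norm y) ^ N \<le> 2 ^ N * (1 + norm x) ^ N" unfolding power_mult_distrib[symmetric] by (rule power_mono) simp
    from le_divide_weight[OF this _ _ c(1)[of N]] have "c N / (1 + norm x) ^ N \<le> c N * 2 ^ N / (1 + norm y) ^ N" by simp
    with c(2)[of x N] show "cmod (g x) \<le> c N * 2 ^ N / (1 + norm y) ^ N" by (rule order_trans)
  qed simp
  have rG: "rapid (\<lambda>x. complex_of_real (G x))"
  proof (rule rapidI)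
    show "(\<lambda>x. complex_of_real (G x)) \<in> borel_measurable borel" by measurable
    show "\<exists>C. \<forall>x. cmod (complex_of_real (G x)) \<le> C / (1 + norm x) ^ N" for N
      using Gle[of _ N] G0 by (intro exI[of _ "c N * 2 ^ N"]) simp
  qed
  define E where "E x = exp (- (x \<bullet> x))" for x :: "real^'n"
  define v where "v = measure lborel (cball (0::real^'n) 1)"
  have v: "0 < v" by (simp add: v_def content_cball)
  \<comment> \<open>The Gaussian is at least 1/e on the unit ball, whose volume is \<open>v\<close>;
    the prefactor restores the size of \<open>g\<close>. The trivial affine argument matches the
    form of \<open>schwartz_affine\<close>.\<close>
  define \<Phi> where "\<Phi> x = complex_of_real (exp 1 / v) * cnv (\<lambda>x. complex_of_real (E x)) (\<lambda>x. complex_of_real (G x)) (1 *\<^sub>R x + 0)" for x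
  have "schwartz \<Phi>" unfolding \<Phi>_def E_def by (intro schwartz_affine schwartz_cnv schwartz_gaussian rG) simp
  moreover have "cmod (g x) \<le> cmod (\<Phi> x)" for x
  proof -
    have int: "integrable lborel (\<lambda>y. E (x - y) * G y)"
    proof -
      have "integrable lborel (\<lambda>y. complex_of_real (E (x - y)) * complex_of_real (G y))"
        unfolding E_def by (intro integrable_rapid_tame_reflect[of "\<lambda>x. complex_of_real (exp (- (x \<bullet> x)))"] schwartz_rapid schwartz_gaussian rapid_imp_tame rG)
      then have "integrable lborel (\<lambda>y. complex_of_real (E (x - y) * G y))" by simp
      then show ?thesis by (simp only: complex_of_real_integrable_eq)
    qed
    have "exp (-1) * cmod (g x) * v = (LINT y|lborel. indicator (cball x 1) y * (exp (-1) * cmod (g x)))" by (simp add: v_def content_cball)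
    also have "\<dots> \<le> (LINT y|lborel. E (x - y) * G y)"
    proof (rule integral_mono[OF _ int])
      show "integrable lborel (\<lambda>y. indicator (cball x 1) y * (exp (- 1) * cmod (g x)))"
        by (intro integrable_mult_left integrable_real_indicator) (auto simp: emeasure_cball)
      fix y
      show "indicator (cball x 1) y * (exp (- 1) * cmod (g x)) \<le> E (x - y) * G y"
      proof (cases "y \<in> cball x 1")
        case True
        then have "norm (x - y) ^ 2 \<le> 1 ^ 2" by (intro power_mono) (auto simp: dist_norm)
        then have "exp (-1) \<le> E (x - y)" unfolding E_def by (simp add: power2_norm_eq_inner)
        moreover have "cmod (g x) \<le> G y" using True by (intro Gge) simp
        ultimately have "exp (- 1) * cmod (g x) \<le> E (x - y) * G y" by (intro mult_mono) (auto simp: E_def)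
        then show ?thesis using True by simp
      qed (use G0 in \<open>simp add: E_def\<close>)
    qed
    finally have *: "exp (-1) * cmod (g x) * v \<le> (LINT y|lborel. E (x - y) * G y)" .
    have "\<Phi> x = complex_of_real (exp 1 / v * (LINT y|lborel. E (x - y) * G y))" unfolding \<Phi>_def cnv_def by (simp flip: of_real_mult)
    then have "cmod (\<Phi> x) = \<bar>exp 1 / v * (LINT y|lborel. E (x - y) * G y)\<bar>" by (simp only: norm_of_real)
    also have "\<dots> \<ge> exp 1 / v * (LINT y|lborel. E (x - y) * G y)" by (rule abs_ge_self)
    also have "exp 1 / v * (LINT y|lborel. E (x - y) * G y) \<ge> exp 1 / v * (exp (-1) * cmod (g x) * v)" using v by (intro mult_left_mono *) auto
    also have "exp 1 / v * (exp (-1) * cmod (g x) * v) = cmod (g x)" using v by (simp add: exp_minus)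
    finally show ?thesis .
  qed
  ultimately show ?thesis by blast
qed

text \<open>A function that is not tame admits shells on which its weighted mass is at least one for every
  power of the weight; the rapidly decreasing function built from these weights detects it.\<close>

lemma tame_if_integrable_rapid:
  fixes F :: "real^'n::finite \<Rightarrow> complex"
  assumes F [measurable]: "F \<in> borel_measurable borel"
    and int: "\<And>g. rapid g \<Longrightarrow> integrable lborel (\<lambda>x. F x * g x)"
  shows "tame F"
proof (rule ccontr)
  assume nt: "\<not> tame F"
  define w where "w N x = ennreal (cmod (F x) / (1 + norm x) ^ N)" for N x
  have w [measurable]: "w N \<in> borel_measurable borel" for N unfolding w_def by measurable
  have inf: "(\<integral>\<^sup>+x. w N x \<partial>lborel) = top" for N
  proof (rule ccontr)
    assume "(\<integral>\<^sup>+x. w N x \<partial>lborel) \<noteq> top"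
    then have "integrable lborel (\<lambda>x. cmod (F x) / (1 + norm x) ^ N)" unfolding w_def by (intro integrableI_nonneg) (auto simp: less_top)
    with nt show False unfolding tame_def by auto
  qed
  have loc: "(\<integral>\<^sup>+x\<in>cball 0 R. w N x \<partial>lborel) < top" for N R
  proof -
    have "rapid (\<lambda>x::real^'n. indicator (cball 0 R) x)"
    proof (rule rapidI)
      show "(\<lambda>x::real^'n. indicator (cball 0 R) x :: complex) \<in> borel_measurable borel" by (intro borel_measurable_indicator) simp
      show "\<exists>C. \<forall>x::real^'n. cmod (indicator (cball 0 R) x) \<le> C / (1 + norm x) ^ M" for M
      proof (intro exI allI)
        fix x :: "real^'n"
        show "cmod (indicator (cball 0 R) x) \<le> (1 + \<bar>R\<bar>) ^ M / (1 + norm x) ^ M"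
          by (cases "x \<in> cball 0 R") (auto simp: pos_le_divide_eq intro!: power_mono)
      qed
    qed
    from int[OF this] have "(\<integral>\<^sup>+x. ennreal (norm (F x * indicator (cball 0 R) x)) \<partial>lborel) < top"
      by (simp add: integrable_iff_bounded)
    moreover have "(\<integral>\<^sup>+x\<in>cball 0 R. w N x \<partial>lborel) \<le> (\<integral>\<^sup>+x. ennreal (norm (F x * indicator (cball 0 R) x)) \<partial>lborel)"
    proof (rule nn_integral_mono)
      fix x :: "real^'n"
      have "cmod (F x) / (1 + norm x) ^ N \<le> cmod (F x) / 1" by (rule divide_left_mono) (auto intro: one_le_power)
      then show "w N x * indicator (cball 0 R) x \<le> ennreal (norm (F x * indicator (cball 0 R) x))"
        unfolding w_def by (auto simp: indicator_def norm_mult intro!: ennreal_leI)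
    qed
    ultimately show ?thesis by (rule le_less_trans[rotated])
  qed
  define A where "A R R' = {x::real^'n. R \<le> norm x \<and> norm x < R'}" for R R'
  have [measurable]: "A R R' \<in> sets borel" for R R' unfolding A_def by measurable
  have [measurable]: "cball (0::real^'n) R \<in> sets borel" for R by simp
  \<comment> \<open>Infinite total mass and finite mass on balls leave infinite mass outside every
    ball; monotone convergence then supplies an outer radius. The gap of at least 1 drives the radii
    to infinity.\<close>
  have ex: "\<exists>R'\<ge>R + 1. 1 \<le> (\<integral>\<^sup>+x\<in>A R R'. w N x \<partial>lborel)" for R N
  proof -
    have "(\<integral>\<^sup>+x. w N x * indicator {x. R \<le> norm x} x \<partial>lborel) = top"
    proof (rule ccontr)
      assume "(\<integral>\<^sup>+x. w N x * indicator {x. R \<le> norm x} x \<partial>lborel) \<noteq> top"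
      moreover have "(\<integral>\<^sup>+x. w N x \<partial>lborel) \<le> (\<integral>\<^sup>+x. w N x * indicator {x. R \<le> norm x} x + w N x * indicator (cball 0 R) x \<partial>lborel)"
        by (intro nn_integral_mono) (auto simp: indicator_def)
      moreover have "\<dots> = (\<integral>\<^sup>+x. w N x * indicator {x. R \<le> norm x} x \<partial>lborel) + (\<integral>\<^sup>+x\<in>cball 0 R. w N x \<partial>lborel)"
        by (rule nn_integral_add) measurable
      ultimately show False using inf[of N] loc[of N R] by (simp add: top_unique)
    qed
    also have "(\<lambda>x::real^'n. w N x * indicator {x. R \<le> norm x} x) = (\<lambda>x. SUP k. w N x * indicator (A R (R + 1 + real k)) x)"
    proof
      fix x :: "real^'n"
      show "w N x * indicator {x. R \<le> norm x} x = (SUP k. w N x * indicator (A R (R + 1 + real k)) x)"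
      proof (rule antisym)
        obtain k where "norm x < real k" using reals_Archimedean2 by blast
        then have "norm x < R + 1 + real (k + nat \<lceil>\<bar>R\<bar>\<rceil>)" by (simp add: of_nat_nat) linarith
        then have "w N x * indicator {x. R \<le> norm x} x \<le> w N x * indicator (A R (R + 1 + real (k + nat \<lceil>\<bar>R\<bar>\<rceil>))) x"
          by (auto simp: A_def indicator_def)
        also have "\<dots> \<le> (SUP k. w N x * indicator (A R (R + 1 + real k)) x)" by (rule SUP_upper) simp
        finally show "w N x * indicator {x. R \<le> norm x} x \<le> (SUP k. w N x * indicator (A R (R + 1 + real k)) x)" .
      qed (auto intro!: SUP_least simp: A_def indicator_def)
    qed
    also have "(\<integral>\<^sup>+x. (SUP k. w N x * indicator (A R (R + 1 + real k)) x) \<partial>lborel) = (SUP k. \<integral>\<^sup>+x. w N x * indicator (A R (R + 1 + real k)) x \<partial>lborel)"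
    proof (rule nn_integral_monotone_convergence_SUP)
      show "incseq (\<lambda>k x. w N x * indicator (A R (R + 1 + real k)) x)" by (auto simp: incseq_def le_fun_def A_def indicator_def)
    qed measurable
    finally have "1 < (SUP k. \<integral>\<^sup>+x. w N x * indicator (A R (R + 1 + real k)) x \<partial>lborel)" by (simp only: ennreal_one_less_top)
    then obtain k where "1 < (\<integral>\<^sup>+x. w N x * indicator (A R (R + 1 + real k)) x \<partial>lborel)" unfolding less_SUP_iff by auto
    then show ?thesis by (intro exI[of _ "R + 1 + real k"]) auto
  qed
  define \<rho> where "\<rho> = rec_nat 0 (\<lambda>N R. SOME R'. R' \<ge> R + 1 \<and> 1 \<le> (\<integral>\<^sup>+x\<in>A R R'. w N x \<partial>lborel))"
  have \<rho>Suc: "\<rho> (Suc N) = (SOME R'. R' \<ge> \<rho> N + 1 \<and> 1 \<le> (\<integral>\<^sup>+x\<in>A (\<rho> N) R'. w N x \<partial>lborel))" and \<rho>0: "\<rho> 0 = 0" for N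
    by (simp_all add: \<rho>_def)
  have \<rho>: "\<rho> (Suc N) \<ge> \<rho> N + 1" "1 \<le> (\<integral>\<^sup>+x\<in>A (\<rho> N) (\<rho> (Suc N)). w N x \<partial>lborel)" for N
    using someI_ex[OF ex[of "\<rho> N" N]] unfolding \<rho>Suc[symmetric] by auto
  have \<rho>mono: "M \<le> N \<Longrightarrow> \<rho> M \<le> \<rho> N" for M N using lift_Suc_mono_le[of \<rho> M N] \<rho>(1) by (smt (verit))
  have \<rho>ge: "real N \<le> \<rho> N" for N
  proof (induction N)
    case (Suc N)
    then show ?case using \<rho>(1)[of N] by simp
  qed (simp add: \<rho>0)
  define n where "n x = (LEAST N. norm x < \<rho> (Suc N))" for x :: "real^'n"
  have nx: "norm x < \<rho> (Suc (n x))" for x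
  proof -
    obtain N where "norm x < real N" using reals_Archimedean2 by blast
    also have "real N \<le> \<rho> (Suc N)" using \<rho>ge[of N] \<rho>(1)[of N] by linarith
    finally show ?thesis unfolding n_def by (rule LeastI)
  qed
  have nle: "\<rho> N \<le> norm x \<Longrightarrow> N \<le> n x" for N x
    using nx[of x] \<rho>mono[of "Suc (n x)" N] by (meson leD le_less_trans not_less_eq_eq order_trans linorder_not_le)
  have neq: "n x = N" if "x \<in> A (\<rho> N) (\<rho> (Suc N))" for x N
  proof (rule antisym)
    show "n x \<le> N" unfolding n_def using that by (intro Least_le) (simp add: A_def)
    show "N \<le> n x" using that by (intro nle) (simp add: A_def)
  qed
  have n [measurable]: "n \<in> measurable borel (count_space UNIV)" unfolding n_def by measurable
  define g where "g x = complex_of_real (1 / (1 + norm x) ^ n x)" for x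
  have g [measurable]: "g \<in> borel_measurable borel" unfolding g_def by measurable
  have "rapid g"
  proof (rule rapidI[OF g])
    fix M
    have "cmod (g x) \<le> (1 + \<rho> M) ^ M / (1 + norm x) ^ M" for x
    proof (cases "\<rho> M \<le> norm x")
      case True
      have "1 \<le> (1 + \<rho> M) ^ M" using \<rho>ge[of M] by (intro one_le_power) linarith
      moreover have "(1 + norm x) ^ M \<le> (1 + norm x) ^ n x" using nle[OF True] by (intro power_increasing) auto
      ultimately have "1 / (1 + norm x) ^ n x \<le> (1 + \<rho> M) ^ M / (1 + norm x) ^ M" by (intro frac_le) auto
      then show ?thesis by (simp add: g_def norm_divide norm_power del: of_real_add)
    next
      case False
      then have "(1 + norm x) ^ M \<le> (1 + \<rho> M) ^ M" by (intro power_mono) auto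
      then have "1 \<le> (1 + \<rho> M) ^ M / (1 + norm x) ^ M" by (simp add: pos_le_divide_eq)
      moreover have "cmod (g x) \<le> 1" by (simp add: g_def norm_divide norm_power one_le_power del: of_real_add)
      ultimately show ?thesis by linarith
    qed
    then show "\<exists>C. \<forall>x. cmod (g x) \<le> C / (1 + norm x) ^ M" by blast
  qed
  from int[OF this] have fin: "(\<integral>\<^sup>+x. ennreal (norm (F x * g x)) \<partial>lborel) < top" by (simp add: integrable_iff_bounded)
  \<comment> \<open>On shell \<open>N\<close> the exponent chosen by \<open>g\<close> is exactly
    \<open>N\<close>, so |F g| agrees there with \<open>w N\<close>, and each of the first
    \<open>K\<close> shells contributes at least 1.\<close>
  have "of_nat K \<le> (\<integral>\<^sup>+x. ennreal (norm (F x * g x)) \<partial>lborel)" for K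
  proof -
    have "of_nat K = (\<Sum>N<K. (1::ennreal))" by simp
    also have "\<dots> \<le> (\<Sum>N<K. \<integral>\<^sup>+x\<in>A (\<rho> N) (\<rho> (Suc N)). w N x \<partial>lborel)" by (intro sum_mono \<rho>)
    also have "\<dots> = (\<integral>\<^sup>+x. (\<Sum>N<K. w N x * indicator (A (\<rho> N) (\<rho> (Suc N))) x) \<partial>lborel)"
      by (rule nn_integral_sum[symmetric]) measurable
    also have "\<dots> \<le> (\<integral>\<^sup>+x. ennreal (norm (F x * g x)) \<partial>lborel)"
    proof (rule nn_integral_mono)
      fix x
      have "(\<Sum>N<K. w N x * indicator (A (\<rho> N) (\<rho> (Suc N))) x) \<le> (\<Sum>N<K. if N = n x then w (n x) x else 0)"
        by (intro sum_mono) (auto simp: indicator_def dest: neq)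
      also have "\<dots> \<le> w (n x) x" by simp
      also have "w (n x) x = ennreal (norm (F x * g x))" by (simp add: w_def g_def norm_mult norm_divide norm_power del: of_real_add)
      finally show "(\<Sum>N<K. w N x * indicator (A (\<rho> N) (\<rho> (Suc N))) x) \<le> ennreal (norm (F x * g x))" .
    qed
    finally show ?thesis .
  qed
  then have "(SUP K. of_nat K) \<le> (\<integral>\<^sup>+x. ennreal (norm (F x * g x)) \<partial>lborel)" by (intro SUP_least)
  with fin show False by (simp add: ennreal_SUP_of_nat_eq_top)
qed

lemma function_rep_tame:
  assumes "function_rep u (F :: real^'n::finite \<Rightarrow> complex)"
  shows "tame F"
proof (rule tame_if_integrable_rapid)
  show F: "F \<in> borel_measurable borel" using assms by (simp add: function_rep_def)
  fix g :: "real^'n \<Rightarrow> complex" assume g: "rapid g"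
  then obtain \<Phi> where \<Phi>: "schwartz \<Phi>" "\<And>x. cmod (g x) \<le> cmod (\<Phi> x)" using rapid_smooth_majorant by blast
  have "integrable lborel (\<lambda>x. F x * \<Phi> x)" using assms \<Phi>(1) unfolding function_rep_def by blast
  then show "integrable lborel (\<lambda>x. F x * g x)"
  proof (rule Bochner_Integration.integrable_bound)
    have "(\<lambda>x. F x * g x) \<in> borel_measurable borel" using F rapid_measurable[OF g] by measurable
    then show "(\<lambda>x. F x * g x) \<in> borel_measurable lborel" by simp
    show "AE x in lborel. norm (F x * g x) \<le> norm (F x * \<Phi> x)" using \<Phi>(2) by (intro AE_I2) (simp add: norm_mult mult_left_mono)
  qed
qed

subsection \<open>The Fourier transform\<close>

definition ee :: "real \<Rightarrow> complex" where
  "ee t = exp (\<i> * complex_of_real (2 * pi * t))"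

lemma norm_ee [simp]: "cmod (ee t) = 1"
  by (simp add: ee_def)

lemma ee_0 [simp]: "ee 0 = 1"
  by (simp add: ee_def)

lemma ee_add: "ee (s + t) = ee s * ee t"
  by (simp add: ee_def algebra_simps exp_add)

lemma ee_minus: "ee (- t) = cnj (ee t)"
  by (simp add: ee_def exp_cnj)

lemma ee_measurable [measurable]: "ee \<in> borel_measurable borel"
  unfolding ee_def by measurable

lemma ee_isCont: "isCont ee t"
  unfolding ee_def by (intro continuous_intros)

lemma norm_ee_diff_le: "cmod (ee t - 1) \<le> 2 * pi * \<bar>t\<bar>"
  using iexp_approx1[of "2 * pi * t" 0] by (simp add: ee_def abs_mult)

lemma fourier_alt: "fourier \<phi> \<xi> = (LINT x|lborel. \<phi> x * ee (- (x \<bullet> \<xi>)))"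
  unfolding fourier_def ee_def by (simp add: ac_simps)

lemma integrable_mult_ee:
  assumes g: "integrable lborel (g :: real^'n::finite \<Rightarrow> complex)" and h [measurable]: "h \<in> borel_measurable borel"
  shows "integrable lborel (\<lambda>x. g x * ee (h x))"
proof (rule Bochner_Integration.integrable_bound[OF g])
  have [measurable]: "g \<in> borel_measurable borel" using borel_measurable_integrable[OF g] by simp
  show "(\<lambda>x. g x * ee (h x)) \<in> borel_measurable lborel" by measurable
qed (simp add: norm_mult)

lemma fourier_measurable [measurable]:
  fixes g :: "real^'n::finite \<Rightarrow> complex"
  assumes [measurable]: "g \<in> borel_measurable borel"
  shows "fourier g \<in> borel_measurable borel" unfolding fourier_alt by measurable

section \<open>Gaussian transform and Fourier inversion\<close>

lemma integral_lborel_prod: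
  fixes f :: "'a::euclidean_space \<Rightarrow> real \<Rightarrow> complex"
  assumes f: "\<And>b. b \<in> Basis \<Longrightarrow> integrable lborel (f b)"
  shows "(LINT x|lborel. (\<Prod>b\<in>Basis. f b (x \<bullet> b))) = (\<Prod>b\<in>Basis. (LINT t|lborel. f b t))"
    and "integrable lborel (\<lambda>x::'a. \<Prod>b\<in>Basis. f b (x \<bullet> b))"
proof -
  interpret product_sigma_finite "\<lambda>b::'a. lborel :: real measure" by standard
  have fm: "b \<in> Basis \<Longrightarrow> f b \<in> borel_measurable borel" for b using borel_measurable_integrable[OF f] by simp
  have m [measurable]: "(\<lambda>x::'a. \<Prod>b\<in>Basis. f b (x \<bullet> b)) \<in> borel_measurable borel"
    by (intro borel_measurable_prod measurable_compose[OF _ fm]) auto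
  let ?T = "\<lambda>f::'a \<Rightarrow> real. \<Sum>b\<in>Basis. f b *\<^sub>R b"
  have T [measurable]: "?T \<in> measurable (\<Pi>\<^sub>M b\<in>(Basis::'a set). lborel) borel" by measurable
  have eq: "(\<Prod>b\<in>Basis. f b (?T y \<bullet> b)) = (\<Prod>b\<in>Basis. f b (y b))" for y
    by (intro prod.cong refl) (simp add: inner_sum_left inner_Basis if_distrib cong: if_cong)
  show "(LINT x|lborel. (\<Prod>b\<in>Basis. f b (x \<bullet> b))) = (\<Prod>b\<in>Basis. (LINT t|lborel. f b t))"
    unfolding lborel_eq[where 'a='a]
    by (subst integral_distr[OF T]) (simp_all add: eq product_integral_prod f)
  show "integrable lborel (\<lambda>x::'a. \<Prod>b\<in>Basis. f b (x \<bullet> b))"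
    unfolding lborel_eq[where 'a='a]
    by (subst integrable_distr_eq[OF T]) (simp_all add: eq product_integrable_prod f)
qed

definition gauss :: "real^'n::finite \<Rightarrow> real" where
  "gauss v = (\<Prod>b\<in>Basis. std_normal_density (v \<bullet> b))"

lemma gauss_nonneg: "0 \<le> gauss v"
  unfolding gauss_def by (intro prod_nonneg) simp

lemma sum_square_inner: "(\<Sum>b\<in>Basis. - (v \<bullet> b)\<^sup>2 / 2) = - (norm (v::'a::euclidean_space))\<^sup>2 / 2"
  unfolding sum_divide_distrib[symmetric] sum_negf power2_norm_eq_inner euclidean_inner[of v v]
  by (simp add: power2_eq_square)

lemma gauss_eq: "gauss (v::real^'n::finite) = (1 / sqrt (2 * pi)) ^ CARD('n) * exp (- (norm v)\<^sup>2 / 2)"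
proof -
  have "gauss v = (\<Prod>b\<in>(Basis :: (real^'n) set). 1 / sqrt (2 * pi)) * (\<Prod>b\<in>(Basis :: (real^'n) set). exp (- (v \<bullet> b)\<^sup>2 / 2))"
    unfolding gauss_def std_normal_density_def prod.distrib[symmetric] by simp
  also have "(\<Prod>b\<in>(Basis :: (real^'n) set). exp (- (v \<bullet> b)\<^sup>2 / 2)) = exp (- (norm v)\<^sup>2 / 2)"
    unfolding exp_sum[OF finite_Basis, symmetric] sum_square_inner ..
  finally show ?thesis by simp
qed

lemma gauss_measurable [measurable]: "gauss \<in> borel_measurable borel"
  unfolding gauss_def by measurable

text \<open>The integrand factors over the coordinates, which leaves the characteristic function of
  the standard normal law in each of them.\<close>

lemma fourier_gauss:
  fixes y :: "real^'n::finite"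
  shows "(LINT v|lborel. complex_of_real (gauss v) * exp (\<i> * complex_of_real (v \<bullet> y))) = complex_of_real (exp (- (norm y)\<^sup>2 / 2))"
    and "integrable lborel (gauss :: real^'n \<Rightarrow> real)"
proof -
  have int: "integrable lborel std_normal_density" by (rule integrable_std_normal_distribution_moment[of 0, simplified] | simp add: integrable_normal_density)+
  have inti: "integrable lborel (\<lambda>t. complex_of_real (std_normal_density t) * exp (\<i> * complex_of_real (t * a)))" for a
    by (rule Bochner_Integration.integrable_bound[OF integrable_of_real[OF int, where 'a=complex]]) (auto simp: norm_mult)
  have char: "(LINT t|lborel. complex_of_real (std_normal_density t) * exp (\<i> * complex_of_real (t * a))) = complex_of_real (exp (- a\<^sup>2 / 2))" for a
  proof -
    have "char std_normal_distribution a = (LINT t|lborel. std_normal_density t *\<^sub>R exp (\<i> * complex_of_real (a * t)))"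
      unfolding char_def by (subst integral_density) auto
    then show ?thesis by (simp add: char_std_normal_distribution scaleR_conv_of_real mult.commute)
  qed
  have "complex_of_real (gauss v) * exp (\<i> * complex_of_real (v \<bullet> y)) =
     (\<Prod>b\<in>Basis. complex_of_real (std_normal_density (v \<bullet> b)) * exp (\<i> * complex_of_real ((v \<bullet> b) * (y \<bullet> b))))" (is "_ = ?R v") for v
    unfolding prod.distrib gauss_def exp_sum[OF finite_Basis, symmetric] sum_distrib_left[symmetric] of_real_prod
    by (subst euclidean_inner[of v y]) (simp only: of_real_sum)
  then have "(LINT v|lborel. complex_of_real (gauss v) * exp (\<i> * complex_of_real (v \<bullet> y))) = (\<Prod>b\<in>Basis. complex_of_real (exp (- (y \<bullet> b)\<^sup>2 / 2)))"
    by (simp only: integral_lborel_prod(1)[OF inti, of "\<lambda>b. y \<bullet> b"] char)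
  also have "\<dots> = complex_of_real (exp (- (norm y)\<^sup>2 / 2))"
    unfolding of_real_prod[symmetric] exp_sum[OF finite_Basis, symmetric] sum_square_inner ..
  finally show "(LINT v|lborel. complex_of_real (gauss v) * exp (\<i> * complex_of_real (v \<bullet> y))) = complex_of_real (exp (- (norm y)\<^sup>2 / 2))" .
  have "integrable lborel (\<lambda>v::real^'n. complex_of_real (gauss v))"
    unfolding gauss_def of_real_prod using integral_lborel_prod(2)[OF integrable_of_real[OF int, where 'a=complex]] .
  then show "integrable lborel (gauss :: real^'n \<Rightarrow> real)" by (simp only: complex_of_real_integrable_eq)
qed

lemma integral_gauss: "(LINT v|lborel. gauss (v :: real^'n::finite)) = 1"
proof -
  have "complex_of_real (LINT v|lborel. gauss (v :: real^'n)) = 1" using fourier_gauss(1)[of "0::real^'n"] by (simp flip: integral_of_real)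
  then show ?thesis using of_real_eq_1_iff by blast
qed

lemma integral_ee_gauss:
  fixes w :: "real^'n::finite"
  assumes \<epsilon>: "0 < \<epsilon>"
  shows "(LINT \<xi>|lborel. ee (w \<bullet> \<xi>) * complex_of_real (gauss (\<epsilon> *\<^sub>R \<xi>)))
    = complex_of_real ((1 / \<epsilon>) ^ CARD('n) * sqrt (2 * pi) ^ CARD('n) * gauss ((2 * pi / \<epsilon>) *\<^sub>R w))"
proof -
  have "(LINT \<xi>|lborel. ee (w \<bullet> \<xi>) * complex_of_real (gauss (\<epsilon> *\<^sub>R \<xi>)))
     = (1 / \<epsilon>) ^ CARD('n) *\<^sub>R (LINT u|lborel. ee (w \<bullet> ((1 / \<epsilon>) *\<^sub>R u)) * complex_of_real (gauss u))"
    using integral_lborel_affine[of "1 / \<epsilon>" "\<lambda>\<xi>. ee (w \<bullet> \<xi>) * complex_of_real (gauss (\<epsilon> *\<^sub>R \<xi>))" 0] \<epsilon> by simp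
  also have "(LINT u|lborel. ee (w \<bullet> ((1 / \<epsilon>) *\<^sub>R u)) * complex_of_real (gauss u))
     = (LINT u|lborel. complex_of_real (gauss u) * exp (\<i> * complex_of_real (u \<bullet> ((2 * pi / \<epsilon>) *\<^sub>R w))))"
    by (simp add: ee_def mult.commute inner_commute)
  also have "\<dots> = complex_of_real (exp (- (norm ((2 * pi / \<epsilon>) *\<^sub>R w))\<^sup>2 / 2))" by (rule fourier_gauss(1))
  also have "exp (- (norm ((2 * pi / \<epsilon>) *\<^sub>R w))\<^sup>2 / 2) = sqrt (2 * pi) ^ CARD('n) * gauss ((2 * pi / \<epsilon>) *\<^sub>R w)"
    unfolding gauss_eq by (simp add: power_divide)
  finally show ?thesis by (simp add: scaleR_conv_of_real)
qed

text \<open>The Gaussian factor makes the double integral absolutely convergent. Integrating over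
  the frequency first turns it into a Gaussian of width \<epsilon>/(2 pi) in space, so the
  regularised inversion integral is an average of \<open>g\<close> near \<open>x\<close>.\<close>

lemma gauss_mult_integral:
  fixes g :: "real^'n::finite \<Rightarrow> complex"
  assumes g: "integrable lborel g" and \<epsilon>: "0 < \<epsilon>"
  shows "(LINT \<xi>|lborel. fourier g \<xi> * ee (x \<bullet> \<xi>) * complex_of_real (exp (- (norm (\<epsilon> *\<^sub>R \<xi>))\<^sup>2 / 2)))
    = (LINT v|lborel. g (x - (\<epsilon> / (2 * pi)) *\<^sub>R v) * complex_of_real (gauss v))"
proof -
  let ?e = "\<lambda>\<xi> y. ee ((x - y) \<bullet> \<xi>) * complex_of_real (gauss (\<epsilon> *\<^sub>R \<xi>))" and ?d = "\<epsilon> / (2 * pi)" and ?s = "sqrt (2 * pi) ^ CARD('n)"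
  let ?h = "\<lambda>y. complex_of_real ((1 / \<epsilon>) ^ CARD('n) * ?s * gauss ((2 * pi / \<epsilon>) *\<^sub>R (x - y)))"
  have [measurable]: "g \<in> borel_measurable borel" using borel_measurable_integrable[OF g] by simp
  have E: "exp (- (norm (\<epsilon> *\<^sub>R \<xi>))\<^sup>2 / 2) = ?s * gauss (\<epsilon> *\<^sub>R \<xi>)" for \<xi> :: "real^'n"
    unfolding gauss_eq by (simp add: power_divide)
  have gi: "integrable lborel (\<lambda>\<xi>::real^'n. gauss (\<epsilon> *\<^sub>R \<xi>))"
    using integrable_lborel_affine[OF fourier_gauss(2), of \<epsilon> 0] \<epsilon> by simp
  let ?k = "\<lambda>(\<xi>, y). g y * ?e \<xi> y"
  have "integrable (lborel \<Otimes>\<^sub>M lborel) ?k" by (rule integrable_pair_dominated[OF _ _ _ gi integrable_norm[OF g]])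
       (auto simp: norm_mult gauss_nonneg mult.commute intro: lborel.sigma_finite_measure_axioms)
  from lborel_pair.Fubini_integral[OF this]
  have fub: "(LINT y|lborel. LINT \<xi>|lborel. g y * ?e \<xi> y)
     = (LINT \<xi>|lborel. LINT y|lborel. g y * ?e \<xi> y)" by simp
  have in1: "(LINT y|lborel. g y * ?e \<xi> y)
     = fourier g \<xi> * ee (x \<bullet> \<xi>) * complex_of_real (gauss (\<epsilon> *\<^sub>R \<xi>))" for \<xi>
  proof -
    let ?K = "ee (x \<bullet> \<xi>) * complex_of_real (gauss (\<epsilon> *\<^sub>R \<xi>))"
    have "ee ((x - y) \<bullet> \<xi>) = ee (- (y \<bullet> \<xi>)) * ee (x \<bullet> \<xi>)" for y
      using ee_add[of "- (y \<bullet> \<xi>)" "x \<bullet> \<xi>"] by (simp add: inner_diff_left)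
    then have "(LINT y|lborel. g y * ?e \<xi> y)
       = (LINT y|lborel. (g y * ee (- (y \<bullet> \<xi>))) * ?K)" by (simp only: mult.assoc)
    also have "\<dots> = (LINT y|lborel. g y * ee (- (y \<bullet> \<xi>))) * ?K" by (rule integral_mult_left_zero)
    finally show ?thesis by (simp only: fourier_alt mult.assoc)
  qed
  have in2: "(LINT \<xi>|lborel. g y * ?e \<xi> y)
     = g y * ?h y" for y
    using integral_ee_gauss[OF \<epsilon>, of "x - y"] by simp
  have "(LINT \<xi>|lborel. fourier g \<xi> * ee (x \<bullet> \<xi>) * complex_of_real (exp (- (norm (\<epsilon> *\<^sub>R \<xi>))\<^sup>2 / 2)))
     = (LINT \<xi>|lborel. complex_of_real ?s * (fourier g \<xi> * ee (x \<bullet> \<xi>) * complex_of_real (gauss (\<epsilon> *\<^sub>R \<xi>))))"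
    unfolding E of_real_mult by (simp only: ac_simps)
  also have "\<dots> = complex_of_real ?s * (LINT y|lborel. g y * ?h y)" unfolding integral_mult_right_zero using fub unfolding in1 in2 by simp
  also have "(LINT y|lborel. g y * ?h y)
     = (?d ^ CARD('n)) *\<^sub>R (LINT v|lborel. g (x - ?d *\<^sub>R v) * complex_of_real ((1 / \<epsilon>) ^ CARD('n) * ?s * gauss v))"
    using integral_lborel_affine[of "- ?d" "\<lambda>y. g y * ?h y" x] \<epsilon> by simp
  also have "\<dots> = (?d ^ CARD('n)) *\<^sub>R ((LINT v|lborel. g (x - ?d *\<^sub>R v) * complex_of_real (gauss v)) * complex_of_real ((1 / \<epsilon>) ^ CARD('n) * ?s))"
    by (simp only: of_real_mult mult.commute[of _ "complex_of_real (gauss _)"] integral_mult_left_zero mult.assoc[symmetric])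
  also have "complex_of_real ?s * \<dots> = complex_of_real (?d ^ CARD('n) * ((1 / \<epsilon>) ^ CARD('n) * (?s * ?s))) * (LINT v|lborel. g (x - ?d *\<^sub>R v) * complex_of_real (gauss v))"
    by (simp add: scaleR_conv_of_real ac_simps)
  also have "?d ^ CARD('n) * ((1 / \<epsilon>) ^ CARD('n) * (?s * ?s)) = 1"
  proof -
    have "?d * ((1 / \<epsilon>) * (sqrt (2 * pi) * sqrt (2 * pi))) = 1" using \<epsilon> by simp
    then have "(?d * ((1 / \<epsilon>) * (sqrt (2 * pi) * sqrt (2 * pi)))) ^ CARD('n) = 1" by (simp only: power_one)
    then show ?thesis by (simp only: power_mult_distrib)
  qed
  finally show ?thesis by simp
qed

text \<open>Let \<epsilon> tend to 0 in \<open>gauss_mult_integral\<close>. Integrability of the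
  transform dominates the left side; continuity and boundedness of \<open>g\<close> give the limit
  on the right, where the Gaussian has mass 1.\<close>

theorem fourier_inversion:
  fixes g :: "real^'n::finite \<Rightarrow> complex"
  assumes cont: "continuous_on UNIV g" and bdd: "\<And>x. cmod (g x) \<le> B"
    and g: "integrable lborel g" and ghat: "integrable lborel (fourier g)"
  shows "g x = (LINT \<xi>|lborel. fourier g \<xi> * ee (x \<bullet> \<xi>))"
proof -
  have [measurable]: "g \<in> borel_measurable borel" using borel_measurable_integrable[OF g] by simp
  define \<epsilon> where "\<epsilon> k = 1 / real (Suc k)" for k
  have \<epsilon>: "0 < \<epsilon> k" for k by (simp add: \<epsilon>_def)
  have lim\<epsilon>: "\<epsilon> \<longlonglongrightarrow> 0" unfolding \<epsilon>_def by (rule LIMSEQ_Suc[OF lim_1_over_n])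
  let ?G = "\<lambda>k \<xi>. fourier g \<xi> * ee (x \<bullet> \<xi>) * complex_of_real (exp (- (norm (\<epsilon> k *\<^sub>R \<xi>))\<^sup>2 / 2))"
  let ?I = "\<lambda>k. (LINT \<xi>|lborel. ?G k \<xi>)"
  have "?I \<longlonglongrightarrow> (LINT \<xi>|lborel. fourier g \<xi> * ee (x \<bullet> \<xi>))"
  proof (rule integral_dominated_convergence[where w="\<lambda>\<xi>. cmod (fourier g \<xi>)"])
    show "AE \<xi> in lborel. (\<lambda>k. ?G k \<xi>) \<longlonglongrightarrow> fourier g \<xi> * ee (x \<bullet> \<xi>)"
    proof (intro AE_I2)
      fix \<xi> :: "real^'n"
      have "(\<lambda>k. ?G k \<xi>) \<longlonglongrightarrow>
         fourier g \<xi> * ee (x \<bullet> \<xi>) * complex_of_real (exp (- (norm (0 *\<^sub>R \<xi>))\<^sup>2 / 2))"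
        by (intro tendsto_intros lim\<epsilon>) simp_all
      then show "(\<lambda>k. ?G k \<xi>) \<longlonglongrightarrow> fourier g \<xi> * ee (x \<bullet> \<xi>)" by simp
    qed
    show "AE \<xi> in lborel. norm (?G k \<xi>) \<le> cmod (fourier g \<xi>)" for k by (intro AE_I2) (simp add: norm_mult mult_left_le)
  qed (use ghat in \<open>auto intro!: integrable_norm\<close>)
  moreover have "?I \<longlonglongrightarrow> (LINT v|lborel. g x * complex_of_real (gauss (v::real^'n)))"
    unfolding gauss_mult_integral[OF g \<epsilon>]
  proof (rule integral_dominated_convergence[where w="\<lambda>v. B * gauss v"])
    show "AE v in lborel. (\<lambda>k. g (x - (\<epsilon> k / (2 * pi)) *\<^sub>R v) * complex_of_real (gauss v)) \<longlonglongrightarrow> g x * complex_of_real (gauss v)"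
    proof (intro AE_I2)
      fix v :: "real^'n"
      have "(\<lambda>k. x - (\<epsilon> k / (2 * pi)) *\<^sub>R v) \<longlonglongrightarrow> x - (0 / (2 * pi)) *\<^sub>R v"
        by (intro tendsto_intros lim\<epsilon>) simp
      then have "(\<lambda>k. x - (\<epsilon> k / (2 * pi)) *\<^sub>R v) \<longlonglongrightarrow> x" by simp
      with cont have "(\<lambda>k. g (x - (\<epsilon> k / (2 * pi)) *\<^sub>R v)) \<longlonglongrightarrow> g x"
        by (intro isCont_tendsto_compose[of x g]) (simp add: continuous_on_eq_continuous_at)
      then show "(\<lambda>k. g (x - (\<epsilon> k / (2 * pi)) *\<^sub>R v) * complex_of_real (gauss v)) \<longlonglongrightarrow> g x * complex_of_real (gauss v)"
        by (intro tendsto_intros)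
    qed
    show "AE v in lborel. norm (g (x - (\<epsilon> k / (2 * pi)) *\<^sub>R v) * complex_of_real (gauss v)) \<le> B * gauss v" for k
      using bdd by (intro AE_I2) (simp add: norm_mult gauss_nonneg mult_right_mono)
    show "integrable lborel (\<lambda>v::real^'n. B * gauss v)" by (intro integrable_mult_right fourier_gauss(2))
  qed measurable
  ultimately have "(LINT \<xi>|lborel. fourier g \<xi> * ee (x \<bullet> \<xi>)) = (LINT v|lborel. g x * complex_of_real (gauss (v::real^'n)))"
    by (rule LIMSEQ_unique)
  then show ?thesis by (simp add: integral_gauss)
qed

lemma fourier_cnv:
  fixes a :: "real^'n::finite \<Rightarrow> complex"
  assumes a: "rapid a" and b: "rapid b"
  shows "fourier (cnv a b) \<xi> = fourier a \<xi> * fourier b \<xi>"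
proof -
  have [measurable]: "a \<in> borel_measurable borel" "b \<in> borel_measurable borel" using a b by auto
  have ia: "integrable lborel a" and ib: "integrable lborel b" using a b by (auto intro: rapid_integrable)
  let ?k = "\<lambda>(y, x). a (x - y) * b y * ee (- (x \<bullet> \<xi>))"
  have "integrable (lborel \<Otimes>\<^sub>M lborel) ?k"
  proof (rule lborel_pair.Fubini_integrable)
    have inner: "(LINT x|lborel. norm (case (y, x) of (y, x) \<Rightarrow> a (x - y) * b y * ee (- (x \<bullet> \<xi>)))) = cmod (b y) * (LINT x|lborel. cmod (a x))" for y
      using lborel_integral_shift[of "\<lambda>x. cmod (a x)" "- y"] by (simp add: norm_mult mult.commute)
    show "integrable lborel (\<lambda>y. LINT x|lborel. norm (case (y, x) of (y, x) \<Rightarrow> a (x - y) * b y * ee (- (x \<bullet> \<xi>))))"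
      unfolding inner by (intro integrable_mult_left integrable_norm ib)
    have "integrable lborel (\<lambda>x. (a (x - y) * b y) * ee (- (x \<bullet> \<xi>)))" for y
      using integrable_lborel_affine[OF ia, of 1 "- y"] by (intro integrable_mult_ee) auto
    then show "AE y in lborel. integrable lborel (\<lambda>x. case (y, x) of (y, x) \<Rightarrow> a (x - y) * b y * ee (- (x \<bullet> \<xi>)))" by simp
  qed measurable
  from lborel_pair.Fubini_integral[OF this]
  have "(LINT x|lborel. LINT y|lborel. a (x - y) * b y * ee (- (x \<bullet> \<xi>))) = (LINT y|lborel. LINT x|lborel. a (x - y) * b y * ee (- (x \<bullet> \<xi>)))" by simp
  moreover have "(LINT x|lborel. a (x - y) * b y * ee (- (x \<bullet> \<xi>))) = fourier a \<xi> * (b y * ee (- (y \<bullet> \<xi>)))" for y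
  proof -
    have "(LINT x|lborel. a (x - y) * b y * ee (- (x \<bullet> \<xi>))) = (LINT x|lborel. a x * b y * ee (- ((x + y) \<bullet> \<xi>)))"
      using lborel_integral_shift[of "\<lambda>x. a (x - y) * b y * ee (- (x \<bullet> \<xi>))" y] by simp
    also have "\<dots> = (LINT x|lborel. (a x * ee (- (x \<bullet> \<xi>))) * (b y * ee (- (y \<bullet> \<xi>))))"
      using ee_add[of "- (x \<bullet> \<xi>)" "- (y \<bullet> \<xi>)" for x] by (simp add: inner_add_left ac_simps)
    also have "\<dots> = fourier a \<xi> * (b y * ee (- (y \<bullet> \<xi>)))" unfolding fourier_alt by (rule integral_mult_left_zero)
    finally show ?thesis .
  qed
  moreover have "fourier (cnv a b) \<xi> = (LINT x|lborel. LINT y|lborel. a (x - y) * b y * ee (- (x \<bullet> \<xi>)))"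
    unfolding fourier_alt cnv_def by simp
  ultimately show ?thesis unfolding fourier_alt[of b] by simp
qed

lemma continuous_cnv:
  fixes a :: "real^'n::finite \<Rightarrow> complex"
  assumes a: "integrable lborel a" and b: "continuous_on UNIV b" "\<And>x. cmod (b x) \<le> B"
  shows "continuous_on UNIV (cnv a b)"
proof -
  have [measurable]: "a \<in> borel_measurable borel" using borel_measurable_integrable[OF a] by simp
  have [measurable]: "b \<in> borel_measurable borel" using b(1) by (rule borel_measurable_continuous_onI)
  have "isCont (\<lambda>x. LINT y|lborel. b (x - y) * a y) x" for x
    unfolding continuous_at_sequentially
  proof (intro allI impI)
    fix s assume s: "s \<longlonglongrightarrow> x"
    show "((\<lambda>x. LINT y|lborel. b (x - y) * a y) \<circ> s) \<longlonglongrightarrow> (LINT y|lborel. b (x - y) * a y)"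
      unfolding comp_def
    proof (rule integral_dominated_convergence[where w="\<lambda>y. B * cmod (a y)"])
      have "(\<lambda>i. b (s i - y)) \<longlonglongrightarrow> b (x - y)" for y
        using b(1) by (intro isCont_tendsto_compose[of "x - y" b] tendsto_diff s tendsto_const) (simp add: continuous_on_eq_continuous_at)
      then show "AE y in lborel. (\<lambda>i. b (s i - y) * a y) \<longlonglongrightarrow> b (x - y) * a y"
        by (intro AE_I2 tendsto_mult tendsto_const)
    qed (use a b(2) in \<open>auto simp: norm_mult intro!: mult_right_mono\<close>)
  qed
  moreover have "cnv a b = (\<lambda>x. LINT y|lborel. b (x - y) * a y)" by (rule ext) (subst cnv_commute, simp only: cnv_def)
  ultimately show ?thesis by (simp add: continuous_on_eq_continuous_at)
qed

lemma fourier_inject: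
  fixes f :: "real^'n::finite \<Rightarrow> complex"
  assumes f: "rapid f" "continuous_on UNIV f" and g: "rapid g" "continuous_on UNIV g"
    and eq: "\<And>\<xi>. fourier f \<xi> = fourier g \<xi>"
  shows "f = g"
proof
  fix x
  define h where "h x = f x - g x" for x
  have h: "rapid h" unfolding h_def using rapid_add[OF f(1) rapid_cmult[OF g(1), of "-1"]] by simp
  have hc: "continuous_on UNIV h" unfolding h_def by (intro continuous_intros f g)
  obtain B where B: "\<And>x. cmod (h x) \<le> B" using rapid_bound[OF h, of 0] by auto
  have "fourier h \<xi> = 0" for \<xi>
  proof -
    have "fourier h \<xi> = fourier f \<xi> - fourier g \<xi>"
      unfolding fourier_alt h_def left_diff_distrib
      by (intro Bochner_Integration.integral_diff integrable_mult_ee rapid_integrable f g) measurable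
    then show ?thesis by (simp add: eq)
  qed
  then have "fourier h = (\<lambda>_. 0)" by blast
  then have "h x = 0" using fourier_inversion[OF hc B rapid_integrable[OF h], of x] by simp
  then show "f x = g x" by (simp add: h_def)
qed

subsection \<open>Vanishing moments\<close>

text \<open>Multiplication by x \<bullet> v corresponds to a directional derivative of the
  transform. The transform vanishes on a ball, so its difference quotients vanish there, and
  dominated convergence passes to their limit under the integral.\<close>

lemma fourier_moment_linear:
  fixes g :: "real^'n::finite \<Rightarrow> complex"
  assumes g: "rapid g" and z: "\<And>\<xi>. norm \<xi> < \<delta> \<Longrightarrow> fourier g \<xi> = 0" and \<xi>: "norm \<xi> < \<delta>"
  shows "fourier (\<lambda>x. complex_of_real (x \<bullet> v) * g x) \<xi> = 0"
proof -
  let ?c = "\<lambda>x. \<i> * complex_of_real (2 * pi * (- (x \<bullet> v)))" and ?g = "\<lambda>x. g x * ee (- (x \<bullet> \<xi>))"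
  have [measurable]: "g \<in> borel_measurable borel" using g by auto
  have ig: "integrable lborel g" by (rule rapid_integrable[OF g])
  \<comment> \<open>The denominator starts at 2 so that the shifted frequency is strictly inside the
    ball already for k = 0.\<close>
  define t where "t k = (\<delta> - norm \<xi>) / (1 + norm v) / real (Suc (Suc k))" for k
  have t: "0 < t k" for k using \<xi> by (simp add: t_def)
  have t0: "t \<longlonglongrightarrow> 0" unfolding t_def
    using LIMSEQ_Suc[OF LIMSEQ_Suc[OF lim_const_over_n[of "(\<delta> - norm \<xi>) / (1 + norm v)"]]] by simp
  have tv: "norm (\<xi> + t k *\<^sub>R v) < \<delta>" for k
  proof -
    have "norm (\<xi> + t k *\<^sub>R v) \<le> norm \<xi> + t k * norm v" using norm_triangle_ineq[of \<xi> "t k *\<^sub>R v"] t[of k] by simp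
    also have "t k * norm v \<le> t k * (1 + norm v)" using t[of k] by simp
    also have "t k * (1 + norm v) = (\<delta> - norm \<xi>) / real (Suc (Suc k))" by (simp add: t_def)
    also have "\<dots> < (\<delta> - norm \<xi>) / 1" using \<xi> by (intro divide_strict_left_mono) auto
    finally show ?thesis by simp
  qed
  define d where "d k x = ?g x * ((ee (- (t k * (x \<bullet> v))) - 1) / complex_of_real (t k))" for k x
  have zero: "(LINT x|lborel. d k x) = 0" for k
  proof -
    have "d k x = (1 / complex_of_real (t k)) * (g x * ee (- (x \<bullet> (\<xi> + t k *\<^sub>R v))) - ?g x)" for x
      using ee_add[of "- (x \<bullet> \<xi>)" "- (t k * (x \<bullet> v))"] t[of k] by (simp add: d_def inner_add_right field_simps)
    then have "(LINT x|lborel. d k x) = (1 / complex_of_real (t k)) * (LINT x|lborel. g x * ee (- (x \<bullet> (\<xi> + t k *\<^sub>R v))) - ?g x)"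
      by simp
    also have "(LINT x|lborel. g x * ee (- (x \<bullet> (\<xi> + t k *\<^sub>R v))) - ?g x) = fourier g (\<xi> + t k *\<^sub>R v) - fourier g \<xi>"
      unfolding fourier_alt by (intro Bochner_Integration.integral_diff integrable_mult_ee ig) measurable
    also have "\<dots> = 0" using z[OF tv] z[OF \<xi>] by simp
    finally show ?thesis by simp
  qed
  have "(\<lambda>k. LINT x|lborel. d k x) \<longlonglongrightarrow> (LINT x|lborel. ?g x * ?c x)"
  proof (rule integral_dominated_convergence[where w="\<lambda>x. (2 * pi * norm v) * (cmod (g x) * (1 + norm x) ^ 1)"])
    show "AE x in lborel. (\<lambda>k. d k x) \<longlonglongrightarrow> ?g x * ?c x"
    proof (intro AE_I2)
      fix x :: "real^'n"
      define a where "a = \<i> * complex_of_real (2 * pi * (- (x \<bullet> v)))"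
      have "((\<lambda>s. exp (a * s)) has_field_derivative a) (at 0)" by (auto intro!: derivative_eq_intros)
      then have "((\<lambda>s. (exp (a * s) - 1) / s) \<longlongrightarrow> a) (at 0)" by (simp add: has_field_derivative_iff)
      moreover have "filterlim (\<lambda>k. complex_of_real (t k)) (at 0) sequentially"
        unfolding filterlim_at using tendsto_of_real[OF t0, where 'a=complex] t by (simp add: less_imp_neq[symmetric] eventually_sequentially)
      ultimately have "(\<lambda>k. (exp (a * complex_of_real (t k)) - 1) / complex_of_real (t k)) \<longlonglongrightarrow> a"
        by (rule filterlim_compose)
      moreover have "exp (a * complex_of_real (t k)) = ee (- (t k * (x \<bullet> v)))" for k by (simp add: a_def ee_def ac_simps)
      ultimately show "(\<lambda>k. d k x) \<longlonglongrightarrow> ?g x * ?c x" unfolding d_def a_def[symmetric] by (intro tendsto_intros) simp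
    qed
    show "integrable lborel (\<lambda>x. (2 * pi * norm v) * (cmod (g x) * (1 + norm x) ^ 1))"
      by (intro integrable_mult_right rapid_weight_integrable g)
    show "AE x in lborel. norm (d k x) \<le> (2 * pi * norm v) * (cmod (g x) * (1 + norm x) ^ 1)" for k
    proof (intro AE_I2)
      fix x :: "real^'n"
      have "cmod ((ee (- (t k * (x \<bullet> v))) - 1) / complex_of_real (t k)) \<le> (2 * pi * \<bar>- (t k * (x \<bullet> v))\<bar>) / t k"
        using norm_ee_diff_le[of "- (t k * (x \<bullet> v))"] t[of k] by (simp add: norm_divide divide_right_mono)
      also have "\<dots> = 2 * pi * \<bar>x \<bullet> v\<bar>" using t[of k] by (simp add: abs_mult)
      also have "\<dots> \<le> 2 * pi * (norm v * (1 + norm x))"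
      proof -
        have "\<bar>x \<bullet> v\<bar> \<le> norm x * norm v" by (rule Cauchy_Schwarz_ineq2)
        also have "\<dots> \<le> norm v * (1 + norm x)" by (simp add: algebra_simps)
        finally show ?thesis by simp
      qed
      finally have "cmod (g x) * cmod ((ee (- (t k * (x \<bullet> v))) - 1) / complex_of_real (t k)) \<le> cmod (g x) * (2 * pi * (norm v * (1 + norm x)))"
        by (intro mult_left_mono) auto
      then show "norm (d k x) \<le> (2 * pi * norm v) * (cmod (g x) * (1 + norm x) ^ 1)"
        by (simp only: d_def norm_mult norm_ee mult_1_right power_one_right ac_simps)
    qed
    show "d k \<in> borel_measurable lborel" for k unfolding d_def by measurable
  qed measurable
  then have "(LINT x|lborel. ?g x * ?c x) = 0" unfolding zero by (simp add: LIMSEQ_const_iff)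
  moreover have "?g x * ?c x =
     (complex_of_real (x \<bullet> v) * g x * ee (- (x \<bullet> \<xi>))) * (- 2 * complex_of_real pi * \<i>)" for x
    by simp
  ultimately have "(LINT x|lborel. (complex_of_real (x \<bullet> v) * g x * ee (- (x \<bullet> \<xi>))) * (- 2 * complex_of_real pi * \<i>)) = 0"
    by (simp only:)
  then have "(LINT x|lborel. complex_of_real (x \<bullet> v) * g x * ee (- (x \<bullet> \<xi>))) * (- 2 * complex_of_real pi * \<i>) = 0"
    by (simp only: integral_mult_left_zero)
  then show ?thesis unfolding fourier_alt by simp
qed

lemma bounded_linear_eq_inner:
  fixes f :: "real^'n::finite \<Rightarrow> real"
  assumes "bounded_linear f"
  shows "\<exists>v. \<forall>x. f x = x \<bullet> v"
proof (intro exI allI)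
  interpret bounded_linear f by fact
  fix x
  have "f x = f (\<Sum>b\<in>Basis. (x \<bullet> b) *\<^sub>R b)" by (simp add: euclidean_representation)
  then show "f x = x \<bullet> (\<Sum>b\<in>Basis. f b *\<^sub>R b)" by (simp add: sum scaleR inner_sum_right mult.commute)
qed

lemma rapid_mult_polynomial:
  fixes P :: "real^'n::finite \<Rightarrow> real"
  assumes P: "real_polynomial_function P" and g: "rapid g"
  shows "rapid (\<lambda>x. complex_of_real (P x) * g x)"
proof -
  obtain C M where C: "\<And>x. \<bar>P x\<bar> \<le> C * (1 + norm x) ^ M" using real_polynomial_function_growth[OF P] by blast
  have "continuous_on UNIV P" using P by (simp add: continuous_on_polymonial_function real_polynomial_function_eq)
  then have "P \<in> borel_measurable borel" by (rule borel_measurable_continuous_onI)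
  then show ?thesis using C by (intro rapid_mult_growth[OF g]) auto
qed

text \<open>The claim is made at every frequency of the ball and for every \<open>g\<close>: in the
  product case the induction hypothesis is used with the factor \<open>Q\<close> absorbed into
  \<open>g\<close>, whose transform then has to vanish on the whole ball.\<close>

lemma fourier_moment:
  fixes P :: "real^'n::finite \<Rightarrow> real"
  assumes P: "real_polynomial_function P"
    and g: "rapid g" "\<And>\<xi>. norm \<xi> < \<delta> \<Longrightarrow> fourier g \<xi> = 0" and \<xi>: "norm \<xi> < \<delta>"
  shows "fourier (\<lambda>x. complex_of_real (P x) * g x) \<xi> = 0"
  using P g \<xi>
proof (induction arbitrary: g \<xi>)
  case (linear f)
  obtain v where "\<And>x. f x = x \<bullet> v" using bounded_linear_eq_inner[OF linear(1)] by blast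
  then show ?case using fourier_moment_linear[OF linear(2,3,4)] by simp
next
  case (const c)
  then show ?case by (simp add: fourier_alt mult.assoc)
next
  case (add P Q)
  have "fourier (\<lambda>x. complex_of_real (P x + Q x) * g x) \<xi> = fourier (\<lambda>x. complex_of_real (P x) * g x) \<xi> + fourier (\<lambda>x. complex_of_real (Q x) * g x) \<xi>"
    unfolding fourier_alt of_real_add distrib_right
    by (intro Bochner_Integration.integral_add integrable_mult_ee rapid_integrable rapid_mult_polynomial add) measurable
  then show ?case using add by simp
next
  case (mult P Q)
  have "fourier (\<lambda>x. complex_of_real (P x) * (complex_of_real (Q x) * g x)) \<xi> = 0"
    by (rule mult.IH(1)) (use mult in \<open>auto intro!: rapid_mult_polynomial\<close>)
  then show ?case by (simp add: mult.assoc)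
qed

lemma integral_polynomial_eq_0:
  fixes P :: "real^'n::finite \<Rightarrow> complex"
  assumes P: "polynomial_function P" and g: "rapid g" "\<And>\<xi>. norm \<xi> < \<delta> \<Longrightarrow> fourier g \<xi> = 0" and \<delta>: "0 < \<delta>"
  shows "(LINT x|lborel. P x * g x) = 0"
proof -
  have re: "real_polynomial_function (\<lambda>x. Re (P x))" and im: "real_polynomial_function (\<lambda>x. Im (P x))"
    using P bounded_linear_Re bounded_linear_Im unfolding polynomial_function_def o_def by blast+
  have z: "(LINT x|lborel. complex_of_real (Q x) * g x) = 0" if "real_polynomial_function Q" for Q
    using fourier_moment[OF that g, where \<xi>=0] \<delta> by (simp add: fourier_alt)
  have "P x * g x = complex_of_real (Re (P x)) * g x + \<i> * (complex_of_real (Im (P x)) * g x)" for x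
    using complex_eq[of "P x"] by (metis distrib_right mult.assoc)
  then have "(LINT x|lborel. P x * g x) = (LINT x|lborel. complex_of_real (Re (P x)) * g x) + (LINT x|lborel. \<i> * (complex_of_real (Im (P x)) * g x))"
    by (simp only:) (intro Bochner_Integration.integral_add integrable_mult_right rapid_integrable rapid_mult_polynomial re im g)
  then show ?thesis using z[OF re] z[OF im] by simp
qed

subsection \<open>Littlewood-Paley pieces\<close>

lemma littlewood_paleyD:
  fixes \<psi> :: "real^'n::finite \<Rightarrow> complex"
  assumes "littlewood_paley \<psi>"
  shows "schwartz \<psi>" "fourier \<psi> \<xi> \<noteq> 0 \<Longrightarrow> 1/2 \<le> norm \<xi> \<and> norm \<xi> < 2"
    "cmod (fourier \<psi> \<xi>) \<le> 1"
    "\<xi> \<noteq> 0 \<Longrightarrow> ((\<lambda>j::int. fourier \<psi> (2 powi (- j) *\<^sub>R \<xi>)) has_sum 1) UNIV"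
proof -
  show "schwartz \<psi>" "\<xi> \<noteq> 0 \<Longrightarrow> ((\<lambda>j::int. fourier \<psi> (2 powi (- j) *\<^sub>R \<xi>)) has_sum 1) UNIV"
    using assms unfolding littlewood_paley_def by auto
  have r: "fourier \<psi> \<xi> \<in> \<real>" "0 \<le> Re (fourier \<psi> \<xi>)" "Re (fourier \<psi> \<xi>) \<le> 1"
    using assms unfolding littlewood_paley_def by auto
  then show "cmod (fourier \<psi> \<xi>) \<le> 1" by (elim Reals_cases) simp
  have "{\<xi>. fourier \<psi> \<xi> \<noteq> 0} \<subseteq> {\<xi>. 1 / 2 \<le> norm \<xi> \<and> norm \<xi> < 2}"
    using assms unfolding littlewood_paley_def by (elim conjE) (rule order_trans[OF closure_subset])
  then show "fourier \<psi> \<xi> \<noteq> 0 \<Longrightarrow> 1/2 \<le> norm \<xi> \<and> norm \<xi> < 2" by blast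
qed

lemma fourier_integrable_if_littlewood_paley:
  assumes "littlewood_paley (\<psi> :: real^'n::finite \<Rightarrow> complex)"
  shows "integrable lborel (fourier \<psi>)"
proof (rule Bochner_Integration.integrable_bound)
  show "integrable lborel (indicat_real (cball (0::real^'n) 2))" by (rule integrable_real_indicator) (auto simp: emeasure_cball)
  show "fourier \<psi> \<in> borel_measurable lborel"
    using fourier_measurable[OF rapid_measurable[OF schwartz_rapid[OF littlewood_paleyD(1)[OF assms]]]] by simp
  show "AE \<xi> in lborel. norm (fourier \<psi> \<xi>) \<le> norm (indicat_real (cball (0::real^'n) 2) \<xi>)"
  proof (intro AE_I2)
    fix \<xi> :: "real^'n"
    show "norm (fourier \<psi> \<xi>) \<le> norm (indicat_real (cball (0::real^'n) 2) \<xi>)"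
      using littlewood_paleyD(2,3)[OF assms, of \<xi>] by (cases "fourier \<psi> \<xi> = 0") auto
  qed
qed

lemma dyadic_eq: "dyadic \<psi> j (y::real^'n::finite) = complex_of_real ((2 powi j) ^ CARD('n)) * \<psi> (2 powi j *\<^sub>R y)"
proof -
  have "(2::complex) powi (j * int CARD('n)) = (2 powi j) ^ CARD('n)" by (simp only: power_int_mult power_int_of_nat)
  also have "\<dots> = complex_of_real ((2 powi j) ^ CARD('n))" by simp
  finally show ?thesis unfolding dyadic_def by (simp only:)
qed

lemma schwartz_dyadic:
  fixes \<psi> :: "real^'n::finite \<Rightarrow> complex"
  assumes "schwartz \<psi>" shows "schwartz (dyadic \<psi> j)"
proof -
  have "dyadic \<psi> j = (\<lambda>y. 2 powi (j * int CARD('n)) * \<psi> ((2 powi j) *\<^sub>R y + 0))"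
    by (rule ext) (simp only: dyadic_def add_0_right)
  then show ?thesis using schwartz_affine[OF assms, of "2 powi j" "2 powi (j * int CARD('n))" 0] by simp
qed

lemma schwartz_dyadic_reflect: "schwartz \<psi> \<Longrightarrow> schwartz (\<lambda>y. dyadic \<psi> j (x - y))"
proof -
  assume "schwartz \<psi>"
  from schwartz_affine[OF schwartz_dyadic[OF this], of "-1" 1 j x] show ?thesis by simp
qed

lemma rapid_dyadic:
  assumes "rapid \<psi>" shows "rapid (dyadic \<psi> j)"
  unfolding dyadic_def[abs_def] by (rule rapid_cmult, rule rapid_scale[OF assms]) simp

lemma fourier_dyadic:
  fixes \<psi> :: "real^'n::finite \<Rightarrow> complex"
  shows "fourier (dyadic \<psi> j) \<xi> = fourier \<psi> (2 powi (- j) *\<^sub>R \<xi>)"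
proof -
  let ?a = "2 powi j :: real"
  have a: "0 < ?a" by simp
  have a': "2 powi (- j) = 1 / ?a" by (simp add: power_int_minus divide_inverse)
  have "fourier \<psi> (2 powi (- j) *\<^sub>R \<xi>) = (\<bar>?a\<bar> ^ CARD('n)) *\<^sub>R (LINT x|lborel. \<psi> (?a *\<^sub>R x) * ee (- ((?a *\<^sub>R x) \<bullet> (2 powi (- j) *\<^sub>R \<xi>))))"
    unfolding fourier_alt using integral_lborel_affine[of ?a "\<lambda>x. \<psi> x * ee (- (x \<bullet> (2 powi (- j) *\<^sub>R \<xi>)))" 0] a by simp
  also have "(\<lambda>x. \<psi> (?a *\<^sub>R x) * ee (- ((?a *\<^sub>R x) \<bullet> (2 powi (- j) *\<^sub>R \<xi>)))) = (\<lambda>x. \<psi> (?a *\<^sub>R x) * ee (- (x \<bullet> \<xi>)))"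
    unfolding a' using a by simp
  also have "(\<bar>?a\<bar> ^ CARD('n)) *\<^sub>R (LINT x|lborel. \<psi> (?a *\<^sub>R x) * ee (- (x \<bullet> \<xi>))) = fourier (dyadic \<psi> j) \<xi>"
    unfolding fourier_alt dyadic_eq scaleR_conv_of_real mult.assoc integral_mult_right_zero by simp
  finally show ?thesis by simp
qed

lemma fourier_dyadic_reflect:
  fixes \<psi> :: "real^'n::finite \<Rightarrow> complex"
  shows "fourier (\<lambda>y. g (x - y)) \<xi> = ee (- (x \<bullet> \<xi>)) * fourier g (- \<xi>)"
proof -
  have "fourier (\<lambda>y. g (x - y)) \<xi> = (LINT y|lborel. g y * ee (- ((x - y) \<bullet> \<xi>)))"
    unfolding fourier_alt using lborel_integral_reflect[of "\<lambda>y. g (x - y) * ee (- (y \<bullet> \<xi>))" x] by simp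
  also have "\<dots> = (LINT y|lborel. ee (- (x \<bullet> \<xi>)) * (g y * ee (- (y \<bullet> (- \<xi>)))))"
    using ee_add[of "- (x \<bullet> \<xi>)" "y \<bullet> \<xi>" for y] by (simp add: inner_diff_left ac_simps)
  finally show ?thesis unfolding fourier_alt by simp
qed

text \<open>The transform of the dyadic kernel vanishes for |\<xi>| < 2^j/2, so the kernel is
  orthogonal to polynomials and the polynomial in \<open>function_rep\<close> leaves no trace in the
  pieces.\<close>

lemma lp_piece_eq_cnv:
  fixes \<psi> :: "real^'n::finite \<Rightarrow> complex"
  assumes \<psi>: "littlewood_paley \<psi>" and F: "function_rep u F"
  shows "lp_piece \<psi> u j x = cnv (dyadic \<psi> j) F x"
proof -
  let ?g = "\<lambda>y. dyadic \<psi> j (x - y)"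
  have s: "schwartz ?g" by (rule schwartz_dyadic_reflect[OF littlewood_paleyD(1)[OF \<psi>]])
  obtain P where P: "polynomial_function P" "u ?g = (LINT x|lborel. F x * ?g x) + (LINT x|lborel. P x * ?g x)"
    using F s unfolding function_rep_def by blast
  have "(LINT x|lborel. P x * ?g x) = 0"
  proof (rule integral_polynomial_eq_0[OF P(1) schwartz_rapid[OF s], of "2 powi j / 2"])
    fix \<xi> :: "real^'n" assume "norm \<xi> < 2 powi j / 2"
    then have "norm (2 powi (- j) *\<^sub>R (- \<xi>)) < 1/2" by (simp add: power_int_minus field_simps)
    then have "fourier \<psi> (2 powi (- j) *\<^sub>R (- \<xi>)) = 0" using littlewood_paleyD(2)[OF \<psi>] by force
    then show "fourier ?g \<xi> = 0" unfolding fourier_dyadic_reflect fourier_dyadic by simp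
  qed simp
  then show ?thesis using P(2) unfolding lp_piece_def cnv_def by (simp add: mult.commute)
qed

lemma norm_dyadic_support:
  assumes \<psi>: "littlewood_paley \<psi>" and nz: "fourier (dyadic \<psi> j) \<xi> \<noteq> 0"
  shows "2 powr (real_of_int j - 1) \<le> norm \<xi>" "norm \<xi> < 2 powr (real_of_int j + 1)"
proof -
  have "1/2 \<le> norm (2 powi (- j) *\<^sub>R \<xi>)" "norm (2 powi (- j) *\<^sub>R \<xi>) < 2"
    using littlewood_paleyD(2)[OF \<psi> nz[unfolded fourier_dyadic]] by auto
  then have "2 powi j / 2 \<le> norm \<xi>" "norm \<xi> < 2 powi j * 2" by (simp_all add: power_int_minus field_simps)
  then show "2 powr (real_of_int j - 1) \<le> norm \<xi>" "norm \<xi> < 2 powr (real_of_int j + 1)"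
    by (simp_all add: powr_diff powr_add powr_real_of_int')
qed

text \<open>The transforms live in annuli 2^(j-1) \<le> |\<xi>| < 2^(j+1); two of them are disjoint
  as soon as the indices differ by 2.\<close>

lemma cnv_dyadic_eq_0:
  fixes \<psi> :: "real^'n::finite \<Rightarrow> complex"
  assumes \<psi>: "littlewood_paley \<psi>" and ij: "2 \<le> \<bar>i - j\<bar>"
  shows "cnv (dyadic \<psi> i) (dyadic \<psi> j) = (\<lambda>_. 0)"
proof (rule fourier_inject)
  have s: "schwartz (dyadic \<psi> k)" for k by (rule schwartz_dyadic[OF littlewood_paleyD(1)[OF \<psi>]])
  then have r: "rapid (dyadic \<psi> k)" for k by (rule schwartz_rapid)
  obtain B where B: "\<And>x. cmod (dyadic \<psi> j x) \<le> B" using rapid_bound[OF r[of j], of 0] by auto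
  show "rapid (cnv (dyadic \<psi> i) (dyadic \<psi> j))" by (intro rapid_cnv r)
  show "continuous_on UNIV (cnv (dyadic \<psi> i) (dyadic \<psi> j))" by (rule continuous_cnv[OF rapid_integrable[OF r] schwartz_continuous[OF s] B])
  show "rapid (\<lambda>_::real^'n. 0)" using rapid_cmult[OF r[of j], of 0] by simp
  fix \<xi>
  have "fourier (dyadic \<psi> i) \<xi> = 0 \<or> fourier (dyadic \<psi> j) \<xi> = 0"
  proof (rule ccontr)
    assume "\<not> ?thesis"
    then have "fourier (dyadic \<psi> i) \<xi> \<noteq> 0" "fourier (dyadic \<psi> j) \<xi> \<noteq> 0" by auto
    from norm_dyadic_support[OF \<psi> this(1)] norm_dyadic_support[OF \<psi> this(2)]
    have "2 powr (real_of_int i - 1) < 2 powr (real_of_int j + 1)" "2 powr (real_of_int j - 1) < 2 powr (real_of_int i + 1)" by linarith+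
    then have "real_of_int i - 1 < real_of_int j + 1" "real_of_int j - 1 < real_of_int i + 1" by (simp_all only: powr_less_cancel_iff one_less_numeral_iff semiring_norm)
    with ij show False by linarith
  qed
  then show "fourier (cnv (dyadic \<psi> i) (dyadic \<psi> j)) \<xi> = fourier (\<lambda>_. 0) \<xi>"
    by (subst fourier_cnv[OF r r]) (auto simp: fourier_alt)
qed simp

lemma cnv_sum:
  assumes "\<And>i. i \<in> I \<Longrightarrow> rapid (a i)" "tame F"
  shows "cnv (\<lambda>x. \<Sum>i\<in>I. a i x) F x = (\<Sum>i\<in>I. cnv (a i) F x)"
  unfolding cnv_def sum_distrib_right
  by (intro Bochner_Integration.integral_sum integrable_rapid_tame_reflect assms)

text \<open>Three neighbouring transforms add up to 1 wherever the middle one does not vanish, so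
  this kernel reproduces the j-th piece under convolution.\<close>

definition fat_dyadic :: "(real^'n::finite \<Rightarrow> complex) \<Rightarrow> int \<Rightarrow> real^'n \<Rightarrow> complex" where
  "fat_dyadic \<psi> j x = (\<Sum>i\<in>{j - 1..j + 1}. dyadic \<psi> i x)"

lemma rapid_fat_dyadic: "rapid \<psi> \<Longrightarrow> rapid (fat_dyadic \<psi> j)"
  unfolding fat_dyadic_def[abs_def] by (rule rapid_sum, rule rapid_dyadic)

lemma cnv_fat_dyadic:
  fixes \<psi> :: "real^'n::finite \<Rightarrow> complex"
  assumes \<psi>: "littlewood_paley \<psi>"
  shows "cnv (fat_dyadic \<psi> j) (dyadic \<psi> j) = dyadic \<psi> j"
proof (rule fourier_inject)
  have s: "schwartz (dyadic \<psi> k)" for k by (rule schwartz_dyadic[OF littlewood_paleyD(1)[OF \<psi>]])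
  then have r: "rapid (dyadic \<psi> k)" for k by (rule schwartz_rapid)
  have rf: "rapid (fat_dyadic \<psi> j)" unfolding fat_dyadic_def[abs_def] by (rule rapid_sum, rule r)
  obtain B where B: "\<And>x. cmod (dyadic \<psi> j x) \<le> B" using rapid_bound[OF r[of j], of 0] by auto
  show "rapid (cnv (fat_dyadic \<psi> j) (dyadic \<psi> j))" by (intro rapid_cnv r rf)
  show "continuous_on UNIV (cnv (fat_dyadic \<psi> j) (dyadic \<psi> j))"
    by (rule continuous_cnv[OF rapid_integrable[OF rf] schwartz_continuous[OF s] B])
  show "rapid (dyadic \<psi> j)" "continuous_on UNIV (dyadic \<psi> j)" by (intro r schwartz_continuous s)+
  fix \<xi>
  have "fourier (fat_dyadic \<psi> j) \<xi> = (\<Sum>i\<in>{j - 1..j + 1}. fourier (dyadic \<psi> i) \<xi>)"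
    unfolding fourier_alt fat_dyadic_def sum_distrib_right
    by (intro Bochner_Integration.integral_sum integrable_mult_ee rapid_integrable r) measurable
  moreover have "(\<Sum>i\<in>{j - 1..j + 1}. fourier (dyadic \<psi> i) \<xi>) = 1" if nz: "fourier (dyadic \<psi> j) \<xi> \<noteq> 0"
  proof -
    have "\<xi> \<noteq> 0" using norm_dyadic_support(1)[OF \<psi> nz] by force
    from littlewood_paleyD(4)[OF \<psi> this] have hs: "((\<lambda>i. fourier (dyadic \<psi> i) \<xi>) has_sum 1) UNIV" by (simp add: fourier_dyadic)
    have "fourier (dyadic \<psi> i) \<xi> = 0" if "i \<notin> {j - 1..j + 1}" for i
    proof (rule ccontr)
      assume i: "fourier (dyadic \<psi> i) \<xi> \<noteq> 0"
      from norm_dyadic_support[OF \<psi> nz] norm_dyadic_support[OF \<psi> i]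
      have "2 powr (real_of_int i - 1) < 2 powr (real_of_int j + 1)" "2 powr (real_of_int j - 1) < 2 powr (real_of_int i + 1)" by linarith+
      then have "real_of_int i - 1 < real_of_int j + 1" "real_of_int j - 1 < real_of_int i + 1" by (simp_all only: powr_less_cancel_iff one_less_numeral_iff semiring_norm)
      with that show False by auto
    qed
    then have "((\<lambda>i. fourier (dyadic \<psi> i) \<xi>) has_sum 1) {j - 1..j + 1}" by (intro has_sum_cong_neutral[THEN iffD1, OF _ _ _ hs]) auto
    then show ?thesis by (simp add: has_sum_finite_iff)
  qed
  ultimately show "fourier (cnv (fat_dyadic \<psi> j) (dyadic \<psi> j)) \<xi> = fourier (dyadic \<psi> j) \<xi>"
    unfolding fourier_cnv[OF rf r] by (cases "fourier (dyadic \<psi> j) \<xi> = 0") simp_all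
qed

abbreviation piece :: "(real^'n::finite \<Rightarrow> complex) \<Rightarrow> (real^'n \<Rightarrow> complex) \<Rightarrow> int \<Rightarrow> real^'n \<Rightarrow> complex" where
  "piece \<psi> F j \<equiv> cnv (dyadic \<psi> j) F"

lemma piece_piece_eq_0:
  assumes \<psi>: "littlewood_paley \<psi>" and F: "tame F" and ij: "2 \<le> \<bar>i - j\<bar>"
  shows "piece \<psi> (piece \<psi> F j) i x = 0"
proof -
  have r: "rapid (dyadic \<psi> k)" for k by (rule schwartz_rapid[OF schwartz_dyadic[OF littlewood_paleyD(1)[OF \<psi>]]])
  show ?thesis unfolding cnv_assoc[OF r r F] cnv_dyadic_eq_0[OF \<psi> ij] by (simp add: cnv_def)
qed

lemma fat_piece:
  assumes \<psi>: "littlewood_paley \<psi>" and F: "tame F"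
  shows "cnv (fat_dyadic \<psi> j) (piece \<psi> F j) x = piece \<psi> F j x"
proof -
  have r: "rapid (dyadic \<psi> k)" for k by (rule schwartz_rapid[OF schwartz_dyadic[OF littlewood_paleyD(1)[OF \<psi>]]])
  have rf: "rapid (fat_dyadic \<psi> j)" unfolding fat_dyadic_def[abs_def] by (rule rapid_sum, rule r)
  show ?thesis unfolding cnv_assoc[OF rf r F] cnv_fat_dyadic[OF \<psi>] ..
qed

text \<open>Convolution kernels commute, so the three terms assemble into the reproducing kernel.
  This evaluates the sum over all scales that arises for class differences, where only these three
  scales survive.\<close>

lemma sum_piece_piece:
  assumes \<psi>: "littlewood_paley \<psi>" and F: "tame F"
  shows "(\<Sum>i\<in>{j - 1..j + 1}. piece \<psi> (piece \<psi> F i) j x) = piece \<psi> F j x"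
proof -
  have r: "rapid (dyadic \<psi> k)" for k by (rule schwartz_rapid[OF schwartz_dyadic[OF littlewood_paleyD(1)[OF \<psi>]]])
  have "piece \<psi> (piece \<psi> F i) j x = piece \<psi> (piece \<psi> F j) i x" for i
    unfolding cnv_assoc[OF r r F] using cnv_commute[of "dyadic \<psi> i" "dyadic \<psi> j"] by presburger
  then have "(\<Sum>i\<in>{j - 1..j + 1}. piece \<psi> (piece \<psi> F i) j x) = (\<Sum>i\<in>{j - 1..j + 1}. piece \<psi> (piece \<psi> F j) i x)" by simp
  also have "\<dots> = cnv (fat_dyadic \<psi> j) (piece \<psi> F j) x" unfolding fat_dyadic_def by (rule cnv_sum[symmetric]) (intro r tame_cnv F)+
  finally show ?thesis using fat_piece[OF \<psi> F] by simp
qed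

lemma dyadic_add: "dyadic \<psi> (j + k) (x :: real^'n::finite) = complex_of_real ((2 powi k) ^ CARD('n)) * dyadic \<psi> j (2 powi k *\<^sub>R x)"
proof -
  have "2 powi (j + k) = 2 powi j * (2 powi k :: real)" by (rule power_int_add) simp
  then show ?thesis unfolding dyadic_eq by (simp add: power_mult_distrib)
qed

text \<open>Moves a statement about scale 2^-k to scale 1, where a single kernel serves all
  \<open>k\<close> and the constants cannot depend on it.\<close>

lemma cnv_dyadic_dilate:
  fixes F :: "real^'n::finite \<Rightarrow> complex"
  shows "cnv (dyadic a j) (\<lambda>y. F (2 powi (- k) *\<^sub>R y)) x = cnv (dyadic a (j + k)) F (2 powi (- k) *\<^sub>R x)"
proof -
  let ?a = "2 powi k :: real"
  have a: "0 < ?a" by simp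
  have a': "2 powi (- k) = 1 / ?a" by (simp add: power_int_minus divide_inverse)
  have "cnv (dyadic a j) (\<lambda>y. F (2 powi (- k) *\<^sub>R y)) x
     = (\<bar>2 powi k\<bar> ^ CARD('n)) *\<^sub>R (LINT v|lborel. dyadic a j (x - 2 powi k *\<^sub>R v) * F (2 powi (- k) *\<^sub>R 2 powi k *\<^sub>R v))"
    unfolding cnv_def using integral_lborel_affine[of "2 powi k" "\<lambda>y. dyadic a j (x - y) * F (2 powi (- k) *\<^sub>R y)" 0] by simp
  also have "\<dots> = (LINT v|lborel. dyadic a (j + k) (2 powi (- k) *\<^sub>R x - v) * F v)"
    unfolding dyadic_add a' scaleR_diff_right scaleR_conv_of_real mult.assoc integral_mult_right_zero
    using a by (simp add: scaleR_diff_right flip: scaleR_conv_of_real)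
  finally show ?thesis unfolding cnv_def .
qed

subsection \<open>The multiplier of a mean of differences\<close>

lemma iter_diff_ee: "iter_diff L (\<lambda>x. c * ee (x \<bullet> \<xi>)) z x = c * ee (x \<bullet> \<xi>) * (ee (z \<bullet> \<xi>) - 1) ^ L"
proof (induction L arbitrary: x)
  case (Suc L)
  show ?case unfolding iter_diff_Suc Suc inner_add_left ee_add by (simp add: algebra_simps)
qed simp

text \<open>The sign of Re((e(t) - 1)^L) for small nonzero t. Since e(t) - 1 = 2i sin(pi t) exp(i pi
  t), the power has argument L pi/2 + L pi t for t > 0, whose cosine has sign (-1)^m for L = 2m and
  (-1)^(m+1) for L = 2m + 1.\<close>

definition diff_sign :: "nat \<Rightarrow> real" where
  "diff_sign L = (-1) ^ ((L + 1) div 2)"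

lemma diff_sign_square [simp]: "diff_sign L * diff_sign L = 1"
  by (simp add: diff_sign_def power_add[symmetric] mult_2[symmetric])

lemma abs_diff_sign [simp]: "\<bar>diff_sign L\<bar> = 1"
  by (simp add: diff_sign_def power_abs)

lemma diff_multiplier_pos:
  assumes L: "1 \<le> L" and t: "t \<noteq> 0" "2 * real L * \<bar>t\<bar> < 1"
  shows "0 < diff_sign L * Re ((ee t - 1) ^ L)"
proof -
  have pos: "0 < diff_sign L * Re ((ee t - 1) ^ L)" if t: "0 < t" "2 * real L * t < 1" for t
  proof -
    \<comment> \<open>The hypothesis on \<open>t\<close> says that this angle stays below pi/2, so
      its sine and cosine are positive.\<close>
    define \<alpha> where "\<alpha> = real L * pi * t"
    have \<alpha>: "0 < \<alpha>" "\<alpha> < pi / 2" using t L by (simp_all add: \<alpha>_def field_simps)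
    have "1 * t \<le> real L * t" using L t by (intro mult_right_mono) auto
    then have "t < 1/2" using t(2) unfolding mult.assoc by linarith
    then have "pi * t < pi * 1" using t by (intro mult_strict_left_mono) auto
    then have sin: "0 < sin (pi * t)" using t by (intro sin_gt_zero) auto
    have e: "ee t - 1 = cis (pi * t + pi / 2) * complex_of_real (2 * sin (pi * t))"
    proof -
      have "ee t = cis (pi * t) * cis (pi * t)"
        unfolding cis_mult mult_2[symmetric] mult.assoc[symmetric] by (simp only: ee_def cis_conv_exp mult.assoc)
      moreover have "(1::complex) = cis (pi * t) * cis (- (pi * t))" by (simp add: cis_mult)
      ultimately have "ee t - 1 = cis (pi * t) * (cis (pi * t) - cis (- (pi * t)))" by (simp add: right_diff_distrib)
      also have "cis (pi * t) - cis (- (pi * t)) = \<i> * complex_of_real (2 * sin (pi * t))" by (simp add: complex_eq_iff)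
      finally show ?thesis by (simp add: cis_mult[symmetric] cis_pi_half)
    qed
    have "(ee t - 1) ^ L = cis (\<alpha> + real L * (pi / 2)) * complex_of_real ((2 * sin (pi * t)) ^ L)"
      unfolding e power_mult_distrib Complex.DeMoivre by (simp add: \<alpha>_def algebra_simps)
    then have re: "Re ((ee t - 1) ^ L) = cos (\<alpha> + real L * (pi / 2)) * (2 * sin (pi * t)) ^ L" by simp
    have "0 < diff_sign L * cos (\<alpha> + real L * (pi / 2))"
    proof (cases "even L")
      case True
      then obtain m where m: "L = 2 * m" by (elim evenE)
      have "cos (\<alpha> + real L * (pi / 2)) = cos (\<alpha> + real m * pi)" by (simp add: m)
      also have "\<dots> = (-1) ^ m * cos \<alpha>" by (simp add: cos_add sin_npi cos_npi)
      finally show ?thesis using cos_gt_zero[OF \<alpha>] by (simp add: diff_sign_def m power_add[symmetric] mult_2[symmetric] flip: mult.assoc)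
    next
      case False
      then obtain m where m: "L = 2 * m + 1" by (elim oddE)
      have "cos (\<alpha> + real L * (pi / 2)) = cos (\<alpha> + pi / 2 + real m * pi)" by (simp add: m algebra_simps)
      also have "\<dots> = (-1) ^ m * - sin \<alpha>" by (simp add: cos_add[of "\<alpha> + pi / 2"] sin_npi cos_npi cos_add)
      also have "\<dots> = (-1) ^ Suc m * sin \<alpha>" by simp
      finally show ?thesis using sin_gt_zero[of \<alpha>] \<alpha> by (simp add: diff_sign_def m power_add[symmetric] mult_2[symmetric] flip: mult.assoc)
    qed
    then show ?thesis unfolding re using sin by (simp add: mult.assoc[symmetric])
  qed
  show ?thesis
  proof (cases "0 < t")
    case True with t show ?thesis by (intro pos) auto
  next
    case False
    have cnj: "Re (cnj w) = Re w" for w by simp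
    have "ee (- t) - 1 = cnj (ee t - 1)" by (simp add: ee_minus)
    then have "Re ((ee (- t) - 1) ^ L) = Re ((ee t - 1) ^ L)" by (simp only: complex_cnj_power[symmetric] cnj)
    with pos[of "- t"] t False show ?thesis by simp
  qed
qed

lemma (in finite_measure) norm_integral_le_const:
  fixes f :: "'a \<Rightarrow> 'b::{banach, second_countable_topology}"
  assumes "AE x in M. norm (f x) \<le> c" "0 \<le> c"
  shows "norm (LINT x|M. f x) \<le> c * measure M (space M)"
proof (cases "integrable M f")
  case True
  have "norm (LINT x|M. f x) \<le> (LINT x|M. norm (f x))" by (rule integral_norm_bound)
  also have "\<dots> \<le> (LINT x|M. c)" using assms True by (intro integral_mono_AE) auto
  finally show ?thesis by (simp add: mult.commute)
qed (use assms in \<open>simp add: not_integrable_integral_eq\<close>)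

text \<open>Symmetry makes the multiplier real. The radius bound gives 2L|z \<bullet> \<xi>| < 1 for
  |\<xi>| \<le> 2, so the integrand of \<open>mult\<close> has no sign change there, and
  nondegeneracy makes the integral nonzero. The bound also gives L\<rho> \<le> 1, which limits the
  spread of the approximants.\<close>

locale difference_mean =
  fixes \<mu> :: "(real^'n::finite) measure" and L :: nat and \<rho> :: real and \<psi> :: "real^'n \<Rightarrow> complex"
  assumes finite: "finite_measure \<mu>" and sets_\<mu> [simp, measurable_cong]: "sets \<mu> = sets borel"
    and supp: "AE z in \<mu>. norm z \<le> \<rho>" and L: "1 \<le> L" and \<rho>: "0 \<le> \<rho>" "4 * real L * \<rho> < 1"
    and sym: "distr \<mu> borel uminus = \<mu>"
    and nondeg: "\<And>\<xi>. \<xi> \<noteq> 0 \<Longrightarrow> \<not> (AE z in \<mu>. z \<bullet> \<xi> = 0)"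
    and \<psi>: "littlewood_paley \<psi>"
begin

interpretation finite_measure \<mu> by (rule finite)

lemma space_\<mu> [simp]: "space \<mu> = UNIV"
  using sets_eq_imp_space_eq[OF sets_\<mu>] by simp

definition total :: real where "total = 2 ^ L * measure \<mu> UNIV"

text \<open>Up to sign, averaging L-th differences over \<mu> acts on an exponential of frequency
  \<xi> as multiplication by this number; the sign makes it positive on the frequencies of
  interest.\<close>

definition mult :: "real^'n \<Rightarrow> real" where
  "mult \<xi> = diff_sign L * (LINT z|\<mu>. Re ((ee (z \<bullet> \<xi>) - 1) ^ L))"

lemma norm_ee_power_le: "cmod ((ee t - 1) ^ L) \<le> 2 ^ L"
  unfolding norm_power using norm_triangle_ineq4[of "ee t" 1] by (intro power_mono) auto

lemma ee_power_integrable: "integrable \<mu> (\<lambda>z. (ee (z \<bullet> \<xi>) - 1) ^ L)"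
  by (rule integrable_const_bound[of _ "2 ^ L"]) (auto intro: norm_ee_power_le)

lemma integral_ee_power: "(LINT z|\<mu>. (ee (z \<bullet> \<xi>) - 1) ^ L) = complex_of_real (diff_sign L * mult \<xi>)"
proof -
  let ?I = "LINT z|\<mu>. (ee (z \<bullet> \<xi>) - 1) ^ L"
  have "?I = (LINT z|distr \<mu> borel uminus. (ee (z \<bullet> \<xi>) - 1) ^ L)" by (simp add: sym)
  also have "\<dots> = (LINT z|\<mu>. (ee ((- z) \<bullet> \<xi>) - 1) ^ L)" by (rule integral_distr) measurable
  also have "\<dots> = (LINT z|\<mu>. cnj ((ee (z \<bullet> \<xi>) - 1) ^ L))" by (simp add: ee_minus)
  also have "\<dots> = cnj ?I" by (rule Bochner_Integration.integral_cnj)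
  finally have "Im ?I = 0" by (metis Im_complex_of_real Reals_cnj_iff complex_is_Real_iff)
  then have "?I = complex_of_real (Re ?I)" by (simp add: complex_eq_iff)
  also have "Re ?I = (LINT z|\<mu>. Re ((ee (z \<bullet> \<xi>) - 1) ^ L))" by (rule integral_Re[symmetric, OF ee_power_integrable])
  also have "\<dots> = diff_sign L * mult \<xi>" by (simp add: mult_def mult.assoc[symmetric])
  finally show ?thesis .
qed

lemma mult_le_total: "\<bar>mult \<xi>\<bar> \<le> total"
proof -
  have "\<bar>mult \<xi>\<bar> = cmod (LINT z|\<mu>. (ee (z \<bullet> \<xi>) - 1) ^ L)" unfolding integral_ee_power norm_of_real abs_mult by simp
  also have "\<dots> \<le> (LINT z|\<mu>. cmod ((ee (z \<bullet> \<xi>) - 1) ^ L))" by (rule integral_norm_bound)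
  also have "\<dots> \<le> (LINT z|\<mu>. 2 ^ L)" by (intro integral_mono integrable_norm ee_power_integrable norm_ee_power_le) simp
  finally show ?thesis by (simp add: total_def mult.commute)
qed

lemma mult_pos: "\<xi> \<noteq> 0 \<Longrightarrow> norm \<xi> \<le> 2 \<Longrightarrow> 0 < mult \<xi>"
proof -
  assume \<xi>: "\<xi> \<noteq> 0" "norm \<xi> \<le> 2"
  let ?f = "\<lambda>z. diff_sign L * Re ((ee (z \<bullet> \<xi>) - 1) ^ L)"
  have small: "2 * real L * \<bar>z \<bullet> \<xi>\<bar> < 1" if "norm z \<le> \<rho>" for z
  proof -
    have "\<bar>z \<bullet> \<xi>\<bar> \<le> norm z * norm \<xi>" by (rule Cauchy_Schwarz_ineq2)
    also have "\<dots> \<le> \<rho> * 2" using that \<xi> \<rho> by (intro mult_mono) auto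
    finally have "2 * real L * \<bar>z \<bullet> \<xi>\<bar> \<le> 2 * real L * (\<rho> * 2)" by (rule mult_left_mono) simp
    also have "2 * real L * (\<rho> * 2) = 4 * real L * \<rho>" by simp
    finally show ?thesis using \<rho>(2) by linarith
  qed
  have int: "integrable \<mu> ?f" by (intro integrable_mult_right integrable_Re ee_power_integrable)
  have nn: "AE z in \<mu>. 0 \<le> ?f z"
    using supp
  proof (rule eventually_mono)
    fix z :: "real^'n" assume "norm z \<le> \<rho>"
    from diff_multiplier_pos[OF L _ small[OF this]] show "0 \<le> ?f z" using L by (cases "z \<bullet> \<xi> = 0") (auto simp: power_0_left)
  qed
  have eq: "mult \<xi> = integral\<^sup>L \<mu> ?f" by (simp add: mult_def)
  moreover have "integral\<^sup>L \<mu> ?f \<noteq> 0"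
  proof
    assume "integral\<^sup>L \<mu> ?f = 0"
    then have "AE z in \<mu>. ?f z = 0" using integral_nonneg_eq_0_iff_AE[OF int nn] by simp
    from eventually_conj[OF this supp] have "AE z in \<mu>. z \<bullet> \<xi> = 0"
    proof (rule eventually_mono)
      fix z :: "real^'n" assume z: "?f z = 0 \<and> norm z \<le> \<rho>"
      then show "z \<bullet> \<xi> = 0" using diff_multiplier_pos[OF L _ small, of z] by force
    qed
    with nondeg[OF \<xi>(1)] show False by blast
  qed
  moreover have "0 \<le> integral\<^sup>L \<mu> ?f" by (rule integral_nonneg_AE[OF nn])
  ultimately show ?thesis by linarith
qed

lemma continuous_mult: "continuous_on UNIV mult"
proof -
  have "isCont mult \<xi>" for \<xi>
    unfolding continuous_at_sequentially
  proof (intro allI impI)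
    fix s assume s: "s \<longlonglongrightarrow> \<xi>"
    have "(\<lambda>i. LINT z|\<mu>. Re ((ee (z \<bullet> s i) - 1) ^ L)) \<longlonglongrightarrow> (LINT z|\<mu>. Re ((ee (z \<bullet> \<xi>) - 1) ^ L))"
    proof (rule integral_dominated_convergence[where w="\<lambda>_. 2 ^ L"])
      have "(\<lambda>i. ee (z \<bullet> s i)) \<longlonglongrightarrow> ee (z \<bullet> \<xi>)" for z
        by (rule isCont_tendsto_compose[OF ee_isCont]) (intro tendsto_intros s)
      then show "AE z in \<mu>. (\<lambda>i. Re ((ee (z \<bullet> s i) - 1) ^ L)) \<longlonglongrightarrow> Re ((ee (z \<bullet> \<xi>) - 1) ^ L)"
        by (intro AE_I2 tendsto_Re tendsto_power tendsto_diff tendsto_const)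
      show "AE z in \<mu>. norm (Re ((ee (z \<bullet> s i) - 1) ^ L)) \<le> 2 ^ L" for i
        using order_trans[OF abs_Re_le_cmod norm_ee_power_le] by (intro AE_I2) simp
    qed auto
    then show "(mult \<circ> s) \<longlonglongrightarrow> mult \<xi>" unfolding mult_def comp_def by (intro tendsto_mult tendsto_const)
  qed
  then show ?thesis by (simp add: continuous_on_eq_continuous_at)
qed

lemma mult_measurable [measurable]: "mult \<in> borel_measurable borel"
  by (rule borel_measurable_continuous_onI[OF continuous_mult])

lemma mult_bounded_below: "\<exists>c>0. \<forall>\<xi>. 1/2 \<le> norm \<xi> \<longrightarrow> norm \<xi> < 2 \<longrightarrow> c \<le> mult \<xi>"
proof -
  let ?A = "cball (0::real^'n) 2 - ball 0 (1/2)"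
  have A: "compact ?A" by (intro compact_diff) auto
  have ne: "?A \<noteq> {}"
  proof -
    obtain b :: "real^'n" where "b \<in> Basis" using nonempty_Basis by blast
    then have "b \<in> ?A" by simp
    then show ?thesis by blast
  qed
  have "continuous_on ?A mult" by (rule continuous_on_subset[OF continuous_mult]) simp
  from continuous_attains_inf[OF A ne this]
  obtain m where m: "m \<in> ?A" "\<forall>\<xi>\<in>?A. mult m \<le> mult \<xi>" by (elim bexE)
  have "0 < mult m" using m(1) by (intro mult_pos) auto
  with m(2) show ?thesis by (intro exI[of _ "mult m"]) auto
qed

lemma total_pos: "0 < total"
proof -
  obtain b :: "real^'n" where "b \<in> Basis" using nonempty_Basis by blast
  then have "0 < mult b" by (intro mult_pos) auto
  with mult_le_total[of b] show ?thesis by linarith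
qed

section \<open>Division by the multiplier\<close>

definition ratio :: "real^'n \<Rightarrow> real" where "ratio \<xi> = 1 - mult \<xi> / total"

text \<open>\<open>approximant k\<close> is the inverse Fourier transform of \<open>(1 - m)\<^sup>k\<close> times that of \<open>\<psi>\<close>,
  where \<open>m\<close> is the normalised multiplier; summing the geometric series over \<open>k\<close> divides by \<open>m\<close>.\<close>

definition approximant :: "nat \<Rightarrow> real^'n \<Rightarrow> complex" where
  "approximant k x = (LINT \<xi>|lborel. (fourier \<psi> \<xi> * complex_of_real (ratio \<xi> ^ k)) * ee (x \<bullet> \<xi>))"

lemma ratio_bound: "\<exists>\<beta>. 0 \<le> \<beta> \<and> \<beta> < 1 \<and> (\<forall>\<xi>. fourier \<psi> \<xi> \<noteq> 0 \<longrightarrow> 0 \<le> ratio \<xi> \<and> ratio \<xi> \<le> \<beta>)"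
proof -
  obtain c where c: "0 < c" "\<And>\<xi>. 1/2 \<le> norm \<xi> \<Longrightarrow> norm \<xi> < 2 \<Longrightarrow> c \<le> mult \<xi>" using mult_bounded_below by blast
  define \<beta> where "\<beta> = max 0 (1 - c / total)"
  have "0 \<le> ratio \<xi> \<and> ratio \<xi> \<le> \<beta>" if "fourier \<psi> \<xi> \<noteq> 0" for \<xi>
  proof -
    have n: "1/2 \<le> norm \<xi>" "norm \<xi> < 2" using littlewood_paleyD(2)[OF \<psi> that] by auto
    have "mult \<xi> / total \<le> 1" using mult_le_total[of \<xi>] total_pos by (simp add: divide_le_eq_1)
    moreover have "c / total \<le> mult \<xi> / total" using c(2)[OF n] total_pos by (intro divide_right_mono) auto
    ultimately show ?thesis by (auto simp: ratio_def \<beta>_def)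
  qed
  moreover have "0 \<le> \<beta>" "\<beta> < 1" using c(1) total_pos by (auto simp: \<beta>_def)
  ultimately show ?thesis by blast
qed

lemma ratio_measurable [measurable]: "ratio \<in> borel_measurable borel"
  unfolding ratio_def by measurable

lemma fourier_\<psi>_measurable [measurable]: "fourier \<psi> \<in> borel_measurable borel"
  by (rule fourier_measurable[OF rapid_measurable[OF schwartz_rapid[OF littlewood_paleyD(1)[OF \<psi>]]]])

lemma ratio_power_le:
  assumes "\<And>\<xi>. fourier \<psi> \<xi> \<noteq> 0 \<Longrightarrow> 0 \<le> ratio \<xi> \<and> ratio \<xi> \<le> \<beta>"
  shows "cmod (fourier \<psi> \<xi> * complex_of_real (ratio \<xi> ^ k)) \<le> cmod (fourier \<psi> \<xi>) * \<beta> ^ k"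
proof (cases "fourier \<psi> \<xi> = 0")
  case False
  then have "0 \<le> ratio \<xi>" "ratio \<xi> \<le> \<beta>" using assms by auto
  then have "ratio \<xi> ^ k \<le> \<beta> ^ k" "\<bar>ratio \<xi> ^ k\<bar> = ratio \<xi> ^ k" by (auto intro: power_mono)
  then show ?thesis unfolding norm_mult norm_of_real by (simp add: mult_left_mono)
qed simp

lemma weighted_fourier_integrable: "integrable lborel (\<lambda>\<xi>. fourier \<psi> \<xi> * complex_of_real (ratio \<xi> ^ k))"
proof -
  obtain \<beta> where \<beta>: "0 \<le> \<beta>" "\<beta> < 1" "\<And>\<xi>. fourier \<psi> \<xi> \<noteq> 0 \<Longrightarrow> 0 \<le> ratio \<xi> \<and> ratio \<xi> \<le> \<beta>" using ratio_bound by blast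
  show ?thesis
  proof (rule Bochner_Integration.integrable_bound)
    show "integrable lborel (\<lambda>\<xi>. cmod (fourier \<psi> \<xi>) * \<beta> ^ k)"
      by (intro integrable_mult_left integrable_norm fourier_integrable_if_littlewood_paley \<psi>)
    show "AE \<xi> in lborel. norm (fourier \<psi> \<xi> * complex_of_real (ratio \<xi> ^ k)) \<le> norm (cmod (fourier \<psi> \<xi>) * \<beta> ^ k)"
      unfolding real_norm_def by (intro AE_I2 order_trans[OF ratio_power_le[OF \<beta>(3)] abs_ge_self])
  qed measurable
qed

lemma approximant_measurable [measurable]: "approximant k \<in> borel_measurable borel"
  unfolding approximant_def by measurable

lemma approximant_0: "approximant 0 x = \<psi> x"
proof -
  have s: "schwartz \<psi>" by (rule littlewood_paleyD(1)[OF \<psi>])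
  obtain B where B: "\<And>x. cmod (\<psi> x) \<le> B" using rapid_bound[OF schwartz_rapid[OF s], of 0] by auto
  show ?thesis
    using fourier_inversion[OF schwartz_continuous[OF s] B rapid_integrable[OF schwartz_rapid[OF s]] fourier_integrable_if_littlewood_paley[OF \<psi>], of x]
    by (simp add: approximant_def)
qed

lemma approximant_geometric: "\<exists>S \<beta>. 0 \<le> S \<and> 0 \<le> \<beta> \<and> \<beta> < 1 \<and> (\<forall>k x. cmod (approximant k x) \<le> S * \<beta> ^ k)"
proof -
  obtain \<beta> where \<beta>: "0 \<le> \<beta>" "\<beta> < 1" "\<And>\<xi>. fourier \<psi> \<xi> \<noteq> 0 \<Longrightarrow> 0 \<le> ratio \<xi> \<and> ratio \<xi> \<le> \<beta>" using ratio_bound by blast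
  define S where "S = (LINT \<xi>|lborel. cmod (fourier \<psi> \<xi>))"
  have "cmod (approximant k x) \<le> S * \<beta> ^ k" for k x
  proof -
    have "cmod (approximant k x) \<le> (LINT \<xi>|lborel. cmod ((fourier \<psi> \<xi> * complex_of_real (ratio \<xi> ^ k)) * ee (x \<bullet> \<xi>)))"
      unfolding approximant_def by (rule integral_norm_bound)
    also have "\<dots> \<le> (LINT \<xi>|lborel. cmod (fourier \<psi> \<xi>) * \<beta> ^ k)"
    proof (rule integral_mono)
      show "integrable lborel (\<lambda>\<xi>. cmod ((fourier \<psi> \<xi> * complex_of_real (ratio \<xi> ^ k)) * ee (x \<bullet> \<xi>)))"
        by (intro integrable_norm integrable_mult_ee weighted_fourier_integrable) measurable
      show "integrable lborel (\<lambda>\<xi>. cmod (fourier \<psi> \<xi>) * \<beta> ^ k)"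
        by (intro integrable_mult_left integrable_norm fourier_integrable_if_littlewood_paley \<psi>)
      fix \<xi>
      show "cmod ((fourier \<psi> \<xi> * complex_of_real (ratio \<xi> ^ k)) * ee (x \<bullet> \<xi>)) \<le> cmod (fourier \<psi> \<xi>) * \<beta> ^ k"
        unfolding norm_mult[of _ "ee _"] norm_ee mult_1_right by (rule ratio_power_le[OF \<beta>(3)])
    qed
    also have "\<dots> = S * \<beta> ^ k" unfolding S_def by (rule integral_mult_left_zero)
    finally show ?thesis .
  qed
  moreover have "0 \<le> S" unfolding S_def by (intro integral_nonneg_AE AE_I2) simp
  ultimately show ?thesis using \<beta> by blast
qed

lemma iter_diff_approximant:
  "iter_diff L (approximant k) z x
    = (LINT \<xi>|lborel. (fourier \<psi> \<xi> * complex_of_real (ratio \<xi> ^ k)) * ee (x \<bullet> \<xi>) * (ee (z \<bullet> \<xi>) - 1) ^ L)"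
proof -
  let ?g = "\<lambda>\<xi>. fourier \<psi> \<xi> * complex_of_real (ratio \<xi> ^ k)"
  have i: "integrable lborel (\<lambda>\<xi>. diff_coef L i *\<^sub>R (?g \<xi> * ee ((x + real i *\<^sub>R z) \<bullet> \<xi>)))" for i
    by (rule integrable_scaleR_right, rule integrable_mult_ee, rule weighted_fourier_integrable) measurable
  have "iter_diff L (approximant k) z x = (\<Sum>i\<le>L. LINT \<xi>|lborel. diff_coef L i *\<^sub>R (?g \<xi> * ee ((x + real i *\<^sub>R z) \<bullet> \<xi>)))"
    by (simp only: iter_diff_sum approximant_def integral_scaleR_right)
  also have "\<dots> = (LINT \<xi>|lborel. (\<Sum>i\<le>L. diff_coef L i *\<^sub>R (?g \<xi> * ee ((x + real i *\<^sub>R z) \<bullet> \<xi>))))"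
    by (rule Bochner_Integration.integral_sum[symmetric]) (rule i)
  also have "\<dots> = (LINT \<xi>|lborel. ?g \<xi> * ee (x \<bullet> \<xi>) * (ee (z \<bullet> \<xi>) - 1) ^ L)"
    by (rule Bochner_Integration.integral_cong[OF refl]) (rule iter_diff_ee[unfolded iter_diff_sum])
  finally show ?thesis .
qed

text \<open>Taking the mean difference multiplies the transform by a constant times 1 -
  \<open>ratio\<close>, that is, it produces the difference of two consecutive terms of the series.
  Both the recursion and the final telescoping come from this.\<close>

lemma mean_iter_diff_approximant:
  "(LINT z|\<mu>. iter_diff L (approximant k) z x) = complex_of_real (diff_sign L * total) * (approximant k x - approximant (Suc k) x)"
proof -
  let ?g = "\<lambda>\<xi>. fourier \<psi> \<xi> * complex_of_real (ratio \<xi> ^ k)"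
  have sf: "sigma_finite_measure \<mu>" by unfold_locales
  interpret pair_sigma_finite \<mu> "lborel :: (real^'n) measure"
    using sf by (simp add: pair_sigma_finite_def lborel.sigma_finite_measure_axioms)
  have "integrable (\<mu> \<Otimes>\<^sub>M lborel) (\<lambda>(z, \<xi>). ?g \<xi> * ee (x \<bullet> \<xi>) * (ee (z \<bullet> \<xi>) - 1) ^ L)"
  proof (rule integrable_pair_dominated[where f="\<lambda>_. 2 ^ L" and g="\<lambda>\<xi>. cmod (?g \<xi>)"])
    show "AE p in \<mu> \<Otimes>\<^sub>M lborel. norm (case p of (z, \<xi>) \<Rightarrow> ?g \<xi> * ee (x \<bullet> \<xi>) * (ee (z \<bullet> \<xi>) - 1) ^ L) \<le> 2 ^ L * cmod (?g (snd p))"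
    proof (intro AE_I2)
      fix p :: "(real^'n) \<times> (real^'n)"
      have "norm (?g \<xi> * ee (x \<bullet> \<xi>) * (ee (z \<bullet> \<xi>) - 1) ^ L) \<le> 2 ^ L * cmod (?g \<xi>)" for z \<xi>
      proof -
        have "norm (?g \<xi> * ee (x \<bullet> \<xi>) * (ee (z \<bullet> \<xi>) - 1) ^ L) = cmod (?g \<xi>) * cmod ((ee (z \<bullet> \<xi>) - 1) ^ L)"
          by (simp only: norm_mult norm_ee mult_1_right)
        also have "\<dots> \<le> cmod (?g \<xi>) * 2 ^ L" by (intro mult_left_mono norm_ee_power_le) simp
        finally show ?thesis by (simp only: mult.commute)
      qed
      then show "norm (case p of (z, \<xi>) \<Rightarrow> ?g \<xi> * ee (x \<bullet> \<xi>) * (ee (z \<bullet> \<xi>) - 1) ^ L) \<le> 2 ^ L * cmod (?g (snd p))"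
        unfolding case_prod_beta .
    qed
    show "integrable lborel (\<lambda>\<xi>. cmod (?g \<xi>))" by (intro integrable_norm weighted_fourier_integrable)
  qed (auto intro: lborel.sigma_finite_measure_axioms sf)
  from Fubini_integral[OF this]
  have "(LINT z|\<mu>. iter_diff L (approximant k) z x) = (LINT \<xi>|lborel. LINT z|\<mu>. ?g \<xi> * ee (x \<bullet> \<xi>) * (ee (z \<bullet> \<xi>) - 1) ^ L)"
    unfolding iter_diff_approximant by simp
  also have "\<dots> = (LINT \<xi>|lborel. ?g \<xi> * ee (x \<bullet> \<xi>) * complex_of_real (diff_sign L * mult \<xi>))"
    unfolding integral_mult_right_zero integral_ee_power ..
  also have "\<dots> = (LINT \<xi>|lborel. complex_of_real (diff_sign L * total) *
      (?g \<xi> * ee (x \<bullet> \<xi>) - fourier \<psi> \<xi> * complex_of_real (ratio \<xi> ^ Suc k) * ee (x \<bullet> \<xi>)))"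
  proof -
    have m: "mult \<xi> = total * (1 - ratio \<xi>)" for \<xi> using total_pos by (simp add: ratio_def)
    show ?thesis unfolding m by (simp add: algebra_simps)
  qed
  also have "\<dots> = complex_of_real (diff_sign L * total) * (approximant k x - approximant (Suc k) x)"
    unfolding integral_mult_right_zero approximant_def
    by (subst Bochner_Integration.integral_diff; (rule integrable_mult_ee, rule weighted_fourier_integrable)?) auto
  finally show ?thesis .
qed

lemma approximant_Suc:
  "approximant (Suc k) x = approximant k x - complex_of_real (diff_sign L / total) * (LINT z|\<mu>. iter_diff L (approximant k) z x)"
proof -
  have "complex_of_real (diff_sign L / total) * complex_of_real (diff_sign L * total) = complex_of_real 1"
    unfolding of_real_mult[symmetric] using total_pos diff_sign_square[of L] by (simp del: diff_sign_square)
  then show ?thesis unfolding mean_iter_diff_approximant mult.assoc[symmetric] by simp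
qed

text \<open>Finite propagation: by \<open>approximant_Suc\<close> the next approximant arises from
  translates by at most L\<rho> \<le> 1, so the value at \<open>x\<close> sees \<psi> only within
  distance \<open>k\<close>. Division by \<open>total\<close> makes each step at most double the
  bound.\<close>

lemma approximant_local:
  assumes "\<And>y. norm (y - x) \<le> real k \<Longrightarrow> cmod (\<psi> y) \<le> S" "0 \<le> S"
  shows "cmod (approximant k x) \<le> 2 ^ k * S"
  using assms(1)
proof (induction k arbitrary: x)
  case 0
  then show ?case by (simp add: approximant_0)
next
  case (Suc k)
  have a: "cmod (approximant k x) \<le> 2 ^ k * S" by (rule Suc.IH) (use Suc.prems in auto)
  have "cmod (LINT z|\<mu>. iter_diff L (approximant k) z x) \<le> 2 ^ L * (2 ^ k * S) * measure \<mu> (space \<mu>)"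
  proof (rule norm_integral_le_const)
    show "AE z in \<mu>. norm (iter_diff L (approximant k) z x) \<le> 2 ^ L * (2 ^ k * S)"
      using supp
    proof (rule eventually_mono)
      fix z :: "real^'n" assume z: "norm z \<le> \<rho>"
      show "norm (iter_diff L (approximant k) z x) \<le> 2 ^ L * (2 ^ k * S)"
      proof (rule iter_diff_bound)
        fix i assume i: "i \<le> L"
        have "real i * norm z \<le> real L * \<rho>" using i z by (intro mult_mono) auto
        also have "\<dots> \<le> 1" using \<rho> by simp
        finally have iz: "norm (real i *\<^sub>R z) \<le> 1" by simp
        show "cmod (approximant k (x + real i *\<^sub>R z)) \<le> 2 ^ k * S"
        proof (rule Suc.IH, rule Suc.prems)
          fix y assume "norm (y - (x + real i *\<^sub>R z)) \<le> real k"
          then show "norm (y - x) \<le> real (Suc k)" using norm_triangle_ineq[of "y - (x + real i *\<^sub>R z)" "real i *\<^sub>R z"] iz by simp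
        qed
      qed
    qed
  qed (use assms(2) in simp)
  then have b: "cmod (LINT z|\<mu>. iter_diff L (approximant k) z x) \<le> total * (2 ^ k * S)" by (simp add: total_def ac_simps)
  have "cmod (approximant (Suc k) x) \<le> cmod (approximant k x) + cmod (complex_of_real (diff_sign L / total) * (LINT z|\<mu>. iter_diff L (approximant k) z x))"
    unfolding approximant_Suc by (rule norm_triangle_ineq4)
  also have "cmod (complex_of_real (diff_sign L / total) * (LINT z|\<mu>. iter_diff L (approximant k) z x)) = cmod (LINT z|\<mu>. iter_diff L (approximant k) z x) / total"
    using total_pos by (simp add: norm_mult norm_divide)
  also have "\<dots> \<le> total * (2 ^ k * S) / total" using total_pos by (intro divide_right_mono b) auto
  also have "\<dots> = 2 ^ k * S" using total_pos by simp
  finally show ?case using a by simp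
qed

text \<open>For some \<delta> > 0 the number a(1+\<delta>)^M is still below 1, and Bernoulli gives 1
  + k \<le> (1+\<delta>)^k/\<delta>; the polynomial is absorbed by a slightly larger ratio.\<close>

lemma polynomial_geometric_summable:
  fixes a :: real
  assumes "0 \<le> a" "a < 1"
  shows "summable (\<lambda>k. (1 + real k) ^ M * a ^ k)"
proof -
  have "((\<lambda>\<delta>. a * (1 + \<delta>) ^ M) \<longlongrightarrow> a * (1 + 0) ^ M) (at_right 0)" by (intro tendsto_intros)
  then have "\<forall>\<^sub>F \<delta> in at_right 0. a * (1 + \<delta>) ^ M < 1" using assms by (intro order_tendstoD(2)) auto
  moreover have "\<forall>\<^sub>F \<delta>::real in at_right 0. \<delta> < 1"
    using eventually_at_right_less[of "0::real"] by (auto simp: eventually_at_right_field intro!: exI[of _ 1])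
  ultimately have "\<forall>\<^sub>F \<delta> in at_right 0. a * (1 + \<delta>) ^ M < 1 \<and> \<delta> < 1 \<and> 0 < \<delta>"
    using eventually_at_right_less[of "0::real"] by (intro eventually_conj)
  from eventually_happens'[OF trivial_limit_at_right_real this]
  obtain \<delta> :: real where \<delta>: "a * (1 + \<delta>) ^ M < 1" "0 < \<delta>" "\<delta> < 1" by blast
  have le: "1 + real k \<le> (1 + \<delta>) ^ k / \<delta>" for k
  proof -
    have "1 + real k * \<delta> \<le> (1 + \<delta>) ^ k" using \<delta> by (intro Bernoulli_inequality) auto
    moreover have "\<delta> * (1 + real k) \<le> 1 + real k * \<delta>" using \<delta> by (simp add: algebra_simps)
    ultimately show ?thesis using \<delta> by (simp add: pos_le_divide_eq mult.commute)
  qed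
  show ?thesis
  proof (rule summable_comparison_test')
    show "summable (\<lambda>k. (1 / \<delta>) ^ M * (a * (1 + \<delta>) ^ M) ^ k)"
      using \<delta> assms by (intro summable_mult summable_geometric) auto
    fix k
    have "(1 + real k) ^ M * a ^ k \<le> ((1 + \<delta>) ^ k / \<delta>) ^ M * a ^ k" using assms by (intro mult_right_mono power_mono le) auto
    also have "\<dots> = (1 / \<delta>) ^ M * (a * (1 + \<delta>) ^ M) ^ k"
      by (simp add: power_divide power_mult_distrib power_mult[symmetric] mult.commute)
    finally show "norm ((1 + real k) ^ M * a ^ k) \<le> (1 / \<delta>) ^ M * (a * (1 + \<delta>) ^ M) ^ k" using assms by simp
  qed
qed

text \<open>Interpolation of two bounds: S \<beta>^k without spatial decay, and 2^k times an
  arbitrary power of the weight from locality. In the product of \<open>q\<close> copies of the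
  first and one copy of the second, \<beta>^q < 1/2 beats the growth 2^k, and the spatial decay
  survives.\<close>

lemma approximant_decay:
  "\<exists>K a. 0 \<le> K \<and> 0 \<le> a \<and> a < 1 \<and> (\<forall>k x. cmod (approximant k x) \<le> K * ((1 + real k) ^ M * a ^ k) / (1 + norm x) ^ M)"
proof -
  obtain S \<beta> where S: "0 \<le> S" "0 \<le> \<beta>" "\<beta> < 1" "\<And>k x. cmod (approximant k x) \<le> S * \<beta> ^ k"
    using approximant_geometric by blast
  have "(\<lambda>q. \<beta> ^ q) \<longlonglongrightarrow> 0" using S by (intro LIMSEQ_power_zero) auto
  then have "\<forall>\<^sub>F q in sequentially. \<beta> ^ q < 1/2" by (rule order_tendstoD) simp
  then obtain q where q: "\<beta> ^ q < 1/2" unfolding eventually_sequentially by blast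
  \<comment> \<open>The order \<open>M\<close> is inflated by q + 1 because a root of that order is
    taken at the end; \<open>a\<close> and \<open>K\<close> below are the corresponding
    roots.\<close>
  let ?N = "M * Suc q"
  obtain C where C: "0 < C" "\<And>x. cmod (\<psi> x) \<le> C / (1 + norm x) ^ ?N"
    using rapid_bound[OF schwartz_rapid[OF littlewood_paleyD(1)[OF \<psi>]], of ?N] by blast
  define a where "a = root (Suc q) (\<beta> ^ q * 2)"
  define K where "K = root (Suc q) (S ^ q * C)"
  have a: "0 \<le> a" "a < 1" "a ^ Suc q = \<beta> ^ q * 2" using S q by (auto simp: a_def real_root_lt_1_iff real_root_pow_pos2 simp del: power_Suc)
  have K: "0 \<le> K" "K ^ Suc q = S ^ q * C" using S C by (auto simp: K_def real_root_pow_pos2 simp del: power_Suc)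
  have "cmod (approximant k x) \<le> K * ((1 + real k) ^ M * a ^ k) / (1 + norm x) ^ M" for k x
  proof (rule power_le_imp_le_base)
    have loc: "cmod (approximant k x) \<le> 2 ^ k * (C * (1 + real k) ^ ?N / (1 + norm x) ^ ?N)"
    proof (rule approximant_local)
      fix y assume y: "norm (y - x) \<le> real k"
      have "1 + norm x \<le> (1 + norm y) * (1 + norm (y - x))" using weight_triangle_diff[of y "y - x"] by simp
      also have "\<dots> \<le> (1 + norm y) * (1 + real k)" using y by (intro mult_left_mono) auto
      finally have "(1 + norm x) ^ ?N \<le> ((1 + real k) * (1 + norm y)) ^ ?N" by (intro power_mono) (auto simp: mult.commute)
      then have "(1 + norm x) ^ ?N \<le> (1 + real k) ^ ?N * (1 + norm y) ^ ?N" by (simp only: power_mult_distrib)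
      from le_divide_weight[OF this _ _ C(1)] have "C / (1 + norm y) ^ ?N \<le> C * (1 + real k) ^ ?N / (1 + norm x) ^ ?N"
        by (simp only: zero_less_power weight_pos)
      with C(2)[of y] show "cmod (\<psi> y) \<le> C * (1 + real k) ^ ?N / (1 + norm x) ^ ?N" by (rule order_trans)
    qed (use C in auto)
    have "cmod (approximant k x) ^ Suc q = cmod (approximant k x) ^ q * cmod (approximant k x)" by simp
    also have "\<dots> \<le> (S * \<beta> ^ k) ^ q * (2 ^ k * (C * (1 + real k) ^ ?N / (1 + norm x) ^ ?N))"
      using S by (intro mult_mono power_mono loc) auto
    also have "\<dots> = (S ^ q * C) * (((1 + real k) ^ M) ^ Suc q * (\<beta> ^ q * 2) ^ k) / ((1 + norm x) ^ M) ^ Suc q"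
      unfolding power_mult_distrib power_mult[symmetric] mult.commute[of k q] by (simp only: times_divide_eq_right ac_simps)
    also have "\<dots> = (K * ((1 + real k) ^ M * a ^ k) / (1 + norm x) ^ M) ^ Suc q"
      unfolding power_divide power_mult_distrib K(2)[symmetric] a(3)[symmetric] power_mult[symmetric] mult.commute[of k "Suc q"] ..
    finally show "cmod (approximant k x) ^ Suc q \<le> (K * ((1 + real k) ^ M * a ^ k) / (1 + norm x) ^ M) ^ Suc q" .
  qed (use K a in auto)
  with K(1) a(1,2) show ?thesis by blast
qed

text \<open>The geometric series in \<open>ratio\<close> has sum \<open>total\<close> /
  \<open>mult\<close>, so the transform is formally that of \<psi> divided by \<open>mult\<close>,
  up to sign.\<close>

definition kernel :: "real^'n \<Rightarrow> complex" where
  "kernel x = complex_of_real (diff_sign L / total) * (\<Sum>k. approximant k x)"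

lemma approximant_summable: "summable (\<lambda>k. cmod (approximant k x))"
proof -
  obtain S \<beta> where S: "0 \<le> S" "0 \<le> \<beta>" "\<beta> < 1" "\<And>k x. cmod (approximant k x) \<le> S * \<beta> ^ k"
    using approximant_geometric by blast
  show ?thesis by (rule summable_comparison_test'[where g="\<lambda>k. S * \<beta> ^ k"])
       (use S in \<open>auto intro!: summable_mult summable_geometric\<close>)
qed

lemma rapid_kernel: "rapid kernel"
proof (rule rapidI)
  show "kernel \<in> borel_measurable borel" unfolding kernel_def by measurable
  fix M
  obtain K a where K: "0 \<le> K" "0 \<le> a" "a < 1" "\<And>k x. cmod (approximant k x) \<le> K * ((1 + real k) ^ M * a ^ k) / (1 + norm x) ^ M"
    using approximant_decay by blast
  define s where "s = (\<Sum>k. (1 + real k) ^ M * a ^ k)"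
  have sm: "summable (\<lambda>k. K / (1 + norm x) ^ M * ((1 + real k) ^ M * a ^ k))" for x :: "real^'n"
    using K by (intro summable_mult polynomial_geometric_summable) auto
  have "cmod (kernel x) \<le> (1 / total * (K * s)) / (1 + norm x) ^ M" for x
  proof -
    have "cmod (\<Sum>k. approximant k x) \<le> (\<Sum>k. cmod (approximant k x))" by (rule summable_norm[OF approximant_summable])
    also have "\<dots> \<le> (\<Sum>k. K / (1 + norm x) ^ M * ((1 + real k) ^ M * a ^ k))"
      by (rule suminf_le[OF _ approximant_summable sm]) (use K(4) in simp)
    also have "\<dots> = K / (1 + norm x) ^ M * s" unfolding s_def by (rule suminf_mult[OF polynomial_geometric_summable[OF K(2,3)]])
    finally have "cmod (\<Sum>k. approximant k x) \<le> K / (1 + norm x) ^ M * s" .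
    then have "1 / total * cmod (\<Sum>k. approximant k x) \<le> 1 / total * (K / (1 + norm x) ^ M * s)"
      using total_pos by (intro mult_left_mono) auto
    then show ?thesis using total_pos by (simp add: kernel_def norm_mult norm_divide)
  qed
  then show "\<exists>C. \<forall>x. cmod (kernel x) \<le> C / (1 + norm x) ^ M" by blast
qed

text \<open>Integrated term by term, the series telescopes to its first approximant, which is \<psi>
  by Fourier inversion.\<close>

lemma mean_iter_diff_kernel: "(LINT z|\<mu>. iter_diff L kernel z x) = \<psi> x"
proof -
  obtain S \<beta> where S: "0 \<le> S" "0 \<le> \<beta>" "\<beta> < 1" "\<And>k x. cmod (approximant k x) \<le> S * \<beta> ^ k"
    using approximant_geometric by blast
  let ?c = "complex_of_real (diff_sign L / total)"
  have sums: "(\<lambda>k. approximant k y) sums (\<Sum>k. approximant k y)" for y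
    by (rule summable_sums[OF summable_norm_cancel[OF approximant_summable]])
  have k: "(\<lambda>k. ?c * approximant k y) sums kernel y" for y unfolding kernel_def by (rule sums_mult[OF sums])
  have s1: "(\<lambda>k. ?c * iter_diff L (approximant k) z x) sums iter_diff L kernel z x" for z
  proof -
    have "(\<lambda>k. \<Sum>i\<le>L. diff_coef L i *\<^sub>R (?c * approximant k (x + real i *\<^sub>R z))) sums (\<Sum>i\<le>L. diff_coef L i *\<^sub>R kernel (x + real i *\<^sub>R z))"
      by (rule sums_sum) (rule sums_scaleR_right[OF k])
    moreover have "(\<Sum>i\<le>L. diff_coef L i *\<^sub>R (?c * approximant k (x + real i *\<^sub>R z))) = ?c * iter_diff L (approximant k) z x" for k
      unfolding iter_diff_sum sum_distrib_left by (simp only: mult_scaleR_right)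
    ultimately show ?thesis unfolding iter_diff_sum[of L kernel] by simp
  qed
  have bnd: "cmod (?c * iter_diff L (approximant k) z x) \<le> (1 / total * 2 ^ L * S) * \<beta> ^ k" for k z
  proof -
    have "cmod (iter_diff L (approximant k) z x) \<le> 2 ^ L * (S * \<beta> ^ k)" by (rule iter_diff_bound) (rule S(4))
    then have "1 / total * cmod (iter_diff L (approximant k) z x) \<le> 1 / total * (2 ^ L * (S * \<beta> ^ k))"
      using total_pos by (intro mult_left_mono) auto
    then show ?thesis using total_pos by (simp add: norm_mult norm_divide)
  qed
  have sb: "summable (\<lambda>k. (1 / total * 2 ^ L * S) * \<beta> ^ k)" using S by (intro summable_mult summable_geometric) auto
  have m: "(\<lambda>z. ?c * iter_diff L (approximant k) z x) \<in> borel_measurable \<mu>" for k unfolding iter_diff_sum by measurable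
  have int: "integrable \<mu> (\<lambda>z. ?c * iter_diff L (approximant k) z x)" for k by (rule integrable_const_bound[OF _ m]) (use bnd in auto)
  have "(LINT z|\<mu>. iter_diff L kernel z x) = (LINT z|\<mu>. (\<Sum>k. ?c * iter_diff L (approximant k) z x))" using sums_unique[OF s1] by simp
  also have "\<dots> = (\<Sum>k. LINT z|\<mu>. ?c * iter_diff L (approximant k) z x)"
  proof (rule integral_suminf[OF int])
    show "AE z in \<mu>. summable (\<lambda>k. norm (?c * iter_diff L (approximant k) z x))"
      by (intro AE_I2 summable_comparison_test'[OF sb]) (use bnd in simp)
    show "summable (\<lambda>k. LINT z|\<mu>. norm (?c * iter_diff L (approximant k) z x))"
    proof (rule summable_comparison_test'[OF summable_mult2[OF sb, of "measure \<mu> (space \<mu>)"]])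
      fix k
      show "norm (LINT z|\<mu>. norm (?c * iter_diff L (approximant k) z x)) \<le> (1 / total * 2 ^ L * S) * \<beta> ^ k * measure \<mu> (space \<mu>)"
        by (rule norm_integral_le_const) (use bnd[of k] S total_pos in auto)
    qed
  qed
  also have "\<dots> = (\<Sum>k. approximant k x - approximant (Suc k) x)"
  proof (intro suminf_cong)
    fix k
    have "?c * complex_of_real (diff_sign L * total) = complex_of_real 1"
      unfolding of_real_mult[symmetric] using total_pos diff_sign_square[of L] by (simp del: diff_sign_square)
    then show "(LINT z|\<mu>. ?c * iter_diff L (approximant k) z x) = approximant k x - approximant (Suc k) x"
      unfolding integral_mult_right_zero mean_iter_diff_approximant mult.assoc[symmetric] by simp
  qed
  also have "\<dots> = approximant 0 x - 0"
    by (intro sums_unique[symmetric] telescope_sums' summable_LIMSEQ_zero[OF summable_norm_cancel[OF approximant_summable]])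
  finally show ?thesis by (simp add: approximant_0)
qed

end

subsection \<open>Transferring mean differences to the kernel\<close>

lemma AE_fst_pair:
  assumes "pair_sigma_finite M1 M2" "Measurable.pred M1 P" "AE x in M1. P x"
  shows "AE p in M1 \<Otimes>\<^sub>M M2. P (fst p)"
proof -
  interpret pair_sigma_finite M1 M2 by fact
  have [measurable]: "Measurable.pred M1 P" by fact
  show ?thesis by (rule AE_pair_measure) (measurable, use assms(3) in auto)
qed

text \<open>With the shift on \<phi> a product majorant exists, as |z| is bounded and the weight can
  be moved. With the shift on \<open>g\<close> it does not come for free, so that case is obtained
  from the first by translating y for each fixed z.\<close>

lemma bounded_shift_pair_integrable:
  fixes \<mu> :: "(real^'n::finite) measure"
  assumes \<mu>: "finite_measure \<mu>" "sets \<mu> = sets borel" "AE z in \<mu>. norm z \<le> R"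
    and \<phi>: "rapid \<phi>" and g: "tame g"
  shows "integrable (\<mu> \<Otimes>\<^sub>M lborel) (\<lambda>(z, y). \<phi> (x - y + a *\<^sub>R z) * g y)"
    and "integrable (\<mu> \<Otimes>\<^sub>M lborel) (\<lambda>(z, y). \<phi> (x - y) * g (y + a *\<^sub>R z))"
    and "(LINT p|(\<mu> \<Otimes>\<^sub>M lborel). \<phi> (x - snd p) * g (snd p + a *\<^sub>R fst p)) =
         (LINT p|(\<mu> \<Otimes>\<^sub>M lborel). \<phi> (x - snd p + a *\<^sub>R fst p) * g (snd p))"
proof -
  note [measurable_cong] = \<mu>(2)
  interpret finite_measure \<mu> by fact
  have sf: "sigma_finite_measure \<mu>" by unfold_locales
  have pf: "pair_sigma_finite \<mu> (lborel :: (real^'n) measure)" using sf by (simp add: pair_sigma_finite_def lborel.sigma_finite_measure_axioms)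
  interpret P: pair_sigma_finite \<mu> "lborel :: (real^'n) measure" by (rule pf)
  have [measurable]: "\<phi> \<in> borel_measurable borel" "g \<in> borel_measurable borel" using \<phi> g by auto
  obtain N where N: "integrable lborel (\<lambda>x. cmod (g x) / (1 + norm x) ^ N)" using g by (auto simp: tame_def)
  obtain C where C: "0 < C" "\<And>x. cmod (\<phi> x) \<le> C / (1 + norm x) ^ N" using rapid_bound[OF \<phi>, of N] by blast
  define B where "B = C * (1 + norm x + \<bar>a\<bar> * R) ^ N"
  show i1: "integrable (\<mu> \<Otimes>\<^sub>M lborel) (\<lambda>(z, y). \<phi> (x - y + a *\<^sub>R z) * g y)"
  proof (rule integrable_pair_dominated[where f="\<lambda>_. B" and g="\<lambda>y. cmod (g y) / (1 + norm y) ^ N"])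
    have "AE p in \<mu> \<Otimes>\<^sub>M (lborel :: (real^'n) measure). norm (fst p) \<le> R" by (rule AE_fst_pair[OF pf _ \<mu>(3)]) measurable
    then show "AE p in \<mu> \<Otimes>\<^sub>M lborel. norm (case p of (z, y) \<Rightarrow> \<phi> (x - y + a *\<^sub>R z) * g y) \<le> B * (cmod (g (snd p)) / (1 + norm (snd p)) ^ N)"
    proof (rule eventually_mono)
      fix p :: "(real^'n) \<times> (real^'n)" assume p: "norm (fst p) \<le> R"
      obtain z y where zy: "p = (z, y)" by force
      have "cmod (\<phi> ((x + a *\<^sub>R z) - y)) \<le> C / (1 + norm ((x + a *\<^sub>R z) - y)) ^ N" by (rule C)
      also have "\<dots> \<le> C * (1 + norm (x + a *\<^sub>R z)) ^ N / (1 + norm y) ^ N" by (rule weight_shift) (use C in simp)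
      also have "\<dots> \<le> B / (1 + norm y) ^ N"
      proof -
        have "norm (x + a *\<^sub>R z) \<le> norm x + \<bar>a\<bar> * norm z" using norm_triangle_ineq[of x "a *\<^sub>R z"] by simp
        also have "\<bar>a\<bar> * norm z \<le> \<bar>a\<bar> * R" using p zy by (intro mult_left_mono) auto
        finally show ?thesis unfolding B_def using C(1) by (intro divide_right_mono mult_left_mono power_mono) auto
      qed
      finally have "cmod (\<phi> (x - y + a *\<^sub>R z)) * cmod (g y) \<le> B / (1 + norm y) ^ N * cmod (g y)"
        by (intro mult_right_mono) (simp_all add: algebra_simps)
      then show "norm (case p of (z, y) \<Rightarrow> \<phi> (x - y + a *\<^sub>R z) * g y) \<le> B * (cmod (g (snd p)) / (1 + norm (snd p)) ^ N)"
        by (simp add: zy norm_mult)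
    qed
  qed (use N sf in \<open>auto intro: lborel.sigma_finite_measure_axioms\<close>)
  have sh: "(LINT y|lborel. f (x - y + a *\<^sub>R z) (g y)) = (LINT y|lborel. f (x - y) (g (y + a *\<^sub>R z)))"
    for z and f :: "real^'n \<Rightarrow> complex \<Rightarrow> 'c::{banach, second_countable_topology}"
    using lborel_integral_shift[of "\<lambda>y. f (x - y + a *\<^sub>R z) (g y)" "a *\<^sub>R z"] by (simp add: algebra_simps)
  show i2: "integrable (\<mu> \<Otimes>\<^sub>M lborel) (\<lambda>(z, y). \<phi> (x - y) * g (y + a *\<^sub>R z))"
  proof (rule P.Fubini_integrable)
    have "integrable \<mu> (\<lambda>z. LINT y|lborel. norm (case (z, y) of (z, y) \<Rightarrow> \<phi> (x - y + a *\<^sub>R z) * g y))"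
      by (rule P.integrable_fst'[OF integrable_norm[OF i1]])
    then show "integrable \<mu> (\<lambda>z. LINT y|lborel. norm (case (z, y) of (z, y) \<Rightarrow> \<phi> (x - y) * g (y + a *\<^sub>R z)))"
      using sh[of "\<lambda>u v. norm (\<phi> u * v)"] by simp
    have "integrable lborel (\<lambda>y. \<phi> (x - y) * g (y + a *\<^sub>R z))" for z
      using integrable_lborel_affine[OF integrable_rapid_tame_reflect[OF \<phi> g, of "x + a *\<^sub>R z"], of 1 "a *\<^sub>R z"]
      by (simp add: add.commute)
    then show "AE z in \<mu>. integrable lborel (\<lambda>y. case (z, y) of (z, y) \<Rightarrow> \<phi> (x - y) * g (y + a *\<^sub>R z))" by simp
  qed measurable
  show "(LINT p|(\<mu> \<Otimes>\<^sub>M lborel). \<phi> (x - snd p) * g (snd p + a *\<^sub>R fst p)) =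
         (LINT p|(\<mu> \<Otimes>\<^sub>M lborel). \<phi> (x - snd p + a *\<^sub>R fst p) * g (snd p))"
    using P.integral_fst'[OF i1] P.integral_fst'[OF i2] sh[of "\<lambda>u v. \<phi> u * v"] by (simp add: case_prod_beta')
qed

text \<open>Transposing a translation reverses its direction, but so does the reflection in x - y;
  hence \<phi> receives the same forward difference that \<open>g\<close> loses.\<close>

lemma mean_diff_identity:
  fixes \<mu> :: "(real^'n::finite) measure"
  assumes \<mu>: "finite_measure \<mu>" "sets \<mu> = sets borel" "AE z in \<mu>. norm z \<le> R"
    and \<phi>: "rapid \<phi>" and g: "tame g"
  shows "integrable (\<mu> \<Otimes>\<^sub>M lborel) (\<lambda>(z, y). \<phi> (x - y) * iter_diff L g z y)" (is ?I)
    and "(LINT p|(\<mu> \<Otimes>\<^sub>M lborel). \<phi> (x - snd p) * iter_diff L g (fst p) (snd p))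
      = (LINT y|lborel. (LINT z|\<mu>. iter_diff L \<phi> z (x - y)) * g y)" (is ?E)
proof -
  note i = bounded_shift_pair_integrable[OF \<mu> \<phi> g, of x]
  interpret finite_measure \<mu> by fact
  have pf: "pair_sigma_finite \<mu> (lborel :: (real^'n) measure)"
    by (simp add: pair_sigma_finite_def lborel.sigma_finite_measure_axioms) unfold_locales
  interpret P: pair_sigma_finite \<mu> "lborel :: (real^'n) measure" by (rule pf)
  have i1: "integrable (\<mu> \<Otimes>\<^sub>M lborel) (\<lambda>p. diff_coef L k *\<^sub>R (\<phi> (x - snd p) * g (snd p + real k *\<^sub>R fst p)))" for k
    using integrable_scaleR_right[OF i(2)[of "real k"], of "diff_coef L k"] by (simp add: case_prod_beta)
  have i2: "integrable (\<mu> \<Otimes>\<^sub>M lborel) (\<lambda>p. diff_coef L k *\<^sub>R (\<phi> (x - snd p + real k *\<^sub>R fst p) * g (snd p)))" for k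
    using integrable_scaleR_right[OF i(1)[of "real k"], of "diff_coef L k"] by (simp add: case_prod_beta)
  have e1: "\<phi> (x - y) * iter_diff L g z y = (\<Sum>k\<le>L. diff_coef L k *\<^sub>R (\<phi> (x - y) * g (y + real k *\<^sub>R z)))" for z y
    unfolding iter_diff_sum by (simp add: sum_distrib_left)
  have e2: "iter_diff L \<phi> z (x - y) * g y = (\<Sum>k\<le>L. diff_coef L k *\<^sub>R (\<phi> (x - y + real k *\<^sub>R z) * g y))" for z y
    unfolding iter_diff_sum by (simp add: sum_distrib_right)
  show ?I unfolding e1 case_prod_beta by (rule Bochner_Integration.integrable_sum) (rule i1)
  have i3: "integrable (\<mu> \<Otimes>\<^sub>M lborel) (\<lambda>p. iter_diff L \<phi> (fst p) (x - snd p) * g (snd p))"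
    unfolding e2 by (rule Bochner_Integration.integrable_sum) (rule i2)
  have "(LINT p|(\<mu> \<Otimes>\<^sub>M lborel). \<phi> (x - snd p) * iter_diff L g (fst p) (snd p))
     = (\<Sum>k\<le>L. LINT p|(\<mu> \<Otimes>\<^sub>M lborel). diff_coef L k *\<^sub>R (\<phi> (x - snd p) * g (snd p + real k *\<^sub>R fst p)))"
    unfolding e1 by (rule Bochner_Integration.integral_sum) (rule i1)
  also have "\<dots> = (\<Sum>k\<le>L. LINT p|(\<mu> \<Otimes>\<^sub>M lborel). diff_coef L k *\<^sub>R (\<phi> (x - snd p + real k *\<^sub>R fst p) * g (snd p)))"
    unfolding integral_scaleR_right i(3) ..
  also have "\<dots> = (LINT p|(\<mu> \<Otimes>\<^sub>M lborel). iter_diff L \<phi> (fst p) (x - snd p) * g (snd p))"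
    unfolding e2 by (rule Bochner_Integration.integral_sum[symmetric]) (rule i2)
  also have "\<dots> = (LINT y|lborel. LINT z|\<mu>. iter_diff L \<phi> z (x - y) * g y)"
    using P.integral_snd[of "\<lambda>z y. iter_diff L \<phi> z (x - y) * g y"] i3 by (simp add: case_prod_beta')
  also have "\<dots> = (LINT y|lborel. (LINT z|\<mu>. iter_diff L \<phi> z (x - y)) * g y)" by (simp only: integral_mult_left_zero)
  finally show ?E .
qed

abbreviation jointly_measurable :: "('a::topological_space \<Rightarrow> 'b::topological_space \<Rightarrow> 'c::topological_space) \<Rightarrow> bool" where
  "jointly_measurable D \<equiv> (\<lambda>p. D (fst p) (snd p)) \<in> borel_measurable (borel \<Otimes>\<^sub>M borel)"

lemma measurable_joint:
  assumes D: "(\<lambda>p. D (fst p) (snd p)) \<in> measurable (M1 \<Otimes>\<^sub>M M2) M'" and fg: "f \<in> measurable M M1" "g \<in> measurable M M2"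
  shows "(\<lambda>z. D (f z) (g z)) \<in> measurable M M'" using measurable_compose[OF measurable_Pair[OF fg] D] by simp

text \<open>The positive lower radius matters for classes: the majorant of their differences
  involves (1 + |y|/|h|) to a power, which has to be bounded over the steps \<open>h\<close> coming
  from \<mu>.\<close>

definition recovers :: "(real^'n::finite \<Rightarrow> complex) \<Rightarrow> nat \<Rightarrow> (real^'n) measure \<Rightarrow> (real^'n \<Rightarrow> complex) \<Rightarrow> bool" where
  "recovers \<psi> L \<mu> \<phi> \<longleftrightarrow> finite_measure \<mu> \<and> sets \<mu> = sets borel \<and>
     (\<exists>a b. 0 < a \<and> (AE z in \<mu>. a \<le> norm z \<and> norm z \<le> b)) \<and> rapid \<phi> \<and>
     (\<forall>x. (LINT z|\<mu>. iter_diff L \<phi> z x) = \<psi> x)"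

text \<open>Common to the differences of a function representative and of a class: every pair that recovers
  \<open>\<psi>\<close>, moved to the scale \<open>2\<^sup>-\<^sup>k\<close>, reproduces the piece of the distribution at that scale.\<close>

definition reproduces ::
  "(real^'n::finite \<Rightarrow> complex) \<Rightarrow> nat \<Rightarrow> ((real^'n \<Rightarrow> complex) \<Rightarrow> complex) \<Rightarrow> (real^'n \<Rightarrow> real^'n \<Rightarrow> complex) \<Rightarrow> bool" where
  "reproduces \<psi> L u D \<longleftrightarrow>
     jointly_measurable D \<and>
     (\<forall>\<mu> \<phi> k x. recovers \<psi> L \<mu> \<phi> \<longrightarrow>
        integrable (\<mu> \<Otimes>\<^sub>M lborel) (\<lambda>(z, y). \<phi> (2 powi k *\<^sub>R x - y) * D (2 powi (- k) *\<^sub>R z) (2 powi (- k) *\<^sub>R y)) \<and>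
        lp_piece \<psi> u k x = (LINT p|(\<mu> \<Otimes>\<^sub>M lborel). \<phi> (2 powi k *\<^sub>R x - snd p) * D (2 powi (- k) *\<^sub>R fst p) (2 powi (- k) *\<^sub>R snd p)))"

lemma dyadic_0 [simp]: "dyadic \<psi> 0 = \<psi>"
  by (rule ext) (simp add: dyadic_def)

lemma iter_diff_scale: "iter_diff L (\<lambda>y. F (a *\<^sub>R y)) z y = iter_diff L F (a *\<^sub>R z) (a *\<^sub>R y)"
  unfolding iter_diff_sum by (simp add: scaleR_add_right mult.commute)

lemma recovers_identity:
  fixes \<psi> :: "real^'n::finite \<Rightarrow> complex"
  assumes "recovers \<psi> L \<mu> \<phi>" and g: "tame g"
  shows "integrable (\<mu> \<Otimes>\<^sub>M lborel) (\<lambda>(z, y). \<phi> (x - y) * iter_diff L g z y)"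
    and "(LINT p|(\<mu> \<Otimes>\<^sub>M lborel). \<phi> (x - snd p) * iter_diff L g (fst p) (snd p)) = cnv \<psi> g x"
proof -
  obtain a b where \<mu>: "finite_measure \<mu>" "sets \<mu> = sets borel" "AE z in \<mu>. a \<le> norm z \<and> norm z \<le> b"
    and \<phi>: "rapid \<phi>" "\<And>x. (LINT z|\<mu>. iter_diff L \<phi> z x) = \<psi> x"
    using assms(1) unfolding recovers_def by blast
  have b: "AE z in \<mu>. norm z \<le> b" using \<mu>(3) by (rule eventually_mono) simp
  show "integrable (\<mu> \<Otimes>\<^sub>M lborel) (\<lambda>(z, y). \<phi> (x - y) * iter_diff L g z y)"
    by (rule mean_diff_identity(1)[OF \<mu>(1,2) b \<phi>(1) g])
  show "(LINT p|(\<mu> \<Otimes>\<^sub>M lborel). \<phi> (x - snd p) * iter_diff L g (fst p) (snd p)) = cnv \<psi> g x"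
    unfolding mean_diff_identity(2)[OF \<mu>(1,2) b \<phi>(1) g] \<phi>(2) cnv_def ..
qed

text \<open>After dilation by 2^k the identity is the one at scale 1,
  \<open>recovers_identity\<close>, for the dilated representative.\<close>

lemma reproduces_function_rep:
  fixes \<psi> :: "real^'n::finite \<Rightarrow> complex"
  assumes \<psi>: "littlewood_paley \<psi>" and F: "function_rep u F"
  shows "reproduces \<psi> L u (iter_diff L F)"
  unfolding reproduces_def
proof (intro conjI allI impI)
  have tF: "tame F" by (rule function_rep_tame[OF F])
  show "(\<lambda>p. iter_diff L F (fst p) (snd p)) \<in> borel_measurable (borel \<Otimes>\<^sub>M borel)"
    by (rule iter_diff_measurable[OF tame_measurable[OF tF]])
  fix \<mu> \<phi> k x assume r: "recovers \<psi> L \<mu> \<phi>"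
  let ?G = "\<lambda>y. F (2 powi (- k) *\<^sub>R y)"
  have tG: "tame ?G" by (rule tame_scale[OF tF]) simp
  note id = recovers_identity[OF r tG, of "2 powi k *\<^sub>R x"]
  show "integrable (\<mu> \<Otimes>\<^sub>M lborel) (\<lambda>(z, y). \<phi> (2 powi k *\<^sub>R x - y) * iter_diff L F (2 powi (- k) *\<^sub>R z) (2 powi (- k) *\<^sub>R y))"
    using id(1) unfolding iter_diff_scale .
  have "lp_piece \<psi> u k x = cnv (dyadic \<psi> (0 + k)) F (2 powi (- k) *\<^sub>R (2 powi k *\<^sub>R x))"
    unfolding lp_piece_eq_cnv[OF \<psi> F] by (simp add: power_int_minus)
  also have "\<dots> = cnv \<psi> ?G (2 powi k *\<^sub>R x)" unfolding cnv_dyadic_dilate[symmetric] by simp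
  finally show "lp_piece \<psi> u k x = (LINT p|(\<mu> \<Otimes>\<^sub>M lborel). \<phi> (2 powi k *\<^sub>R x - snd p) * iter_diff L F (2 powi (- k) *\<^sub>R fst p) (2 powi (- k) *\<^sub>R snd p))"
    using id(2) unfolding iter_diff_scale by simp
qed

subsection \<open>Pointwise lower bounds\<close>

text \<open>Sphere and annulus are treated together; the radii 1 and 2 enclose both supports. The
  remaining assumptions are those of \<open>difference_mean\<close> that survive dilation.\<close>

locale base_measure =
  fixes \<beta> :: "(real^'n::finite) measure"
  assumes finite_\<beta>: "finite_measure \<beta>" and sets_\<beta> [simp, measurable_cong]: "sets \<beta> = sets borel"
    and supp_\<beta>: "AE z in \<beta>. 1 \<le> norm z \<and> norm z \<le> 2"
    and sym_\<beta>: "distr \<beta> borel uminus = \<beta>"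
    and nondeg_\<beta>: "\<And>\<xi>. \<xi> \<noteq> 0 \<Longrightarrow> \<not> (AE z in \<beta>. z \<bullet> \<xi> = 0)"
begin

text \<open>The dilated measure lives at radii up to 2t, so the hypothesis on \<open>t\<close> is
  the smallness condition 4L\<rho> < 1 with \<rho> = 2t.\<close>

lemma recovers_scaled:
  assumes \<psi>: "littlewood_paley \<psi>" and L: "1 \<le> L" and t: "0 < t" "8 * real L * t < 1"
  shows "\<exists>\<phi>. recovers \<psi> L (distr \<beta> borel (\<lambda>z. t *\<^sub>R z)) \<phi>"
proof -
  let ?\<mu> = "distr \<beta> borel (\<lambda>z. t *\<^sub>R z)"
  interpret finite_measure \<beta> by (rule finite_\<beta>)
  have AE: "AE z in ?\<mu>. t \<le> norm z \<and> norm z \<le> 2 * t"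
    by (subst AE_distr_iff) (use supp_\<beta> t in \<open>auto simp: mult.commute elim!: eventually_mono\<close>)
  interpret difference_mean ?\<mu> L "2 * t" \<psi>
  proof (rule difference_mean.intro)
    show "finite_measure ?\<mu>" by (rule finite_measure_distr) measurable
    show "AE z in ?\<mu>. norm z \<le> 2 * t" using AE by (rule eventually_mono) simp
    have "distr ?\<mu> borel uminus = distr (distr \<beta> borel uminus) borel (\<lambda>z. t *\<^sub>R z)" by (simp add: distr_distr comp_def)
    then show "distr ?\<mu> borel uminus = ?\<mu>" by (simp add: sym_\<beta>)
    fix \<xi> :: "real^'n" assume "\<xi> \<noteq> 0"
    from nondeg_\<beta>[OF this] show "\<not> (AE z in ?\<mu>. z \<bullet> \<xi> = 0)" using t by (subst AE_distr_iff) auto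
  qed (use L t \<psi> in auto)
  have "recovers \<psi> L ?\<mu> kernel" unfolding recovers_def using AE t rapid_kernel mean_iter_diff_kernel finite by auto
  then show ?thesis by blast
qed

end

lemma nn_integral_rapid_weight_finite:
  assumes "rapid (\<phi> :: real^'n::finite \<Rightarrow> complex)" "0 < t" "0 \<le> \<sigma>"
  shows "(\<integral>\<^sup>+w. ennreal (cmod (\<phi> w) * (1 + norm w / t) powr \<sigma>) \<partial>lborel) < top"
proof -
  have [measurable]: "\<phi> \<in> borel_measurable borel" using assms by auto
  define N where "N = nat \<lceil>\<sigma>\<rceil>"
  define m where "m = (1 + 1 / t) ^ N"
  have le: "cmod (\<phi> w) * (1 + norm w / t) powr \<sigma> \<le> m * (cmod (\<phi> w) * (1 + norm w) ^ N)" for w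
  proof -
    have "(1 + norm w / t) powr \<sigma> \<le> (1 + norm w / t) powr (real N)" using assms unfolding N_def by (intro powr_mono) auto
    also have "\<dots> = (1 + norm w / t) ^ N" using assms by (intro powr_realpow) (simp add: add_pos_nonneg)
    also have "\<dots> \<le> ((1 + 1 / t) * (1 + norm w)) ^ N" using assms by (intro power_mono) (auto simp: field_simps)
    finally have "(1 + norm w / t) powr \<sigma> \<le> m * (1 + norm w) ^ N" by (simp only: power_mult_distrib m_def)
    from mult_left_mono[OF this norm_ge_zero[of "\<phi> w"]] show ?thesis by (simp only: ac_simps)
  qed
  have "(\<integral>\<^sup>+w. ennreal (cmod (\<phi> w) * (1 + norm w / t) powr \<sigma>) \<partial>lborel)
     \<le> (\<integral>\<^sup>+w. ennreal (m * (cmod (\<phi> w) * (1 + norm w) ^ N)) \<partial>lborel)"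
    by (intro nn_integral_mono ennreal_leI le)
  also have "\<dots> < top"
    using integrable_mult_right[OF rapid_weight_integrable[OF assms(1), of N], of m]
    unfolding integrable_iff_bounded real_norm_def using assms(2)
    by (simp add: m_def abs_mult power_abs less_top abs_of_nonneg)
  finally show ?thesis .
qed

lemma AE_peetre_max:
  assumes [measurable]: "G \<in> borel_measurable borel" and t: "0 < t"
  shows "AE v in lborel. ennreal (cmod (G (x - v))) \<le> ennreal ((1 + norm v / t) powr (real CARD('n) / r)) * peetre_max r t G (x :: real^'n::finite)"
proof -
  have "AE v in lborel. ennreal (cmod (G (x - v)) * (1 + norm v / t) powr (- (real CARD('n) / r))) \<le> peetre_max r t G x"
    unfolding peetre_max_def by (rule esssup_AE)
  then show ?thesis
  proof (rule eventually_mono)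
    fix v :: "real^'n"
    let ?w = "(1 + norm v / t) powr (real CARD('n) / r)"
    have "0 < 1 + norm v / t" using t by (intro add_pos_nonneg) auto
    then have w: "0 < ?w" by (simp add: add_pos_nonneg)
    assume "ennreal (cmod (G (x - v)) * (1 + norm v / t) powr (- (real CARD('n) / r))) \<le> peetre_max r t G x"
    then have "ennreal ?w * ennreal (cmod (G (x - v)) * (1 + norm v / t) powr (- (real CARD('n) / r))) \<le> ennreal ?w * peetre_max r t G x"
      by (rule mult_left_mono) simp
    also have "ennreal ?w * ennreal (cmod (G (x - v)) * (1 + norm v / t) powr (- (real CARD('n) / r))) = ennreal (cmod (G (x - v)))"
      using w by (simp add: ennreal_mult[symmetric] powr_minus)
    finally show "ennreal (cmod (G (x - v))) \<le> ennreal ?w * peetre_max r t G x" .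
  qed
qed

text \<open>Here \<open>t0\<close> is the radius \<open>t\<close> measured in units of 2^-k. After
  the substitution the weighted integral of \<phi> depends on \<open>t0\<close> alone, which makes
  the lower bounds uniform in the scale.\<close>

lemma nn_integral_peetre_le:
  fixes G :: "real^'n::finite \<Rightarrow> complex"
  assumes G [measurable]: "G \<in> borel_measurable borel" and \<phi>: "rapid \<phi>" and t: "0 < t" "t0 = 2 powi k * t" and E: "peetre_max r t G x \<le> E"
  shows "(\<integral>\<^sup>+w. ennreal (cmod (\<phi> w)) * ennreal (cmod (G (x - 2 powi (- k) *\<^sub>R w))) \<partial>lborel)
     \<le> (\<integral>\<^sup>+w. ennreal (cmod (\<phi> w) * (1 + norm w / t0) powr (real CARD('n) / r)) \<partial>lborel) * E"
proof -
  have [measurable]: "\<phi> \<in> borel_measurable borel" using \<phi> by auto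
  let ?a = "2 powi k :: real"
  have a: "0 < ?a" by simp
  have a': "2 powi (- k) = 1 / ?a" by (simp add: power_int_minus divide_inverse)
  have "(\<integral>\<^sup>+w. ennreal (cmod (\<phi> w)) * ennreal (cmod (G (x - 2 powi (- k) *\<^sub>R w))) \<partial>lborel)
     = ennreal (\<bar>?a\<bar> ^ CARD('n)) * (\<integral>\<^sup>+v. ennreal (cmod (\<phi> (?a *\<^sub>R v))) * ennreal (cmod (G (x - v))) \<partial>lborel)"
    using nn_integral_lborel_affine[of "\<lambda>w. ennreal (cmod (\<phi> w)) * ennreal (cmod (G (x - 2 powi (- k) *\<^sub>R w)))" ?a 0] a
    by (simp add: a')
  also have "\<dots> \<le> ennreal (\<bar>?a\<bar> ^ CARD('n)) * (\<integral>\<^sup>+v. ennreal (cmod (\<phi> (?a *\<^sub>R v)) * (1 + norm v / t) powr (real CARD('n) / r)) * E \<partial>lborel)"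
  proof (intro mult_left_mono nn_integral_mono_AE)
    show "AE v in lborel. ennreal (cmod (\<phi> (?a *\<^sub>R v))) * ennreal (cmod (G (x - v))) \<le> ennreal (cmod (\<phi> (?a *\<^sub>R v)) * (1 + norm v / t) powr (real CARD('n) / r)) * E"
      using AE_peetre_max[OF G t(1), of x r]
    proof (rule eventually_mono)
      fix v :: "real^'n"
      assume "ennreal (cmod (G (x - v))) \<le> ennreal ((1 + norm v / t) powr (real CARD('n) / r)) * peetre_max r t G x"
      also have "\<dots> \<le> ennreal ((1 + norm v / t) powr (real CARD('n) / r)) * E" by (intro mult_left_mono E) simp
      finally have "ennreal (cmod (\<phi> (?a *\<^sub>R v))) * ennreal (cmod (G (x - v))) \<le> ennreal (cmod (\<phi> (?a *\<^sub>R v))) * (ennreal ((1 + norm v / t) powr (real CARD('n) / r)) * E)"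
        by (rule mult_left_mono) simp
      then show "ennreal (cmod (\<phi> (?a *\<^sub>R v))) * ennreal (cmod (G (x - v))) \<le> ennreal (cmod (\<phi> (?a *\<^sub>R v)) * (1 + norm v / t) powr (real CARD('n) / r)) * E"
        by (simp add: ennreal_mult mult.assoc)
    qed
  qed simp
  also have "\<dots> = ennreal (\<bar>?a\<bar> ^ CARD('n)) * (\<integral>\<^sup>+v. ennreal (cmod (\<phi> (?a *\<^sub>R v)) * (1 + norm (?a *\<^sub>R v) / t0) powr (real CARD('n) / r)) \<partial>lborel) * E"
    using a t by (simp add: nn_integral_multc mult.assoc)
  also have "ennreal (\<bar>?a\<bar> ^ CARD('n)) * (\<integral>\<^sup>+v. ennreal (cmod (\<phi> (?a *\<^sub>R v)) * (1 + norm (?a *\<^sub>R v) / t0) powr (real CARD('n) / r)) \<partial>lborel)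
     = (\<integral>\<^sup>+w. ennreal (cmod (\<phi> w) * (1 + norm w / t0) powr (real CARD('n) / r)) \<partial>lborel)"
    using nn_integral_lborel_affine[of "\<lambda>w. ennreal (cmod (\<phi> w) * (1 + norm w / t0) powr (real CARD('n) / r))" ?a 0] a by simp
  finally show ?thesis .
qed

text \<open>The \<mu>-integral is carried out before absolute values are taken, so the cancellation
  in the mean of the differences is kept; this is what the sphere and annulus means need.\<close>

lemma reproduces_bound:
  fixes \<psi> :: "real^'n::finite \<Rightarrow> complex"
  assumes D: "reproduces \<psi> L u D" and r: "recovers \<psi> L \<mu> \<phi>"
  shows "ennreal (cmod (lp_piece \<psi> u k x)) \<le>
     (\<integral>\<^sup>+w. ennreal (cmod (\<phi> w)) * ennreal (cmod (LINT z|\<mu>. D (2 powi (- k) *\<^sub>R z) (x - 2 powi (- k) *\<^sub>R w))) \<partial>lborel)"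
proof -
  have fin: "finite_measure \<mu>" and s [measurable_cong]: "sets \<mu> = sets borel" and \<phi>: "rapid \<phi>" using r unfolding recovers_def by auto
  have [measurable]: "\<phi> \<in> borel_measurable borel" using \<phi> by auto
  have Dm: "jointly_measurable D" using D unfolding reproduces_def by blast
  interpret finite_measure \<mu> by (rule fin)
  have pf: "pair_sigma_finite \<mu> (lborel :: (real^'n) measure)"
    by (simp add: pair_sigma_finite_def lborel.sigma_finite_measure_axioms) unfold_locales
  interpret P: pair_sigma_finite \<mu> "lborel :: (real^'n) measure" by (rule pf)
  let ?b = "2 powi (- k) :: real" let ?X = "2 powi k *\<^sub>R x"
  have bX: "?b *\<^sub>R (?X - w) = x - ?b *\<^sub>R w" for w by (simp add: scaleR_diff_right power_int_minus)
  have int: "integrable (\<mu> \<Otimes>\<^sub>M lborel) (\<lambda>(z, y). \<phi> (?X - y) * D (?b *\<^sub>R z) (?b *\<^sub>R y))"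
    and eq: "lp_piece \<psi> u k x = (LINT p|(\<mu> \<Otimes>\<^sub>M lborel). \<phi> (?X - snd p) * D (?b *\<^sub>R fst p) (?b *\<^sub>R snd p))"
    using D r unfolding reproduces_def by blast+
  define H where "H y = (LINT z|\<mu>. D (?b *\<^sub>R z) y)" for y
  have "(\<lambda>p. D (?b *\<^sub>R snd p) (fst p)) \<in> borel_measurable (borel \<Otimes>\<^sub>M \<mu>)" by (rule measurable_joint[OF Dm]) measurable
  then have Hm [measurable]: "H \<in> borel_measurable borel"
    unfolding H_def by (intro borel_measurable_lebesgue_integral) (simp add: case_prod_beta')
  have "lp_piece \<psi> u k x = (LINT y|lborel. LINT z|\<mu>. \<phi> (?X - y) * D (?b *\<^sub>R z) (?b *\<^sub>R y))"
    using P.integral_snd[OF int] eq by (simp add: case_prod_beta')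
  also have "\<dots> = (LINT y|lborel. \<phi> (?X - y) * H (?b *\<^sub>R y))" unfolding H_def by simp
  finally have "ennreal (cmod (lp_piece \<psi> u k x)) = ennreal (cmod (LINT y|lborel. \<phi> (?X - y) * H (?b *\<^sub>R y)))" by simp
  also have "\<dots> \<le> (\<integral>\<^sup>+y. ennreal (cmod (\<phi> (?X - y) * H (?b *\<^sub>R y))) \<partial>lborel)"
  proof (cases "integrable lborel (\<lambda>y. \<phi> (?X - y) * H (?b *\<^sub>R y))")
    case True
    then show ?thesis by (rule integral_norm_bound_ennreal)
  qed (simp add: not_integrable_integral_eq)
  also have "\<dots> = (\<integral>\<^sup>+w. ennreal (cmod (\<phi> (?X - (?X - w)) * H (?b *\<^sub>R (?X - w)))) \<partial>lborel)"
    using nn_integral_lborel_reflect[of "\<lambda>y. ennreal (cmod (\<phi> (?X - y) * H (?b *\<^sub>R y)))" ?X] by simp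
  also have "\<dots> = (\<integral>\<^sup>+w. ennreal (cmod (\<phi> w)) * ennreal (cmod (H (x - ?b *\<^sub>R w))) \<partial>lborel)"
    unfolding bX by (simp add: norm_mult ennreal_mult)
  finally show ?thesis unfolding H_def .
qed

subsection \<open>Quasinorms\<close>

lemma ennpowr_top [simp]: "ennpowr top a = top"
  and ennpowr_ennreal: "0 \<le> t \<Longrightarrow> ennpowr (ennreal t) a = ennreal (t powr a)"
  by (auto simp: ennpowr_def)

lemma ennpowr_mono: "x \<le> y \<Longrightarrow> 0 \<le> a \<Longrightarrow> ennpowr x a \<le> ennpowr y a"
  by (cases x; cases y) (auto simp: ennpowr_ennreal top_unique intro!: ennreal_leI powr_mono2)

lemma ennpowr_ennpowr: "ennpowr (ennpowr x a) b = ennpowr x (a * b)"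
  by (cases x) (auto simp: ennpowr_ennreal powr_powr)

lemma ennpowr_1 [simp]: "ennpowr x 1 = x"
  by (cases x) (auto simp: ennpowr_ennreal)

lemma ennpowr_mult: "0 < c \<Longrightarrow> ennpowr (ennreal c * x) a = ennreal (c powr a) * ennpowr x a"
  by (cases x) (auto simp: ennpowr_ennreal powr_mult ennreal_mult_top ennreal_mult[symmetric])

lemma ennpowr_measurable [measurable]: "(\<lambda>x. ennpowr x a) \<in> borel_measurable borel"
  unfolding ennpowr_def by measurable

lemma le_ennpowr_inverse:
  assumes "0 < a" "ennpowr x a \<le> y" shows "x \<le> ennpowr y (1 / a)"
  using ennpowr_mono[OF assms(2), of "1 / a"] assms(1) by (simp add: ennpowr_ennpowr)

lemma ennpowr_inverse_le:
  assumes "0 < a" "x \<le> ennpowr y (1 / a)" shows "ennpowr x a \<le> y"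
  using ennpowr_mono[OF assms(2), of a] assms(1) by (simp add: ennpowr_ennpowr)

text \<open>A supremum is below the sum of powers; together with Tonelli this replaces the triangle
  inequality, which is missing for exponents below 1.\<close>

lemma ennpowr_SUP_le:
  fixes u :: "int \<Rightarrow> ennreal"
  assumes "0 < a"
  shows "ennpowr (SUP j. u j) a \<le> (\<integral>\<^sup>+j. ennpowr (u j) a \<partial>count_space UNIV)"
proof (rule ennpowr_inverse_le[OF assms], rule SUP_least)
  fix j
  have "ennpowr (u j) a \<le> (\<integral>\<^sup>+j. ennpowr (u j) a \<partial>count_space UNIV)" by (rule nn_integral_ge_point) simp
  then show "u j \<le> ennpowr (\<integral>\<^sup>+j. ennpowr (u j) a \<partial>count_space UNIV) (1 / a)" by (rule le_ennpowr_inverse[OF assms])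
qed

lemma Lp_qnorm_PInf: "Lp_qnorm M \<infinity> g = esssup M g"
  and Lp_qnorm_ereal: "Lp_qnorm M (ereal a) g = ennpowr (\<integral>\<^sup>+x. ennpowr (g x) a \<partial>M) (1 / a)"
  by (simp_all add: Lp_qnorm_def)

lemma ereal_exponent_cases:
  assumes "(0::ereal) < p" obtains "p = \<infinity>" | a where "p = ereal a" "0 < a"
  using assms by (cases p) auto

lemma Lp_qnorm_mono:
  assumes p: "0 < p" and f: "f \<in> borel_measurable M" and le: "\<And>x. f x \<le> g x"
  shows "Lp_qnorm M p f \<le> Lp_qnorm M p g"
  using p
proof (cases rule: ereal_exponent_cases)
  case 1
  then show ?thesis by (simp add: Lp_qnorm_PInf esssup_mono[OF f le])
next
  case (2 a)
  then show ?thesis unfolding 2(1) Lp_qnorm_ereal by (intro ennpowr_mono nn_integral_mono le) auto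
qed

lemma esssup_cmult_le:
  fixes f :: "'a \<Rightarrow> ennreal"
  assumes [measurable]: "f \<in> borel_measurable M"
  shows "esssup M (\<lambda>x. c * f x) \<le> c * esssup M f"
proof (rule esssup_I)
  show "AE x in M. c * f x \<le> c * esssup M f" using esssup_AE[of f M] by (rule eventually_mono) (rule mult_left_mono, auto)
qed measurable

lemma Lp_qnorm_cmult:
  assumes p: "0 < p" and f [measurable]: "f \<in> borel_measurable M" and c: "0 < c"
  shows "Lp_qnorm M p (\<lambda>x. ennreal c * f x) = ennreal c * Lp_qnorm M p f"
  using p
proof (cases rule: ereal_exponent_cases)
  case 1
  have cc: "ennreal (1 / c) * (ennreal c * y) = y" "ennreal c * (ennreal (1 / c) * y) = y" for y
    using c by (simp_all add: mult.assoc[symmetric] ennreal_mult[symmetric])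
  have "esssup M f \<le> ennreal (1 / c) * esssup M (\<lambda>x. ennreal c * f x)"
    using esssup_cmult_le[of "\<lambda>x. ennreal c * f x" M "ennreal (1 / c)"] by (simp add: cc)
  then have "ennreal c * esssup M f \<le> ennreal c * (ennreal (1 / c) * esssup M (\<lambda>x. ennreal c * f x))" by (rule mult_left_mono) simp
  then show ?thesis unfolding 1 Lp_qnorm_PInf cc by (intro antisym esssup_cmult_le f)
next
  case (2 a)
  show ?thesis unfolding 2(1) Lp_qnorm_ereal ennpowr_mult[OF c] using c 2(2) by (subst nn_integral_cmult) (auto simp: ennpowr_mult powr_powr)
qed

lemma Lp_qnorm_mono_cmult:
  assumes p: "0 < p" and f [measurable]: "f \<in> borel_measurable M" and c: "0 < c" and le: "\<And>x. f x \<le> ennreal c * g x"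
  shows "Lp_qnorm M p f \<le> ennreal c * Lp_qnorm M p g"
proof -
  have cc: "ennreal (1 / c) * (ennreal c * y) = y" "ennreal c * (ennreal (1 / c) * y) = y" for y
    using c by (simp_all add: mult.assoc[symmetric] ennreal_mult[symmetric])
  have "ennreal (1 / c) * f x \<le> g x" for x using mult_left_mono[OF le[of x], of "ennreal (1 / c)"] by (simp add: cc)
  then have "Lp_qnorm M p (\<lambda>x. ennreal (1 / c) * f x) \<le> Lp_qnorm M p g" by (intro Lp_qnorm_mono p) auto
  then have "ennreal (1 / c) * Lp_qnorm M p f \<le> Lp_qnorm M p g" using c by (simp add: Lp_qnorm_cmult[OF p f])
  from mult_left_mono[OF this, of "ennreal c"] show ?thesis by (simp add: cc)
qed

lemma lqLp_qnorm_mono_cmult: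
  assumes p: "0 < p" and q: "0 < q" and f: "\<And>k. f k \<in> borel_measurable borel" and c: "0 < c"
    and le: "\<And>k x. f k x \<le> ennreal c * g k x"
  shows "lqLp_qnorm p q f \<le> ennreal c * lqLp_qnorm p q g"
  unfolding lqLp_qnorm_def
  by (rule Lp_qnorm_mono_cmult[OF q _ c], simp, rule Lp_qnorm_mono_cmult[OF p _ c le]) (use f in simp)

lemma AE_le_esssup_count_space: "b (k::int) \<le> esssup (count_space UNIV) b"
  using esssup_AE[of b "count_space UNIV"] by (simp add: AE_count_space)

lemma Lp_qnorm_count_shift:
  fixes b :: "int \<Rightarrow> ennreal"
  assumes q: "0 < q"
  shows "Lp_qnorm (count_space UNIV) q (\<lambda>k. b (k + m)) = Lp_qnorm (count_space UNIV) q b"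
  using q
proof (cases rule: ereal_exponent_cases)
  case 1
  have le: "esssup (count_space UNIV) (\<lambda>k. b (k + m)) \<le> esssup (count_space UNIV) b" for b :: "int \<Rightarrow> ennreal" and m
    by (rule esssup_I) (auto simp: AE_count_space AE_le_esssup_count_space)
  from le[of "\<lambda>k. b (k + m)" "- m"] le[of b m] show ?thesis unfolding 1 Lp_qnorm_PInf by (simp add: antisym)
next
  case (2 a)
  have "bij (\<lambda>k::int. k + m)" by (rule bij_plus_right)
  then have "(\<integral>\<^sup>+k. ennpowr (b (k + m)) a \<partial>count_space UNIV) = (\<integral>\<^sup>+k. ennpowr (b k) a \<partial>count_space UNIV)"
    by (rule nn_integral_bij_count_space)
  then show ?thesis unfolding 2(1) Lp_qnorm_ereal by simp
qed

lemma lqLp_qnorm_shift: "0 < q \<Longrightarrow> lqLp_qnorm p q (\<lambda>k. g (k + m)) = lqLp_qnorm p q g"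
  unfolding lqLp_qnorm_def by (rule Lp_qnorm_count_shift)

text \<open>A bound by the term at scale k + m costs only a constant: the sequence quasinorm is
  translation invariant and the weight changes by a fixed power of 2.\<close>

lemma weighted_qnorm_shift_le:
  assumes p: "0 < p" and q: "0 < q" and C: "0 < C"
    and f: "\<And>k. f k \<in> borel_measurable borel" and le: "\<And>k x. f k x \<le> ennreal C * g (k + m) x"
  shows "weighted_qnorm s p q f \<le> ennreal (C * 2 powr (- of_int m * s)) * weighted_qnorm s p q g"
proof -
  have "weighted_qnorm s p q f \<le> ennreal (C * 2 powr (- of_int m * s)) *
     lqLp_qnorm p q (\<lambda>k x. ennreal (2 powr (of_int (k + m) * s)) * g (k + m) x)"
    unfolding weighted_qnorm_def
  proof (rule lqLp_qnorm_mono_cmult[OF p q])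
    fix k x
    let ?A = "2 powr (- of_int m * s)" and ?B = "2 powr (of_int (k + m) * s)"
    have e: "2 powr (of_int k * s) = ?A * ?B" by (simp add: powr_add[symmetric] algebra_simps)
    have "ennreal (2 powr (of_int k * s)) * f k x \<le> ennreal (2 powr (of_int k * s)) * (ennreal C * g (k + m) x)" by (intro mult_left_mono le) simp
    also have "\<dots> = (ennreal ?A * ennreal ?B) * (ennreal C * g (k + m) x)" unfolding e by (simp only: ennreal_mult powr_ge_zero)
    also have "\<dots> = (ennreal C * ennreal ?A) * (ennreal ?B * g (k + m) x)" by (simp only: ac_simps)
    also have "ennreal C * ennreal ?A = ennreal (C * ?A)" using C by (simp only: ennreal_mult powr_ge_zero less_imp_le)
    finally show "ennreal (2 powr (of_int k * s)) * f k x \<le> ennreal (C * ?A) * (ennreal ?B * g (k + m) x)" .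
  qed (use f C in auto)
  also have "lqLp_qnorm p q (\<lambda>k x. ennreal (2 powr (of_int (k + m) * s)) * g (k + m) x) = weighted_qnorm s p q g"
    unfolding weighted_qnorm_def by (rule lqLp_qnorm_shift[OF q, of p "\<lambda>k x. ennreal (2 powr (of_int k * s)) * g k x"])
  finally show ?thesis .
qed

section \<open>Suprema against two-sided geometric weights\<close>

definition geo :: "real \<Rightarrow> int \<Rightarrow> real" where
  "geo \<theta> i = \<theta> ^ nat \<bar>i\<bar>"

lemma geo_pos: "0 < \<theta> \<Longrightarrow> 0 < geo \<theta> i"
  by (simp add: geo_def)

lemma geo_le_1: "0 \<le> \<theta> \<Longrightarrow> \<theta> \<le> 1 \<Longrightarrow> geo \<theta> i \<le> 1"
  by (simp add: geo_def power_le_one)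

lemma geo_mult: "geo (\<theta> * \<eta>) i = geo \<theta> i * geo \<eta> i"
  by (simp add: geo_def power_mult_distrib)

lemma geo_powr: "0 < \<theta> \<Longrightarrow> geo \<theta> i powr a = geo (\<theta> powr a) i"
  unfolding geo_def by (simp add: powr_realpow[symmetric] powr_powr mult.commute)

lemma geo_minus: "geo \<theta> (i - j) = geo \<theta> (j - i)"
  by (simp add: geo_def abs_minus_commute)

lemma geo_sum_finite:
  assumes \<theta>: "0 < \<theta>" "\<theta> < 1"
  shows "\<exists>K>0. \<forall>k. (\<integral>\<^sup>+j. ennreal (geo \<theta> (j - k)) \<partial>count_space UNIV) \<le> ennreal K"
proof -
  \<comment> \<open>In the enumeration of the integers by \<open>int_decode\<close>, the n-th one
    has absolute value at least (n-1)/2. So \<theta>^|i| becomes a power of the square root of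
    \<theta> in n, with one spare factor 1/\<eta>.\<close>
  define \<eta> where "\<eta> = sqrt \<theta>"
  have \<eta>: "0 < \<eta>" "\<eta> < 1" "\<eta> * \<eta> = \<theta>" using \<theta> by (auto simp: \<eta>_def)
  define K where "K = (1 / \<eta>) * (1 / (1 - \<eta>))"
  have K: "0 < K" using \<eta> by (simp add: K_def)
  have "(\<integral>\<^sup>+j. ennreal (geo \<theta> (j - k)) \<partial>count_space UNIV) \<le> ennreal K" for k
  proof -
    have "bij (\<lambda>j::int. j + (- k))" by (rule bij_plus_right)
    from nn_integral_bij_count_space[OF this, of "\<lambda>j. ennreal (geo \<theta> j)"]
    have "(\<integral>\<^sup>+j. ennreal (geo \<theta> (j - k)) \<partial>count_space UNIV) = (\<integral>\<^sup>+j. ennreal (geo \<theta> j) \<partial>count_space UNIV)" by simp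
    also have "\<dots> = (\<integral>\<^sup>+n. ennreal (geo \<theta> (int_decode n)) \<partial>count_space UNIV)"
      by (rule nn_integral_bij_count_space[symmetric, OF bij_int_decode])
    also have "\<dots> \<le> (\<integral>\<^sup>+n. ennreal (1 / \<eta> * \<eta> ^ n) \<partial>count_space UNIV)"
    proof (intro nn_integral_mono ennreal_leI)
      fix n :: nat
      have "n \<le> 2 * nat \<bar>int_decode n\<bar> + 1" unfolding int_decode_def sum_decode_def by auto
      then have "\<eta> ^ (2 * nat \<bar>int_decode n\<bar> + 1) \<le> \<eta> ^ n" using \<eta> by (intro power_decreasing) auto
      then have "geo \<theta> (int_decode n) * \<eta> \<le> \<eta> ^ n"
        unfolding geo_def \<eta>(3)[symmetric] by (simp add: power_mult power2_eq_square mult.commute)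
      then show "geo \<theta> (int_decode n) \<le> 1 / \<eta> * \<eta> ^ n" using \<eta> by (simp add: field_simps)
    qed
    also have "\<dots> = ennreal (1 / \<eta> * (1 / (1 - \<eta>)))"
      unfolding nn_integral_count_space_nat
    proof (rule suminf_ennreal_eq)
      show "(\<lambda>n. 1 / \<eta> * \<eta> ^ n) sums (1 / \<eta> * (1 / (1 - \<eta>)))" using \<eta> by (intro sums_mult geometric_sums) simp
    qed (use \<eta> in simp)
    finally show ?thesis by (simp add: K_def)
  qed
  with K show ?thesis by blast
qed

text \<open>The weight is squared so that it can be split: one factor \<theta>^|j-k| makes the sum
  over \<open>j\<close> converge, the other remains in the supremum on the right. The constant does
  not depend on \<open>k\<close>.\<close>

lemma Lp_qnorm_SUP_le:
  assumes p: "0 < p" and \<theta>: "0 < \<theta>" "\<theta> < 1"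
  shows "\<exists>C>0. \<forall>(u :: int \<Rightarrow> 'a \<Rightarrow> ennreal) k. (\<forall>j. u j \<in> borel_measurable M) \<longrightarrow>
    Lp_qnorm M p (\<lambda>x. SUP j. ennreal (geo (\<theta> * \<theta>) (j - k)) * u j x)
      \<le> ennreal C * (SUP j. ennreal (geo \<theta> (j - k)) * Lp_qnorm M p (u j))"
  using p
proof (cases rule: ereal_exponent_cases)
  let ?h = "\<lambda>j k. ennreal (geo (\<theta> * \<theta>) (j - k))" and ?g = "\<lambda>j k. ennreal (geo \<theta> (j - k))"
  case 1
  have "Lp_qnorm M p (\<lambda>x. SUP j. ?h j k * u j x)
      \<le> ennreal 1 * (SUP j. ?g j k * Lp_qnorm M p (u j))"
    if [measurable]: "\<And>j. u j \<in> borel_measurable M" for u :: "int \<Rightarrow> 'a \<Rightarrow> ennreal" and k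
    unfolding 1 Lp_qnorm_PInf
  proof (rule esssup_I)
    have "AE x in M. \<forall>j. u j x \<le> esssup M (u j)" by (subst AE_all_countable) (auto intro: esssup_AE)
    then show "AE x in M. (SUP j. ?h j k * u j x) \<le> ennreal 1 * (SUP j. ?g j k * esssup M (u j))"
    proof (rule eventually_mono)
      fix x assume x: "\<forall>j. u j x \<le> esssup M (u j)"
      show "(SUP j. ?h j k * u j x) \<le> ennreal 1 * (SUP j. ?g j k * esssup M (u j))"
      proof (rule SUP_least)
        fix j
        have "geo (\<theta> * \<theta>) (j - k) \<le> geo \<theta> (j - k)"
          unfolding geo_mult using geo_le_1[of \<theta> "j - k"] geo_pos[of \<theta> "j - k"] \<theta> by (simp add: mult_left_le)
        then have "?h j k * u j x \<le> ?g j k * esssup M (u j)" using x by (intro mult_mono ennreal_leI) auto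
        also have "\<dots> \<le> (SUP j. ?g j k * esssup M (u j))" by (rule SUP_upper) simp
        finally show "?h j k * u j x \<le> ennreal 1 * (SUP j. ?g j k * esssup M (u j))" by simp
      qed
    qed
  qed measurable
  then show ?thesis by (intro exI[of _ 1]) auto
next
  case (2 a)
  let ?h = "\<lambda>j k. ennreal (geo (\<theta> * \<theta>) (j - k))" and ?g = "\<lambda>j k. ennreal (geo \<theta> (j - k))"
  have "0 < \<theta> powr a" "\<theta> powr a < 1" using \<theta> 2 powr_less_mono2[of a \<theta> 1] by auto
  from geo_sum_finite[OF this] obtain K where K: "0 < K" "\<And>k. (\<integral>\<^sup>+j. ennreal (geo (\<theta> powr a) (j - k)) \<partial>count_space UNIV) \<le> ennreal K" by blast
  have "Lp_qnorm M p (\<lambda>x. SUP j. ?h j k * u j x)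
      \<le> ennreal (K powr (1 / a)) * (SUP j. ?g j k * Lp_qnorm M p (u j))"
    if [measurable]: "\<And>j. u j \<in> borel_measurable M" for u :: "int \<Rightarrow> 'a \<Rightarrow> ennreal" and k
  proof -
    define S where "S = (SUP j. ?g j k * Lp_qnorm M p (u j))"
    have g: "0 < geo \<theta> (j - k)" for j by (rule geo_pos[OF \<theta>(1)])
    have trm: "(\<integral>\<^sup>+x. ennpowr (?h j k * u j x) a \<partial>M) \<le> ennreal (geo (\<theta> powr a) (j - k)) * ennpowr S a" for j
    proof -
      have "(\<integral>\<^sup>+x. ennpowr (?h j k * u j x) a \<partial>M)
          = ennreal (geo (\<theta> * \<theta>) (j - k) powr a) * (\<integral>\<^sup>+x. ennpowr (u j x) a \<partial>M)"
        using \<theta> by (subst ennpowr_mult) (auto simp: geo_pos nn_integral_cmult)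
      also have "(\<integral>\<^sup>+x. ennpowr (u j x) a \<partial>M) = ennpowr (Lp_qnorm M p (u j)) a"
        unfolding 2(1) Lp_qnorm_ereal using 2(2) by (simp add: ennpowr_ennpowr)
      also have "ennreal (geo (\<theta> * \<theta>) (j - k) powr a) * ennpowr (Lp_qnorm M p (u j)) a
          = ennreal (geo (\<theta> powr a) (j - k)) * ennpowr (?g j k * Lp_qnorm M p (u j)) a"
        using g[of j] unfolding ennpowr_mult[OF g] geo_powr[OF \<theta>(1), symmetric] geo_mult by (simp add: powr_mult ennreal_mult mult.assoc)
      also have "\<dots> \<le> ennreal (geo (\<theta> powr a) (j - k)) * ennpowr S a"
        unfolding S_def using 2(2) by (intro mult_left_mono ennpowr_mono SUP_upper) auto
      finally show ?thesis .
    qed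
    have "(\<integral>\<^sup>+x. ennpowr (SUP j. ?h j k * u j x) a \<partial>M)
       \<le> (\<integral>\<^sup>+x. (\<integral>\<^sup>+j. ennpowr (?h j k * u j x) a \<partial>count_space UNIV) \<partial>M)"
      by (intro nn_integral_mono ennpowr_SUP_le 2)
    also have "\<dots> = (\<integral>\<^sup>+j. (\<integral>\<^sup>+x. ennpowr (?h j k * u j x) a \<partial>M) \<partial>count_space UNIV)"
      by (subst nn_integral_count_space_nn_integral) auto
    also have "\<dots> \<le> (\<integral>\<^sup>+j. ennreal (geo (\<theta> powr a) (j - k)) * ennpowr S a \<partial>count_space UNIV)"
      by (intro nn_integral_mono trm)
    also have "\<dots> = (\<integral>\<^sup>+j. ennreal (geo (\<theta> powr a) (j - k)) \<partial>count_space UNIV) * ennpowr S a"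
      by (rule nn_integral_multc) simp
    also have "\<dots> \<le> ennreal K * ennpowr S a" by (intro mult_right_mono K) simp
    finally have "ennpowr (\<integral>\<^sup>+x. ennpowr (SUP j. ?h j k * u j x) a \<partial>M) (1 / a) \<le> ennpowr (ennreal K * ennpowr S a) (1 / a)"
      using 2(2) by (intro ennpowr_mono) auto
    also have "\<dots> = ennreal (K powr (1 / a)) * S" unfolding ennpowr_mult[OF K(1)] ennpowr_ennpowr using 2(2) by simp
    finally show ?thesis unfolding S_def 2(1) Lp_qnorm_ereal .
  qed
  moreover have "0 < K powr (1 / a)" using K by simp
  ultimately show ?thesis by blast
qed

text \<open>A Schur type estimate in the scale variable: the supremum is replaced by a sum of
  powers, and the weight is summable in \<open>k\<close> uniformly in \<open>j\<close>.\<close>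

lemma Lp_qnorm_count_SUP_le:
  assumes q: "0 < q" and \<theta>: "0 < \<theta>" "\<theta> < 1"
  shows "\<exists>C>0. \<forall>b :: int \<Rightarrow> ennreal. Lp_qnorm (count_space UNIV) q (\<lambda>k. SUP j. ennreal (geo \<theta> (j - k)) * b j)
     \<le> ennreal C * Lp_qnorm (count_space UNIV) q b"
  using q
proof (cases rule: ereal_exponent_cases)
  let ?g = "\<lambda>j k. ennreal (geo \<theta> (j - k))"
  case 1
  have "Lp_qnorm (count_space UNIV) q (\<lambda>k. SUP j. ?g j k * b j)
     \<le> ennreal 1 * Lp_qnorm (count_space UNIV) q b" for b :: "int \<Rightarrow> ennreal"
    unfolding 1 Lp_qnorm_PInf
  proof (rule esssup_I)
    have "?g j k * b j \<le> ennreal 1 * esssup (count_space UNIV) b" for j k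
      using \<theta> by (intro mult_mono ennreal_leI geo_le_1 AE_le_esssup_count_space) auto
    then show "AE k in count_space UNIV. (SUP j. ?g j k * b j) \<le> ennreal 1 * esssup (count_space UNIV) b" by (intro AE_I2 SUP_least)
  qed simp
  then show ?thesis by (intro exI[of _ 1]) auto
next
  case (2 a)
  let ?g = "\<lambda>j k. ennreal (geo \<theta> (j - k))"
  have "0 < \<theta> powr a" "\<theta> powr a < 1" using \<theta> 2 powr_less_mono2[of a \<theta> 1] by auto
  from geo_sum_finite[OF this] obtain K where K: "0 < K" "\<And>k. (\<integral>\<^sup>+j. ennreal (geo (\<theta> powr a) (j - k)) \<partial>count_space UNIV) \<le> ennreal K" by blast
  have "Lp_qnorm (count_space UNIV) q (\<lambda>k. SUP j. ?g j k * b j)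
     \<le> ennreal (K powr (1 / a)) * Lp_qnorm (count_space UNIV) q b" for b :: "int \<Rightarrow> ennreal"
  proof -
    have "(\<integral>\<^sup>+k. ennpowr (SUP j. ?g j k * b j) a \<partial>count_space UNIV)
       \<le> (\<integral>\<^sup>+k. (\<integral>\<^sup>+j. ennpowr (?g j k * b j) a \<partial>count_space UNIV) \<partial>count_space UNIV)"
      by (intro nn_integral_mono ennpowr_SUP_le 2)
    also have "\<dots> = (\<integral>\<^sup>+j. (\<integral>\<^sup>+k. ennpowr (?g j k * b j) a \<partial>count_space UNIV) \<partial>count_space UNIV)"
      by (subst nn_integral_count_space_nn_integral) auto
    also have "\<dots> = (\<integral>\<^sup>+j. (\<integral>\<^sup>+k. ennreal (geo (\<theta> powr a) (k - j)) \<partial>count_space UNIV) * ennpowr (b j) a \<partial>count_space UNIV)"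
      using \<theta> by (subst ennpowr_mult) (auto simp: geo_pos geo_powr nn_integral_multc geo_minus intro!: nn_integral_cong)
    also have "\<dots> \<le> (\<integral>\<^sup>+j. ennreal K * ennpowr (b j) a \<partial>count_space UNIV)"
      by (intro nn_integral_mono mult_right_mono K) simp
    also have "\<dots> = ennreal K * (\<integral>\<^sup>+j. ennpowr (b j) a \<partial>count_space UNIV)" by (rule nn_integral_cmult) simp
    finally have "ennpowr (\<integral>\<^sup>+k. ennpowr (SUP j. ?g j k * b j) a \<partial>count_space UNIV) (1 / a)
        \<le> ennpowr (ennreal K * (\<integral>\<^sup>+j. ennpowr (b j) a \<partial>count_space UNIV)) (1 / a)"
      using 2(2) by (intro ennpowr_mono) auto
    also have "\<dots> = ennreal (K powr (1 / a)) * ennpowr (\<integral>\<^sup>+j. ennpowr (b j) a \<partial>count_space UNIV) (1 / a)"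
      by (rule ennpowr_mult[OF K(1)])
    finally show ?thesis unfolding 2(1) Lp_qnorm_ereal .
  qed
  moreover have "0 < K powr (1 / a)" using K by simp
  ultimately show ?thesis by blast
qed

lemma lqLp_qnorm_SUP_le:
  assumes p: "0 < p" and q: "0 < q" and \<theta>: "0 < \<theta>" "\<theta> < 1"
  shows "\<exists>C>0. \<forall>u :: int \<Rightarrow> real^'n::finite \<Rightarrow> ennreal. (\<forall>j. u j \<in> borel_measurable borel) \<longrightarrow>
    lqLp_qnorm p q (\<lambda>k x. SUP j. ennreal (geo (\<theta> * \<theta>) (j - k)) * u j x) \<le> ennreal C * lqLp_qnorm p q u"
proof -
  obtain C where C: "0 < C" "\<And>(u :: int \<Rightarrow> real^'n \<Rightarrow> ennreal) k. (\<forall>j. u j \<in> borel_measurable lborel) \<Longrightarrow>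
    Lp_qnorm lborel p (\<lambda>x. SUP j. ennreal (geo (\<theta> * \<theta>) (j - k)) * u j x)
      \<le> ennreal C * (SUP j. ennreal (geo \<theta> (j - k)) * Lp_qnorm lborel p (u j))"
    using Lp_qnorm_SUP_le[OF p \<theta>, where M="lborel :: (real^'n) measure"] by blast
  obtain C' where C': "0 < C'" "\<And>b :: int \<Rightarrow> ennreal. Lp_qnorm (count_space UNIV) q (\<lambda>k. SUP j. ennreal (geo \<theta> (j - k)) * b j)
     \<le> ennreal C' * Lp_qnorm (count_space UNIV) q b"
    using Lp_qnorm_count_SUP_le[OF q \<theta>] by blast
  have "lqLp_qnorm p q (\<lambda>k x. SUP j. ennreal (geo (\<theta> * \<theta>) (j - k)) * u j x) \<le> ennreal (C * C') * lqLp_qnorm p q u"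
    if u: "\<forall>j. u j \<in> borel_measurable borel" for u :: "int \<Rightarrow> real^'n \<Rightarrow> ennreal"
  proof -
    have "lqLp_qnorm p q (\<lambda>k x. SUP j. ennreal (geo (\<theta> * \<theta>) (j - k)) * u j x)
       \<le> ennreal C * Lp_qnorm (count_space UNIV) q (\<lambda>k. SUP j. ennreal (geo \<theta> (j - k)) * Lp_qnorm lborel p (u j))"
      unfolding lqLp_qnorm_def by (rule Lp_qnorm_mono_cmult[OF q _ C(1)]) (use u C(2) in auto)
    also have "\<dots> \<le> ennreal C * (ennreal C' * lqLp_qnorm p q u)" unfolding lqLp_qnorm_def by (intro mult_left_mono C') simp
    also have "\<dots> = ennreal (C * C') * lqLp_qnorm p q u" using C(1) C'(1) by (simp add: ennreal_mult mult.assoc)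
    finally show ?thesis .
  qed
  moreover have "0 < C * C'" using C C' by simp
  ultimately show ?thesis by blast
qed

text \<open>Essential suprema of non-measurable functions are \<open>top\<close>, so that the upper bounds need this.\<close>

lemma esssup_measurable:
  fixes h :: "'a \<times> 'b \<Rightarrow> ennreal"
  assumes M: "sigma_finite_measure M" and h [measurable]: "h \<in> borel_measurable (N \<Otimes>\<^sub>M M)"
  shows "(\<lambda>x. esssup M (\<lambda>y. h (x, y))) \<in> borel_measurable N"
proof (rule borel_measurableI_greater)
  interpret sigma_finite_measure M by fact
  fix c :: ennreal
  \<comment> \<open>A superlevel set of the essential supremum consists of the parameters whose
    section has positive measure, and the measure of a section is a measurable function of the
    parameter.\<close>
  have eq: "c < esssup M (\<lambda>y. h (x, y)) \<longleftrightarrow> 0 < emeasure M {y \<in> space M. c < h (x, y)}" if x: "x \<in> space N" for x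
  proof
    define k where "k y = h (x, y)" for y
    have hm [measurable]: "k \<in> borel_measurable M" unfolding k_def using x by measurable
    have keq: "(\<lambda>y. h (x, y)) = k" by (rule ext) (simp only: k_def)
    show "c < esssup M (\<lambda>y. h (x, y)) \<Longrightarrow> 0 < emeasure M {y \<in> space M. c < h (x, y)}"
      unfolding keq k_def[symmetric] by (rule esssup_pos_measure[OF hm])
    show "c < esssup M (\<lambda>y. h (x, y))" if "0 < emeasure M {y \<in> space M. c < h (x, y)}"
      unfolding keq
    proof (rule ccontr)
      have pos: "0 < emeasure M {y \<in> space M. c < k y}" using that by (simp add: k_def)
      assume "\<not> c < esssup M k"
      then have "{y \<in> space M. c < k y} \<subseteq> {y \<in> space M. esssup M k < k y}" by auto
      then have "emeasure M {y \<in> space M. c < k y} \<le> emeasure M {y \<in> space M. esssup M k < k y}" by (rule emeasure_mono) measurable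
      also have "\<dots> = 0" by (rule esssup_zero_measure)
      finally show False using pos by simp
    qed
  qed
  have "{x \<in> space N. c < esssup M (\<lambda>y. h (x, y))} = {x \<in> space N. 0 < emeasure M (Pair x -` {p \<in> space (N \<Otimes>\<^sub>M M). c < h p})}"
  proof (intro Collect_cong conj_cong refl)
    fix x assume x: "x \<in> space N"
    then have "Pair x -` {p \<in> space (N \<Otimes>\<^sub>M M). c < h p} = {y \<in> space M. c < h (x, y)}" by (auto simp: space_pair_measure)
    with eq[OF x] show "c < esssup M (\<lambda>y. h (x, y)) \<longleftrightarrow> 0 < emeasure M (Pair x -` {p \<in> space (N \<Otimes>\<^sub>M M). c < h p})" by simp
  qed
  also have "\<dots> \<in> sets N" using measurable_emeasure_Pair[of "{p \<in> space (N \<Otimes>\<^sub>M M). c < h p}" N] by measurable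
  finally show "{x \<in> space N. c < esssup M (\<lambda>y. h (x, y))} \<in> sets N" .
qed

subsection \<open>Peetre's inequality\<close>

lemma weight_powr_triangle:
  assumes "0 \<le> s"
  shows "(1 + norm (x + y)) powr s \<le> (1 + norm x) powr s * (1 + norm (y::'a::real_normed_vector)) powr s"
  unfolding powr_mult[symmetric] using assms weight_triangle[of x y] by (intro powr_mono2) auto

lemma weight_powr_shift:
  assumes "0 \<le> s"
  shows "(1 + norm (x + y)) powr (- s) \<le> (1 + norm x) powr (- s) * (1 + norm (y::'a::real_normed_vector)) powr s"
proof -
  have "(1 + norm x) powr s \<le> (1 + norm (x + y)) powr s * (1 + norm y) powr s" using weight_powr_triangle[OF assms, of "x + y" "- y"] by simp
  moreover have "0 < (1 + norm x) powr s" "0 < (1 + norm (x + y)) powr s" by simp_all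
  ultimately show ?thesis by (simp add: powr_minus field_simps)
qed

lemma rapid_bound_powr:
  assumes "rapid K" "0 \<le> s"
  shows "\<exists>C>0. \<forall>x. cmod (K x) \<le> C * (1 + norm x) powr (- s)"
proof -
  obtain C where C: "0 < C" "\<And>x. cmod (K x) \<le> C / (1 + norm x) ^ nat \<lceil>s\<rceil>"
    using rapid_bound[OF assms(1), of "nat \<lceil>s\<rceil>"] by blast
  have "C / (1 + norm x) ^ nat \<lceil>s\<rceil> \<le> C * (1 + norm x) powr (- s)" for x :: "real^'a"
  proof -
    have "(1 + norm x) powr s \<le> (1 + norm x) powr (real (nat \<lceil>s\<rceil>))" using assms(2) by (intro powr_mono) auto
    also have "\<dots> = (1 + norm x) ^ nat \<lceil>s\<rceil>" by (rule powr_realpow) simp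
    finally have "C / (1 + norm x) ^ nat \<lceil>s\<rceil> \<le> C / (1 + norm x) powr s" using C(1) by (intro divide_left_mono) auto
    then show ?thesis by (simp add: powr_minus divide_inverse)
  qed
  with C show ?thesis by (meson order_trans)
qed

abbreviation peetre_integral :: "real \<Rightarrow> real \<Rightarrow> (real^'n::finite \<Rightarrow> complex) \<Rightarrow> real^'n \<Rightarrow> ennreal" where
  "peetre_integral p s g x \<equiv> (\<integral>\<^sup>+y. ennreal (cmod (g y) powr p * (1 + norm (x - y)) powr (- s)) \<partial>lborel)"

lemma norm_cnv_le: "ennreal (cmod (cnv K g x)) \<le> (\<integral>\<^sup>+y. ennreal (cmod (K (x - y)) * cmod (g y)) \<partial>lborel)"
proof (cases "integrable lborel (\<lambda>y. K (x - y) * g y)")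
  case True
  from integral_norm_bound_ennreal[OF True] show ?thesis unfolding cnv_def norm_mult .
qed (simp add: cnv_def not_integrable_integral_eq)

text \<open>A self-improving estimate. With \<open>A\<close> the weighted supremum of |g|, the
  reproducing formula gives A \<le> C A^(1-p) J, and dividing yields the claim. The growth
  hypothesis serves to make \<open>A\<close> finite; its constant \<open>B\<close> does not enter
  \<open>C\<close>.\<close>

lemma peetre_le_1:
  fixes K :: "real^'n::finite \<Rightarrow> complex"
  assumes p: "0 < p" "p \<le> 1" and K: "rapid K" and s: "0 \<le> s"
  shows "\<exists>C>0. \<forall>g B x. g \<in> borel_measurable borel \<longrightarrow> (\<forall>x. g x = cnv K g x) \<longrightarrow> (\<forall>x. cmod (g x) \<le> B * (1 + norm x) powr (s / p)) \<longrightarrow>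
    ennreal (cmod (g x) powr p) \<le> ennreal C * peetre_integral p s g x"
proof -
  have sp: "0 \<le> s / p" using p s by simp
  obtain C where C: "0 < C" "\<And>x. cmod (K x) \<le> C * (1 + norm x) powr (- (s / p))"
    using rapid_bound_powr[OF K sp] by blast
  have [measurable]: "K \<in> borel_measurable borel" using K by auto
  have "ennreal (cmod (g x) powr p) \<le> ennreal C * peetre_integral p s g x"
    if g [measurable]: "g \<in> borel_measurable borel" and eq: "\<And>x. g x = cnv K g x" and B: "\<And>x. cmod (g x) \<le> B * (1 + norm x) powr (s / p)"
    for g :: "real^'n \<Rightarrow> complex" and B x
  proof -
    define J where "J = peetre_integral p s g x"
    define a where "a v = cmod (g (x - v)) * (1 + norm v) powr (- (s / p))" for v
    have B0: "0 \<le> B" using order_trans[OF norm_ge_zero B[of 0]] by simp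
    have bdd: "bdd_above (range a)"
    proof (rule bdd_aboveI2)
      fix v
      have "cmod (g (x - v)) \<le> B * (1 + norm (x - v)) powr (s / p)" by (rule B)
      also have "\<dots> \<le> B * ((1 + norm x) powr (s / p) * (1 + norm v) powr (s / p))"
        using weight_powr_triangle[OF sp, of x "- v"] B0 by (intro mult_left_mono) auto
      finally have "a v \<le> B * ((1 + norm x) powr (s / p) * (1 + norm v) powr (s / p)) * (1 + norm v) powr (- (s / p))"
        unfolding a_def by (rule mult_right_mono) simp
      also have "\<dots> = B * (1 + norm x) powr (s / p)" by (simp add: powr_minus)
      finally show "a v \<le> B * (1 + norm x) powr (s / p)" .
    qed
    define A where "A = (SUP v. a v)"
    have aA: "a v \<le> A" for v unfolding A_def by (rule cSUP_upper[OF _ bdd]) simp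
    have a0: "0 \<le> a v" for v by (simp add: a_def)
    have A0: "0 \<le> A" using a0[of 0] aA[of 0] by linarith
    have gy: "cmod (g y) \<le> A * (1 + norm (x - y)) powr (s / p)" for y
    proof -
      have "0 < (1 + norm (x - y)) powr (s / p)" by simp
      then show ?thesis using aA[of "x - y"] by (simp add: a_def powr_minus divide_inverse[symmetric] pos_divide_le_eq)
    qed
    \<comment> \<open>Of |g| = |g|^p |g|^(1-p) the second factor is bounded through
      \<open>A\<close>; the exponents of the weight then add up to -s.\<close>
    have key: "cmod (g y) * (1 + norm (x - y)) powr (- (s / p)) \<le> A powr (1 - p) * (cmod (g y) powr p * (1 + norm (x - y)) powr (- s))" for y
    proof (cases "g y = 0")
      case False
      let ?W = "1 + norm (x - y)"
      have W: "0 < ?W" by simp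
      have "cmod (g y) = cmod (g y) powr p * cmod (g y) powr (1 - p)" using False by (simp add: powr_add[symmetric])
      also have "\<dots> \<le> cmod (g y) powr p * (A * ?W powr (s / p)) powr (1 - p)" using p by (intro mult_left_mono powr_mono2 gy) auto
      also have "\<dots> = cmod (g y) powr p * (A powr (1 - p) * ?W powr (s / p * (1 - p)))" using A0 by (simp add: powr_mult powr_powr)
      finally have "cmod (g y) * ?W powr (- (s / p)) \<le> cmod (g y) powr p * (A powr (1 - p) * ?W powr (s / p * (1 - p))) * ?W powr (- (s / p))"
        by (rule mult_right_mono) simp
      also have "\<dots> = A powr (1 - p) * (cmod (g y) powr p * (?W powr (s / p * (1 - p)) * ?W powr (- (s / p))))" by (simp only: ac_simps)
      also have "?W powr (s / p * (1 - p)) * ?W powr (- (s / p)) = ?W powr (- s)" using p by (simp add: powr_add[symmetric] field_simps)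
      finally show ?thesis .
    qed simp
    have av: "ennreal (a v) \<le> ennreal (C * A powr (1 - p)) * J" for v
    proof -
      have "ennreal (a v) = ennreal (cmod (cnv K g (x - v))) * ennreal ((1 + norm v) powr (- (s / p)))"
        unfolding a_def eq[of "x - v", symmetric] by (simp add: ennreal_mult)
      also have "\<dots> \<le> (\<integral>\<^sup>+y. ennreal (cmod (K (x - v - y)) * cmod (g y)) \<partial>lborel) * ennreal ((1 + norm v) powr (- (s / p)))"
        by (rule mult_right_mono[OF norm_cnv_le]) simp
      also have "\<dots> = (\<integral>\<^sup>+y. ennreal (cmod (K (x - v - y)) * cmod (g y)) * ennreal ((1 + norm v) powr (- (s / p))) \<partial>lborel)"
        by (rule nn_integral_multc[symmetric]) measurable
      also have "\<dots> \<le> (\<integral>\<^sup>+y. ennreal (C * A powr (1 - p)) * ennreal (cmod (g y) powr p * (1 + norm (x - y)) powr (- s)) \<partial>lborel)"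
      proof (rule nn_integral_mono)
        fix y
        have "cmod (K (x - v - y)) \<le> C * (1 + norm ((x - y) + (- v))) powr (- (s / p))" using C(2)[of "x - v - y"] by (simp add: algebra_simps)
        also have "\<dots> \<le> C * ((1 + norm (x - y)) powr (- (s / p)) * (1 + norm v) powr (s / p))"
          using weight_powr_shift[OF sp, of "x - y" "- v"] C(1) by (intro mult_left_mono) auto
        finally have "cmod (K (x - v - y)) * (cmod (g y) * (1 + norm v) powr (- (s / p)))
            \<le> C * ((1 + norm (x - y)) powr (- (s / p)) * (1 + norm v) powr (s / p)) * (cmod (g y) * (1 + norm v) powr (- (s / p)))"
          by (rule mult_right_mono) simp
        also have "\<dots> = C * (cmod (g y) * (1 + norm (x - y)) powr (- (s / p)))" by (simp add: powr_minus)
        also have "\<dots> \<le> C * (A powr (1 - p) * (cmod (g y) powr p * (1 + norm (x - y)) powr (- s)))"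
          using C(1) by (intro mult_left_mono key) auto
        finally have "cmod (K (x - v - y)) * cmod (g y) * (1 + norm v) powr (- (s / p)) \<le> C * A powr (1 - p) * (cmod (g y) powr p * (1 + norm (x - y)) powr (- s))"
          by (simp only: mult.assoc)
        from ennreal_leI[OF this] C(1)
        show "ennreal (cmod (K (x - v - y)) * cmod (g y)) * ennreal ((1 + norm v) powr (- (s / p)))
            \<le> ennreal (C * A powr (1 - p)) * ennreal (cmod (g y) powr p * (1 + norm (x - y)) powr (- s))"
          by (simp only: ennreal_mult[symmetric] mult_nonneg_nonneg norm_ge_zero powr_ge_zero less_imp_le)
      qed
      also have "\<dots> = ennreal (C * A powr (1 - p)) * J" unfolding J_def by (rule nn_integral_cmult) measurable
      finally show ?thesis .
    qed
    show ?thesis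
    proof (cases J)
      case top
      then show ?thesis using C(1) unfolding J_def by (simp add: ennreal_mult_top)
    next
      case (real j)
      have "a v \<le> C * A powr (1 - p) * j" for v using av[of v] real C(1) by (simp add: ennreal_mult[symmetric])
      \<comment> \<open>The bound was proved for every \<open>v\<close> with the same right-hand
        side, so it passes to the supremum.\<close>
      then have le: "A \<le> C * A powr (1 - p) * j" unfolding A_def by (intro cSUP_least) auto
      have "A powr p \<le> C * j"
      proof (cases "A = 0")
        case False
        with A0 have A: "0 < A" by simp
        have "A powr p * A powr (1 - p) = A" using A by (simp add: powr_add[symmetric])
        with le have "A powr p * A powr (1 - p) \<le> (C * j) * A powr (1 - p)" by (simp add: ac_simps)
        then show ?thesis using A by simp
      qed (use C real in simp)
      moreover have "cmod (g x) powr p \<le> A powr p" using aA[of 0] p by (intro powr_mono2) (auto simp: a_def)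
      ultimately have "ennreal (cmod (g x) powr p) \<le> ennreal (C * j)" by (intro ennreal_leI) linarith
      then show ?thesis using real C(1) unfolding J_def by (simp add: ennreal_mult)
    qed
  qed
  with C(1) show ?thesis by blast
qed

text \<open>Instead of Hoelder, |g| \<le> l^(1-p)|g|^p + l with a free parameter \<open>l\<close>.
  It splits the reproducing integral into a multiple of \<open>J\<close> and a multiple of the norm
  of \<open>K\<close>, and l^p close to \<open>J\<close> balances them.\<close>

lemma peetre_ge_1:
  fixes K :: "real^'n::finite \<Rightarrow> complex"
  assumes p: "1 \<le> p" and K: "rapid K" and s: "0 \<le> s"
  shows "\<exists>C>0. \<forall>g x. g \<in> borel_measurable borel \<longrightarrow> (\<forall>x. g x = cnv K g x) \<longrightarrow>
    ennreal (cmod (g x) powr p) \<le> ennreal C * peetre_integral p s g x"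
proof -
  obtain C where C: "0 < C" "\<And>x. cmod (K x) \<le> C * (1 + norm x) powr (- s)"
    using rapid_bound_powr[OF K s] by blast
  have [measurable]: "K \<in> borel_measurable borel" using K by auto
  define k0 where "k0 = (LINT y|lborel. cmod (K y))"
  have k0: "0 \<le> k0" "(\<integral>\<^sup>+y. ennreal (cmod (K (x - y))) \<partial>lborel) = ennreal k0" for x
  proof -
    show "0 \<le> k0" unfolding k0_def by simp
    have "(\<integral>\<^sup>+y. ennreal (cmod (K (x - y))) \<partial>lborel) = (\<integral>\<^sup>+y. ennreal (cmod (K y)) \<partial>lborel)"
      by (rule nn_integral_lborel_reflect) measurable
    also have "\<dots> = ennreal k0" unfolding k0_def by (rule nn_integral_eq_integral[OF integrable_norm[OF rapid_integrable[OF K]]]) simp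
    finally show "(\<integral>\<^sup>+y. ennreal (cmod (K (x - y))) \<partial>lborel) = ennreal k0" .
  qed
  have "ennreal (cmod (g x) powr p) \<le> ennreal ((C + k0) powr p) * peetre_integral p s g x"
    if g [measurable]: "g \<in> borel_measurable borel" and eq: "\<And>x. g x = cnv K g x"
    for g :: "real^'n \<Rightarrow> complex" and x
  proof -
    define J where "J = peetre_integral p s g x"
    have young: "t \<le> l powr (1 - p) * t powr p + l" if "0 < l" "0 \<le> t" for t l :: real
    proof (cases "t \<le> l")
      case True
      then show ?thesis by (simp add: add_increasing)
    next
      case False
      with that have t: "0 < t" "l < t" by auto
      have "t = t powr (1 - p) * t powr p" using t by (simp add: powr_add[symmetric])
      also have "\<dots> \<le> l powr (1 - p) * t powr p" using t that p by (intro mult_right_mono powr_mono2') auto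
      finally show ?thesis using that by linarith
    qed
    have main: "ennreal (cmod (g x)) \<le> ennreal (l powr (1 - p) * C) * J + ennreal (l * k0)" if l: "0 < l" for l
    proof -
      have "ennreal (cmod (g x)) \<le> (\<integral>\<^sup>+y. ennreal (cmod (K (x - y)) * cmod (g y)) \<partial>lborel)"
        using norm_cnv_le[of K g x] eq[of x] by simp
      also have "\<dots> \<le> (\<integral>\<^sup>+y. ennreal (l powr (1 - p) * C) * ennreal (cmod (g y) powr p * (1 + norm (x - y)) powr (- s)) + ennreal l * ennreal (cmod (K (x - y))) \<partial>lborel)"
      proof (rule nn_integral_mono)
        fix y
        have "cmod (K (x - y)) * cmod (g y) \<le> cmod (K (x - y)) * (l powr (1 - p) * cmod (g y) powr p + l)" by (intro mult_left_mono young l) auto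
        also have "\<dots> = cmod (K (x - y)) * (l powr (1 - p) * cmod (g y) powr p) + l * cmod (K (x - y))" by (simp add: algebra_simps)
        also have "cmod (K (x - y)) * (l powr (1 - p) * cmod (g y) powr p) \<le> C * (1 + norm (x - y)) powr (- s) * (l powr (1 - p) * cmod (g y) powr p)"
          by (intro mult_right_mono C) auto
        finally have "cmod (K (x - y)) * cmod (g y) \<le> (l powr (1 - p) * C) * (cmod (g y) powr p * (1 + norm (x - y)) powr (- s)) + l * cmod (K (x - y))"
          by (simp add: ac_simps)
        from ennreal_leI[OF this] show "ennreal (cmod (K (x - y)) * cmod (g y)) \<le> ennreal (l powr (1 - p) * C) * ennreal (cmod (g y) powr p * (1 + norm (x - y)) powr (- s)) + ennreal l * ennreal (cmod (K (x - y)))"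
          using l C(1) by (simp add: ennreal_mult[symmetric] ennreal_plus[symmetric] del: ennreal_plus)
      qed
      also have "\<dots> = ennreal (l powr (1 - p) * C) * J + ennreal l * ennreal k0"
        unfolding J_def k0(2)[of x, symmetric] by (subst nn_integral_add) (auto simp: nn_integral_cmult)
      finally show ?thesis using l k0(1) by (simp add: ennreal_mult)
    qed
    show ?thesis
    proof (cases J)
      case top
      have "0 < (C + k0) powr p" using C(1) k0(1) by simp
      then show ?thesis using top unfolding J_def by (simp add: ennreal_mult_top)
    next
      case (real j)
      \<comment> \<open>The extra \<open>e\<close> keeps \<open>l\<close> positive when
        \<open>J\<close> vanishes; it is sent to 0 afterwards.\<close>
      have eps: "cmod (g x) powr p \<le> (C + k0) powr p * j + (C + k0) powr p * e" if e: "0 < e" for e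
      proof -
        define l where "l = (j + e) powr (1 / p)"
        have l: "0 < l" "l powr p = j + e" using real e p by (auto simp: l_def powr_powr)
        have "cmod (g x) \<le> l powr (1 - p) * C * j + l * k0"
          using main[OF l(1)] real C(1) k0(1) l(1) by (simp add: ennreal_mult[symmetric] ennreal_plus[symmetric] del: ennreal_plus)
        also have "l powr (1 - p) * C * j \<le> l powr (1 - p) * C * l powr p" using C(1) l e by (intro mult_left_mono) auto
        also have "\<dots> = C * l" using l(1) by (simp add: powr_diff)
        finally have "cmod (g x) \<le> (C + k0) * l" by (simp add: algebra_simps)
        then have "cmod (g x) powr p \<le> ((C + k0) * l) powr p" using p by (intro powr_mono2) auto
        also have "\<dots> = (C + k0) powr p * (j + e)" using C(1) k0(1) l by (simp add: powr_mult)
        finally show ?thesis by (simp add: algebra_simps)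
      qed
      have "cmod (g x) powr p \<le> (C + k0) powr p * j"
      proof (rule field_le_epsilon)
        fix e :: real assume e: "0 < e"
        have pos: "0 < (C + k0) powr p" using C(1) k0(1) by simp
        then have "(C + k0) powr p * (e / (C + k0) powr p) = e" by simp
        with eps[of "e / (C + k0) powr p"] e pos
        show "cmod (g x) powr p \<le> (C + k0) powr p * j + e" by simp
      qed
      then show ?thesis using real unfolding J_def by (simp add: ennreal_mult[symmetric] ennreal_leI)
    qed
  qed
  moreover have "0 < (C + k0) powr p" using C(1) k0(1) by simp
  ultimately show ?thesis by blast
qed

text \<open>For small exponents the inequality with a power of the weight depending on the growth of \<open>g\<close>
  shows first that \<open>g\<close> is bounded; the constant is then independent of \<open>g\<close>.\<close>

lemma peetre_inequality:
  fixes K :: "real^'n::finite \<Rightarrow> complex"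
  assumes p: "0 < p" and K: "rapid K" and s: "0 \<le> s"
  shows "\<exists>C>0. \<forall>g B M x. g \<in> borel_measurable borel \<longrightarrow> (\<forall>x. g x = cnv K g x) \<longrightarrow> (\<forall>x. cmod (g x) \<le> B * (1 + norm x) ^ M) \<longrightarrow>
    (\<integral>\<^sup>+y. ennreal (cmod (g y) powr p) \<partial>lborel) < top \<longrightarrow>
    ennreal (cmod (g x) powr p) \<le> ennreal C * peetre_integral p s g x"
proof (cases "1 \<le> p")
  case True
  from peetre_ge_1[OF True K s] show ?thesis by blast
next
  case False
  then have p1: "p \<le> 1" by simp
  obtain C where C: "0 < C" "\<And>g B x. g \<in> borel_measurable borel \<Longrightarrow> (\<forall>x. g x = cnv K g x) \<Longrightarrow> (\<forall>x. cmod (g x) \<le> B * (1 + norm x) powr (s / p)) \<Longrightarrow>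
    ennreal (cmod (g x) powr p) \<le> ennreal C * peetre_integral p s g x"
    using peetre_le_1[OF p p1 K s] by blast
  have "ennreal (cmod (g x) powr p) \<le> ennreal C * peetre_integral p s g x"
    if g: "g \<in> borel_measurable borel" "\<forall>x. g x = cnv K g x" "\<forall>x. cmod (g x) \<le> B * (1 + norm x) ^ M"
      and fin: "(\<integral>\<^sup>+y. ennreal (cmod (g y) powr p) \<partial>lborel) < top" for g :: "real^'n \<Rightarrow> complex" and B M x
  proof -
    define s' where "s' = real M * p"
    have s': "0 \<le> s'" "s' / p = real M" using p by (auto simp: s'_def)
    obtain C' where C': "0 < C'" "\<And>g B x. g \<in> borel_measurable borel \<Longrightarrow> (\<forall>x. g x = cnv K g x) \<Longrightarrow> (\<forall>x. cmod (g x) \<le> B * (1 + norm x) powr (s' / p)) \<Longrightarrow>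
      ennreal (cmod (g x) powr p) \<le> ennreal C' * peetre_integral p s' g x"
      using peetre_le_1[OF p p1 K s'(1)] by blast
    obtain m where m: "(\<integral>\<^sup>+y. ennreal (cmod (g y) powr p) \<partial>lborel) = ennreal m" "0 \<le> m"
      using fin by (cases "\<integral>\<^sup>+y. ennreal (cmod (g y) powr p) \<partial>lborel") auto
    have bound: "cmod (g x) \<le> (C' * m) powr (1 / p)" for x
    proof -
      have "\<forall>x. cmod (g x) \<le> B * (1 + norm x) powr (s' / p)" unfolding s'(2) using g(3) by (simp add: powr_realpow)
      from C'(2)[OF g(1,2) this, of x]
      have "ennreal (cmod (g x) powr p) \<le> ennreal C' * peetre_integral p s' g x" .
      also have "\<dots> \<le> ennreal C' * (\<integral>\<^sup>+y. ennreal (cmod (g y) powr p) \<partial>lborel)"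
      proof (intro mult_left_mono nn_integral_mono ennreal_leI mult_left_le)
        fix y
        have "(1 + norm (x - y)) powr (- s') \<le> (1 + norm (x - y)) powr 0" using s'(1) by (intro powr_mono) auto
        then show "(1 + norm (x - y)) powr (- s') \<le> 1" by simp
      qed auto
      also have "\<dots> = ennreal (C' * m)" using m C' by (simp add: ennreal_mult)
      finally have "cmod (g x) powr p \<le> C' * m" using C'(1) m(2) by simp
      then have "(cmod (g x) powr p) powr (1 / p) \<le> (C' * m) powr (1 / p)" using p by (intro powr_mono2) auto
      then show ?thesis using p by (simp add: powr_powr)
    qed
    have "\<forall>x. cmod (g x) \<le> (C' * m) powr (1 / p) * (1 + norm x) powr (s / p)"
    proof
      fix x :: "real^'n"
      have "(1 + norm x) powr 0 \<le> (1 + norm x) powr (s / p)" using s p by (intro powr_mono) auto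
      then have "(C' * m) powr (1 / p) * 1 \<le> (C' * m) powr (1 / p) * (1 + norm x) powr (s / p)" by (intro mult_left_mono) auto
      with bound[of x] show "cmod (g x) \<le> (C' * m) powr (1 / p) * (1 + norm x) powr (s / p)" by linarith
    qed
    then show ?thesis by (rule C(2)[OF g(1,2)])
  qed
  with C(1) show ?thesis by blast
qed

lemma cmod_powr_le_imp:
  assumes "0 < a" "ennreal (cmod z powr a) \<le> E"
  shows "ennreal (cmod z) \<le> ennpowr E (1 / a)" using assms by (intro le_ennpowr_inverse) (auto simp: ennpowr_ennreal)

text \<open>Each piece is a dilate of a function reproduced by one fixed kernel, so that estimates
  at unit scale carry constants independent of \<open>j\<close>.\<close>

lemma piece_rescale:
  fixes \<psi> :: "real^'n::finite \<Rightarrow> complex"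
  assumes \<psi>: "littlewood_paley \<psi>" and F: "tame F"
  shows "\<exists>g. tame g \<and> (\<forall>x. cnv (fat_dyadic \<psi> 0) g x = g x) \<and> (\<forall>x. piece \<psi> F j x = g (2 powi j *\<^sub>R x))"
proof -
  let ?G = "\<lambda>y. F (2 powi (- j) *\<^sub>R y)"
  have G: "tame ?G" by (rule tame_scale[OF F]) simp
  have r: "rapid (dyadic \<psi> 0)" using schwartz_rapid[OF littlewood_paleyD(1)[OF \<psi>]] by simp
  have "piece \<psi> F j x = piece \<psi> ?G 0 (2 powi j *\<^sub>R x)" for x unfolding cnv_dyadic_dilate by (simp add: power_int_minus)
  moreover have "cnv (fat_dyadic \<psi> 0) (piece \<psi> ?G 0) x = piece \<psi> ?G 0 x" for x by (rule fat_piece[OF \<psi> G])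
  moreover have "tame (piece \<psi> ?G 0)" by (rule tame_cnv[OF r G])
  ultimately show ?thesis by blast
qed

text \<open>\<open>H\<close> does not depend on the shift y because moving the centre in the Peetre
  integral costs only a factor (1 + |2^j y|)^(\<sigma>p) before the root is taken. Finiteness of the
  norm of the piece enters through \<open>peetre_inequality\<close>.\<close>

lemma peetre_majorant:
  fixes \<psi> :: "real^'n::finite \<Rightarrow> complex"
  assumes \<psi>: "littlewood_paley \<psi>" and p: "0 < p" and \<sigma>: "ereal (real CARD('n)) / p < ereal \<sigma>" "0 < \<sigma>"
  shows "\<exists>C>0. \<forall>F j. tame F \<longrightarrow> Lp_qnorm lborel p (\<lambda>x. ennreal (cmod (piece \<psi> F j x))) < top \<longrightarrow>
    (\<exists>H\<in>borel_measurable borel. (\<forall>x y. ennreal (cmod (piece \<psi> F j (x - y))) \<le> ennreal ((1 + 2 powi j * norm y) powr \<sigma>) * H x) \<and>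
       Lp_qnorm lborel p H \<le> ennreal C * Lp_qnorm lborel p (\<lambda>x. ennreal (cmod (piece \<psi> F j x))))"
proof -
  let ?N = "\<lambda>F j x. ennreal (cmod (piece \<psi> F j x))"
  define K where "K = fat_dyadic \<psi> 0"
  have K: "rapid K" unfolding K_def by (rule rapid_fat_dyadic[OF schwartz_rapid[OF littlewood_paleyD(1)[OF \<psi>]]])
  have [measurable]: "K \<in> borel_measurable borel" using K by auto
  have unit: "\<exists>g. g \<in> borel_measurable borel \<and> (\<forall>x. g x = cnv K g x) \<and> (\<exists>B M. \<forall>x. cmod (g x) \<le> B * (1 + norm x) ^ M) \<and>
      (\<forall>x. piece \<psi> F j x = g (2 powi j *\<^sub>R x))" if F: "tame F" for F :: "real^'n \<Rightarrow> complex" and j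
  proof -
    obtain g where g: "tame g" "\<And>x. cnv K g x = g x" "\<And>x. piece \<psi> F j x = g (2 powi j *\<^sub>R x)"
      using piece_rescale[OF \<psi> F, of j] unfolding K_def by blast
    obtain B M where "\<And>x. cmod (cnv K g x) \<le> B * (1 + norm x) ^ M" using cnv_growth[OF K g(1)] by blast
    with g show ?thesis by (intro exI[of _ g] conjI exI[of _ B] exI[of _ M]) auto
  qed
  show ?thesis using p
  proof (cases rule: ereal_exponent_cases)
    case 1
    \<comment> \<open>For p = \<infinity> a constant \<open>H\<close> does: \<open>k0\<close> times
      the essential supremum of the piece bounds it at every point, and the weight is at least
      1.\<close>
    define k0 where "k0 = (LINT y|lborel. cmod (K y))"
    have k0: "(\<integral>\<^sup>+y. ennreal (cmod (K y)) \<partial>lborel) = ennreal k0" "0 \<le> k0"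
      unfolding k0_def by (rule nn_integral_eq_integral[OF integrable_norm[OF rapid_integrable[OF K]]]) auto
    have "\<exists>H\<in>borel_measurable borel. (\<forall>x y. ?N F j (x - y) \<le> ennreal ((1 + 2 powi j * norm y) powr \<sigma>) * H x) \<and>
       Lp_qnorm lborel p H \<le> ennreal (k0 + 1) * Lp_qnorm lborel p (?N F j)"
      if F: "tame F" for F :: "real^'n \<Rightarrow> complex" and j
    proof -
      obtain g where g [measurable]: "g \<in> borel_measurable borel" and eq: "\<And>x. g x = cnv K g x"
        and fg: "\<And>x. piece \<psi> F j x = g (2 powi j *\<^sub>R x)" using unit[OF F, of j] by blast
      let ?c = "2 powi j :: real"
      define E where "E = esssup lborel (?N F j)"
      have AE: "AE x in lborel. ennreal (cmod (g (?c *\<^sub>R x))) \<le> E" unfolding E_def fg[symmetric] by (rule esssup_AE)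
      have gx: "ennreal (cmod (g x)) \<le> ennreal k0 * E" for x
      proof -
        have "ennreal (cmod (g x)) \<le> (\<integral>\<^sup>+y. ennreal (cmod (K (x - y)) * cmod (g y)) \<partial>lborel)"
          using norm_cnv_le[of K g x] eq[of x] by simp
        also have "\<dots> = ennreal (\<bar>?c\<bar> ^ CARD('n)) * (\<integral>\<^sup>+y. ennreal (cmod (K (x - ?c *\<^sub>R y)) * cmod (g (?c *\<^sub>R y))) \<partial>lborel)"
          using nn_integral_lborel_affine[of "\<lambda>y. ennreal (cmod (K (x - y)) * cmod (g y))" ?c 0] by simp
        also have "\<dots> \<le> ennreal (\<bar>?c\<bar> ^ CARD('n)) * (\<integral>\<^sup>+y. ennreal (cmod (K (x - ?c *\<^sub>R y))) * E \<partial>lborel)"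
        proof (intro mult_left_mono nn_integral_mono_AE)
          show "AE y in lborel. ennreal (cmod (K (x - ?c *\<^sub>R y)) * cmod (g (?c *\<^sub>R y))) \<le> ennreal (cmod (K (x - ?c *\<^sub>R y))) * E"
            using AE by (rule eventually_mono) (simp add: ennreal_mult mult_left_mono)
        qed simp
        also have "\<dots> = ennreal (\<bar>?c\<bar> ^ CARD('n)) * (\<integral>\<^sup>+y. ennreal (cmod (K (x - ?c *\<^sub>R y))) \<partial>lborel) * E"
          by (simp add: nn_integral_multc mult.assoc)
        also have "ennreal (\<bar>?c\<bar> ^ CARD('n)) * (\<integral>\<^sup>+y. ennreal (cmod (K (x - ?c *\<^sub>R y))) \<partial>lborel) = (\<integral>\<^sup>+y. ennreal (cmod (K (x - y))) \<partial>lborel)"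
          using nn_integral_lborel_affine[of "\<lambda>y. ennreal (cmod (K (x - y)))" ?c 0] by simp
        also have "\<dots> = ennreal k0" unfolding k0(1)[symmetric] by (rule nn_integral_lborel_reflect) measurable
        finally show ?thesis .
      qed
      have "?N F j (x - y) \<le> ennreal ((1 + ?c * norm y) powr \<sigma>) * (ennreal (k0 + 1) * E)" for x y
      proof -
        have "1 \<le> (1 + ?c * norm y) powr \<sigma>" using \<sigma>(2) by (intro ge_one_powr_ge_zero) auto
        then have "1 * (ennreal k0 * E) \<le> ennreal ((1 + ?c * norm y) powr \<sigma>) * (ennreal (k0 + 1) * E)"
          by (intro mult_mono ennreal_leI) auto
        with gx[of "?c *\<^sub>R (x - y)"] show ?thesis unfolding fg by simp
      qed
      moreover have "Lp_qnorm lborel p (\<lambda>_::real^'n. ennreal (k0 + 1) * E) \<le> ennreal (k0 + 1) * E"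
        unfolding 1 Lp_qnorm_PInf by (rule esssup_I) auto
      ultimately show ?thesis unfolding E_def 1 Lp_qnorm_PInf[symmetric]
        by (intro bexI[of _ "\<lambda>_. ennreal (k0 + 1) * Lp_qnorm lborel \<infinity> (?N F j)"]) auto
    qed
    moreover have "0 < k0 + 1" using k0 by simp
    ultimately show ?thesis by blast
  next
    case (2 a)
    let ?s = "\<sigma> * a"
    have s: "real CARD('n) < \<sigma> * a" using \<sigma>(1) 2 by (simp add: field_simps)
    have s0: "0 \<le> \<sigma> * a" using \<sigma>(2) 2 by simp
    obtain C where C: "0 < C" "\<And>g B M x. g \<in> borel_measurable borel \<Longrightarrow> (\<forall>x. g x = cnv K g x) \<Longrightarrow> (\<forall>x. cmod (g x) \<le> B * (1 + norm x) ^ M) \<Longrightarrow>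
      (\<integral>\<^sup>+y. ennreal (cmod (g y) powr a) \<partial>lborel) < top \<Longrightarrow>
      ennreal (cmod (g x) powr a) \<le> ennreal C * peetre_integral a ?s g x"
      using peetre_inequality[OF 2(2) K s0] by blast
    define W where "W = enn2real (\<integral>\<^sup>+x. ennreal ((1 + norm (x::real^'n)) powr (- ?s)) \<partial>lborel)"
    have W: "(\<integral>\<^sup>+x. ennreal ((1 + norm (x::real^'n)) powr (- ?s)) \<partial>lborel) = ennreal W" "0 \<le> W"
      unfolding W_def using nn_integral_weight_finite[where 'a="real^'n", of "\<sigma> * a"] s by auto
    have "\<exists>H\<in>borel_measurable borel. (\<forall>x y. ?N F j (x - y) \<le> ennreal ((1 + 2 powi j * norm y) powr \<sigma>) * H x) \<and>
       Lp_qnorm lborel p H \<le> ennreal ((C * (W + 1)) powr (1 / a)) * Lp_qnorm lborel p (?N F j)"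
      if F: "tame F" and fin: "Lp_qnorm lborel p (?N F j) < top" for F :: "real^'n \<Rightarrow> complex" and j
    proof -
      obtain g B M where g [measurable]: "g \<in> borel_measurable borel" and eq: "\<forall>x. g x = cnv K g x"
        and BM: "\<forall>x. cmod (g x) \<le> B * (1 + norm x) ^ M"
        and fg: "\<And>x. piece \<psi> F j x = g (2 powi j *\<^sub>R x)" using unit[OF F, of j] by blast
      let ?c = "2 powi j :: real"
      define cn where "cn = \<bar>?c\<bar> ^ CARD('n)"
      define J where "J = (\<integral>\<^sup>+x. ennreal (cmod (g (?c *\<^sub>R x)) powr a) \<partial>lborel)"
      have sc: "(\<integral>\<^sup>+x. f x \<partial>lborel) = ennreal cn * (\<integral>\<^sup>+x. f (?c *\<^sub>R x) \<partial>lborel)" if "f \<in> borel_measurable borel" for f :: "real^'n \<Rightarrow> ennreal"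
        using nn_integral_lborel_affine[OF that, of ?c 0] by (simp add: cn_def)
      have Lp: "Lp_qnorm lborel p (?N F j) = ennpowr J (1 / a)" unfolding 2(1) Lp_qnorm_ereal J_def fg by (simp add: ennpowr_ennreal)
      have Jfin: "J < top" using fin unfolding Lp by (cases J) auto
      have gfin: "(\<integral>\<^sup>+x. ennreal (cmod (g x) powr a) \<partial>lborel) < top"
        \<comment> \<open>The condition at scale \<open>j\<close> and the one at unit scale differ
          by the Jacobian \<open>cn\<close> only.\<close>
        using Jfin unfolding J_def by (subst sc) (auto simp: ennreal_mult_less_top)
      define E where "E x = ennreal C * peetre_integral a ?s g x" for x
      have [measurable]: "E \<in> borel_measurable borel" unfolding E_def by measurable
      have gE: "ennreal (cmod (g x) powr a) \<le> E x" for x unfolding E_def by (rule C(2)[OF g eq BM gfin])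
      have shift: "E (x - y) \<le> ennreal ((1 + norm y) powr ?s) * E x" for x y
      proof -
        have "(\<integral>\<^sup>+z. ennreal (cmod (g z) powr a * (1 + norm (x - y - z)) powr (- ?s)) \<partial>lborel)
          \<le> (\<integral>\<^sup>+z. ennreal ((1 + norm y) powr ?s) * ennreal (cmod (g z) powr a * (1 + norm (x - z)) powr (- ?s)) \<partial>lborel)"
        proof (rule nn_integral_mono)
          fix z
          have "(1 + norm (x - y - z)) powr (- ?s) \<le> (1 + norm (x - z)) powr (- ?s) * (1 + norm y) powr ?s"
            using weight_powr_shift[OF s0, of "x - z" "- y"] by (simp add: algebra_simps)
          then have "cmod (g z) powr a * (1 + norm (x - y - z)) powr (- ?s) \<le> cmod (g z) powr a * ((1 + norm (x - z)) powr (- ?s) * (1 + norm y) powr ?s)"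
            by (rule mult_left_mono) simp
          then have "cmod (g z) powr a * (1 + norm (x - y - z)) powr (- ?s) \<le> (1 + norm y) powr ?s * (cmod (g z) powr a * (1 + norm (x - z)) powr (- ?s))"
            by (simp only: ac_simps)
          then show "ennreal (cmod (g z) powr a * (1 + norm (x - y - z)) powr (- ?s)) \<le> ennreal ((1 + norm y) powr ?s) * ennreal (cmod (g z) powr a * (1 + norm (x - z)) powr (- ?s))"
            by (subst ennreal_mult[symmetric]) (auto intro!: ennreal_leI)
        qed
        also have "\<dots> = ennreal ((1 + norm y) powr ?s) * (\<integral>\<^sup>+z. ennreal (cmod (g z) powr a * (1 + norm (x - z)) powr (- ?s)) \<partial>lborel)"
          by (rule nn_integral_cmult) measurable
        finally have "ennreal C * (\<integral>\<^sup>+z. ennreal (cmod (g z) powr a * (1 + norm (x - y - z)) powr (- ?s)) \<partial>lborel)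
            \<le> ennreal C * (ennreal ((1 + norm y) powr ?s) * (\<integral>\<^sup>+z. ennreal (cmod (g z) powr a * (1 + norm (x - z)) powr (- ?s)) \<partial>lborel))"
          by (rule mult_left_mono) simp
        then show ?thesis unfolding E_def by (simp only: ac_simps)
      qed
      define H where "H x = ennpowr (E (?c *\<^sub>R x)) (1 / a)" for x
      have Hm: "H \<in> borel_measurable borel" unfolding H_def by measurable
      have pt: "?N F j (x - y) \<le> ennreal ((1 + ?c * norm y) powr \<sigma>) * H x" for x y
      proof -
        have "?N F j (x - y) = ennreal (cmod (g (?c *\<^sub>R x - ?c *\<^sub>R y)))" unfolding fg scaleR_diff_right ..
        also have "\<dots> \<le> ennpowr (ennreal ((1 + norm (?c *\<^sub>R y)) powr ?s) * E (?c *\<^sub>R x)) (1 / a)"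
          by (rule cmod_powr_le_imp[OF 2(2) order_trans[OF gE shift]])
        also have "\<dots> = ennreal ((1 + ?c * norm y) powr \<sigma>) * H x"
        proof -
          have "0 < 1 + ?c * norm y" by (intro add_pos_nonneg) auto
          then show ?thesis unfolding H_def using 2(2) by (subst ennpowr_mult) (auto simp: powr_powr)
        qed
        finally show ?thesis .
      qed
      have "(\<integral>\<^sup>+x. ennpowr (H x) a \<partial>lborel) = (\<integral>\<^sup>+x. E (?c *\<^sub>R x) \<partial>lborel)"
        unfolding H_def using 2(2) by (simp add: ennpowr_ennpowr)
      also have "\<dots> \<le> ennreal (C * (W + 1)) * J"
      proof -
        have "ennreal cn * (\<integral>\<^sup>+x. E (?c *\<^sub>R x) \<partial>lborel) = (\<integral>\<^sup>+x. E x \<partial>lborel)" by (rule sc[symmetric]) measurable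
        also have "\<dots> = ennreal C * (\<integral>\<^sup>+x. peetre_integral a ?s g x \<partial>lborel)"
          unfolding E_def by (rule nn_integral_cmult) measurable
        also have "(\<integral>\<^sup>+x. peetre_integral a ?s g x \<partial>lborel)
           = (\<integral>\<^sup>+y. (\<integral>\<^sup>+x. ennreal (cmod (g y) powr a * (1 + norm (x - y)) powr (- ?s)) \<partial>lborel) \<partial>lborel)"
          by (rule lborel_pair.Fubini'[symmetric]) measurable
        also have "\<dots> = (\<integral>\<^sup>+y. ennreal (cmod (g y) powr a) * ennreal W \<partial>lborel)"
        proof (rule nn_integral_cong)
          fix y :: "real^'n"
          have "(\<integral>\<^sup>+x. ennreal ((1 + norm (x - y)) powr (- ?s)) \<partial>lborel) = ennreal W"
            using nn_integral_lborel_affine[of "\<lambda>x. ennreal ((1 + norm (x - y)) powr (- ?s))" 1 y] W(1) by simp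
          then show "(\<integral>\<^sup>+x. ennreal (cmod (g y) powr a * (1 + norm (x - y)) powr (- ?s)) \<partial>lborel) = ennreal (cmod (g y) powr a) * ennreal W"
            by (simp add: ennreal_mult nn_integral_cmult)
        qed
        also have "\<dots> = (ennreal cn * J) * ennreal W"
          unfolding J_def by (subst nn_integral_multc) (auto simp: sc[of "\<lambda>y. ennreal (cmod (g y) powr a)"])
        also have "ennreal C * ((ennreal cn * J) * ennreal W) \<le> ennreal C * ((ennreal cn * J) * ennreal (W + 1))"
          by (intro mult_left_mono ennreal_leI) auto
        also have "\<dots> = ennreal cn * (ennreal (C * (W + 1)) * J)" using C(1) W(2) by (simp add: ennreal_mult ac_simps del: ennreal_plus)
        finally have "ennreal cn * (\<integral>\<^sup>+x. E (?c *\<^sub>R x) \<partial>lborel) \<le> ennreal cn * (ennreal (C * (W + 1)) * J)" .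
        from mult_left_mono[OF this, of "ennreal (1 / cn)"]
        have "(ennreal (1 / cn) * ennreal cn) * (\<integral>\<^sup>+x. E (?c *\<^sub>R x) \<partial>lborel) \<le> (ennreal (1 / cn) * ennreal cn) * (ennreal (C * (W + 1)) * J)"
          by (simp add: mult.assoc)
        moreover have "0 < cn" by (simp add: cn_def)
        then have "ennreal (1 / cn) * ennreal cn = 1" by (simp add: ennreal_mult[symmetric])
        ultimately show ?thesis by simp
      qed
      finally have "ennpowr (\<integral>\<^sup>+x. ennpowr (H x) a \<partial>lborel) (1 / a) \<le> ennpowr (ennreal (C * (W + 1)) * J) (1 / a)"
        using 2(2) by (intro ennpowr_mono) auto
      also have "\<dots> = ennreal ((C * (W + 1)) powr (1 / a)) * ennpowr J (1 / a)" using C(1) W(2) by (intro ennpowr_mult) simp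
      finally have "Lp_qnorm lborel p H \<le> ennreal ((C * (W + 1)) powr (1 / a)) * Lp_qnorm lborel p (?N F j)"
        unfolding Lp unfolding 2(1) Lp_qnorm_ereal .
      with Hm pt show ?thesis by blast
    qed
    moreover have "0 < (C * (W + 1)) powr (1 / a)" using C(1) W(2) by simp
    ultimately show ?thesis by blast
  qed
qed

subsection \<open>Differences of the pieces\<close>

text \<open>For steps of at least unit length the terms of the difference are estimated one by one;
  all shifted points satisfy 1 + |y - ih| \<le> (1 + L)|h|(1 + |y|/|h|).\<close>

lemma unit_diff_bound_high:
  assumes \<sigma>: "0 < \<sigma>" and g: "\<And>y. cmod (g (x - y)) \<le> H * (1 + norm y) powr \<sigma>" and h: "1 \<le> norm h"
  shows "cmod (iter_diff L g h (x - y)) \<le> (2 ^ L * (1 + real L) powr \<sigma>) * norm h powr \<sigma> * (1 + norm y / norm h) powr \<sigma> * H"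
proof -
  have H: "0 \<le> H" using order_trans[OF norm_ge_zero g[of 0]] by simp
  have "cmod (g ((x - y) + real i *\<^sub>R h)) \<le> H * ((1 + real L) * norm h * (1 + norm y / norm h)) powr \<sigma>" if i: "i \<le> L" for i
  proof -
    have h0: "norm h \<noteq> 0" using h by linarith
    have "norm (y - real i *\<^sub>R h) \<le> norm y + real i * norm h" using norm_triangle_ineq4[of y "real i *\<^sub>R h"] by simp
    also have "real i * norm h \<le> real L * norm h" using i by (intro mult_right_mono) auto
    finally have "1 + norm (y - real i *\<^sub>R h) \<le> norm h + real L * norm h + norm y" using h by linarith
    also have "\<dots> \<le> norm h + real L * norm h + norm y + real L * norm y" by simp
    also have "\<dots> = (1 + real L) * norm h * (1 + norm y / norm h)" using h0 by (simp add: field_simps)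
    finally have le: "1 + norm (y - real i *\<^sub>R h) \<le> (1 + real L) * norm h * (1 + norm y / norm h)" .
    have "cmod (g (x - (y - real i *\<^sub>R h))) \<le> H * (1 + norm (y - real i *\<^sub>R h)) powr \<sigma>" by (rule g)
    also have "\<dots> \<le> H * ((1 + real L) * norm h * (1 + norm y / norm h)) powr \<sigma>"
      using H \<sigma> le by (intro mult_left_mono powr_mono2) auto
    finally show ?thesis by (simp add: algebra_simps)
  qed
  from iter_diff_bound[where L=L and F=g, OF this]
  show ?thesis by (simp add: powr_mult mult.assoc) (simp add: ac_simps)
qed

lemma iter_diff_measurable_fixed [measurable]:
  assumes [measurable]: "F \<in> borel_measurable borel"
  shows "iter_diff L F h \<in> borel_measurable borel"
proof -
  have "iter_diff L F h = (\<lambda>x. \<Sum>i\<le>L. diff_coef L i *\<^sub>R F (x + real i *\<^sub>R h))" by (rule ext) (rule iter_diff_sum)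
  then show ?thesis by simp
qed

lemma cnv_iter_diff:
  assumes "rapid K" "tame g" "\<And>x. cnv K g x = g x"
  shows "iter_diff L g h x = cnv (iter_diff L K h) g x"
proof -
  have "cnv (iter_diff L K h) g x = (LINT y|lborel. (\<Sum>i\<le>L. diff_coef L i *\<^sub>R (K ((x + real i *\<^sub>R h) - y) * g y)))"
    unfolding cnv_def iter_diff_sum sum_distrib_right by (simp add: algebra_simps)
  also have "\<dots> = (\<Sum>i\<le>L. LINT y|lborel. diff_coef L i *\<^sub>R (K ((x + real i *\<^sub>R h) - y) * g y))"
    by (intro Bochner_Integration.integral_sum integrable_scaleR_right integrable_rapid_tame_reflect assms)
  also have "\<dots> = (\<Sum>i\<le>L. diff_coef L i *\<^sub>R cnv K g (x + real i *\<^sub>R h))" unfolding cnv_def by simp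
  finally show ?thesis unfolding assms(3) iter_diff_sum ..
qed

text \<open>For short steps the difference is put on the reproducing kernel, which yields |h|^L. The
  order of decay required of the kernel compensates the growth of \<open>g\<close> with the integer
  part above \<sigma> and leaves an integrable weight.\<close>

lemma unit_diff_bound_low:
  fixes K :: "real^'n::finite \<Rightarrow> complex"
  assumes \<sigma>: "0 < \<sigma>" and K: "rapid K"
    and C: "0 < C" "\<And>h x. norm h \<le> 1 \<Longrightarrow> cmod (iter_diff L K h x) \<le> C * norm h ^ L / (1 + norm x) ^ (nat \<lceil>\<sigma>\<rceil> + Suc CARD('n))"
    and eq: "tame g" "\<And>x. cnv K g x = g x"
    and g: "\<And>y. cmod (g (x - y)) \<le> H * (1 + norm y) powr \<sigma>" and h: "norm h \<le> 1" "h \<noteq> 0"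
  shows "cmod (iter_diff L g h (x - y)) \<le>
    (C * (LINT v|lborel. 1 / (1 + norm (v::real^'n)) ^ Suc CARD('n))) * norm h ^ L * (1 + norm y / norm h) powr \<sigma> * H"
proof -
  have H: "0 \<le> H" using order_trans[OF norm_ge_zero g[of 0]] by simp
  define I where "I = (LINT v|lborel. 1 / (1 + norm (v::real^'n)) ^ Suc CARD('n))"
  have int: "integrable lborel (\<lambda>v::real^'n. 1 / (1 + norm v) ^ Suc CARD('n))" by (rule integrable_weight) simp
  let ?z = "x - y"
  define A where "A = C * norm h ^ L * (1 + norm y) powr \<sigma> * H"
  have A: "0 \<le> A" using C(1) H by (simp add: A_def)
  have bd: "cmod (iter_diff L K h (?z - w) * g w) \<le> A * (1 / (1 + norm (?z - w)) ^ Suc CARD('n))" for w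
  proof -
    let ?v = "?z - w"
    have "cmod (g w) \<le> H * (1 + norm (?v + y)) powr \<sigma>" using g[of "x - w"] by (simp add: algebra_simps)
    also have "\<dots> \<le> H * ((1 + norm ?v) powr \<sigma> * (1 + norm y) powr \<sigma>)"
      using weight_powr_triangle[of \<sigma> ?v y] \<sigma> H by (intro mult_left_mono) auto
    also have "\<dots> \<le> H * ((1 + norm ?v) ^ nat \<lceil>\<sigma>\<rceil> * (1 + norm y) powr \<sigma>)"
    proof (intro mult_left_mono mult_right_mono H)
      have "(1 + norm ?v) powr \<sigma> \<le> (1 + norm ?v) powr (real (nat \<lceil>\<sigma>\<rceil>))" using \<sigma> by (intro powr_mono) auto
      then show "(1 + norm ?v) powr \<sigma> \<le> (1 + norm ?v) ^ nat \<lceil>\<sigma>\<rceil>" by (simp add: powr_realpow)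
    qed simp
    finally have gw: "cmod (g w) \<le> H * ((1 + norm ?v) ^ nat \<lceil>\<sigma>\<rceil> * (1 + norm y) powr \<sigma>)" .
    have "cmod (iter_diff L K h ?v * g w) \<le> (C * norm h ^ L / (1 + norm ?v) ^ (nat \<lceil>\<sigma>\<rceil> + Suc CARD('n))) * (H * ((1 + norm ?v) ^ nat \<lceil>\<sigma>\<rceil> * (1 + norm y) powr \<sigma>))"
      unfolding norm_mult using C(1) by (intro mult_mono C h gw) auto
    also have "\<dots> = A * (1 / (1 + norm ?v) ^ Suc CARD('n))"
    proof -
      define P where "P = (1 + norm ?v) ^ nat \<lceil>\<sigma>\<rceil>"
      define Q where "Q = (1 + norm ?v) ^ Suc CARD('n)"
      have "P \<noteq> 0" by (simp add: P_def)
      then show ?thesis unfolding A_def power_add P_def[symmetric] Q_def[symmetric] by simp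
    qed
    finally show ?thesis .
  qed
  have int': "integrable lborel (\<lambda>w::real^'n. 1 / (1 + norm (?z - w)) ^ Suc CARD('n))"
    using integrable_lborel_affine[OF int, of "-1" ?z] by simp
  have "cmod (iter_diff L g h ?z) \<le> (LINT w|lborel. A * (1 / (1 + norm (?z - w)) ^ Suc CARD('n)))"
    unfolding cnv_iter_diff[OF K eq] unfolding cnv_def
  proof (rule Bochner_Integration.integral_norm_bound_integral[OF _ integrable_mult_right[OF int'] bd])
    have [measurable]: "K \<in> borel_measurable borel" "g \<in> borel_measurable borel" using K eq(1) by auto
    show "integrable lborel (\<lambda>w. iter_diff L K h (?z - w) * g w)"
    proof (rule Bochner_Integration.integrable_bound[OF integrable_mult_right[OF int', of A]])
      show "AE w in lborel. norm (iter_diff L K h (?z - w) * g w) \<le> norm (A * (1 / (1 + norm (?z - w)) ^ Suc CARD('n)))"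
        using A by (intro AE_I2 order_trans[OF bd]) simp
    qed measurable
  qed
  also have "\<dots> = A * I" unfolding I_def integral_mult_right_zero using lborel_integral_reflect[of "\<lambda>w::real^'n. 1 / (1 + norm w) ^ Suc CARD('n)" ?z] by (simp only:)
  also have "\<dots> \<le> (C * norm h ^ L * (1 + norm y / norm h) powr \<sigma> * H) * I"
  proof -
    have "norm y * norm h \<le> norm y * 1" using h by (intro mult_left_mono) auto
    then have "norm y \<le> norm y / norm h" using h by (simp add: le_divide_eq)
    then have "(1 + norm y) powr \<sigma> \<le> (1 + norm y / norm h) powr \<sigma>" using \<sigma> by (intro powr_mono2) auto
    moreover have "0 \<le> I" unfolding I_def by simp
    ultimately show ?thesis unfolding A_def using C(1) H by (intro mult_right_mono mult_left_mono) auto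
  qed
  finally show ?thesis unfolding I_def by (simp only: ac_simps)
qed

lemma fat_dyadic_diff_decay:
  fixes \<psi> :: "real^'n::finite \<Rightarrow> complex"
  assumes "schwartz \<psi>"
  shows "\<exists>C>0. \<forall>h x. norm h \<le> 1 \<longrightarrow> cmod (iter_diff L (fat_dyadic \<psi> j) h x) \<le> C * norm h ^ L / (1 + norm x) ^ N"
proof -
  have "\<exists>C>0. \<forall>h x. norm h \<le> 1 \<longrightarrow> cmod (iter_diff L (dyadic \<psi> i) h x) \<le> C * norm h ^ L / (1 + norm x) ^ N" for i
    by (rule schwartz_iter_diff_decay[OF schwartz_dyadic[OF assms]])
  then obtain C where C: "\<And>i. 0 < C i" "\<And>i h x. norm h \<le> 1 \<Longrightarrow> cmod (iter_diff L (dyadic \<psi> i) h x) \<le> C i * norm h ^ L / (1 + norm x) ^ N"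
    by metis
  have "cmod (iter_diff L (fat_dyadic \<psi> j) h x) \<le> (\<Sum>i\<in>{j - 1..j + 1}. C i) * norm h ^ L / (1 + norm x) ^ N" if h: "norm h \<le> 1" for h x
  proof -
    have "iter_diff L (fat_dyadic \<psi> j) h x = (\<Sum>i\<in>{j - 1..j + 1}. iter_diff L (dyadic \<psi> i) h x)"
      unfolding iter_diff_sum fat_dyadic_def scaleR_sum_right by (rule sum.swap)
    also have "cmod \<dots> \<le> (\<Sum>i\<in>{j - 1..j + 1}. C i * norm h ^ L / (1 + norm x) ^ N)" by (rule sum_norm_le) (rule C(2)[OF h])
    finally show ?thesis unfolding sum_distrib_right sum_divide_distrib .
  qed
  moreover have "0 < (\<Sum>i\<in>{j - 1..j + 1}. C i)" using C(1) by (intro sum_pos) auto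
  ultimately show ?thesis by blast
qed

text \<open>Joins the two regimes at 2^j|h| = 1: since \<sigma> < L, the minimum is the L-th power
  below 1 and the power \<sigma> above it.\<close>

lemma piece_diff_bound:
  fixes \<psi> :: "real^'n::finite \<Rightarrow> complex"
  assumes \<psi>: "littlewood_paley \<psi>" and \<sigma>: "0 < \<sigma>" "\<sigma> < real L"
  shows "\<exists>C>0. \<forall>F j x H. tame F \<longrightarrow> (\<forall>y. cmod (piece \<psi> F j (x - y)) \<le> (1 + 2 powi j * norm y) powr \<sigma> * H) \<longrightarrow>
    (\<forall>h y. h \<noteq> 0 \<longrightarrow> cmod (iter_diff L (piece \<psi> F j) h (x - y)) \<le>
       C * min ((2 powi j * norm h) ^ L) ((2 powi j * norm h) powr \<sigma>) * (1 + norm y / norm h) powr \<sigma> * H)"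
proof -
  have K: "rapid (fat_dyadic \<psi> 0)" by (rule rapid_fat_dyadic[OF schwartz_rapid[OF littlewood_paleyD(1)[OF \<psi>]]])
  obtain C where C: "0 < C" "\<And>h x. norm h \<le> 1 \<Longrightarrow> cmod (iter_diff L (fat_dyadic \<psi> 0) h x) \<le> C * norm h ^ L / (1 + norm x) ^ (nat \<lceil>\<sigma>\<rceil> + Suc CARD('n))"
    using fat_dyadic_diff_decay[OF littlewood_paleyD(1)[OF \<psi>], of L 0] by blast
  define C1 where "C1 = C * (LINT v|lborel. 1 / (1 + norm (v::real^'n)) ^ Suc CARD('n))"
  define C2 where "C2 = 2 ^ L * (1 + real L) powr \<sigma>"
  define B where "B = C1 + C2"
  have C1: "0 \<le> C1" unfolding C1_def using C(1) by simp
  have C2: "0 < C2" unfolding C2_def by (simp add: add_pos_nonneg)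
  have "cmod (iter_diff L (piece \<psi> F j) h (x - y)) \<le> B * min ((2 powi j * norm h) ^ L) ((2 powi j * norm h) powr \<sigma>) * (1 + norm y / norm h) powr \<sigma> * H"
    if F: "tame F" and bd: "\<And>y. cmod (piece \<psi> F j (x - y)) \<le> (1 + 2 powi j * norm y) powr \<sigma> * H" and h: "h \<noteq> 0"
    for F :: "real^'n \<Rightarrow> complex" and j x H h y
  proof -
    let ?c = "2 powi j :: real"
    have c: "0 < ?c" by simp
    obtain g where g: "tame g" "\<And>x. cnv (fat_dyadic \<psi> 0) g x = g x" "\<And>x. piece \<psi> F j x = g (?c *\<^sub>R x)"
      using piece_rescale[OF \<psi> F, of j] by blast
    have fg: "piece \<psi> F j = (\<lambda>x. g (?c *\<^sub>R x))" by (rule ext) (rule g(3))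
    have H: "0 \<le> H" using order_trans[OF norm_ge_zero bd[of 0]] by simp
    let ?h = "?c *\<^sub>R h" let ?x = "?c *\<^sub>R x" let ?y = "?c *\<^sub>R y"
    have g': "cmod (g (?x - y)) \<le> H * (1 + norm y) powr \<sigma>" for y
    proof -
      have "?c * norm (inverse ?c *\<^sub>R y) = norm y" "?c *\<^sub>R (x - inverse ?c *\<^sub>R y) = ?x - y" by (simp_all add: scaleR_diff_right)
      with bd[of "inverse ?c *\<^sub>R y"] show ?thesis unfolding g(3) by (simp only: mult.commute)
    qed
    have e: "norm ?y / norm ?h = norm y / norm h" using c by simp
    have nh: "norm ?h = ?c * norm h" by simp
    have P: "0 \<le> (1 + norm y / norm h) powr \<sigma> * H" using H by simp
    have "cmod (iter_diff L g ?h (?x - ?y)) \<le> B * min (norm ?h ^ L) (norm ?h powr \<sigma>) * (1 + norm y / norm h) powr \<sigma> * H"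
    proof (cases "norm ?h \<le> 1")
      case True
      have "?h \<noteq> 0" using h c by simp
      from unit_diff_bound_low[OF \<sigma>(1) K C g(1,2) g' True this, of ?y]
      have 1: "cmod (iter_diff L g ?h (?x - ?y)) \<le> C1 * norm ?h ^ L * ((1 + norm y / norm h) powr \<sigma> * H)"
        unfolding C1_def e by (simp only: mult.assoc)
      have "norm ?h powr real L \<le> norm ?h powr \<sigma>" using \<sigma>(2) True by (intro powr_mono') auto
      moreover have "norm ?h powr real L = norm ?h ^ L" using h c by (intro powr_realpow) simp
      ultimately have m: "min (norm ?h ^ L) (norm ?h powr \<sigma>) = norm ?h ^ L" by simp
      have "C1 * norm ?h ^ L * ((1 + norm y / norm h) powr \<sigma> * H) \<le> B * norm ?h ^ L * ((1 + norm y / norm h) powr \<sigma> * H)"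
        using C2 unfolding B_def by (intro mult_right_mono P) auto
      with 1 show ?thesis unfolding m by (simp only: mult.assoc)
    next
      case False
      then have h1: "1 \<le> norm ?h" by simp
      from unit_diff_bound_high[where g=g and h="?h" and x="?x" and y="?y", OF \<sigma>(1) g' h1, of L]
      have 1: "cmod (iter_diff L g ?h (?x - ?y)) \<le> C2 * norm ?h powr \<sigma> * ((1 + norm y / norm h) powr \<sigma> * H)"
        unfolding C2_def e by (simp only: mult.assoc)
      have "norm ?h powr \<sigma> \<le> norm ?h powr real L" using \<sigma>(2) h1 by (intro powr_mono) auto
      moreover have "norm ?h powr real L = norm ?h ^ L" using h c by (intro powr_realpow) simp
      ultimately have m: "min (norm ?h ^ L) (norm ?h powr \<sigma>) = norm ?h powr \<sigma>" by simp
      have "C2 * norm ?h powr \<sigma> * ((1 + norm y / norm h) powr \<sigma> * H) \<le> B * norm ?h powr \<sigma> * ((1 + norm y / norm h) powr \<sigma> * H)"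
        using C1 unfolding B_def by (intro mult_right_mono P) auto
      with 1 show ?thesis unfolding m by (simp only: mult.assoc)
    qed
    moreover have "iter_diff L (piece \<psi> F j) h (x - y) = iter_diff L g ?h (?x - ?y)"
      unfolding fg iter_diff_scale scaleR_diff_right ..
    ultimately show ?thesis unfolding nh by simp
  qed
  moreover have "0 < B" using C1 C2 by (simp add: B_def)
  ultimately show ?thesis by blast
qed

lemma ennpowr_less_top: "ennpowr x a < top \<longleftrightarrow> x < top"
  by (cases x) (auto simp: ennpowr_ennreal)

lemma Lp_qnorm_AE_finite:
  assumes p: "0 < p" and f [measurable]: "f \<in> borel_measurable M" and fin: "Lp_qnorm M p f < top"
  shows "AE x in M. f x < top"
  using p
proof (cases rule: ereal_exponent_cases)
  case 1
  then have "esssup M f < top" using fin by (simp add: Lp_qnorm_PInf)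
  with esssup_AE[of f M] show ?thesis by (auto elim!: eventually_mono)
next
  case (2 a)
  have "(\<integral>\<^sup>+x. ennpowr (f x) a \<partial>M) < top" using fin unfolding 2(1) Lp_qnorm_ereal by (simp only: ennpowr_less_top)
  then have "AE x in M. ennpowr (f x) a \<noteq> \<infinity>" by (intro nn_integral_PInf_AE) auto
  then show ?thesis by (rule eventually_mono) (simp add: less_top[symmetric] ennpowr_less_top, simp add: ennpowr_def split: if_splits)
qed

lemma lqLp_qnorm_finite:
  assumes "0 < q" "lqLp_qnorm p q g < top"
  shows "Lp_qnorm lborel p (g k) < top" using Lp_qnorm_AE_finite[OF assms(1) _ assms(2)[unfolded lqLp_qnorm_def]] by (simp add: AE_count_space)

text \<open>Here m = j - k. For m \<ge> 0 the power \<sigma> of w leaves 2^(-m(s-\<sigma>)), for m <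
  0 the power L leaves 2^(-|m|(L-s)); the factor 4 in the bound on w is the source of 4^L.\<close>

lemma scale_decay:
  assumes s: "0 < \<sigma>" "\<sigma> < s" "s < real L" and \<epsilon>: "\<epsilon> = min (real L - s) (s - \<sigma>)"
    and w: "0 < w" "w \<le> 4 * 2 powi m"
  shows "2 powr (- of_int m * s) * min (w ^ L) (w powr \<sigma>) \<le> 4 ^ L * geo (2 powr (- \<epsilon>)) m"
proof -
  have e: "geo (2 powr (- \<epsilon>)) m = 2 powr (- \<epsilon> * \<bar>of_int m\<bar>)"
    unfolding geo_def by (simp add: powr_realpow[symmetric] powr_powr)
  have w': "w \<le> 4 * 2 powr (of_int m)" using w(2) by (simp add: powr_real_of_int')
  show ?thesis
  proof (cases "0 \<le> m")
    case True
    have "min (w ^ L) (w powr \<sigma>) \<le> (4 * 2 powr (of_int m)) powr \<sigma>" using w w' s by (intro min.coboundedI2 powr_mono2) auto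
    also have "\<dots> = 4 powr \<sigma> * 2 powr (of_int m * \<sigma>)" by (simp add: powr_mult powr_powr)
    finally have "2 powr (- of_int m * s) * min (w ^ L) (w powr \<sigma>) \<le> 2 powr (- of_int m * s) * (4 powr \<sigma> * 2 powr (of_int m * \<sigma>))"
      by (rule mult_left_mono) simp
    also have "\<dots> = 4 powr \<sigma> * 2 powr (- (s - \<sigma>) * of_int m)" by (simp add: powr_add[symmetric] algebra_simps)
    also have "\<dots> \<le> 4 powr real L * 2 powr (- \<epsilon> * \<bar>of_int m\<bar>)"
    proof (rule mult_mono)
      have "\<epsilon> * real_of_int m \<le> (s - \<sigma>) * real_of_int m" using True \<epsilon> by (intro mult_right_mono) auto
      then have "- (s - \<sigma>) * real_of_int m \<le> - \<epsilon> * \<bar>real_of_int m\<bar>" using True by (simp add: algebra_simps)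
      then show "2 powr (- (s - \<sigma>) * real_of_int m) \<le> 2 powr (- \<epsilon> * \<bar>real_of_int m\<bar>)" by (rule powr_mono) simp
    qed (use s in auto)
    finally show ?thesis unfolding e by (simp add: powr_realpow)
  next
    case False
    have "min (w ^ L) (w powr \<sigma>) \<le> (4 * 2 powr (of_int m)) ^ L" using w w' by (intro min.coboundedI1 power_mono) auto
    also have "\<dots> = 4 ^ L * 2 powr (of_int m * real L)" by (simp add: power_mult_distrib powr_realpow[symmetric] powr_powr)
    finally have "2 powr (- of_int m * s) * min (w ^ L) (w powr \<sigma>) \<le> 2 powr (- of_int m * s) * (4 ^ L * 2 powr (of_int m * real L))"
      by (rule mult_left_mono) simp
    also have "\<dots> = 4 ^ L * 2 powr ((real L - s) * of_int m)" by (simp add: powr_add[symmetric] algebra_simps)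
    also have "\<dots> \<le> 4 ^ L * 2 powr (- \<epsilon> * \<bar>of_int m\<bar>)"
    proof (intro mult_left_mono powr_mono)
      have "(real L - s) * real_of_int m \<le> \<epsilon> * real_of_int m" using False \<epsilon> by (intro mult_right_mono_neg) auto
      then show "(real L - s) * real_of_int m \<le> - \<epsilon> * \<bar>real_of_int m\<bar>" using False by simp
    qed auto
    finally show ?thesis unfolding e .
  qed
qed

lemma ennreal_mult_top_pos: "0 < c \<Longrightarrow> ennreal c * top = top"
  by (simp add: ennreal_mult_top)

text \<open>The factor 4 leaves room for the steps $\tau 2^{-k} z$ with \<open>\<tau>\<close> and \<open>|z|\<close> at most 2.\<close>

definition majorizes_pieces ::
  "(real^'n::finite \<Rightarrow> complex) \<Rightarrow> nat \<Rightarrow> real \<Rightarrow> real \<Rightarrow> ((real^'n \<Rightarrow> complex) \<Rightarrow> complex) \<Rightarrow> (int \<Rightarrow> real^'n \<Rightarrow> ennreal) \<Rightarrow> bool"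
where
  "majorizes_pieces \<psi> L s \<sigma> u U \<longleftrightarrow> (\<forall>k x y h. h \<noteq> 0 \<longrightarrow> norm h \<le> 4 * 2 powi (- k) \<longrightarrow>
     ennreal (2 powr (of_int k * s)) * (\<integral>\<^sup>+j. ennreal (cmod (iter_diff L (lp_piece \<psi> u j) h (x - y))) \<partial>count_space UNIV)
       \<le> ennreal ((1 + norm y / norm h) powr \<sigma>) * U k x)"

text \<open>Relative to 2^(js) H_j(x), the difference of the j-th piece carries a geometric factor
  in |j - k|. Half of the decay sums over \<open>j\<close>, so a multiple of the supremum
  \<open>V\<close> weighted with the other half bounds the whole sum of absolute values.\<close>

lemma class_majorant:
  fixes \<psi> :: "real^'n::finite \<Rightarrow> complex"
  assumes \<psi>: "littlewood_paley \<psi>" and p: "0 < p" and q: "0 < q"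
    and \<sigma>: "ereal (real CARD('n)) / p < ereal \<sigma>" "0 < \<sigma>" "\<sigma> < s" "s < real L"
  shows "\<exists>C>0. \<forall>u F. u \<in> besov \<psi> s p q \<longrightarrow> function_rep u F \<longrightarrow>
    (\<exists>U. (\<forall>k. U k \<in> borel_measurable borel) \<and> lqLp_qnorm p q U \<le> ennreal C * besov_qnorm \<psi> s p q u \<and>
      majorizes_pieces \<psi> L s \<sigma> u U)"
proof -
  let ?N = "\<lambda>F j x. ennreal (cmod (piece \<psi> F j x))"
  have \<sigma>L: "\<sigma> < real L" using \<sigma> by linarith
  obtain C1 where C1: "0 < C1" "\<And>F j. tame F \<Longrightarrow> Lp_qnorm lborel p (?N F j) < top \<Longrightarrow>
    (\<exists>H\<in>borel_measurable borel. (\<forall>x y. ?N F j (x - y) \<le> ennreal ((1 + 2 powi j * norm y) powr \<sigma>) * H x) \<and>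
       Lp_qnorm lborel p H \<le> ennreal C1 * Lp_qnorm lborel p (?N F j))"
    using peetre_majorant[OF \<psi> p \<sigma>(1,2)] by blast
  obtain C2 where C2: "0 < C2" "\<And>F j x H h y. tame F \<Longrightarrow> (\<forall>y. cmod (piece \<psi> F j (x - y)) \<le> (1 + 2 powi j * norm y) powr \<sigma> * H) \<Longrightarrow>
    h \<noteq> 0 \<Longrightarrow> cmod (iter_diff L (piece \<psi> F j) h (x - y)) \<le>
       C2 * min ((2 powi j * norm h) ^ L) ((2 powi j * norm h) powr \<sigma>) * (1 + norm y / norm h) powr \<sigma> * H"
    using piece_diff_bound[OF \<psi> \<sigma>(2) \<sigma>L] by blast
  define \<epsilon> where "\<epsilon> = min (real L - s) (s - \<sigma>)"
  \<comment> \<open>A quarter of the rate: 2^(-\<epsilon>) becomes the fourth power of \<theta>. Two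
    factors go into the sum over \<open>j\<close>, and two remain in \<open>V\<close>, as
    \<open>lqLp_qnorm_SUP_le\<close> demands.\<close>
  define \<theta> where "\<theta> = 2 powr (- (\<epsilon> / 4))"
  have "0 < \<epsilon>" using \<sigma> by (simp add: \<epsilon>_def)
  then have \<theta>: "0 < \<theta>" "\<theta> < 1" unfolding \<theta>_def using powr_less_mono[of "- (\<epsilon> / 4)" 0 2] by auto
  have \<theta>4: "geo (2 powr (- \<epsilon>)) m = geo (\<theta> * \<theta>) m * geo (\<theta> * \<theta>) m" for m
    unfolding geo_mult[symmetric] \<theta>_def by (simp add: powr_add[symmetric])
  have \<theta>2: "0 < \<theta> * \<theta>" "\<theta> * \<theta> < 1" using \<theta> using mult_strict_mono[of \<theta> 1 \<theta> 1] by auto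
  obtain C3 where C3: "0 < C3" "\<And>u :: int \<Rightarrow> real^'n \<Rightarrow> ennreal. (\<forall>j. u j \<in> borel_measurable borel) \<Longrightarrow>
    lqLp_qnorm p q (\<lambda>k x. SUP j. ennreal (geo (\<theta> * \<theta>) (j - k)) * u j x) \<le> ennreal C3 * lqLp_qnorm p q u"
    using lqLp_qnorm_SUP_le[OF p q \<theta>] by blast
  obtain K where K: "0 < K" "\<And>k. (\<integral>\<^sup>+j. ennreal (geo (\<theta> * \<theta>) (j - k)) \<partial>count_space UNIV) \<le> ennreal K"
    using geo_sum_finite[OF \<theta>2] by blast
  define B where "B = C2 * 4 ^ L"
  have B: "0 < B" using C2(1) by (simp add: B_def)
  have "\<exists>U. (\<forall>k. U k \<in> borel_measurable borel) \<and> lqLp_qnorm p q U \<le> ennreal (B * K * (C3 * C1)) * besov_qnorm \<psi> s p q u \<and>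
      majorizes_pieces \<psi> L s \<sigma> u U"
    if u: "u \<in> besov \<psi> s p q" and F: "function_rep u F" for u F
  proof -
    have tF: "tame F" by (rule function_rep_tame[OF F])
    have lp: "lp_piece \<psi> u j = piece \<psi> F j" for j by (rule ext) (rule lp_piece_eq_cnv[OF \<psi> F])
    have r: "rapid (dyadic \<psi> j)" for j by (rule schwartz_rapid[OF schwartz_dyadic[OF littlewood_paleyD(1)[OF \<psi>]]])
    have pm [measurable]: "piece \<psi> F j \<in> borel_measurable borel" for j by (rule cnv_measurable[OF rapid_measurable[OF r] tame_measurable[OF tF]])
    have "besov_qnorm \<psi> s p q u < top" using u by (simp add: besov_def)
    then have fin': "Lp_qnorm lborel p (\<lambda>x. ennreal (2 powr (of_int j * s)) * ennreal (cmod (piece \<psi> F j x))) < top" for j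
      unfolding besov_qnorm_def lp by (rule lqLp_qnorm_finite[OF q])
    have fin: "Lp_qnorm lborel p (?N F j) < top" for j using fin'[of j] by (auto simp: Lp_qnorm_cmult[OF p] ennreal_mult_less_top)
    obtain H where H: "\<And>j. H j \<in> borel_measurable borel"
      "\<And>j x y. ?N F j (x - y) \<le> ennreal ((1 + 2 powi j * norm y) powr \<sigma>) * H j x"
      "\<And>j. Lp_qnorm lborel p (H j) \<le> ennreal C1 * Lp_qnorm lborel p (?N F j)"
      using C1(2)[OF tF fin] by metis
    note [measurable] = H(1)
    define v where "v j x = ennreal (2 powr (of_int j * s)) * H j x" for j x
    define V where "V k x = (SUP j. ennreal (geo (\<theta> * \<theta>) (j - k)) * v j x)" for k x
    define U where "U k x = ennreal (B * K) * V k x" for k x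
    have vm [measurable]: "v j \<in> borel_measurable borel" for j unfolding v_def by measurable
    have Vm [measurable]: "V k \<in> borel_measurable borel" for k unfolding V_def by measurable
    have Um: "U k \<in> borel_measurable borel" for k unfolding U_def by measurable
    have "lqLp_qnorm p q U \<le> ennreal (B * K) * lqLp_qnorm p q V"
      by (rule lqLp_qnorm_mono_cmult[OF p q Um]) (use B K in \<open>auto simp: U_def\<close>)
    also have "lqLp_qnorm p q V \<le> ennreal C3 * lqLp_qnorm p q v" unfolding V_def by (rule C3(2)) (use vm in simp)
    also have "lqLp_qnorm p q v \<le> ennreal C1 * besov_qnorm \<psi> s p q u"
      unfolding besov_qnorm_def lqLp_qnorm_def
    proof (rule Lp_qnorm_mono_cmult[OF q _ C1(1)])
      fix k
      have "Lp_qnorm lborel p (v k) = ennreal (2 powr (of_int k * s)) * Lp_qnorm lborel p (H k)" unfolding v_def by (rule Lp_qnorm_cmult[OF p]) auto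
      also have "\<dots> \<le> ennreal (2 powr (of_int k * s)) * (ennreal C1 * Lp_qnorm lborel p (\<lambda>x. ennreal (cmod (piece \<psi> F k x))))"
        by (intro mult_left_mono H) simp
      also have "\<dots> = ennreal C1 * Lp_qnorm lborel p (\<lambda>x. ennreal (2 powr (of_int k * s)) * ennreal (cmod (piece \<psi> F k x)))"
        by (subst Lp_qnorm_cmult[OF p]) (auto simp: ac_simps)
      finally show "Lp_qnorm lborel p (v k) \<le> ennreal C1 * Lp_qnorm lborel p (\<lambda>x. ennreal (2 powr (of_int k * s)) * ennreal (cmod (lp_piece \<psi> u k x)))"
        unfolding lp .
    qed simp
    finally have Un: "lqLp_qnorm p q U \<le> ennreal (B * K * (C3 * C1)) * besov_qnorm \<psi> s p q u"
      using B K C3(1) C1(1) by (simp add: ennreal_mult mult.assoc mult_left_mono)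
    have pt: "ennreal (2 powr (of_int k * s)) * (\<integral>\<^sup>+j. ennreal (cmod (iter_diff L (lp_piece \<psi> u j) h (x - y))) \<partial>count_space UNIV)
          \<le> ennreal ((1 + norm y / norm h) powr \<sigma>) * U k x" if h: "h \<noteq> 0" "norm h \<le> 4 * 2 powi (- k)" for k x y h
    proof -
      let ?W = "(1 + norm y / norm h) powr \<sigma>"
      have "0 < 1 + norm y / norm h" by (intro add_pos_nonneg) auto
      then have W: "0 < ?W" by simp
      have each: "ennreal (2 powr (of_int k * s)) * ennreal (cmod (iter_diff L (piece \<psi> F j) h (x - y)))
         \<le> ennreal (geo (\<theta> * \<theta>) (j - k)) * (ennreal B * (ennreal ?W * V k x))" for j
      \<comment> \<open>Where \<open>H\<close> is infinite so is \<open>V\<close>, and the claim is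
        trivial; otherwise \<open>H\<close> is a real number and \<open>piece_diff_bound\<close>
        applies.\<close>
      proof (cases "H j x")
        case top
        have "ennreal (geo (\<theta> * \<theta>) (j - k)) * v j x = top"
          unfolding v_def top using geo_pos[OF \<theta>2(1)] by (simp add: ennreal_mult_top_pos)
        then have "V k x = top" unfolding V_def using SUP_upper[of j UNIV "\<lambda>j. ennreal (geo (\<theta> * \<theta>) (j - k)) * v j x"] by (simp add: top_unique)
        then show ?thesis using W B geo_pos[OF \<theta>2(1)] by (simp add: ennreal_mult_top_pos)
      next
        case (real H')
        let ?w = "2 powi j * norm h" let ?g = "geo (\<theta> * \<theta>) (j - k)"
        have g: "0 < ?g" by (rule geo_pos[OF \<theta>2(1)])
        have "cmod (piece \<psi> F j (x - y)) \<le> (1 + 2 powi j * norm y) powr \<sigma> * H'" for y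
          using H(2)[of j x y] real by (simp add: ennreal_mult[symmetric])
        then have "cmod (iter_diff L (piece \<psi> F j) h (x - y)) \<le> C2 * min (?w ^ L) (?w powr \<sigma>) * ?W * H'"
          by (intro C2(2)[OF tF] h) auto
        then have "2 powr (of_int k * s) * cmod (iter_diff L (piece \<psi> F j) h (x - y)) \<le> 2 powr (of_int k * s) * (C2 * min (?w ^ L) (?w powr \<sigma>) * ?W * H')"
          by (rule mult_left_mono) simp
        also have e0: "2 powr (of_int k * s) = 2 powr (- of_int (j - k) * s) * 2 powr (of_int j * s)" by (simp add: powr_add[symmetric] algebra_simps)
        also have "(2 powr (- of_int (j - k) * s) * 2 powr (of_int j * s)) * (C2 * min (?w ^ L) (?w powr \<sigma>) * ?W * H')
           = (2 powr (- of_int (j - k) * s) * min (?w ^ L) (?w powr \<sigma>)) * (C2 * ?W * (2 powr (of_int j * s) * H'))" by (simp only: ac_simps)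
        also have "\<dots> \<le> (4 ^ L * geo (2 powr (- \<epsilon>)) (j - k)) * (C2 * ?W * (2 powr (of_int j * s) * H'))"
        proof (intro mult_right_mono scale_decay[OF \<sigma>(2-4) \<epsilon>_def])
          show "0 < ?w" using h by simp
          have "?w \<le> 2 powi j * (4 * 2 powi (- k))" using h(2) by (intro mult_left_mono) auto
          also have "\<dots> = 4 * 2 powi (j - k)" using power_int_add[of "2::real" j "- k"] by simp
          finally show "?w \<le> 4 * 2 powi (j - k)" .
        qed (use C2(1) real in auto)
        also have "\<dots> = ?g * (B * (?W * (?g * (2 powr (of_int j * s) * H'))))" unfolding \<theta>4 B_def by (simp only: ac_simps)
        finally have "ennreal (2 powr (of_int k * s) * cmod (iter_diff L (piece \<psi> F j) h (x - y))) \<le> ennreal (?g * (B * (?W * (?g * (2 powr (of_int j * s) * H')))))"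
          unfolding e0 by (rule ennreal_leI)
        also have "\<dots> = ennreal ?g * (ennreal B * (ennreal ?W * (ennreal ?g * v j x)))"
          using g B W real unfolding v_def by (simp add: ennreal_mult)
        also have "\<dots> \<le> ennreal ?g * (ennreal B * (ennreal ?W * V k x))" unfolding V_def by (intro mult_left_mono SUP_upper) auto
        finally show ?thesis by (simp add: ennreal_mult)
      qed
      have "ennreal (2 powr (of_int k * s)) * (\<integral>\<^sup>+j. ennreal (cmod (iter_diff L (lp_piece \<psi> u j) h (x - y))) \<partial>count_space UNIV)
         = (\<integral>\<^sup>+j. ennreal (2 powr (of_int k * s)) * ennreal (cmod (iter_diff L (piece \<psi> F j) h (x - y))) \<partial>count_space UNIV)"
        unfolding lp by (rule nn_integral_cmult[symmetric]) simp
      also have "\<dots> \<le> (\<integral>\<^sup>+j. ennreal (geo (\<theta> * \<theta>) (j - k)) * (ennreal B * (ennreal ?W * V k x)) \<partial>count_space UNIV)"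
        by (intro nn_integral_mono each)
      also have "\<dots> = (\<integral>\<^sup>+j. ennreal (geo (\<theta> * \<theta>) (j - k)) \<partial>count_space UNIV) * (ennreal B * (ennreal ?W * V k x))"
        by (rule nn_integral_multc) simp
      also have "\<dots> \<le> ennreal K * (ennreal B * (ennreal ?W * V k x))" by (intro mult_right_mono K) simp
      also have "\<dots> = ennreal ?W * U k x" unfolding U_def using B K(1) by (simp add: ennreal_mult ac_simps)
      finally show ?thesis .
    qed
    show ?thesis using Um Un pt unfolding majorizes_pieces_def by blast
  qed
  moreover have "0 < B * K * (C3 * C1)" using B K(1) C3(1) C1(1) by simp
  ultimately show ?thesis by blast
qed

subsection \<open>Differences of a class\<close>

text \<open>As a Bochner integral over counting measure, the sum over scales becomes accessible to
  Fubini and to measurability of parameter integrals. Both sides are 0 when the series does not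
  converge absolutely.\<close>

lemma infsum_eq_integral_count_space:
  fixes f :: "'a \<Rightarrow> complex"
  shows "infsum f UNIV = (LINT j|count_space UNIV. f j)"
proof (cases "f summable_on UNIV")
  case True
  then have "(\<lambda>x. norm (f x)) summable_on UNIV" by (simp add: summable_on_iff_abs_summable_on_complex)
  then have "Infinite_Set_Sum.abs_summable_on f UNIV" by (simp add: abs_summable_equivalent)
  from infsetsum_infsum[OF this] show ?thesis unfolding infsetsum_def by simp
next
  case False
  then have "\<not> Infinite_Set_Sum.abs_summable_on f UNIV" by (simp add: summable_on_iff_abs_summable_on_complex abs_summable_equivalent[symmetric])
  then have "\<not> integrable (count_space UNIV) f" by (simp add: Infinite_Set_Sum.abs_summable_on_def)
  with False show ?thesis by (simp add: infsum_not_exists not_integrable_integral_eq)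
qed

lemma class_diff_eq_integral:
  "class_diff \<psi> L u h x = (LINT j|count_space UNIV. iter_diff L (lp_piece \<psi> u j) h x)"
  unfolding class_diff_def by (rule infsum_eq_integral_count_space)

lemma sigma_finite_count_int: "sigma_finite_measure (count_space (UNIV :: int set))"
  by (rule sigma_finite_measure_count_space)

lemma class_diff_pair_measurable:
  assumes "\<And>j. lp_piece \<psi> u j \<in> borel_measurable borel"
  shows "(\<lambda>(p, j). iter_diff L (lp_piece \<psi> u j) (fst p) (snd p)) \<in> borel_measurable ((borel \<Otimes>\<^sub>M borel) \<Otimes>\<^sub>M count_space (UNIV :: int set))"
  unfolding case_prod_beta'
  by (rule measurable_compose_countable'[where I=UNIV and g=snd and f="\<lambda>j q. iter_diff L (lp_piece \<psi> u j) (fst (fst q)) (snd (fst q))"])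
     (auto intro!: measurable_compose[OF measurable_fst iter_diff_measurable[OF assms]])

lemma class_diff_measurable:
  assumes "\<And>j. lp_piece \<psi> u j \<in> borel_measurable borel"
  shows "(\<lambda>p. class_diff \<psi> L u (fst p) (snd p)) \<in> borel_measurable (borel \<Otimes>\<^sub>M borel)"
  unfolding class_diff_eq_integral
  by (rule sigma_finite_measure.borel_measurable_lebesgue_integral[OF sigma_finite_count_int class_diff_pair_measurable[OF assms]])

lemma norm_class_diff_le:
  "ennreal (cmod (class_diff \<psi> L u h x)) \<le> (\<integral>\<^sup>+j. ennreal (cmod (iter_diff L (lp_piece \<psi> u j) h x)) \<partial>count_space UNIV)"
proof (cases "integrable (count_space UNIV) (\<lambda>j. iter_diff L (lp_piece \<psi> u j) h x)")
  case True
  from integral_norm_bound_ennreal[OF True] show ?thesis unfolding class_diff_eq_integral .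
qed (simp add: class_diff_eq_integral not_integrable_integral_eq)

lemma AE_lborel_ex:
  assumes "AE x in (lborel :: 'a::euclidean_space measure). P x" shows "\<exists>x. P x"
proof (rule ccontr)
  assume "\<not> ?thesis"
  with assms have "AE x in (lborel :: 'a measure). False" by simp
  then have "{x \<in> space lborel. \<not> False} \<in> null_sets (lborel :: 'a measure)" by (subst (asm) AE_iff_null) auto
  then show False by (simp add: null_sets_def)
qed

text \<open>For a single piece the identity is known, since pieces are tame; it remains to exchange
  the sum over \<open>j\<close> with the integrals. The majorant gives absolute convergence, and
  afterwards the k-th piece of the j-th piece vanishes unless |j - k| \<le> 1.\<close>

lemma reproduces_class:
  fixes \<psi> :: "real^'n::finite \<Rightarrow> complex"
  assumes \<psi>: "littlewood_paley \<psi>" and p: "0 < p" and q: "0 < q"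
    and \<sigma>: "ereal (real CARD('n)) / p < ereal \<sigma>" "0 < \<sigma>" "\<sigma> < s" "s < real L"
    and u: "u \<in> besov \<psi> s p q" and F: "function_rep u F"
  shows "reproduces \<psi> L u (class_diff \<psi> L u)"
  unfolding reproduces_def
proof (intro conjI allI impI)
  have tF: "tame F" by (rule function_rep_tame[OF F])
  have lp: "lp_piece \<psi> u j = piece \<psi> F j" for j by (rule ext) (rule lp_piece_eq_cnv[OF \<psi> F])
  have r: "rapid (dyadic \<psi> j)" for j by (rule schwartz_rapid[OF schwartz_dyadic[OF littlewood_paleyD(1)[OF \<psi>]]])
  have tp: "tame (piece \<psi> F j)" for j by (rule tame_cnv[OF r tF])
  have pm: "lp_piece \<psi> u j \<in> borel_measurable borel" for j unfolding lp by (rule tame_measurable[OF tp])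
  show cm: "(\<lambda>p. class_diff \<psi> L u (fst p) (snd p)) \<in> borel_measurable (borel \<Otimes>\<^sub>M borel)"
    by (rule class_diff_measurable[OF pm])
  obtain C U where U: "\<And>k. U k \<in> borel_measurable borel" "lqLp_qnorm p q U \<le> ennreal C * besov_qnorm \<psi> s p q u"
    "majorizes_pieces \<psi> L s \<sigma> u U"
    using class_majorant[OF \<psi> p q \<sigma>] u F by blast
  have "ennreal C * besov_qnorm \<psi> s p q u < top" using u by (simp add: besov_def ennreal_mult_less_top)
  with U(2) have "lqLp_qnorm p q U < top" by (rule order_le_less_trans)
  from lqLp_qnorm_finite[OF q this] have Ufin: "AE x in lborel. U k x < top" for k by (intro Lp_qnorm_AE_finite[OF p]) (use U(1) in auto)
  fix \<mu> :: "(real^'n) measure" and \<phi> :: "real^'n \<Rightarrow> complex" and k :: int and x :: "real^'n"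
  assume rec: "recovers \<psi> L \<mu> \<phi>"
  obtain a b where \<mu>: "finite_measure \<mu>" "sets \<mu> = sets borel" "0 < a" "AE z in \<mu>. a \<le> norm z \<and> norm z \<le> b" and \<phi>: "rapid \<phi>"
    using rec unfolding recovers_def by blast
  note [measurable_cong] = \<mu>(2)
  have [measurable]: "\<phi> \<in> borel_measurable borel" using \<phi> by auto
  interpret finite_measure \<mu> by fact
  have pf: "pair_sigma_finite \<mu> (lborel :: (real^'n) measure)"
    by (simp add: pair_sigma_finite_def lborel.sigma_finite_measure_axioms) unfold_locales
  interpret P: pair_sigma_finite \<mu> "lborel :: (real^'n) measure" by (rule pf)
  let ?M = "\<mu> \<Otimes>\<^sub>M (lborel :: (real^'n) measure)" let ?J = "count_space (UNIV :: int set)"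
  have pf2: "pair_sigma_finite ?M ?J" using P.sigma_finite_measure_axioms sigma_finite_count_int by (simp add: pair_sigma_finite_def)
  interpret Q: pair_sigma_finite ?M ?J by (rule pf2)
  let ?b = "2 powi (- k) :: real" let ?X = "2 powi k *\<^sub>R x"
  define f where "f = (\<lambda>(w, j). \<phi> (?X - snd w) * iter_diff L (lp_piece \<psi> u j) (?b *\<^sub>R fst w) (?b *\<^sub>R snd w))"
  have b0: "0 < ?b" by simp
  have bX: "?b *\<^sub>R ?X = x" by (simp add: power_int_minus)
  have fm [measurable]: "f \<in> borel_measurable (?M \<Otimes>\<^sub>M ?J)"
  proof -
    have "(\<lambda>q. (\<lambda>(p, j). iter_diff L (lp_piece \<psi> u j) (fst p) (snd p)) ((?b *\<^sub>R fst (fst q), ?b *\<^sub>R snd (fst q)), snd q)) \<in> borel_measurable (?M \<Otimes>\<^sub>M ?J)"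
      by (rule measurable_compose[OF _ class_diff_pair_measurable[OF pm]]) measurable
    then have [measurable]: "(\<lambda>q. iter_diff L (lp_piece \<psi> u (snd q)) (?b *\<^sub>R fst (fst q)) (?b *\<^sub>R snd (fst q))) \<in> borel_measurable (?M \<Otimes>\<^sub>M ?J)"
      by simp
    show ?thesis unfolding f_def case_prod_beta' by measurable
  qed
  \<comment> \<open>The coarse scale \<open>k'\<close> is chosen so that every step 2^-k z with |z|
    \<le> b is short enough for the majorant at that one scale.\<close>
  obtain n :: nat where n: "?b * b < 2 ^ n" using real_arch_pow[of 2 "?b * b"] by auto
  define k' where "k' = - int n"
  have k': "?b * b \<le> 4 * 2 powi (- k')" using less_imp_le[OF n] zero_le_power[of "2::real" n] unfolding k'_def minus_minus power_int_of_nat by linarith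
  \<comment> \<open>The majorant is finite almost everywhere only. One good point \<open>x0\<close>
    suffices, because moving from \<open>x0\<close> to any other point costs a power of the
    distance, which the decay of \<phi> absorbs; \<open>m\<close> bounds that cost.\<close>
  obtain x0 where "U k' x0 < top" using AE_lborel_ex[OF Ufin[of k']] by blast
  then obtain U0 where U0: "U k' x0 = ennreal U0" "0 \<le> U0" by (cases "U k' x0") auto
  define m where "m = 1 + norm (x0 - x) / (?b * a) + 1 / a"
  have m: "0 < m" unfolding m_def using \<mu>(3) by (intro add_pos_pos add_pos_nonneg) auto
  define N where "N = nat \<lceil>\<sigma>\<rceil>"
  define B where "B = 2 powr (- of_int k' * s) * (m powr \<sigma> * U0)"
  have B: "0 \<le> B" using U0 by (simp add: B_def)
  have S: "(\<integral>\<^sup>+j. ennreal (cmod (iter_diff L (lp_piece \<psi> u j) (?b *\<^sub>R z) (?b *\<^sub>R y))) \<partial>?J) \<le> ennreal (B * (1 + norm (?X - y)) ^ N)"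
    (is "?S \<le> _") if z: "a \<le> norm z" "norm z \<le> b" for z y
  proof -
    have h: "?b *\<^sub>R z \<noteq> 0" using z \<mu>(3) b0 by auto
    have "norm (?b *\<^sub>R z) \<le> ?b * b" using z by (simp add: mult_left_mono)
    also note k'
    finally have h': "norm (?b *\<^sub>R z) \<le> 4 * 2 powi (- k')" .
    define v where "v = x0 - ?b *\<^sub>R y"
    have veq: "v = (x0 - x) + ?b *\<^sub>R (?X - y)" unfolding v_def scaleR_diff_right bX by simp
    have "1 + norm v / norm (?b *\<^sub>R z) \<le> 1 + norm v / (?b * a)"
      using z \<mu>(3) b0 less_le_trans[OF \<mu>(3) z(1)] by (intro add_left_mono divide_left_mono mult_pos_pos) auto
    also have "\<dots> \<le> 1 + (norm (x0 - x) + ?b * norm (?X - y)) / (?b * a)"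
      unfolding veq using norm_triangle_ineq[of "x0 - x" "?b *\<^sub>R (?X - y)"] \<mu>(3) b0 by (intro add_left_mono divide_right_mono) auto
    also have "\<dots> = 1 + norm (x0 - x) / (?b * a) + 1 / a * norm (?X - y)" using \<mu>(3) b0 by (simp add: add_divide_distrib)
    also have "\<dots> \<le> m * (1 + norm (?X - y))"
    proof -
      have "0 \<le> (1 + norm (x0 - x) / (?b * a)) * norm (?X - y)" "0 \<le> 1 / a" using \<mu>(3) by auto
      then show ?thesis unfolding m_def distrib_left distrib_right by linarith
    qed
    finally have le: "1 + norm v / norm (?b *\<^sub>R z) \<le> m * (1 + norm (?X - y))" .
    have "(1 + norm v / norm (?b *\<^sub>R z)) powr \<sigma> \<le> (m * (1 + norm (?X - y))) powr \<sigma>"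
      using le \<sigma>(2) by (intro powr_mono2) auto
    also have "\<dots> = m powr \<sigma> * (1 + norm (?X - y)) powr \<sigma>" using m by (simp add: powr_mult)
    also have "\<dots> \<le> m powr \<sigma> * (1 + norm (?X - y)) powr (real N)"
      unfolding N_def using \<sigma>(2) by (intro mult_left_mono powr_mono) auto
    also have "(1 + norm (?X - y)) powr (real N) = (1 + norm (?X - y)) ^ N" by (rule powr_realpow) simp
    finally have w: "(1 + norm v / norm (?b *\<^sub>R z)) powr \<sigma> \<le> m powr \<sigma> * (1 + norm (?X - y)) ^ N" .
    have e: "ennreal (2 powr (- of_int k' * s)) * ennreal (2 powr (of_int k' * s)) = 1" by (simp add: ennreal_mult[symmetric] powr_add[symmetric])
    have "ennreal (2 powr (of_int k' * s)) * ?S \<le> ennreal ((1 + norm v / norm (?b *\<^sub>R z)) powr \<sigma>) * U k' x0"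
      using U(3)[unfolded majorizes_pieces_def, rule_format, OF h h', of x0 v] by (simp add: v_def)
    also have "\<dots> \<le> ennreal (m powr \<sigma> * (1 + norm (?X - y)) ^ N) * ennreal U0"
      unfolding U0(1) by (intro mult_right_mono ennreal_leI w) simp
    finally have "ennreal (2 powr (- of_int k' * s)) * (ennreal (2 powr (of_int k' * s)) * ?S) \<le> ennreal (2 powr (- of_int k' * s)) * (ennreal (m powr \<sigma> * (1 + norm (?X - y)) ^ N) * ennreal U0)"
      by (rule mult_left_mono) simp
    moreover have "ennreal (2 powr (- of_int k' * s)) * (ennreal (m powr \<sigma> * (1 + norm (?X - y)) ^ N) * ennreal U0) = ennreal (B * (1 + norm (?X - y)) ^ N)"
      unfolding B_def using U0 by (simp add: ennreal_mult[symmetric] ac_simps)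
    ultimately show ?thesis by (simp only: mult.assoc[symmetric] e mult_1)
  qed
  have fint: "integrable (?M \<Otimes>\<^sub>M ?J) f"
  proof (rule integrableI_bounded[OF fm])
    have "(\<integral>\<^sup>+w. ennreal (norm (f w)) \<partial>(?M \<Otimes>\<^sub>M ?J)) = (\<integral>\<^sup>+w. (\<integral>\<^sup>+j. ennreal (norm (f (w, j))) \<partial>?J) \<partial>?M)"
      by (rule Q.M2.nn_integral_fst[symmetric]) measurable
    also have "\<dots> \<le> (\<integral>\<^sup>+w. ennreal (B * (cmod (\<phi> (?X - snd w)) * (1 + norm (?X - snd w)) ^ N)) \<partial>?M)"
    proof (rule nn_integral_mono_AE)
      have "AE w in ?M. a \<le> norm (fst w) \<and> norm (fst w) \<le> b" by (rule AE_fst_pair[OF pf _ \<mu>(4)]) measurable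
      then show "AE w in ?M. (\<integral>\<^sup>+j. ennreal (norm (f (w, j))) \<partial>?J) \<le> ennreal (B * (cmod (\<phi> (?X - snd w)) * (1 + norm (?X - snd w)) ^ N))"
      proof (rule eventually_mono)
        fix w :: "(real^'n) \<times> (real^'n)" assume w: "a \<le> norm (fst w) \<and> norm (fst w) \<le> b"
        have "(\<integral>\<^sup>+j. ennreal (norm (f (w, j))) \<partial>?J)
           = ennreal (cmod (\<phi> (?X - snd w))) * (\<integral>\<^sup>+j. ennreal (cmod (iter_diff L (lp_piece \<psi> u j) (?b *\<^sub>R fst w) (?b *\<^sub>R snd w))) \<partial>?J)"
          unfolding f_def by (simp add: norm_mult ennreal_mult nn_integral_cmult)
        also have "\<dots> \<le> ennreal (cmod (\<phi> (?X - snd w))) * ennreal (B * (1 + norm (?X - snd w)) ^ N)"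
          using w by (intro mult_left_mono S) auto
        also have "\<dots> = ennreal (B * (cmod (\<phi> (?X - snd w)) * (1 + norm (?X - snd w)) ^ N))"
          using B by (simp add: ennreal_mult[symmetric] ac_simps)
        finally show "(\<integral>\<^sup>+j. ennreal (norm (f (w, j))) \<partial>?J) \<le> ennreal (B * (cmod (\<phi> (?X - snd w)) * (1 + norm (?X - snd w)) ^ N))" .
      qed
    qed
    also have "\<dots> = (\<integral>\<^sup>+z. (\<integral>\<^sup>+y. ennreal (B * (cmod (\<phi> (?X - y)) * (1 + norm (?X - y)) ^ N)) \<partial>lborel) \<partial>\<mu>)"
      by (subst lborel.nn_integral_fst[symmetric]) auto
    also have "(\<integral>\<^sup>+y. ennreal (B * (cmod (\<phi> (?X - y)) * (1 + norm (?X - y)) ^ N)) \<partial>lborel) = (\<integral>\<^sup>+y. ennreal (B * (cmod (\<phi> y) * (1 + norm y) ^ N)) \<partial>lborel)"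
      by (rule nn_integral_lborel_reflect) measurable
    also have "(\<integral>\<^sup>+z. (\<integral>\<^sup>+y. ennreal (B * (cmod (\<phi> y) * (1 + norm y) ^ N)) \<partial>lborel) \<partial>\<mu>) < top"
    proof -
      have "(\<integral>\<^sup>+y. ennreal (norm (B * (cmod (\<phi> y) * (1 + norm y) ^ N))) \<partial>lborel) < \<infinity>"
        using integrable_mult_right[OF rapid_weight_integrable[OF \<phi>, of N], of B] unfolding integrable_iff_bounded by blast
      then have "(\<integral>\<^sup>+y. ennreal (B * (cmod (\<phi> y) * (1 + norm y) ^ N)) \<partial>lborel) < top"
        using B by (simp add: abs_mult power_abs abs_of_nonneg)
      then show ?thesis by (simp add: ennreal_mult_less_top emeasure_eq_measure)
    qed
    finally show "(\<integral>\<^sup>+w. ennreal (norm (f w)) \<partial>(?M \<Otimes>\<^sub>M ?J)) < \<infinity>" by simp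
  qed
  have sumj: "(LINT j|?J. f (w, j)) = \<phi> (?X - snd w) * class_diff \<psi> L u (?b *\<^sub>R fst w) (?b *\<^sub>R snd w)" for w
    unfolding f_def class_diff_eq_integral by simp
  show "integrable ?M (\<lambda>(z, y). \<phi> (?X - y) * class_diff \<psi> L u (?b *\<^sub>R z) (?b *\<^sub>R y))"
    using Q.integrable_fst'[OF fint] unfolding sumj by (simp add: case_prod_beta')
  have intw: "(LINT w|?M. f (w, j)) = piece \<psi> (piece \<psi> F j) k x" for j
  proof -
    let ?g = "\<lambda>y. piece \<psi> F j (?b *\<^sub>R y)"
    have tg: "tame ?g" by (rule tame_scale[OF tp]) simp
    have "(LINT w|?M. f (w, j)) = (LINT w|?M. \<phi> (?X - snd w) * iter_diff L ?g (fst w) (snd w))" unfolding f_def lp iter_diff_scale by simp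
    also have "\<dots> = cnv (dyadic \<psi> 0) ?g ?X" using recovers_identity(2)[OF rec tg, of ?X] by simp
    also have "\<dots> = piece \<psi> (piece \<psi> F j) k x" unfolding cnv_dyadic_dilate bX by simp
    finally show ?thesis .
  qed
  have "(LINT w|?M. \<phi> (?X - snd w) * class_diff \<psi> L u (?b *\<^sub>R fst w) (?b *\<^sub>R snd w)) = (LINT w|?M. (LINT j|?J. f (w, j)))"
    unfolding sumj ..
  also have "\<dots> = (LINT j|?J. (LINT w|?M. f (w, j)))" using Q.integral_fst'[OF fint] Q.integral_snd[of "\<lambda>w j. f (w, j)"] fint by simp
  also have "\<dots> = (LINT j|?J. piece \<psi> (piece \<psi> F j) k x)" unfolding intw ..
  \<comment> \<open>All but three scales give 0, so the integral over counting measure is a finite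
    sum.\<close>
  also have "\<dots> = (\<Sum>j | j \<in> UNIV \<and> piece \<psi> (piece \<psi> F j) k x \<noteq> 0. piece \<psi> (piece \<psi> F j) k x)"
  proof (rule lebesgue_integral_count_space_finite_support)
    show "finite {j \<in> UNIV. piece \<psi> (piece \<psi> F j) k x \<noteq> 0}"
      by (rule finite_subset[of _ "{k - 1..k + 1}"]) (use piece_piece_eq_0[OF \<psi> tF, of k] in force)+
  qed
  also have "\<dots> = (\<Sum>j\<in>{k - 1..k + 1}. piece \<psi> (piece \<psi> F j) k x)"
    by (rule sum.mono_neutral_left) (use piece_piece_eq_0[OF \<psi> tF, of k] in force)+
  also have "\<dots> = lp_piece \<psi> u k x" unfolding lp by (rule sum_piece_piece[OF \<psi> tF])
  finally show "lp_piece \<psi> u k x = (LINT w|?M. \<phi> (?X - snd w) * class_diff \<psi> L u (?b *\<^sub>R fst w) (?b *\<^sub>R snd w))" by simp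
qed

subsection \<open>Means over the sphere and over the annulus\<close>

text \<open>With \<beta> the sphere or the annulus measure this is the mean inside S and V,
  respectively; the two families are then handled by the same lemmas.\<close>

definition dilate_mean :: "(real^'n::finite) measure \<Rightarrow> (real^'n \<Rightarrow> real^'n \<Rightarrow> complex) \<Rightarrow> real \<Rightarrow> real^'n \<Rightarrow> complex" where
  "dilate_mean \<beta> D t x = (LINT z|\<beta>. D (t *\<^sub>R z) x) / of_real (measure \<beta> UNIV)"

abbreviation mean_max :: "(real^'n::finite) measure \<Rightarrow> real \<Rightarrow> real \<Rightarrow> (real^'n \<Rightarrow> real^'n \<Rightarrow> complex) \<Rightarrow> real^'n \<Rightarrow> ennreal" where
  "mean_max \<beta> r t D \<equiv> peetre_max r t (dilate_mean \<beta> D t)"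

definition annulus_measure :: "(real^'n::finite) measure" where
  "annulus_measure = density lborel (\<lambda>z. ennreal (indicator annulus z))"

lemma annulus_in_borel [measurable]: "(annulus :: (real^'n::finite) set) \<in> sets borel"
  unfolding annulus_def by measurable

lemma sets_annulus_measure [simp, measurable_cong]: "sets annulus_measure = sets borel"
  and space_annulus_measure [simp]: "space annulus_measure = UNIV"
  by (simp_all add: annulus_measure_def)

lemma emeasure_annulus_measure:
  assumes "A \<in> sets borel" shows "emeasure annulus_measure A = emeasure lborel (annulus \<inter> A :: (real^'n::finite) set)"
proof -
  have "emeasure annulus_measure A = (\<integral>\<^sup>+z. indicator (annulus \<inter> A :: (real^'n) set) z \<partial>lborel)"
  proof -
    have "ennreal (indicator annulus z) * indicator A z = indicator (annulus \<inter> A) z" for z :: "real^'n" by (simp add: indicator_def)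
    then show ?thesis unfolding annulus_measure_def using assms by (subst emeasure_density) auto
  qed
  then show ?thesis using assms by simp
qed

lemma annulus_mean_eq:
  assumes [measurable]: "jointly_measurable D"
  shows "annulus_mean D = dilate_mean annulus_measure (D :: real^'n::finite \<Rightarrow> real^'n \<Rightarrow> complex)"
proof (intro ext)
  fix t x
  have [measurable]: "(\<lambda>z. D (t *\<^sub>R z) x) \<in> borel_measurable borel" by (rule measurable_joint[OF assms]) measurable
  have "measure annulus_measure (UNIV :: (real^'n) set) = measure lborel (annulus :: (real^'n) set)"
    unfolding measure_def by (simp add: emeasure_annulus_measure)
  then show "annulus_mean D t x = dilate_mean annulus_measure D t x"
    unfolding annulus_mean_def dilate_mean_def annulus_measure_def set_lebesgue_integral_def
    by (subst integral_density) auto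
qed

lemma sphere_mean_eq:
  assumes [measurable]: "jointly_measurable D"
  shows "sphere_mean D = dilate_mean sphere_measure (D :: real^'n::finite \<Rightarrow> real^'n \<Rightarrow> complex)"
proof (intro ext)
  fix t x
  let ?H = "hausdorff_measure (CARD('n) - 1) :: (real^'n) measure"
  have s: "sets ?H = sets borel" by (rule sets_hausdorff_measure)
  have S: "sphere (0::real^'n) 1 \<in> sets ?H" unfolding s by simp
  have "(\<lambda>z. D (t *\<^sub>R z) x) \<in> borel_measurable borel" by (rule measurable_joint[OF assms]) measurable
  then have m: "(\<lambda>z. D (t *\<^sub>R z) x) \<in> borel_measurable ?H" by (simp add: measurable_cong_sets[OF s refl])
  have sm: "sphere_measure = density ?H (\<lambda>z. ennreal (indicator (sphere 0 1) z))"
    unfolding sphere_measure_def by (intro arg_cong[where f="density ?H"] ext) (simp add: indicator_def)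
  have "emeasure sphere_measure (UNIV :: (real^'n) set) = emeasure ?H (sphere 0 1)"
    unfolding sphere_measure_def using S
    by (subst emeasure_density) (auto simp: space_hausdorff_measure[symmetric])
  then have "measure sphere_measure (UNIV :: (real^'n) set) = measure ?H (sphere 0 1)" unfolding measure_def by simp
  then show "sphere_mean D t x = dilate_mean sphere_measure D t x"
    unfolding sphere_mean_def dilate_mean_def set_lebesgue_integral_def unfolding sm
    using S m by (subst integral_density) auto
qed

lemma base_measure_annulus: "base_measure (annulus_measure :: (real^'n::finite) measure)"
proof (rule base_measure.intro)
  have fin: "emeasure lborel (annulus :: (real^'n) set) < \<infinity>"
  proof -
    have "emeasure lborel (annulus :: (real^'n) set) \<le> emeasure lborel (cball (0::real^'n) 2)" by (rule emeasure_mono) (auto simp: annulus_def)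
    also have "\<dots> < \<infinity>" by (rule emeasure_lborel_cball_finite)
    finally show ?thesis .
  qed
  show "finite_measure (annulus_measure :: (real^'n) measure)"
    by (rule finite_measureI) (use fin in \<open>simp add: emeasure_annulus_measure less_top\<close>)
  have AE: "AE z in (annulus_measure :: (real^'n) measure). z \<in> annulus"
    unfolding annulus_measure_def by (subst AE_density) (auto simp: indicator_def)
  then show "AE z in (annulus_measure :: (real^'n) measure). 1 \<le> norm z \<and> norm z \<le> 2" by (rule eventually_mono) (simp add: annulus_def)
  show "distr (annulus_measure :: (real^'n) measure) borel uminus = annulus_measure"
  proof (rule measure_eqI)
    fix A :: "(real^'n) set" assume "A \<in> sets (distr annulus_measure borel uminus)"
    then have A [measurable]: "A \<in> sets borel" by simp
    have mm: "(uminus :: real^'n \<Rightarrow> real^'n) \<in> borel_measurable borel" by measurable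
    have "emeasure (distr annulus_measure borel uminus) A = emeasure lborel (annulus \<inter> uminus -` A)"
      using measurable_sets[OF mm A] by (simp add: emeasure_distr emeasure_annulus_measure)
    also have "annulus \<inter> uminus -` A = uminus -` (annulus \<inter> A) \<inter> space lborel" by (auto simp: annulus_def)
    also have "emeasure lborel \<dots> = emeasure (distr lborel borel uminus) (annulus \<inter> A)" by (rule emeasure_distr[symmetric]) auto
    also have "distr lborel borel (uminus :: real^'n \<Rightarrow> real^'n) = lborel"
      using lborel_affine[of "-1" "0 :: real^'n"] by (simp add: density_1)
    finally show "emeasure (distr annulus_measure borel uminus) A = emeasure annulus_measure A" by (simp add: emeasure_annulus_measure)
  qed simp
  fix \<xi> :: "real^'n" assume \<xi>: "\<xi> \<noteq> 0"
  show "\<not> (AE z in annulus_measure. z \<bullet> \<xi> = 0)"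
  proof
    assume "AE z in annulus_measure. z \<bullet> \<xi> = 0"
    then have "AE z in lborel. z \<in> annulus \<longrightarrow> z \<bullet> \<xi> = 0"
      unfolding annulus_measure_def by (subst (asm) AE_density) (auto simp: indicator_def elim!: eventually_mono split: if_splits)
    then obtain N where N: "{z. \<not> (z \<in> annulus \<longrightarrow> z \<bullet> \<xi> = 0)} \<subseteq> N" "emeasure lborel N = 0" "N \<in> sets lborel"
      by (elim AE_E) auto
    have "negligible N" using N(2,3) by (simp add: negligible_iff_null_sets null_sets_def null_sets_completionI)
    \<comment> \<open>An open half of the annulus on which z \<bullet> \<xi> is positive: nonempty
      and open, hence not negligible.\<close>
    define B where "B = {z :: real^'n. 1 < norm z} \<inter> {z. norm z < 2} \<inter> {z. 0 < z \<bullet> \<xi>}"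
    have "open B" unfolding B_def by (intro open_Int open_Collect_less continuous_intros)
    moreover have "B \<subseteq> N" using N(1) by (auto simp: B_def annulus_def)
    then have "negligible B" using \<open>negligible N\<close> by (rule negligible_subset[rotated])
    ultimately have "B = {}" using open_not_negligible by blast
    moreover have "(3 / 2 / norm \<xi>) *\<^sub>R \<xi> \<in> B" using \<xi> by (simp add: B_def)
    ultimately show False by blast
  qed
qed simp

lemma base_measure_sphere:
  assumes n: "2 \<le> CARD('n)" shows "base_measure (sphere_measure :: (real^'n::finite) measure)"
proof (rule base_measure.intro)
  show "AE z in (sphere_measure :: (real^'n) measure). 1 \<le> norm z \<and> norm z \<le> 2" using AE_sphere_measure by (rule eventually_mono) simp
  have "orthogonal_transformation (uminus :: real^'n \<Rightarrow> real^'n)"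
    by (simp add: orthogonal_transformation_neg[of "\<lambda>x. x", simplified])
  then show "distr (sphere_measure :: (real^'n) measure) borel uminus = sphere_measure" by (rule distr_sphere_measure)
qed (use sphere_measure_nondegenerate[OF n] in \<open>auto intro: finite_sphere_measure\<close>)

subsection \<open>Upper bounds\<close>

definition dominates_diff :: "real \<Rightarrow> real \<Rightarrow> (int \<Rightarrow> real^'n::finite \<Rightarrow> ennreal) \<Rightarrow> (real^'n \<Rightarrow> real^'n \<Rightarrow> complex) \<Rightarrow> bool" where
  "dominates_diff s \<sigma> U D \<longleftrightarrow> (\<forall>k x y h. h \<noteq> 0 \<longrightarrow> norm h \<le> 4 * 2 powi (- k) \<longrightarrow>
     ennreal (2 powr (of_int k * s)) * ennreal (cmod (D h (x - y))) \<le> ennreal ((1 + norm y / norm h) powr \<sigma>) * U k x)"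

lemma ennreal_mult_le_swap:
  assumes "0 < c" "ennreal c * a \<le> b" shows "a \<le> ennreal (1 / c) * b"
proof -
  have "ennreal (1 / c) * (ennreal c * a) \<le> ennreal (1 / c) * b" using assms(2) by (rule mult_left_mono) simp
  then show ?thesis using assms(1) by (simp add: mult.assoc[symmetric] ennreal_mult[symmetric])
qed

lemma peetre_max_le:
  fixes G :: "real^'n::finite \<Rightarrow> complex"
  assumes [measurable]: "G \<in> borel_measurable borel" and t: "0 < t"
    and le: "\<And>y. ennreal (cmod (G (x - y))) \<le> ennreal ((1 + norm y / t) powr (real CARD('n) / r)) * E"
  shows "peetre_max r t G x \<le> E"
  unfolding peetre_max_def
proof (rule esssup_I)
  show "AE y in lborel. ennreal (cmod (G (x - y)) * (1 + norm y / t) powr (- (real CARD('n) / r))) \<le> E"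
  proof (rule AE_I2)
    fix y :: "real^'n"
    let ?w = "(1 + norm y / t) powr (real CARD('n) / r)"
    have "0 < 1 + norm y / t" using t by (intro add_pos_nonneg) auto
    then have w: "0 < ?w" by simp
    have "ennreal (1 / ?w) * ennreal (cmod (G (x - y))) \<le> ennreal (1 / ?w) * (ennreal ?w * E)" by (intro mult_left_mono le) simp
    also have "\<dots> = E" using w by (simp add: mult.assoc[symmetric] ennreal_mult[symmetric])
    also have "ennreal (1 / ?w) * ennreal (cmod (G (x - y))) = ennreal (cmod (G (x - y)) * (1 + norm y / t) powr (- (real CARD('n) / r)))"
      using w by (simp add: ennreal_mult[symmetric] powr_minus divide_inverse mult.commute)
    finally show "ennreal (cmod (G (x - y)) * (1 + norm y / t) powr (- (real CARD('n) / r))) \<le> E" .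
  qed
qed measurable

lemma peetre_max_measurable:
  fixes G :: "'a \<Rightarrow> real^'n::finite \<Rightarrow> complex"
  assumes G: "(\<lambda>p. G (fst p) (snd p)) \<in> borel_measurable (N \<Otimes>\<^sub>M borel)" and [measurable]: "c \<in> borel_measurable N"
  shows "(\<lambda>p. peetre_max r (c (fst p)) (G (fst p)) (snd p)) \<in> borel_measurable (N \<Otimes>\<^sub>M borel)"
proof -
  have [measurable]: "(\<lambda>q. G (fst (fst q)) (snd (fst q) - snd q)) \<in> borel_measurable ((N \<Otimes>\<^sub>M borel) \<Otimes>\<^sub>M lborel)" by (rule measurable_joint[OF G]) measurable
  have "(\<lambda>q. ennreal (cmod (G (fst (fst q)) (snd (fst q) - snd q)) * (1 + norm (snd q) / c (fst (fst q))) powr (- (real CARD('n) / r)))) \<in> borel_measurable ((N \<Otimes>\<^sub>M borel) \<Otimes>\<^sub>M lborel)"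
    by measurable
  from esssup_measurable[OF lborel.sigma_finite_measure_axioms this] show ?thesis unfolding peetre_max_def by simp
qed

lemma esssup_on_measurable:
  fixes g :: "'a::euclidean_space \<Rightarrow> real^'n::finite \<Rightarrow> ennreal"
  assumes A: "A \<in> sets borel" and g: "(\<lambda>p. g (fst p) (snd p)) \<in> borel_measurable (borel \<Otimes>\<^sub>M borel)"
  shows "(\<lambda>x. esssup_on A (\<lambda>\<tau>. g \<tau> x)) \<in> borel_measurable borel"
proof -
  have "sigma_finite_measure (restrict_space lborel A)" using A by (intro sigma_finite_measure_restrict_space lborel.sigma_finite_measure_axioms) simp
  moreover have "(\<lambda>q. g (snd q) (fst q)) \<in> borel_measurable (borel \<Otimes>\<^sub>M restrict_space lborel A)"
    by (rule measurable_joint[OF g], rule measurable_compose[OF measurable_snd], rule measurable_restrict_space1) auto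
  ultimately show ?thesis unfolding esssup_on_def using esssup_measurable[of "restrict_space lborel A" "\<lambda>q. g (snd q) (fst q)" borel] by simp
qed

lemma esssup_on_le:
  assumes "A \<in> sets borel" and g: "jointly_measurable g" and le: "\<And>\<tau>. \<tau> \<in> A \<Longrightarrow> g \<tau> x \<le> E"
  shows "esssup_on A (\<lambda>\<tau>. g \<tau> x) \<le> E"
  unfolding esssup_on_def
proof (rule esssup_I)
  have "(\<lambda>\<tau>. g \<tau> x) \<in> borel_measurable borel" by (rule measurable_joint[OF g]) measurable
  then show "(\<lambda>\<tau>. g \<tau> x) \<in> borel_measurable (restrict_space lborel A)" by (intro measurable_restrict_space1) simp
  show "AE \<tau> in restrict_space lborel A. g \<tau> x \<le> E" using le by (intro AE_I2) (auto simp: space_restrict_space)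
qed

lemma punctured_ball_borel: "{h :: real^'n::finite. 0 < norm h \<and> norm h < c} \<in> sets borel"
proof -
  have "open ({h :: real^'n. 0 < norm h} \<inter> {h. norm h < c})" by (intro open_Int open_Collect_less continuous_intros)
  then show ?thesis by (simp add: Collect_conj_eq borel_open)
qed

lemma ennreal_mult_inverse_cancel: "0 < c \<Longrightarrow> ennreal c * (ennreal (1 / c) * b) = b"
  by (simp add: mult.assoc[symmetric] ennreal_mult[symmetric])

lemma dominates_diffD:
  assumes "dominates_diff s \<sigma> U D" "h \<noteq> 0" "norm h \<le> 4 * 2 powi (- k)"
  shows "ennreal (cmod (D h (x - y))) \<le> ennreal ((1 + norm y / norm h) powr \<sigma>) * (ennreal (1 / 2 powr (of_int k * s)) * U k x)"
proof -
  have "ennreal (2 powr (of_int k * s)) * ennreal (cmod (D h (x - y))) \<le> ennreal ((1 + norm y / norm h) powr \<sigma>) * U k x"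
    using assms unfolding dominates_diff_def by blast
  from ennreal_mult_le_swap[OF _ this] show ?thesis by (simp only: ac_simps powr_gt_zero)
qed

lemma weighted_qnorm_le:
  assumes "0 < p" "0 < q" "\<And>k. f k \<in> borel_measurable borel" "\<And>k x. f k x \<le> ennreal (1 / 2 powr (of_int k * s)) * U k x"
  shows "weighted_qnorm s p q f \<le> lqLp_qnorm p q U"
proof -
  have "lqLp_qnorm p q (\<lambda>k x. ennreal (2 powr (of_int k * s)) * f k x) \<le> ennreal 1 * lqLp_qnorm p q U"
  proof (rule lqLp_qnorm_mono_cmult[OF assms(1,2)])
    fix k x
    have "ennreal (2 powr (of_int k * s)) * f k x \<le> ennreal (2 powr (of_int k * s)) * (ennreal (1 / 2 powr (of_int k * s)) * U k x)"
      by (intro mult_left_mono assms) simp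
    then show "ennreal (2 powr (of_int k * s)) * f k x \<le> ennreal 1 * U k x" by (simp only: ennreal_mult_inverse_cancel powr_gt_zero) simp
  qed (use assms(3) in auto)
  then show ?thesis by (simp add: weighted_qnorm_def)
qed

context base_measure
begin

lemma dilate_mean_measurable:
  assumes Dm: "jointly_measurable D"
  shows "(\<lambda>p. dilate_mean \<beta> D (fst p) (snd p)) \<in> borel_measurable (borel \<Otimes>\<^sub>M borel)"
proof -
  interpret finite_measure \<beta> by (rule finite_\<beta>)
  have "(\<lambda>q. D (fst (fst q) *\<^sub>R snd q) (snd (fst q))) \<in> borel_measurable ((borel \<Otimes>\<^sub>M borel) \<Otimes>\<^sub>M \<beta>)"
    by (rule measurable_joint[OF Dm]) measurable
  then have "(\<lambda>(p, z). D (fst p *\<^sub>R z) (snd p)) \<in> borel_measurable ((borel \<Otimes>\<^sub>M borel) \<Otimes>\<^sub>M \<beta>)" by (simp add: case_prod_beta')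
  then have [measurable]: "(\<lambda>p. LINT z|\<beta>. D (fst p *\<^sub>R z) (snd p)) \<in> borel_measurable (borel \<Otimes>\<^sub>M borel)"
    by (rule borel_measurable_lebesgue_integral)
  show ?thesis unfolding dilate_mean_def by measurable
qed

lemma dilate_mean_measurable_fixed:
  assumes Dm: "jointly_measurable D"
  shows "dilate_mean \<beta> D t \<in> borel_measurable borel" by (rule measurable_joint[OF dilate_mean_measurable[OF Dm]]) measurable

text \<open>The division by the mass of \<beta> turns a pointwise bound on the support into the same
  bound for the mean; when the mass is 0 or the integrand is not integrable, the mean has the
  default value 0.\<close>

lemma dilate_mean_le:
  assumes le: "\<And>z. 1 \<le> norm z \<Longrightarrow> norm z \<le> 2 \<Longrightarrow> ennreal (cmod (D (t *\<^sub>R z) x)) \<le> E"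
  shows "ennreal (cmod (dilate_mean \<beta> D t x)) \<le> E"
proof (cases "measure \<beta> UNIV = 0")
  case True
  then show ?thesis by (simp add: dilate_mean_def)
next
  case False
  interpret finite_measure \<beta> by (rule finite_\<beta>)
  let ?m = "measure \<beta> UNIV"
  have sp: "space \<beta> = UNIV" using sets_eq_imp_space_eq[OF sets_\<beta>] by simp
  have m: "0 < ?m" using False by (simp add: zero_less_measure_iff less_le)
  have "ennreal (cmod (LINT z|\<beta>. D (t *\<^sub>R z) x)) \<le> (\<integral>\<^sup>+z. ennreal (cmod (D (t *\<^sub>R z) x)) \<partial>\<beta>)"
  proof (cases "integrable \<beta> (\<lambda>z. D (t *\<^sub>R z) x)")
    case True
    then show ?thesis by (rule integral_norm_bound_ennreal)
  qed (simp add: not_integrable_integral_eq)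
  also have "\<dots> \<le> (\<integral>\<^sup>+z. E \<partial>\<beta>)"
    by (rule nn_integral_mono_AE, rule eventually_mono[OF supp_\<beta>], rule le) auto
  also have "\<dots> = ennreal ?m * E" by (simp add: sp emeasure_eq_measure mult.commute)
  finally have "ennreal (1 / ?m) * ennreal (cmod (LINT z|\<beta>. D (t *\<^sub>R z) x)) \<le> ennreal (1 / ?m) * (ennreal ?m * E)"
    by (rule mult_left_mono) simp
  also have "\<dots> = E" using ennreal_mult_inverse_cancel[of "1 / ?m" E] m by simp
  also have "ennreal (1 / ?m) * ennreal (cmod (LINT z|\<beta>. D (t *\<^sub>R z) x)) = ennreal (cmod (dilate_mean \<beta> D t x))"
    unfolding dilate_mean_def using m by (simp add: ennreal_mult[symmetric] norm_divide)
  finally show ?thesis .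
qed

lemma peetre_dilate_mean_le:
  assumes Dm: "jointly_measurable D" and r: "0 < r"
    and D: "dominates_diff s (real CARD('n) / r) U D" and t: "0 < t" "t \<le> 2 * 2 powi (- k)"
  shows "mean_max \<beta> r t D x \<le> ennreal (1 / 2 powr (of_int k * s)) * U k x"
proof (rule peetre_max_le[OF dilate_mean_measurable_fixed[OF Dm] t(1)], rule dilate_mean_le)
  fix y z :: "real^'n" assume z: "1 \<le> norm z" "norm z \<le> 2"
  have h: "t *\<^sub>R z \<noteq> 0" using t z by auto
  have "norm (t *\<^sub>R z) \<le> t * 2" using t z by (simp add: mult_left_mono)
  also have "\<dots> \<le> 4 * 2 powi (- k)" using t by simp
  finally have h': "norm (t *\<^sub>R z) \<le> 4 * 2 powi (- k)" .
  \<comment> \<open>The maximal function weighs with radius t, the majorant with |tz|; since |z|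
    \<ge> 1 the latter radius is the larger one and its weight the smaller one.\<close>
  have "t * 1 \<le> t * norm z" using t z by (intro mult_left_mono) auto
  then have "norm y / norm (t *\<^sub>R z) \<le> norm y / t" using t z less_le_trans[OF zero_less_one z(1)] by (intro divide_left_mono mult_pos_pos) auto
  then have "(1 + norm y / norm (t *\<^sub>R z)) powr (real CARD('n) / r) \<le> (1 + norm y / t) powr (real CARD('n) / r)"
    using r by (intro powr_mono2) auto
  then have "ennreal ((1 + norm y / norm (t *\<^sub>R z)) powr (real CARD('n) / r)) * (ennreal (1 / 2 powr (of_int k * s)) * U k x)
      \<le> ennreal ((1 + norm y / t) powr (real CARD('n) / r)) * (ennreal (1 / 2 powr (of_int k * s)) * U k x)"
    by (intro mult_right_mono ennreal_leI) auto
  with dominates_diffD[OF D h h', of x y]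
  show "ennreal (cmod (D (t *\<^sub>R z) (x - y))) \<le> ennreal ((1 + norm y / t) powr (real CARD('n) / r)) * (ennreal (1 / 2 powr (of_int k * s)) * U k x)"
    by (rule order_trans)
qed

lemma peetre_dilate_mean_measurable:
  assumes Dm: "jointly_measurable D"
  shows "(\<lambda>p. mean_max \<beta> r (fst p * c) D (snd p)) \<in> borel_measurable (borel \<Otimes>\<^sub>M borel)"
proof -
  have "(\<lambda>p. dilate_mean \<beta> D (fst p * c) (snd p)) \<in> borel_measurable (borel \<Otimes>\<^sub>M borel)" by (rule measurable_joint[OF dilate_mean_measurable[OF Dm]]) measurable
  from peetre_max_measurable[OF this, of "\<lambda>\<tau>. \<tau> * c"] show ?thesis by simp
qed

lemma upper_mean:
  assumes Dm: "jointly_measurable D" and r: "0 < r"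
    and D: "dominates_diff s (real CARD('n) / r) U D" and pq: "0 < p" "0 < q"
  shows "weighted_qnorm s p q (\<lambda>k. mean_max \<beta> r (2 powi (- k)) D) \<le> lqLp_qnorm p q U"
proof (rule weighted_qnorm_le[OF pq])
  fix k
  show "mean_max \<beta> r (2 powi (- k)) D \<in> borel_measurable borel"
    using measurable_joint[OF peetre_dilate_mean_measurable[OF Dm, of r "2 powi (- k)"], of "\<lambda>_. 1" borel id] by simp
  fix x
  show "mean_max \<beta> r (2 powi (- k)) D x \<le> ennreal (1 / 2 powr (of_int k * s)) * U k x" by (rule peetre_dilate_mean_le[OF Dm r D]) auto
qed

lemma upper_mean_sup:
  assumes Dm: "jointly_measurable D" and r: "0 < r"
    and D: "dominates_diff s (real CARD('n) / r) U D" and pq: "0 < p" "0 < q"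
  shows "weighted_qnorm s p q (\<lambda>k x. esssup_on {0<..<2} (\<lambda>\<tau>. mean_max \<beta> r (\<tau> * 2 powi (- k)) D x)) \<le> lqLp_qnorm p q U"
proof (rule weighted_qnorm_le[OF pq])
  fix k
  note m = peetre_dilate_mean_measurable[OF Dm, of r "2 powi (- k)"]
  show "(\<lambda>x. esssup_on {0<..<2} (\<lambda>\<tau>. mean_max \<beta> r (\<tau> * 2 powi (- k)) D x)) \<in> borel_measurable borel"
    by (rule esssup_on_measurable[OF _ m]) simp
  fix x
  show "esssup_on {0<..<2} (\<lambda>\<tau>. mean_max \<beta> r (\<tau> * 2 powi (- k)) D x) \<le> ennreal (1 / 2 powr (of_int k * s)) * U k x"
    by (rule esssup_on_le[OF _ m], simp, rule peetre_dilate_mean_le[OF Dm r D]) auto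
qed

end

lemma upper_difference_sup:
  fixes D :: "real^'n::finite \<Rightarrow> real^'n \<Rightarrow> complex"
  assumes Dm: "jointly_measurable D" and r: "0 < r"
    and D: "dominates_diff s (real CARD('n) / r) U D" and pq: "0 < p" "0 < q"
  shows "D_sup_qnorm s p q r D \<le> lqLp_qnorm p q U"
  unfolding D_sup_qnorm_def
proof (rule weighted_qnorm_le[OF pq])
  fix k
  let ?A = "{h :: real^'n. 0 < norm h \<and> norm h < 2}" let ?c = "2 powi (- k) :: real"
  note A = punctured_ball_borel[where 'n='n, of 2]
  have "(\<lambda>p. D (?c *\<^sub>R fst p) (snd p)) \<in> borel_measurable (borel \<Otimes>\<^sub>M borel)" by (rule measurable_joint[OF Dm]) measurable
  from peetre_max_measurable[OF this, of "\<lambda>h. norm (?c *\<^sub>R h)" r]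
  have m: "(\<lambda>p. D_max r (?c *\<^sub>R fst p) D (snd p)) \<in> borel_measurable (borel \<Otimes>\<^sub>M borel)" by (simp add: D_max_def)
  show "(\<lambda>x. esssup_on ?A (\<lambda>h. D_max r (?c *\<^sub>R h) D x)) \<in> borel_measurable borel" by (rule esssup_on_measurable[OF A m])
  fix x
  show "esssup_on ?A (\<lambda>h. D_max r (?c *\<^sub>R h) D x) \<le> ennreal (1 / 2 powr (of_int k * s)) * U k x"
  proof (rule esssup_on_le[OF A m])
    fix h :: "real^'n" assume h: "h \<in> ?A"
    have nz: "?c *\<^sub>R h \<noteq> 0" using h by auto
    have "norm (?c *\<^sub>R h) \<le> ?c * 4" using h by (simp add: mult_left_mono)
    then have le: "norm (?c *\<^sub>R h) \<le> 4 * ?c" by simp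
    have "D (?c *\<^sub>R h) \<in> borel_measurable borel" by (rule measurable_joint[OF Dm]) measurable
    then show "D_max r (?c *\<^sub>R h) D x \<le> ennreal (1 / 2 powr (of_int k * s)) * U k x"
      unfolding D_max_def by (rule peetre_max_le) (use nz dominates_diffD[OF D nz le] in auto)
  qed
qed

subsection \<open>Lower bounds\<close>

lemma reproduces_measurable:
  "reproduces \<psi> L u D \<Longrightarrow> jointly_measurable D"
  unfolding reproduces_def by blast

lemma small_scale: "\<exists>m::nat. 8 * real L * (2 * 2 powi (- int m)) < 1"
proof -
  obtain m :: nat where "16 * real L < 2 ^ m" using real_arch_pow[of 2 "16 * real L"] by auto
  then have "8 * real L * (2 * 2 powi (- int m)) < 1" by (simp add: power_int_minus field_simps)
  then show ?thesis by blast
qed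

lemma besov_qnorm_shift_le:
  fixes u :: "(real^'n::finite \<Rightarrow> complex) \<Rightarrow> complex"
  assumes "0 < p" "0 < q" "0 < C" "\<And>k. lp_piece \<psi> u k \<in> borel_measurable borel"
    and "\<And>k x. ennreal (cmod (lp_piece \<psi> u k x)) \<le> ennreal C * g (k + m) x"
  shows "besov_qnorm \<psi> s p q u \<le> ennreal (C * 2 powr (- of_int m * s)) * weighted_qnorm s p q g"
proof -
  have "besov_qnorm \<psi> s p q u = weighted_qnorm s p q (\<lambda>k x. ennreal (cmod (lp_piece \<psi> u k x)))"
    by (simp add: besov_qnorm_def weighted_qnorm_def)
  also have "\<dots> \<le> ennreal (C * 2 powr (- of_int m * s)) * weighted_qnorm s p q g"
    by (rule weighted_qnorm_shift_le[where f="\<lambda>k x. ennreal (cmod (lp_piece \<psi> u k x))", OF assms(1-3)]) (use assms(4,5) in auto)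
  finally show ?thesis .
qed

context base_measure
begin

lemma measure_\<beta>_pos: "0 < measure \<beta> UNIV"
proof (rule ccontr)
  interpret finite_measure \<beta> by (rule finite_\<beta>)
  have sp: "space \<beta> = UNIV" using sets_eq_imp_space_eq[OF sets_\<beta>] by simp
  assume "\<not> ?thesis"
  then have "measure \<beta> UNIV = 0" by (simp add: zero_less_measure_iff)
  then have "emeasure \<beta> (space \<beta>) = 0" by (simp add: emeasure_eq_measure sp)
  then have "AE z in \<beta>. z \<bullet> axis undefined 1 = 0" by (intro AE_I[of _ _ "space \<beta>"]) (auto simp: sp)
  moreover have "axis undefined (1::real) \<noteq> (0 :: real^'n)" by (simp add: axis_eq_0_iff)
  ultimately show False using nondeg_\<beta> by blast
qed

lemma integral_dilated:
  assumes Dm: "jointly_measurable D"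
  shows "(LINT z|distr \<beta> borel (\<lambda>z. t *\<^sub>R z). D (c *\<^sub>R z) x) = of_real (measure \<beta> UNIV) * dilate_mean \<beta> D (c * t) x"
proof -
  have m: "(\<lambda>z. D (c *\<^sub>R z) x) \<in> borel_measurable borel" by (rule measurable_joint[OF Dm]) measurable
  have "(LINT z|distr \<beta> borel (\<lambda>z. t *\<^sub>R z). D (c *\<^sub>R z) x) = (LINT z|\<beta>. D (c *\<^sub>R (t *\<^sub>R z)) x)"
    by (rule integral_distr[OF _ m]) measurable
  also have "\<dots> = of_real (measure \<beta> UNIV) * dilate_mean \<beta> D (c * t) x" unfolding dilate_mean_def using measure_\<beta>_pos by simp
  finally show ?thesis .
qed

text \<open>The piece is an average of mean differences against \<phi>, and the maximal function
  bounds these up to a polynomial weight, which \<phi> integrates. The constant depends on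
  \<open>t\<close> through \<phi>, but on neither \<open>k\<close> nor \<open>u\<close>.\<close>

lemma lower_pointwise:
  assumes \<psi>: "littlewood_paley \<psi>" and L: "1 \<le> L" and t: "0 < t" "8 * real L * t < 1" and r: "0 < r"
  shows "\<exists>C>0. \<forall>u D k x E. reproduces \<psi> L u D \<longrightarrow>
    mean_max \<beta> r (t * 2 powi (- k)) D x \<le> E \<longrightarrow>
    ennreal (cmod (lp_piece \<psi> u k x)) \<le> ennreal C * E"
proof -
  obtain \<phi> where rec: "recovers \<psi> L (distr \<beta> borel (\<lambda>z. t *\<^sub>R z)) \<phi>"
    using recovers_scaled[OF \<psi> L t] by blast
  then have \<phi>: "rapid \<phi>" unfolding recovers_def by blast
  let ?m = "measure \<beta> UNIV"
  define c where "c = enn2real (\<integral>\<^sup>+w. ennreal (cmod (\<phi> w) * (1 + norm w / t) powr (real CARD('n) / r)) \<partial>lborel)"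
  have c: "(\<integral>\<^sup>+w. ennreal (cmod (\<phi> w) * (1 + norm w / t) powr (real CARD('n) / r)) \<partial>lborel) = ennreal c" "0 \<le> c"
    using nn_integral_rapid_weight_finite[OF \<phi> t(1), of "real CARD('n) / r"] r unfolding c_def by auto
  have "ennreal (cmod (lp_piece \<psi> u k x)) \<le> ennreal (?m * c + 1) * E"
    if D: "reproduces \<psi> L u D" and E: "mean_max \<beta> r (t * 2 powi (- k)) D x \<le> E" for u D k x E
  proof -
    note Dm = reproduces_measurable[OF D]
    let ?t = "t * 2 powi (- k)"
    have [measurable]: "dilate_mean \<beta> D ?t \<in> borel_measurable borel" by (rule dilate_mean_measurable_fixed[OF Dm])
    have [measurable]: "\<phi> \<in> borel_measurable borel" using \<phi> by auto
    have t': "0 < ?t" "t = 2 powi k * ?t" using t by (auto simp: power_int_minus)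
    have "ennreal (cmod (lp_piece \<psi> u k x)) \<le>
       (\<integral>\<^sup>+w. ennreal ?m * (ennreal (cmod (\<phi> w)) * ennreal (cmod (dilate_mean \<beta> D ?t (x - 2 powi (- k) *\<^sub>R w)))) \<partial>lborel)"
      using reproduces_bound[OF D rec, of k x] unfolding integral_dilated[OF Dm] by (simp add: norm_mult ennreal_mult ac_simps)
    also have "\<dots> = ennreal ?m * (\<integral>\<^sup>+w. ennreal (cmod (\<phi> w)) * ennreal (cmod (dilate_mean \<beta> D ?t (x - 2 powi (- k) *\<^sub>R w))) \<partial>lborel)"
      by (rule nn_integral_cmult) measurable
    also have "\<dots> \<le> ennreal ?m * (ennreal c * E)"
      using nn_integral_peetre_le[OF dilate_mean_measurable_fixed[OF Dm] \<phi> t' E] unfolding c(1) by (intro mult_left_mono) auto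
    also have "\<dots> \<le> ennreal (?m * c + 1) * E" using c(2) by (simp add: ennreal_mult[symmetric] mult.assoc[symmetric] mult_right_mono)
    finally show ?thesis .
  qed
  moreover have "0 < ?m * c + 1" using c(2) by (simp add: add_nonneg_pos)
  ultimately show ?thesis by blast
qed

lemma lower_mean:
  assumes \<psi>: "littlewood_paley \<psi>" and L: "1 \<le> L" and r: "0 < r" and pq: "0 < p" "0 < q"
  shows "\<exists>C>0. \<forall>u D. (\<forall>k. lp_piece \<psi> u k \<in> borel_measurable borel) \<longrightarrow> reproduces \<psi> L u D \<longrightarrow>
    besov_qnorm \<psi> s p q u \<le> ennreal C * weighted_qnorm s p q (\<lambda>k. mean_max \<beta> r (2 powi (- k)) D)"
proof -
  obtain m :: nat where m: "8 * real L * (2 * 2 powi (- int m)) < 1" using small_scale by blast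
  have "0 \<le> 8 * real L * 2 powi (- int m)" by simp
  with m have t: "0 < (2::real) powi (- int m)" "8 * real L * 2 powi (- int m) < 1" by auto
  obtain C where C: "0 < C" "\<And>u D k x E. reproduces \<psi> L u D \<Longrightarrow>
    peetre_max r (2 powi (- int m) * 2 powi (- k)) (dilate_mean \<beta> D (2 powi (- int m) * 2 powi (- k))) x \<le> E \<Longrightarrow>
    ennreal (cmod (lp_piece \<psi> u k x)) \<le> ennreal C * E"
    using lower_pointwise[OF \<psi> L t r] by blast
  \<comment> \<open>The radius is small enough for the division and itself dyadic, so k turns into k
    + m and the index shift is paid by a constant.\<close>
  have e: "2 powi (- int m) * 2 powi (- k) = (2::real) powi (- (k + int m))" for k by (simp add: power_int_add[symmetric] add.commute)
  have "besov_qnorm \<psi> s p q u \<le> ennreal (C * 2 powr (- of_int (int m) * s)) *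
     weighted_qnorm s p q (\<lambda>k. mean_max \<beta> r (2 powi (- k)) D)"
    if "\<forall>k. lp_piece \<psi> u k \<in> borel_measurable borel" and D: "reproduces \<psi> L u D" for u D
    by (rule besov_qnorm_shift_le[OF pq C(1)]) (use that C(2)[OF D, unfolded e] in auto)
  moreover have "0 < C * 2 powr (- of_int (int m) * s)" using C(1) by simp
  ultimately show ?thesis by blast
qed

text \<open>The constant of \<open>lower_pointwise\<close> depends on \<open>t\<close> without any control, but it is bounded on a set of
  radii that is not null.\<close>

lemma lower_mean_sup:
  assumes \<psi>: "littlewood_paley \<psi>" and L: "1 \<le> L" and r: "0 < r" and pq: "0 < p" "0 < q"
  shows "\<exists>C>0. \<forall>u D. (\<forall>k. lp_piece \<psi> u k \<in> borel_measurable borel) \<longrightarrow> reproduces \<psi> L u D \<longrightarrow>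
    besov_qnorm \<psi> s p q u \<le> ennreal C * weighted_qnorm s p q
      (\<lambda>k x. esssup_on {0<..<2} (\<lambda>\<tau>. mean_max \<beta> r (\<tau> * 2 powi (- k)) D x))"
proof -
  obtain m :: nat where m: "8 * real L * (2 * 2 powi (- int m)) < 1" using small_scale by blast
  let ?t = "\<lambda>\<tau>::real. \<tau> * 2 powi (- int m)"
  define P where "P \<tau> C \<longleftrightarrow> (\<forall>u D k x E. reproduces \<psi> L u D \<longrightarrow>
    mean_max \<beta> r (?t \<tau> * 2 powi (- k)) D x \<le> E \<longrightarrow>
    ennreal (cmod (lp_piece \<psi> u k x)) \<le> ennreal C * E)" for \<tau> C
  have "\<exists>C>0. P \<tau> C" if \<tau>: "\<tau> \<in> {0<..<2}" for \<tau>
    unfolding P_def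
  proof (rule lower_pointwise[OF \<psi> L _ _ r])
    show "0 < ?t \<tau>" using \<tau> by simp
    have "8 * real L * ?t \<tau> \<le> 8 * real L * (2 * 2 powi (- int m))" using \<tau> by (intro mult_left_mono mult_right_mono) auto
    with m show "8 * real L * ?t \<tau> < 1" by linarith
  qed
  then obtain c where c: "\<And>\<tau>. \<tau> \<in> {0<..<2} \<Longrightarrow> 0 < c \<tau>" "\<And>\<tau>. \<tau> \<in> {0<..<2} \<Longrightarrow> P \<tau> (c \<tau>)" by metis
  define T where "T n = {\<tau> \<in> {0<..<2}. c \<tau> \<le> real n}" for n
  \<comment> \<open>The constants \<open>c\<close> are picked by choice and need not depend
    measurably on \<tau>; hence the sets \<open>T n\<close> are shown not to lie in a null set,
    rather than to have positive measure. Otherwise countably many null sets would cover the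
    interval.\<close>
  have "\<exists>n. \<forall>N\<in>null_sets lborel. \<not> T n \<subseteq> N"
  proof (rule ccontr)
    assume "\<not> ?thesis"
    then obtain N where N: "\<And>n. N n \<in> null_sets lborel" "\<And>n. T n \<subseteq> N n" by metis
    have "{0<..<2} \<subseteq> (\<Union>n. N n)"
    proof
      fix \<tau> :: real assume \<tau>: "\<tau> \<in> {0<..<2}"
      obtain n where "c \<tau> \<le> real n" using real_arch_simple by blast
      then have "\<tau> \<in> T n" using \<tau> by (simp add: T_def)
      with N(2) show "\<tau> \<in> (\<Union>n. N n)" by blast
    qed
    moreover have "N k \<in> sets borel" for k using null_setsD2[OF N(1)[of k]] by simp
    ultimately have "emeasure lborel {0<..<2::real} \<le> emeasure lborel (\<Union>n. N n)" by (intro emeasure_mono) auto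
    also have "\<dots> = 0" using N(1) by (intro null_setsD1 null_sets_UN) auto
    finally show False by simp
  qed
  then obtain n where n: "\<And>N. N \<in> null_sets lborel \<Longrightarrow> \<not> T n \<subseteq> N" by blast
  have "0 < real n"
  proof (rule ccontr)
    assume "\<not> ?thesis"
    then have "T n = {}" using c(1) by (force simp: T_def)
    with n[of "{}"] show False by simp
  qed
  have e: "?t \<tau> * 2 powi (- k) = \<tau> * 2 powi (- (k + int m))" for k \<tau> by (simp add: power_int_add[symmetric] add.commute mult.assoc)
  have pt: "ennreal (cmod (lp_piece \<psi> u k x)) \<le> ennreal (real n) *
      esssup_on {0<..<2} (\<lambda>\<tau>. mean_max \<beta> r (\<tau> * 2 powi (- (k + int m))) D x)"
    (is "_ \<le> _ * ?E") if D: "reproduces \<psi> L u D" for u D k x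
  proof -
    have "AE \<tau> in restrict_space lborel {0<..<2}. mean_max \<beta> r (\<tau> * 2 powi (- (k + int m))) D x \<le> ?E"
      unfolding esssup_on_def by (rule esssup_AE)
    then have "AE \<tau> in lborel. \<tau> \<in> {0<..<2} \<longrightarrow> mean_max \<beta> r (\<tau> * 2 powi (- (k + int m))) D x \<le> ?E"
      by (subst (asm) AE_restrict_space_iff) auto
    then obtain N where N: "{\<tau>. \<not> (\<tau> \<in> {0<..<2} \<longrightarrow> mean_max \<beta> r (\<tau> * 2 powi (- (k + int m))) D x \<le> ?E)} \<subseteq> N"
      "emeasure lborel N = 0" "N \<in> sets lborel" by (elim AE_E) auto
    \<comment> \<open>The essential supremum bounds the maximal function off a null set, so some
      radius with controlled constant obeys that bound.\<close>
    then have "\<not> T n \<subseteq> N" by (intro n) (simp add: null_sets_def)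
    then obtain \<tau> where \<tau>: "\<tau> \<in> T n" "\<tau> \<notin> N" by blast
    then have \<tau>': "\<tau> \<in> {0<..<2}" "c \<tau> \<le> real n" by (auto simp: T_def)
    have "mean_max \<beta> r (?t \<tau> * 2 powi (- k)) D x \<le> ?E" unfolding e using N(1) \<tau>(2) \<tau>'(1) by blast
    with c(2)[OF \<tau>'(1)] D have "ennreal (cmod (lp_piece \<psi> u k x)) \<le> ennreal (c \<tau>) * ?E" unfolding P_def by blast
    also have "\<dots> \<le> ennreal (real n) * ?E" using \<tau>'(2) by (intro mult_right_mono ennreal_leI) auto
    finally show ?thesis .
  qed
  have "besov_qnorm \<psi> s p q u \<le> ennreal (real n * 2 powr (- of_int (int m) * s)) * weighted_qnorm s p q
      (\<lambda>k x. esssup_on {0<..<2} (\<lambda>\<tau>. mean_max \<beta> r (\<tau> * 2 powi (- k)) D x))"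
    if "\<forall>k. lp_piece \<psi> u k \<in> borel_measurable borel" and D: "reproduces \<psi> L u D" for u D
    by (rule besov_qnorm_shift_le[OF pq \<open>0 < real n\<close>]) (use that pt[OF D] in auto)
  moreover have "0 < real n * 2 powr (- of_int (int m) * s)" using \<open>0 < real n\<close> by simp
  ultimately show ?thesis by blast
qed

end

text \<open>The annulus measure is used because it is absolutely continuous: an essential supremum
  over \<open>h\<close> says nothing on the sphere, which is Lebesgue null. Single differences are
  bounded here, so absolute values may be taken inside the mean.\<close>

lemma lower_difference_sup:
  fixes \<psi> :: "real^'n::finite \<Rightarrow> complex"
  assumes \<psi>: "littlewood_paley \<psi>" and L: "1 \<le> L" and r: "0 < r" and pq: "0 < p" "0 < q"
  shows "\<exists>C>0. \<forall>u D. (\<forall>k. lp_piece \<psi> u k \<in> borel_measurable borel) \<longrightarrow> reproduces \<psi> L u D \<longrightarrow>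
    besov_qnorm \<psi> s p q u \<le> ennreal C * D_sup_qnorm s p q r D"
proof -
  interpret A: base_measure "annulus_measure :: (real^'n) measure" by (rule base_measure_annulus)
  interpret finite_measure "annulus_measure :: (real^'n) measure" by (rule A.finite_\<beta>)
  obtain m :: nat where m: "8 * real L * (2 * 2 powi (- int m)) < 1" using small_scale by blast
  let ?t = "2 powi (- int m) :: real" let ?\<beta> = "annulus_measure :: (real^'n) measure" let ?a = "real CARD('n) / r"
  have "0 \<le> 8 * real L * ?t" by simp
  with m have t: "0 < ?t" "8 * real L * ?t < 1" by auto
  obtain \<phi> where rec: "recovers \<psi> L (distr ?\<beta> borel (\<lambda>z. ?t *\<^sub>R z)) \<phi>"
    using A.recovers_scaled[OF \<psi> L t] by blast
  then have \<phi>: "rapid \<phi>" unfolding recovers_def by blast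
  have \<phi>m [measurable]: "\<phi> \<in> borel_measurable borel" using \<phi> by auto
  define c where "c = enn2real (\<integral>\<^sup>+w. ennreal (cmod (\<phi> w) * (1 + norm w / ?t) powr ?a) \<partial>lborel)"
  have c: "(\<integral>\<^sup>+w. ennreal (cmod (\<phi> w) * (1 + norm w / ?t) powr ?a) \<partial>lborel) = ennreal c" "0 \<le> c"
    using nn_integral_rapid_weight_finite[OF \<phi> t(1), of ?a] r unfolding c_def by auto
  define C where "C = measure ?\<beta> UNIV * c + 1"
  have C: "0 < C" unfolding C_def using c(2) by (simp add: add_nonneg_pos)
  have pt: "ennreal (cmod (lp_piece \<psi> u k x)) \<le> ennreal C *
      esssup_on {h. 0 < norm h \<and> norm h < 2} (\<lambda>h. D_max r (2 powi (- (k + int m)) *\<^sub>R h) D x)"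
    (is "_ \<le> _ * ?E") if D: "reproduces \<psi> L u D" for u D k x
  proof -
    note Dm = reproduces_measurable[OF D]
    let ?b = "2 powi (- k) :: real" let ?s = "2 powi (- (k + int m)) :: real"
    have bt: "?b * ?t = ?s" by (simp add: power_int_add[symmetric])
    let ?I = "\<lambda>w. LINT z|distr ?\<beta> borel (\<lambda>z. ?t *\<^sub>R z). D (?b *\<^sub>R z) (x - ?b *\<^sub>R w)" and ?D = "\<lambda>z w. D (?s *\<^sub>R z) (x - ?b *\<^sub>R w)"
    let ?F = "\<lambda>z w. ennreal (cmod (\<phi> w)) * ennreal (cmod (?D z w))"
    have sm: "D h \<in> borel_measurable borel" for h by (rule measurable_joint[OF Dm]) measurable
    let ?A = "{h :: real^'n. 0 < norm h \<and> norm h < 2}"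
    note A = punctured_ball_borel[where 'n='n, of 2]
    have "AE h in restrict_space lborel ?A. D_max r (?s *\<^sub>R h) D x \<le> ?E" unfolding esssup_on_def by (rule esssup_AE)
    then have "AE h in lborel. h \<in> ?A \<longrightarrow> D_max r (?s *\<^sub>R h) D x \<le> ?E"
      by (subst (asm) AE_restrict_space_iff) (use A in auto)
    \<comment> \<open>The annulus lies in the punctured ball of radius 2, so the almost everywhere
      bound passes to the annulus measure.\<close>
    then have AE: "AE z in ?\<beta>. 1 \<le> norm z \<and> D_max r (?s *\<^sub>R z) D x \<le> ?E"
      unfolding annulus_measure_def
      by (subst AE_density) (auto simp: indicator_def annulus_def elim!: eventually_mono)
    have [measurable]: "(\<lambda>q. D (?s *\<^sub>R snd q) (x - ?b *\<^sub>R fst q)) \<in> borel_measurable (borel \<Otimes>\<^sub>M borel)"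
      by (rule measurable_joint[OF Dm]) measurable
    have "ennreal (cmod (lp_piece \<psi> u k x)) \<le>
       (\<integral>\<^sup>+w. ennreal (cmod (\<phi> w)) * ennreal (cmod (?I w)) \<partial>lborel)"
      by (rule reproduces_bound[OF D rec])
    also have "\<dots> \<le> (\<integral>\<^sup>+w. (\<integral>\<^sup>+z. ?F z w \<partial>?\<beta>) \<partial>lborel)"
    proof (rule nn_integral_mono)
      fix w :: "real^'n"
      have mz: "(\<lambda>z. D (?b *\<^sub>R z) (x - ?b *\<^sub>R w)) \<in> borel_measurable borel" by (rule measurable_joint[OF Dm]) measurable
      have [measurable]: "(\<lambda>z. ?D z w) \<in> borel_measurable borel" by (rule measurable_joint[OF Dm]) measurable
      have "?I w = (LINT z|?\<beta>. D (?b *\<^sub>R (?t *\<^sub>R z)) (x - ?b *\<^sub>R w))" by (rule integral_distr[OF _ mz]) measurable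
      also have "\<dots> = (LINT z|?\<beta>. ?D z w)" unfolding scaleR_scaleR bt ..
      finally have "ennreal (cmod (?I w))
          = ennreal (cmod (LINT z|?\<beta>. ?D z w))" by simp
      also have "\<dots> \<le> (\<integral>\<^sup>+z. ennreal (cmod (?D z w)) \<partial>?\<beta>)"
      proof (cases "integrable ?\<beta> (\<lambda>z. ?D z w)")
        case True
        then show ?thesis by (rule integral_norm_bound_ennreal)
      qed (simp add: not_integrable_integral_eq)
      finally have "ennreal (cmod (\<phi> w)) * ennreal (cmod (?I w))
          \<le> ennreal (cmod (\<phi> w)) * (\<integral>\<^sup>+z. ennreal (cmod (?D z w)) \<partial>?\<beta>)"
        by (rule mult_left_mono) simp
      also have "\<dots> = (\<integral>\<^sup>+z. ?F z w \<partial>?\<beta>)" by (rule nn_integral_cmult[symmetric]) measurable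
      finally show "ennreal (cmod (\<phi> w)) * ennreal (cmod (?I w))
          \<le> (\<integral>\<^sup>+z. ?F z w \<partial>?\<beta>)" .
    qed
    \<comment> \<open>The order is exchanged because the maximal function controls almost all
      translates for a fixed step z, with an exceptional set that depends on z.\<close>
    also have "\<dots> = (\<integral>\<^sup>+z. (\<integral>\<^sup>+w. ?F z w \<partial>lborel) \<partial>?\<beta>)"
    proof -
      interpret P: pair_sigma_finite "lborel :: (real^'n) measure" ?\<beta>
        by (simp add: pair_sigma_finite_def lborel.sigma_finite_measure_axioms sigma_finite_measure_axioms)
      have "(\<lambda>q. ennreal (cmod (\<phi> (fst q))) * ennreal (cmod (D (?s *\<^sub>R snd q) (x - ?b *\<^sub>R fst q)))) \<in> borel_measurable (lborel \<Otimes>\<^sub>M ?\<beta>)"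
        by measurable
      from P.Fubini[OF this] show ?thesis by simp
    qed
    also have "\<dots> \<le> (\<integral>\<^sup>+z. ennreal c * ?E \<partial>?\<beta>)"
    proof (rule nn_integral_mono_AE, rule eventually_mono[OF AE])
      fix z :: "real^'n" assume z: "1 \<le> norm z \<and> D_max r (?s *\<^sub>R z) D x \<le> ?E"
      let ?n = "norm (?s *\<^sub>R z)"
      have n0: "0 < ?n" "?t * norm z = 2 powi k * ?n"
      proof -
        have "0 < norm z" using z by linarith
        then have "z \<noteq> 0" by simp
        then show "0 < ?n" by simp
        have "2 powi k * ?b = 1" by (simp add: power_int_minus)
        then have "?t * norm z = (2 powi k * ?b) * (?t * norm z)" by simp
        also have "\<dots> = 2 powi k * (?b * ?t * norm z)" by (simp only: mult.assoc)
        finally show "?t * norm z = 2 powi k * ?n" unfolding bt by simp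
      qed
      have "(\<integral>\<^sup>+w. ?F z w \<partial>lborel)
         \<le> (\<integral>\<^sup>+w. ennreal (cmod (\<phi> w) * (1 + norm w / (?t * norm z)) powr ?a) \<partial>lborel) * ?E"
        by (rule nn_integral_peetre_le[OF sm \<phi> n0]) (use z in \<open>simp add: D_max_def\<close>)
      also have "\<dots> \<le> ennreal c * ?E"
        unfolding c(1)[symmetric]
      \<comment> \<open>As |z| \<ge> 1, the weight at radius 2^-m |z| is below the one at radius
        2^-m, so one constant serves all steps.\<close>
      proof (intro mult_right_mono nn_integral_mono ennreal_leI mult_left_mono powr_mono2 add_left_mono divide_left_mono)
        show "?t \<le> ?t * norm z" using z mult_left_mono[of 1 "norm z" ?t] by simp
        show "0 < ?t * norm z * ?t" using z t(1) by (intro mult_pos_pos) auto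
      qed (use r t in auto)
      finally show "(\<integral>\<^sup>+w. ?F z w \<partial>lborel) \<le> ennreal c * ?E" .
    qed
    also have "\<dots> = (ennreal c * ?E) * ennreal (measure ?\<beta> UNIV)" by (simp add: emeasure_eq_measure)
    also have "\<dots> = ennreal (measure ?\<beta> UNIV * c) * ?E" using c(2) by (simp add: ennreal_mult ac_simps)
    also have "\<dots> \<le> ennreal C * ?E" unfolding C_def by (intro mult_right_mono ennreal_leI) auto
    finally show ?thesis .
  qed
  have "besov_qnorm \<psi> s p q u \<le> ennreal (C * 2 powr (- of_int (int m) * s)) * D_sup_qnorm s p q r D"
    if "\<forall>k. lp_piece \<psi> u k \<in> borel_measurable borel" and D: "reproduces \<psi> L u D" for u D
    unfolding D_sup_qnorm_def by (rule besov_qnorm_shift_le[OF pq C]) (use that pt[OF D] in auto)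
  moreover have "0 < C * 2 powr (- of_int (int m) * s)" using C by simp
  ultimately show ?thesis by blast
qed

subsection \<open>The equivalence\<close>

lemma lp_piece_measurable:
  assumes "littlewood_paley \<psi>" "function_rep u F"
  shows "lp_piece \<psi> u k \<in> borel_measurable borel"
proof -
  have "lp_piece \<psi> u k = piece \<psi> F k" by (rule ext) (rule lp_piece_eq_cnv[OF assms])
  moreover have "rapid (dyadic \<psi> k)" by (rule rapid_dyadic[OF schwartz_rapid[OF littlewood_paleyD(1)[OF assms(1)]]])
  ultimately show ?thesis using cnv_measurable rapid_measurable tame_measurable[OF function_rep_tame[OF assms(2)]] by metis
qed

lemma majorizes_imp_dominates:
  assumes "majorizes_pieces \<psi> L s \<sigma> u U" shows "dominates_diff s \<sigma> U (class_diff \<psi> L u)"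
  unfolding dominates_diff_def
proof (intro allI impI)
  fix k :: int and x y h :: "real^'a" assume "h \<noteq> 0" "norm h \<le> 4 * 2 powi (- k)"
  with assms have "ennreal (2 powr (of_int k * s)) * (\<integral>\<^sup>+j. ennreal (cmod (iter_diff L (lp_piece \<psi> u j) h (x - y))) \<partial>count_space UNIV)
       \<le> ennreal ((1 + norm y / norm h) powr \<sigma>) * U k x"
    unfolding majorizes_pieces_def by blast
  then show "ennreal (2 powr (of_int k * s)) * ennreal (cmod (class_diff \<psi> L u h (x - y))) \<le> ennreal ((1 + norm y / norm h) powr \<sigma>) * U k x"
    by (rule order_trans[OF mult_left_mono[OF norm_class_diff_le], rotated]) simp
qed

lemma qnorms_dilate_mean:
  fixes D :: "real^'n::finite \<Rightarrow> real^'n \<Rightarrow> complex"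
  assumes Dm: "jointly_measurable D"
  shows "S_qnorm s p q r D = weighted_qnorm s p q (\<lambda>k. mean_max sphere_measure r (2 powi (- k)) D)"
    "V_qnorm s p q r D = weighted_qnorm s p q (\<lambda>k. mean_max annulus_measure r (2 powi (- k)) D)"
    "S_sup_qnorm s p q r D = weighted_qnorm s p q (\<lambda>k x. esssup_on {0<..<2} (\<lambda>\<tau>. mean_max sphere_measure r (\<tau> * 2 powi (- k)) D x))"
    "V_sup_qnorm s p q r D = weighted_qnorm s p q (\<lambda>k x. esssup_on {0<..<2} (\<lambda>\<tau>. mean_max annulus_measure r (\<tau> * 2 powi (- k)) D x))"
  by (simp_all add: S_qnorm_def V_qnorm_def S_sup_qnorm_def V_sup_qnorm_def S_max_def V_max_def sphere_mean_eq[OF Dm] annulus_mean_eq[OF Dm])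

lemma qnorms_upper:
  fixes D :: "real^'n::finite \<Rightarrow> real^'n \<Rightarrow> complex"
  assumes n: "2 \<le> CARD('n)" and Dm: "jointly_measurable D" and r: "0 < r"
    and D: "dominates_diff s (real CARD('n) / r) U D" and pq: "0 < p" "0 < q"
    and Q: "Q \<in> {S_qnorm s p q r, S_sup_qnorm s p q r, V_qnorm s p q r, V_sup_qnorm s p q r, D_sup_qnorm s p q r}"
  shows "Q D \<le> lqLp_qnorm p q U"
proof -
  interpret S: base_measure "sphere_measure :: (real^'n) measure" by (rule base_measure_sphere[OF n])
  interpret A: base_measure "annulus_measure :: (real^'n) measure" by (rule base_measure_annulus)
  note up = Dm r D pq
  show ?thesis
    using Q S.upper_mean[OF up] S.upper_mean_sup[OF up] A.upper_mean[OF up] A.upper_mean_sup[OF up] upper_difference_sup[OF up]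
    unfolding qnorms_dilate_mean[OF Dm, symmetric] by blast
qed

lemma qnorms_lower:
  fixes \<psi> :: "real^'n::finite \<Rightarrow> complex"
  assumes n: "2 \<le> CARD('n)" and \<psi>: "littlewood_paley \<psi>" and L: "1 \<le> L" and r: "0 < r" and pq: "0 < p" "0 < q"
    and Q: "Q \<in> {S_qnorm s p q r, S_sup_qnorm s p q r, V_qnorm s p q r, V_sup_qnorm s p q r, D_sup_qnorm s p q r}"
  shows "\<exists>C>0. \<forall>u D. (\<forall>k. lp_piece \<psi> u k \<in> borel_measurable borel) \<longrightarrow> reproduces \<psi> L u D \<longrightarrow>
    besov_qnorm \<psi> s p q u \<le> ennreal C * Q D"
proof -
  interpret S: base_measure "sphere_measure :: (real^'n) measure" by (rule base_measure_sphere[OF n])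
  interpret A: base_measure "annulus_measure :: (real^'n) measure" by (rule base_measure_annulus)
  note low = \<psi> L r pq
  \<comment> \<open>The quasinorms agree with those of \<open>dilate_mean\<close> for jointly
    measurable families; \<open>reproduces\<close> supplies the measurability.\<close>
  have tr: ?thesis if R: "\<exists>C>0. \<forall>u D. (\<forall>k. lp_piece \<psi> u k \<in> borel_measurable borel) \<longrightarrow> reproduces \<psi> L u D \<longrightarrow>
      besov_qnorm \<psi> s p q u \<le> ennreal C * R D"
    and eq: "\<And>D. jointly_measurable D \<Longrightarrow> Q D = R D" for R
  proof -
    have "Q D = R D" if "reproduces \<psi> L u D" for u D by (rule eq[OF reproduces_measurable[OF that]])
    with R show ?thesis by fastforce
  qed
  from Q consider "Q = S_qnorm s p q r" | "Q = S_sup_qnorm s p q r" | "Q = V_qnorm s p q r" | "Q = V_sup_qnorm s p q r" | "Q = D_sup_qnorm s p q r"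
    by blast
  then show ?thesis
  proof cases
    case 1
    show ?thesis by (rule tr[OF S.lower_mean[OF low]]) (simp only: 1 qnorms_dilate_mean)
  next
    case 2
    show ?thesis by (rule tr[OF S.lower_mean_sup[OF low]]) (simp only: 2 qnorms_dilate_mean)
  next
    case 3
    show ?thesis by (rule tr[OF A.lower_mean[OF low]]) (simp only: 3 qnorms_dilate_mean)
  next
    case 4
    show ?thesis by (rule tr[OF A.lower_mean_sup[OF low]]) (simp only: 4 qnorms_dilate_mean)
  next
    case 5
    show ?thesis unfolding 5 by (rule lower_difference_sup[OF low])
  qed
qed

theorem theorem1p5:
  fixes \<psi> :: "real^'n \<Rightarrow> complex" and p q :: ereal and s r :: real and L :: nat
  assumes "CARD('n) \<ge> 2"
    and "littlewood_paley \<psi>"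
    and "0 < p" and "0 < q"
    and "L \<ge> 1"
    and "ereal (real CARD('n)) / p < ereal s" and "s < real L"
    and "real CARD('n) / s < r" and "ereal r < p"
  shows "\<forall>Q \<in> {S_qnorm s p q r, S_sup_qnorm s p q r, V_qnorm s p q r, V_sup_qnorm s p q r,
                D_sup_qnorm s p q r}.
     \<exists>C>0. \<forall>f \<in> besov \<psi> s p q. (\<exists>F. function_rep f F) \<longrightarrow>
       Q (class_diff \<psi> L f) \<le> ennreal C * besov_qnorm \<psi> s p q f \<and>
       besov_qnorm \<psi> s p q f \<le> ennreal C * Q (class_diff \<psi> L f) \<and>
       (\<forall>F. function_rep f F \<longrightarrow>
            besov_qnorm \<psi> s p q f \<le> ennreal C * Q (iter_diff L F))"
proof
  note n = assms(1) and \<psi> = assms(2) and pq = assms(3,4)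
  have "0 \<le> ereal (real CARD('n)) / p" using pq(1) by (cases p) auto
  then have "0 < ereal s" using assms(6) by (rule order_le_less_trans)
  then have s: "0 < s" by simp
  have "0 < real CARD('n) / s" using s by simp
  with assms(8) have r: "0 < r" by linarith
  \<comment> \<open>The Peetre exponent. The hypotheses n/s < r < p say exactly that it lies
    strictly between n/p and s.\<close>
  let ?\<sigma> = "real CARD('n) / r"
  have \<sigma>: "0 < ?\<sigma>" "?\<sigma> < s" using r s assms(8) by (auto simp: field_simps)
  have \<sigma>p: "ereal (real CARD('n)) / p < ereal ?\<sigma>"
  proof (cases p)
    case (real a)
    then show ?thesis using assms(9) r by (simp add: divide_strict_left_mono)
  qed (use pq(1) \<sigma>(1) in auto)
  fix Q :: "(real^'n \<Rightarrow> real^'n \<Rightarrow> complex) \<Rightarrow> ennreal"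
  assume Q: "Q \<in> {S_qnorm s p q r, S_sup_qnorm s p q r, V_qnorm s p q r, V_sup_qnorm s p q r, D_sup_qnorm s p q r}"
  obtain C1 where C1: "0 < C1" "\<And>u F. u \<in> besov \<psi> s p q \<Longrightarrow> function_rep u F \<Longrightarrow>
    (\<exists>U. (\<forall>k. U k \<in> borel_measurable borel) \<and> lqLp_qnorm p q U \<le> ennreal C1 * besov_qnorm \<psi> s p q u \<and> majorizes_pieces \<psi> L s ?\<sigma> u U)"
    using class_majorant[OF \<psi> pq \<sigma>p \<sigma> assms(7)] by blast
  obtain C2 where C2: "0 < C2" "\<And>u D. (\<forall>k. lp_piece \<psi> u k \<in> borel_measurable borel) \<Longrightarrow> reproduces \<psi> L u D \<Longrightarrow>
    besov_qnorm \<psi> s p q u \<le> ennreal C2 * Q D"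
    using qnorms_lower[OF n \<psi> assms(5) r pq Q] by blast
  let ?C = "max C1 C2"
  have "Q (class_diff \<psi> L f) \<le> ennreal ?C * besov_qnorm \<psi> s p q f \<and>
       besov_qnorm \<psi> s p q f \<le> ennreal ?C * Q (class_diff \<psi> L f) \<and>
       (\<forall>F. function_rep f F \<longrightarrow> besov_qnorm \<psi> s p q f \<le> ennreal ?C * Q (iter_diff L F))"
    if f: "f \<in> besov \<psi> s p q" and ex: "\<exists>F. function_rep f F" for f
  proof (intro conjI allI impI)
    obtain G where G: "function_rep f G" using ex by blast
    have m: "\<forall>k. lp_piece \<psi> f k \<in> borel_measurable borel" using lp_piece_measurable[OF \<psi> G] by blast
    have rep: "reproduces \<psi> L f (class_diff \<psi> L f)" by (rule reproduces_class[OF \<psi> pq \<sigma>p \<sigma> assms(7) f G])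
    obtain U where U: "majorizes_pieces \<psi> L s ?\<sigma> f U" "lqLp_qnorm p q U \<le> ennreal C1 * besov_qnorm \<psi> s p q f"
      using C1(2)[OF f G] by blast
    have lift: "besov_qnorm \<psi> s p q f \<le> ennreal ?C * Q D" if "reproduces \<psi> L f D" for D
      using C2(2)[OF m that] by (rule order_trans) (intro mult_right_mono ennreal_leI, auto)
    have "Q (class_diff \<psi> L f) \<le> ennreal C1 * besov_qnorm \<psi> s p q f"
      by (rule order_trans[OF qnorms_upper[OF n reproduces_measurable[OF rep] r majorizes_imp_dominates[OF U(1)] pq Q] U(2)])
    also have "\<dots> \<le> ennreal ?C * besov_qnorm \<psi> s p q f" by (intro mult_right_mono ennreal_leI) auto
    finally show "Q (class_diff \<psi> L f) \<le> ennreal ?C * besov_qnorm \<psi> s p q f" .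
    show "besov_qnorm \<psi> s p q f \<le> ennreal ?C * Q (class_diff \<psi> L f)" by (rule lift[OF rep])
    show "besov_qnorm \<psi> s p q f \<le> ennreal ?C * Q (iter_diff L F)" if "function_rep f F" for F
      by (rule lift[OF reproduces_function_rep[OF \<psi> that]])
  qed
  moreover have "0 < ?C" using C1(1) by simp
  ultimately show "\<exists>C>0. \<forall>f \<in> besov \<psi> s p q. (\<exists>F. function_rep f F) \<longrightarrow>
       Q (class_diff \<psi> L f) \<le> ennreal C * besov_qnorm \<psi> s p q f \<and>
       besov_qnorm \<psi> s p q f \<le> ennreal C * Q (class_diff \<psi> L f) \<and>
       (\<forall>F. function_rep f F \<longrightarrow>
            besov_qnorm \<psi> s p q f \<le> ennreal C * Q (iter_diff L F))"
    by blast
qed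

end
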